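(* Let $E_{\mathrm{dG}}:(S_\ell^0)^d\to H^1_0(\Omega)^d$ be a linear operator such that, for all $v\in(S_\ell^0)^d$, $$\int_FE_{\mathrm{dG}}v\cdot m_F=\int_F\{\!\{v\}\!\}\cdot m_F\quad\forall F\in\mathcal F^i,\ m_F\in\mathbb P_{\ell-1}(F)^d,$$ $$\int_KE_{\mathrm{dG}}v\cdot m_K=\int_Kv\cdot m_K\quad\forall K\in\mathcal M,\ m_K\in\mathbb P_{\ell-2}(K)^d.$$ Let $\eta>\overline\eta$, $\mu>0$ and $f\in H^{-1}(\Omega)$, and let $(u,p)$ and $(u_{\mathrm{dG}},p_{\mathrm{dG}})$ be the solutions of the Stokes problem and of the discrete problem, respectively. Then $$\mu\|u-u_{\mathrm{dG}}\|_{\mathrm{dG}}\le C\,\frac{1+\|E_{\mathrm{dG}}\|}{\underline\alpha_{\mathrm{dG}}}\Big(\delta_{\mathrm{dG}}\,\mu\inf_{w\in(S_\ell^0)^d}\|u-w\|_{\mathrm{dG}}+\inf_{q\in\widehat S_{\ell-1}^0}\|p-q\|_{L^2(\Omega)}\Big)$$ and $$\|p-p_{\mathrm{dG}}\|_{L^2(\Omega)}\le C\,\frac{(1+\|E_{\mathrm{dG}}\|)^2}{\underline\alpha_{\mathrm{dG}}\beta_{\mathrm{dG}}}\Big(\delta_{\mathrm{dG}}\,\mu\inf_{w\in(S_\ell^0)^d}\|u-w\|_{\mathrm{dG}}+\inf_{q\in\widehat S_{\ell-1}^0}\|p-q\|_{L^2(\Omega)}\Big).$$ Here $C>0$ is a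 nondecreasing function of the shape constant $\gamma_{\mathcal M}$, which may also depend on $\Omega$, $d$, $\ell$, but is independent of $\mu$, $\eta$, $f$.
   Context: **Domain, mesh, spaces.** $d\in\{2,3\}$, $\ell\ge1$ is an integer, $\Omega\subseteq\mathbb R^d$ is an open bounded polyhedron with Lipschitz boundary. $H^1_0(\Omega)$ is normed by $\|\nabla\cdot\|_{L^2(\Omega)}$, $H^{-1}(\Omega):=(H^1_0(\Omega)^d)'$ with duality pairing $\langle\cdot,\cdot\rangle$, and $L^2_0(\Omega):=\{q\in L^2(\Omega):\int_\Omega q=0\}$. $\mathcal M$ is a face-to-face simplicial mesh of $\Omega$ with shape constant $\gamma_{\mathcal M}:=\max_{K\in\mathcal M}h_K/\rho_K$, where $h_K=\operatorname{diam}K$ and $\rho_K$ is the diameter of the largest ball inscribed in $K$. $\mathcal F$ and $\mathcal F^i$ are the sets of all, respectively all interior, faces of $\mathcal M$; $\Sigma:=\bigcup_{F\in\mathcal F}F$; $h|_F:=\operatorname{diam}F$; $n|_F:=n_F$ is a fixed unit normal of $F$, pointing outside $\Omega$ if $F\subseteq\partial\Omega$. $\nabla_{\mathcal M}$, $\operatorname{div}_{\mathcal M}$ are the elementwise (broken) gradient and divergence. For an interior face $F=K_1\cap K_2$ with $n_F$ pointing outside $K_1$, $[\![v]\!]=v|_{K_1}-v|_{K_2}$ and $\{\!\{v\}\!\}=\frac12(v|_{K_1}+v|_{K_2})$; on boundary faces $[\![v]\!]=\{\!\{v\}\!\}=v$; $\{\!\{\nabla v\}\!\}$ means $\{\!\{\nabla_{\mathcal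 M}v\}\!\}$. $\mathbb P_k$ denotes polynomials of total degree $\le k$, $\mathbb P_{-1}=\{0\}$. $S_k^0:=\{v:\Omega\to\mathbb R: v|_K\in\mathbb P_k(K)\ \forall K\in\mathcal M\}$, $\widehat S_k^0:=S_k^0\cap L^2_0(\Omega)$. **Stokes problem.** Find $u\in H^1_0(\Omega)^d$, $p\in L^2_0(\Omega)$ with $\mu\int_\Omega\nabla u:\nabla v-\int_\Omega p\operatorname{div}v=\langle f,v\rangle$ for all $v\in H^1_0(\Omega)^d$ and $\int_\Omega q\operatorname{div}u=0$ for all $q\in L^2_0(\Omega)$. **Discrete problem.** For a penalty parameter $\eta>0$, $a_{\mathrm{dG}}(w,v):=\int_\Omega\nabla_{\mathcal M}w:\nabla_{\mathcal M}v-\int_\Sigma\{\!\{\nabla w\}\!\}n\cdot[\![v]\!]-\int_\Sigma[\![w]\!]\cdot\{\!\{\nabla v\}\!\}n+\int_\Sigma\frac{\eta}{h}[\![w]\!]\cdot[\![v]\!]$, $b_{\mathrm{dG}}(w,q):=-\int_\Omega q\operatorname{div}_{\mathcal M}w+\int_\Sigma[\![w]\!]\cdot n\,\{\!\{q\}\!\}$. Find $u_{\mathrm{dG}}\in(S_\ell^0)^d$, $p_{\mathrm{dG}}\in\widehat S_{\ell-1}^0$ with $\mu\,a_{\mathrm{dG}}(u_{\mathrm{dG}},v)+b_{\mathrm{dG}}(v,p_{\mathrm{dG}})=\langle f,E_{\mathrm{dG}}v\rangle$ for all $v\in(S_\ell^0)^d$ and $b_{\mathrm{dG}}(u_{\mathrm{dG}},q)=0$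 for all $q\in\widehat S_{\ell-1}^0$. $Z_{\mathrm{dG}}:=\{w\in(S_\ell^0)^d:b_{\mathrm{dG}}(w,q)=0\ \forall q\in\widehat S_{\ell-1}^0\}$ is the kernel of the discrete divergence. **Norms and constants.** $\|w\|_{\mathrm{dG}}^2:=\int_\Omega|\nabla_{\mathcal M}w|^2+\int_\Sigma\frac\eta h|[\![w]\!]|^2$ on $H^1_0(\Omega)^d+(S_\ell^0)^d$. $\|E_{\mathrm{dG}}\|$ is the operator norm from $((S_\ell^0)^d,\|\cdot\|_{\mathrm{dG}})$ to $(H^1_0(\Omega)^d,\|\nabla\cdot\|_{L^2(\Omega)})$. $\overline\eta>0$ is a constant, depending only on $\gamma_{\mathcal M}$ and $\ell$, such that $\int_\Sigma h|\{\!\{v\}\!\}|^2\le\overline\eta\|v\|_{L^2(\Omega)}^2$ for all $v\in(S_\ell^0)^{d\times d}$. $\underline\alpha_{\mathrm{dG}}:=1-\sqrt{\overline\eta/\eta}$. $\beta_{\mathrm{dG}}\in(0,1]$ is an inf-sup constant: $\beta_{\mathrm{dG}}\|q\|_{L^2(\Omega)}\le\sup_{w\in(S_\ell^0)^d}b_{\mathrm{dG}}(w,q)/\|w\|_{\mathrm{dG}}$ for all $q\in\widehat S_{\ell-1}^0$ (it is known that one can take $\beta_{\mathrm{dG}}^{-1}\le C\max\{1,\sqrt\eta\}$). $\delta_{\mathrm{dG}}$ is a constant such that $\inf_{z\in Z_{\mathrm{dG}}}\|u-z\|_{\mathrm{dG}}\le\delta_{\mathrm{dG}}\inf_{w\in(S_\ell^0)^d}\|u-w\|_{\mathrm{dG}}$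 for the Stokes velocity $u$. *)

theory Defs
  imports "HOL-Analysis.Analysis"
begin

text \<open>
  Lebesgue and Sobolev functions are represented by functions that matter only up to null sets.
\<close>

definition L2 :: "'a measure \<Rightarrow> ('a \<Rightarrow> 'b::euclidean_space) set" where
  "L2 N = {g. g \<in> borel_measurable N \<and> integrable N (\<lambda>x. (norm (g x))\<^sup>2)}"

definition L2_norm :: "'a measure \<Rightarrow> ('a \<Rightarrow> 'b::euclidean_space) \<Rightarrow> real" where
  "L2_norm N g = sqrt (\<integral>x. (norm (g x))\<^sup>2 \<partial>N)"

definition L2_0 :: "(real^'n) set \<Rightarrow> (real^'n \<Rightarrow> real) set" where
  "L2_0 U = {q \<in> L2 (lebesgue_on U). (\<integral>x. q x \<partial>lebesgue_on U) = 0}"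

text \<open>\<open>pow X\<close> is the space $X^d$ of vector fields with components in \<open>X\<close>; \<open>pow (pow X)\<close> is $X^{d\times d}$.\<close>

definition pow :: "(real^'n \<Rightarrow> 'b) set \<Rightarrow> (real^'n \<Rightarrow> 'b^'n) set" where
  "pow X = {v. \<forall>i. (\<lambda>x. v x $ i) \<in> X}"

text \<open>\<open>D js\<close> is the iterated partial derivative of \<open>\<phi>\<close> along the list \<open>js\<close> of coordinate directions.\<close>

definition smooth :: "(real^'n \<Rightarrow> real) \<Rightarrow> bool" where
  "smooth \<phi> \<longleftrightarrow>
    (\<exists>D :: 'n list \<Rightarrow> real^'n \<Rightarrow> real. D [] = \<phi> \<and>
      (\<forall>js x. (D js has_derivative (\<lambda>h. \<Sum>i\<in>UNIV. h $ i * D (i # js) x)) (at x)))"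

definition grad :: "(real^'n \<Rightarrow> real) \<Rightarrow> real^'n \<Rightarrow> real^'n" where
  "grad \<phi> x = (\<chi> i. frechet_derivative \<phi> (at x) (axis i 1))"

definition test_functions :: "(real^'n) set \<Rightarrow> (real^'n \<Rightarrow> real) set" where
  "test_functions U =
    {\<phi>. smooth \<phi> \<and> compact (closure {x. \<phi> x \<noteq> 0}) \<and> closure {x. \<phi> x \<noteq> 0} \<subseteq> U}"

definition is_weak_grad ::
  "(real^'n) set \<Rightarrow> (real^'n \<Rightarrow> real) \<Rightarrow> (real^'n \<Rightarrow> real^'n) \<Rightarrow> bool" where
  "is_weak_grad U v G \<longleftrightarrow> G \<in> L2 (lebesgue_on U) \<and>
    (\<forall>\<phi>\<in>test_functions U. \<forall>i.
      (\<integral>x. v x * grad \<phi> x $ i \<partial>lebesgue_on U) = - (\<integral>x. G x $ i * \<phi> x \<partial>lebesgue_on U))"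

definition H1 :: "(real^'n) set \<Rightarrow> (real^'n \<Rightarrow> real) set" where
  "H1 U = {v \<in> L2 (lebesgue_on U). \<exists>G. is_weak_grad U v G}"

definition weak_grad :: "(real^'n) set \<Rightarrow> (real^'n \<Rightarrow> real) \<Rightarrow> real^'n \<Rightarrow> real^'n" where
  "weak_grad U v = (SOME G. is_weak_grad U v G)"

definition weak_jac :: "(real^'n) set \<Rightarrow> (real^'n \<Rightarrow> real^'n) \<Rightarrow> real^'n \<Rightarrow> real^'n^'n" where
  "weak_jac U v x = (\<chi> i. weak_grad U (\<lambda>y. v y $ i) x)"

definition H10 :: "(real^'n) set \<Rightarrow> (real^'n \<Rightarrow> real) set" where
  "H10 U = {v \<in> H1 U. \<exists>\<phi> :: nat \<Rightarrow> real^'n \<Rightarrow> real. (\<forall>k. \<phi> k \<in> test_functions U) \<and>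
     (\<lambda>k. L2_norm (lebesgue_on U) (\<lambda>x. \<phi> k x - v x)) \<longlonglongrightarrow> 0 \<and>
     (\<lambda>k. L2_norm (lebesgue_on U) (\<lambda>x. grad (\<phi> k) x - weak_grad U v x)) \<longlonglongrightarrow> 0}"

text \<open>Bounded linear functionals on $H^1_0(U)^d$, normed by $\|\nabla\cdot\|_{L^2(U)}$.\<close>

definition H_minus1 :: "(real^'n) set \<Rightarrow> ((real^'n \<Rightarrow> real^'n) \<Rightarrow> real) set" where
  "H_minus1 U = {f.
     (\<forall>v\<in>pow (H10 U). \<forall>w\<in>pow (H10 U). \<forall>a b.
        f (\<lambda>x. a *\<^sub>R v x + b *\<^sub>R w x) = a * f v + b * f w) \<and>
     (\<exists>c. \<forall>v\<in>pow (H10 U). \<bar>f v\<bar> \<le> c * L2_norm (lebesgue_on U) (weak_jac U v))}"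

text \<open>Polynomials of total degree at most \<open>k\<close>; the index is an integer so that $\mathbb P_{-1} = \{0\}$.\<close>

definition polys :: "int \<Rightarrow> (real^'n \<Rightarrow> real) set" where
  "polys k = {P. \<exists>c :: ('n \<Rightarrow> nat) \<Rightarrow> real. \<forall>x.
     P x = (\<Sum>\<alpha> | int (\<Sum>i\<in>UNIV. \<alpha> i) \<le> k. c \<alpha> * (\<Prod>i\<in>UNIV. (x $ i) ^ \<alpha> i))}"

text \<open>
  Near each boundary point, the domain lies on one side of the graph of a Lipschitz function over
  the hyperplane orthogonal to some unit vector \<open>e\<close>.
\<close>

definition lipschitz_boundary :: "(real^'n) set \<Rightarrow> bool" where
  "lipschitz_boundary U \<longleftrightarrow>
    (\<forall>z\<in>frontier U. \<exists>V e L (\<psi> :: real^'n \<Rightarrow> real).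
       open V \<and> z \<in> V \<and> norm e = 1 \<and> L-lipschitz_on UNIV \<psi> \<and>
       U \<inter> V = {x \<in> V. x \<bullet> e < \<psi> (x - (x \<bullet> e) *\<^sub>R e)})"

text \<open>The library's \<open>polyhedron\<close> is convex, so a general polyhedron is a union of convex polytopes.\<close>

definition polyhedral_domain :: "(real^'n) set \<Rightarrow> bool" where
  "polyhedral_domain U \<longleftrightarrow> open U \<and> bounded U \<and> U \<noteq> {} \<and>
     (\<exists>\<P>. finite \<P> \<and> (\<forall>P\<in>\<P>. polytope P) \<and> closure U = \<Union>\<P>) \<and> lipschitz_boundary U"

definition simplicial_mesh :: "(real^'n) set \<Rightarrow> (real^'n) set set \<Rightarrow> bool" where
  "simplicial_mesh U M \<longleftrightarrow>
     triangulation M \<and> (\<forall>K\<in>M. int CARD('n) simplex K) \<and> \<Union>M = closure U"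

definition inball_diameter :: "(real^'n) set \<Rightarrow> real" where
  "inball_diameter K = (SUP r\<in>{r. 0 \<le> r \<and> (\<exists>x. cball x r \<subseteq> K)}. 2 * r)"

definition shape_const :: "(real^'n) set set \<Rightarrow> real" where
  "shape_const M = Max ((\<lambda>K. diameter K / inball_diameter K) ` M)"

definition faces :: "(real^'n) set set \<Rightarrow> (real^'n) set set" where
  "faces M = {F. \<exists>K\<in>M. F facet_of K}"

definition interior_faces :: "(real^'n) set set \<Rightarrow> (real^'n) set set" where
  "interior_faces M = {F. \<exists>K1\<in>M. \<exists>K2\<in>M. K1 \<noteq> K2 \<and> F = K1 \<inter> K2 \<and> F facet_of K1 \<and> F facet_of K2}"

definition points_outside :: "(real^'n) set \<Rightarrow> (real^'n) set \<Rightarrow> real^'n \<Rightarrow> bool" where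
  "points_outside K F e \<longleftrightarrow> (\<forall>x\<in>F. \<forall>y\<in>K. e \<bullet> (y - x) \<le> 0)"

definition normal_field ::
  "(real^'n) set \<Rightarrow> (real^'n) set set \<Rightarrow> ((real^'n) set \<Rightarrow> real^'n) \<Rightarrow> bool" where
  "normal_field U M n \<longleftrightarrow> (\<forall>F\<in>faces M.
     norm (n F) = 1 \<and> (\<forall>x\<in>F. \<forall>y\<in>F. n F \<bullet> (y - x) = 0) \<and>
     (F \<subseteq> frontier U \<longrightarrow> (\<forall>K\<in>M. F facet_of K \<longrightarrow> points_outside K F (n F))))"

text \<open>
  The $(d-1)$-dimensional Lebesgue measure on a face \<open>F\<close>: a subset of \<open>F\<close> has the volume of
  the cylinder of height 1 that is centred at it and orthogonal to \<open>F\<close>. Here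
  \<open>closest_point (affine hull F)\<close> is the orthogonal projection onto the hyperplane containing \<open>F\<close>.
\<close>

definition face_measure :: "(real^'n) set \<Rightarrow> (real^'n) measure" where
  "face_measure F =
     (let \<pi> = closest_point (affine hull F)
      in distr (lebesgue_on {y. \<pi> y \<in> F \<and> dist y (\<pi> y) \<le> 1/2}) borel \<pi>)"

definition skeleton_integral ::
  "(real^'n) set set \<Rightarrow> ((real^'n) set \<Rightarrow> real^'n \<Rightarrow> real) \<Rightarrow> real" where
  "skeleton_integral M g = (\<Sum>F\<in>faces M. \<integral>x. g F x \<partial>face_measure F)"

definition broken_grad :: "(real^'n) set set \<Rightarrow> (real^'n \<Rightarrow> real) \<Rightarrow> real^'n \<Rightarrow> real^'n" where
  "broken_grad M v x =
    (if \<exists>K\<in>M. x \<in> interior K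
     then weak_grad (interior (THE K. K \<in> M \<and> x \<in> interior K)) v x else 0)"

definition broken_jac ::
  "(real^'n) set set \<Rightarrow> (real^'n \<Rightarrow> real^'n) \<Rightarrow> real^'n \<Rightarrow> real^'n^'n" where
  "broken_jac M v x = (\<chi> i. broken_grad M (\<lambda>y. v y $ i) x)"

definition broken_div ::
  "(real^'n) set set \<Rightarrow> (real^'n \<Rightarrow> real^'n) \<Rightarrow> real^'n \<Rightarrow> real" where
  "broken_div M v x = trace (broken_jac M v x)"

text \<open>
  The trace on \<open>F\<close> of \<open>v\<close> in $H^1$ of the interior of \<open>K\<close>: the $L^2(F)$-limit of the restrictions
  of smooth functions converging to \<open>v\<close> in $H^1$. The values of \<open>v\<close> on \<open>F\<close> itself are irrelevant.
\<close>

definition is_face_trace ::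
  "(real^'n) set \<Rightarrow> (real^'n) set \<Rightarrow> (real^'n \<Rightarrow> real) \<Rightarrow> (real^'n \<Rightarrow> real) \<Rightarrow> bool" where
  "is_face_trace K F v g \<longleftrightarrow> g \<in> L2 (face_measure F) \<and>
     (\<exists>\<phi> :: nat \<Rightarrow> real^'n \<Rightarrow> real. (\<forall>k. smooth (\<phi> k)) \<and>
       (\<lambda>k. L2_norm (lebesgue_on (interior K)) (\<lambda>x. \<phi> k x - v x)) \<longlonglongrightarrow> 0 \<and>
       (\<lambda>k. L2_norm (lebesgue_on (interior K))
              (\<lambda>x. grad (\<phi> k) x - weak_grad (interior K) v x)) \<longlonglongrightarrow> 0 \<and>
       (\<lambda>k. L2_norm (face_measure F) (\<lambda>x. \<phi> k x - g x)) \<longlonglongrightarrow> 0)"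

definition face_trace ::
  "(real^'n) set \<Rightarrow> (real^'n) set \<Rightarrow> (real^'n \<Rightarrow> real) \<Rightarrow> real^'n \<Rightarrow> real" where
  "face_trace K F v = (SOME g. is_face_trace K F v g)"

text \<open>
  The element with facet \<open>F\<close> that the vector \<open>e\<close>, normal to \<open>F\<close>, points out of. For \<open>e = n F\<close> it is
  the element $K_1$ of the jump $v|_{K_1} - v|_{K_2}$, and for \<open>e = - n F\<close> it is $K_2$.
\<close>

definition element_behind ::
  "(real^'n) set set \<Rightarrow> (real^'n) set \<Rightarrow> real^'n \<Rightarrow> (real^'n) set" where
  "element_behind M F e = (THE K. K \<in> M \<and> F facet_of K \<and> points_outside K F e)"

definition jump ::
  "(real^'n) set set \<Rightarrow> ((real^'n) set \<Rightarrow> real^'n) \<Rightarrow> (real^'n \<Rightarrow> real)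
     \<Rightarrow> (real^'n) set \<Rightarrow> real^'n \<Rightarrow> real" where
  "jump M n v F x =
    (if F \<in> interior_faces M
     then face_trace (element_behind M F (n F)) F v x
          - face_trace (element_behind M F (- n F)) F v x
     else face_trace (element_behind M F (n F)) F v x)"

definition average ::
  "(real^'n) set set \<Rightarrow> ((real^'n) set \<Rightarrow> real^'n) \<Rightarrow> (real^'n \<Rightarrow> real)
     \<Rightarrow> (real^'n) set \<Rightarrow> real^'n \<Rightarrow> real" where
  "average M n v F x =
    (if F \<in> interior_faces M
     then (face_trace (element_behind M F (n F)) F v x
           + face_trace (element_behind M F (- n F)) F v x) / 2
     else face_trace (element_behind M F (n F)) F v x)"

definition vec_jump ::
  "(real^'n) set set \<Rightarrow> ((real^'n) set \<Rightarrow> real^'n) \<Rightarrow> (real^'n \<Rightarrow> real^'n)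
     \<Rightarrow> (real^'n) set \<Rightarrow> real^'n \<Rightarrow> real^'n" where
  "vec_jump M n v F x = (\<chi> i. jump M n (\<lambda>y. v y $ i) F x)"

definition vec_average ::
  "(real^'n) set set \<Rightarrow> ((real^'n) set \<Rightarrow> real^'n) \<Rightarrow> (real^'n \<Rightarrow> real^'n)
     \<Rightarrow> (real^'n) set \<Rightarrow> real^'n \<Rightarrow> real^'n" where
  "vec_average M n v F x = (\<chi> i. average M n (\<lambda>y. v y $ i) F x)"

definition mat_average ::
  "(real^'n) set set \<Rightarrow> ((real^'n) set \<Rightarrow> real^'n) \<Rightarrow> (real^'n \<Rightarrow> real^'n^'n)
     \<Rightarrow> (real^'n) set \<Rightarrow> real^'n \<Rightarrow> real^'n^'n" where
  "mat_average M n A F x = (\<chi> i j. average M n (\<lambda>y. A y $ i $ j) F x)"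

definition dG_space :: "(real^'n) set set \<Rightarrow> int \<Rightarrow> (real^'n \<Rightarrow> real) set" where
  "dG_space M k = {v. \<forall>K\<in>M. \<exists>P\<in>polys k. AE x in lebesgue_on K. v x = P x}"

definition dG_space_0 ::
  "(real^'n) set \<Rightarrow> (real^'n) set set \<Rightarrow> int \<Rightarrow> (real^'n \<Rightarrow> real) set" where
  "dG_space_0 U M k = dG_space M k \<inter> L2_0 U"

definition stokes_solution ::
  "(real^'n) set \<Rightarrow> real \<Rightarrow> ((real^'n \<Rightarrow> real^'n) \<Rightarrow> real)
     \<Rightarrow> (real^'n \<Rightarrow> real^'n) \<Rightarrow> (real^'n \<Rightarrow> real) \<Rightarrow> bool" where
  "stokes_solution U \<mu> f u p \<longleftrightarrow> u \<in> pow (H10 U) \<and> p \<in> L2_0 U \<and>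
     (\<forall>v\<in>pow (H10 U).
        \<mu> * (\<integral>x. weak_jac U u x \<bullet> weak_jac U v x \<partial>lebesgue_on U)
        - (\<integral>x. p x * trace (weak_jac U v x) \<partial>lebesgue_on U) = f v) \<and>
     (\<forall>q\<in>L2_0 U. (\<integral>x. q x * trace (weak_jac U u x) \<partial>lebesgue_on U) = 0)"

definition a_dG ::
  "(real^'n) set \<Rightarrow> (real^'n) set set \<Rightarrow> ((real^'n) set \<Rightarrow> real^'n) \<Rightarrow> real
     \<Rightarrow> (real^'n \<Rightarrow> real^'n) \<Rightarrow> (real^'n \<Rightarrow> real^'n) \<Rightarrow> real" where
  "a_dG U M n \<eta> w v =
     (\<integral>x. broken_jac M w x \<bullet> broken_jac M v x \<partial>lebesgue_on U)
     - skeleton_integral M (\<lambda>F x. (mat_average M n (broken_jac M w) F x *v n F) \<bullet> vec_jump M n v F x)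
     - skeleton_integral M (\<lambda>F x. vec_jump M n w F x \<bullet> (mat_average M n (broken_jac M v) F x *v n F))
     + skeleton_integral M (\<lambda>F x. \<eta> / diameter F * (vec_jump M n w F x \<bullet> vec_jump M n v F x))"

definition b_dG ::
  "(real^'n) set \<Rightarrow> (real^'n) set set \<Rightarrow> ((real^'n) set \<Rightarrow> real^'n)
     \<Rightarrow> (real^'n \<Rightarrow> real^'n) \<Rightarrow> (real^'n \<Rightarrow> real) \<Rightarrow> real" where
  "b_dG U M n w q =
     - (\<integral>x. q x * broken_div M w x \<partial>lebesgue_on U)
     + skeleton_integral M (\<lambda>F x. (vec_jump M n w F x \<bullet> n F) * average M n q F x)"

definition dG_norm ::
  "(real^'n) set \<Rightarrow> (real^'n) set set \<Rightarrow> ((real^'n) set \<Rightarrow> real^'n) \<Rightarrow> real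
     \<Rightarrow> (real^'n \<Rightarrow> real^'n) \<Rightarrow> real" where
  "dG_norm U M n \<eta> w = sqrt (
     (\<integral>x. (norm (broken_jac M w x))\<^sup>2 \<partial>lebesgue_on U)
     + skeleton_integral M (\<lambda>F x. \<eta> / diameter F * (norm (vec_jump M n w F x))\<^sup>2))"

definition dG_solution ::
  "(real^'n) set \<Rightarrow> (real^'n) set set \<Rightarrow> ((real^'n) set \<Rightarrow> real^'n) \<Rightarrow> nat \<Rightarrow> real
     \<Rightarrow> ((real^'n \<Rightarrow> real^'n) \<Rightarrow> (real^'n \<Rightarrow> real^'n)) \<Rightarrow> real
     \<Rightarrow> ((real^'n \<Rightarrow> real^'n) \<Rightarrow> real) \<Rightarrow> (real^'n \<Rightarrow> real^'n) \<Rightarrow> (real^'n \<Rightarrow> real) \<Rightarrow> bool" where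
  "dG_solution U M n l \<eta> E \<mu> f u p \<longleftrightarrow>
     u \<in> pow (dG_space M (int l)) \<and> p \<in> dG_space_0 U M (int l - 1) \<and>
     (\<forall>v\<in>pow (dG_space M (int l)). \<mu> * a_dG U M n \<eta> u v + b_dG U M n v p = f (E v)) \<and>
     (\<forall>q\<in>dG_space_0 U M (int l - 1). b_dG U M n u q = 0)"

definition discrete_kernel ::
  "(real^'n) set \<Rightarrow> (real^'n) set set \<Rightarrow> ((real^'n) set \<Rightarrow> real^'n) \<Rightarrow> nat
     \<Rightarrow> (real^'n \<Rightarrow> real^'n) set" where
  "discrete_kernel U M n l =
     {w \<in> pow (dG_space M (int l)). \<forall>q\<in>dG_space_0 U M (int l - 1). b_dG U M n w q = 0}"

text \<open>
  A linear operator from \<open>pow (dG_space M (int l))\<close> to \<open>pow (H10 U)\<close>. Since functions represent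
  classes modulo null sets, it has to respect equality almost everywhere.
\<close>

definition linear_smoother ::
  "(real^'n) set \<Rightarrow> (real^'n) set set \<Rightarrow> nat
     \<Rightarrow> ((real^'n \<Rightarrow> real^'n) \<Rightarrow> (real^'n \<Rightarrow> real^'n)) \<Rightarrow> bool" where
  "linear_smoother U M l E \<longleftrightarrow>
     (\<forall>v\<in>pow (dG_space M (int l)). E v \<in> pow (H10 U)) \<and>
     (\<forall>v\<in>pow (dG_space M (int l)). \<forall>w\<in>pow (dG_space M (int l)).
        (AE x in lebesgue_on U. v x = w x) \<longrightarrow> (AE x in lebesgue_on U. E v x = E w x)) \<and>
     (\<forall>v\<in>pow (dG_space M (int l)). \<forall>w\<in>pow (dG_space M (int l)). \<forall>a b.
        AE x in lebesgue_on U. E (\<lambda>y. a *\<^sub>R v y + b *\<^sub>R w y) x = a *\<^sub>R E v x + b *\<^sub>R E w x)"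

text \<open>
  The two one-sided traces of \<open>E v\<close> on an interior face coincide, so the average of \<open>E v\<close> is its trace.
\<close>

definition preserves_moments ::
  "(real^'n) set set \<Rightarrow> ((real^'n) set \<Rightarrow> real^'n) \<Rightarrow> nat
     \<Rightarrow> ((real^'n \<Rightarrow> real^'n) \<Rightarrow> (real^'n \<Rightarrow> real^'n)) \<Rightarrow> bool" where
  "preserves_moments M n l E \<longleftrightarrow> (\<forall>v\<in>pow (dG_space M (int l)).
     (\<forall>F\<in>interior_faces M. \<forall>m\<in>pow (polys (int l - 1)).
        (\<integral>x. vec_average M n (E v) F x \<bullet> m x \<partial>face_measure F)
        = (\<integral>x. vec_average M n v F x \<bullet> m x \<partial>face_measure F)) \<and>
     (\<forall>K\<in>M. \<forall>m\<in>pow (polys (int l - 2)).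
        (\<integral>x. E v x \<bullet> m x \<partial>lebesgue_on K) = (\<integral>x. v x \<bullet> m x \<partial>lebesgue_on K)))"

text \<open>As in \<open>onorm\<close>, \<open>x / 0 = 0\<close> makes it unnecessary to exclude \<open>v = 0\<close>; likewise in \<open>inf_sup_const\<close>.\<close>

definition smoother_norm ::
  "(real^'n) set \<Rightarrow> (real^'n) set set \<Rightarrow> ((real^'n) set \<Rightarrow> real^'n) \<Rightarrow> nat \<Rightarrow> real
     \<Rightarrow> ((real^'n \<Rightarrow> real^'n) \<Rightarrow> (real^'n \<Rightarrow> real^'n)) \<Rightarrow> real" where
  "smoother_norm U M n l \<eta> E =
     (SUP v\<in>pow (dG_space M (int l)).
        L2_norm (lebesgue_on U) (weak_jac U (E v)) / dG_norm U M n \<eta> v)"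

definition trace_const ::
  "(real^'n) set \<Rightarrow> (real^'n) set set \<Rightarrow> ((real^'n) set \<Rightarrow> real^'n) \<Rightarrow> nat \<Rightarrow> real \<Rightarrow> bool" where
  "trace_const U M n l etabar \<longleftrightarrow> 0 < etabar \<and>
     (\<forall>A\<in>pow (pow (dG_space M (int l))).
        skeleton_integral M (\<lambda>F x. diameter F * (norm (mat_average M n A F x))\<^sup>2)
        \<le> etabar * (L2_norm (lebesgue_on U) A)\<^sup>2)"

definition inf_sup_const ::
  "(real^'n) set \<Rightarrow> (real^'n) set set \<Rightarrow> ((real^'n) set \<Rightarrow> real^'n) \<Rightarrow> nat \<Rightarrow> real \<Rightarrow> real \<Rightarrow> bool" where
  "inf_sup_const U M n l \<eta> \<beta> \<longleftrightarrow> 0 < \<beta> \<and> \<beta> \<le> 1 \<and>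
     (\<forall>q\<in>dG_space_0 U M (int l - 1).
        \<beta> * L2_norm (lebesgue_on U) q
        \<le> (SUP w\<in>pow (dG_space M (int l)). b_dG U M n w q / dG_norm U M n \<eta> w))"

definition velocity_error ::
  "(real^'n) set \<Rightarrow> (real^'n) set set \<Rightarrow> ((real^'n) set \<Rightarrow> real^'n) \<Rightarrow> real
     \<Rightarrow> (real^'n \<Rightarrow> real^'n) set \<Rightarrow> (real^'n \<Rightarrow> real^'n) \<Rightarrow> real" where
  "velocity_error U M n \<eta> W u = (INF w\<in>W. dG_norm U M n \<eta> (\<lambda>x. u x - w x))"

definition pressure_error ::
  "(real^'n) set \<Rightarrow> (real^'n \<Rightarrow> real) set \<Rightarrow> (real^'n \<Rightarrow> real) \<Rightarrow> real" where
  "pressure_error U Q p = (INF q\<in>Q. L2_norm (lebesgue_on U) (\<lambda>x. p x - q x))"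

end

theory Submission
  imports Defs "HOL-Computational_Algebra.Polynomial"
begin

text \<open>
  Elementwise integration by parts and the moment conditions on \<open>E\<close> give, for discrete \<open>w\<close>, \<open>v\<close>, \<open>q\<close>,
  the identities \<open>b_dG v q = - \<integral> q div (E v)\<close> and
  \<open>a_dG w v = \<integral> \<nabla>w : \<nabla>(E v) - \<integral> [[w]] \<cdot> {{\<nabla>v}} n + \<integral> \<eta>/h [[w]] \<cdot> [[v]]\<close>. The right-hand side of the latter
  makes sense for Sobolev functions \<open>w\<close> and is consistent, since their jumps vanish. So testing the
  discrete problem with \<open>e = u_dG - z\<close> for \<open>z\<close> in the discrete kernel leaves only best-approximation
  errors, and coercivity of \<open>a_dG\<close> with constant \<open>1 - sqrt (etabar / \<eta>)\<close> bounds \<open>e\<close>; the pressure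
  then follows from the inf-sup condition. All mesh-dependent quantities enter through the hypotheses,
  so an absolute constant suffices. The norm of \<open>E\<close> is the supremum of a bounded set only because
  the discrete space is finite-dimensional and \<open>dG_norm\<close> is definite on it.
\<close>

section \<open>Square-integrable functions\<close>

text \<open>The obstacle is that face traces are given only as limits of restrictions of smooth
  functions, so an elementwise trace theory has to precede every estimate. Both of its tools come
  from one identity, the divergence theorem for the radial field \<open>\<psi>(x) (x - a)\<close> on
  a cone with apex \<open>a\<close>: applied to squares it is the trace inequality, and combined
  over the vertices of a simplex it is the divergence theorem there. Working with functions that are
  limits of smooth ones by definition (\<open>H1_elem\<close>) covers piecewise polynomials and
  \<open>H10\<close> alike without a density theorem.

  Only the first argument of \<open>a_dG\<close> is enlarged to Sobolev functions. Their gradients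
  have no traces on faces, and the term that would need them, the one with
  \<open>{{\<nabla>w}}\<close>, is exactly the one that the moment conditions absorb into
  \<open>\<nabla>(E v)\<close>.

  The constant is 9 for both errors. The velocity needs only 3, one for \<open>u - z\<close> and two
  for \<open>u_dG - z\<close>. The pressure needs 3 * 2 + 2 for \<open>p_dG - q\<close> and one for
  \<open>p - q\<close>. The factor 2 in the pressure terms bounds the divergence by the full
  gradient.\<close>

lemma L2I: "g \<in> borel_measurable N \<Longrightarrow> integrable N (\<lambda>x. (norm (g x))\<^sup>2) \<Longrightarrow> g \<in> L2 N"
  by (simp add: L2_def)

lemma L2_measurable: "g \<in> L2 N \<Longrightarrow> g \<in> borel_measurable N"
  by (simp add: L2_def)

lemma L2_integrable_sq: "g \<in> L2 N \<Longrightarrow> integrable N (\<lambda>x. (norm (g x))\<^sup>2)"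
  by (simp add: L2_def)

lemma L2_norm_nonneg [simp]: "0 \<le> L2_norm N g"
  by (simp add: L2_norm_def)

lemma L2_norm_power2: "(L2_norm N g)\<^sup>2 = (\<integral>x. (norm (g x))\<^sup>2 \<partial>N)"
  by (simp add: L2_norm_def)

lemma abs_inner_le_sum_squares:
  fixes a b :: "'b::real_inner"
  shows "norm (a \<bullet> b) \<le> (norm a)\<^sup>2 + (norm b)\<^sup>2"
proof -
  have "\<bar>a \<bullet> b\<bar> \<le> norm a * norm b" by (rule Cauchy_Schwarz_ineq2)
  moreover have "2 * (norm a * norm b) \<le> (norm a)\<^sup>2 + (norm b)\<^sup>2"
    using sum_squares_bound[of "norm a" "norm b"] by simp
  moreover have "0 \<le> norm a * norm b" by simp
  ultimately show ?thesis by simp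
qed

lemma L2_integrable_inner:
  fixes f g :: "'a \<Rightarrow> 'b::euclidean_space"
  assumes "f \<in> L2 N" "g \<in> L2 N"
  shows "integrable N (\<lambda>x. f x \<bullet> g x)"
proof (rule Bochner_Integration.integrable_bound)
  show "integrable N (\<lambda>x. (norm (f x))\<^sup>2 + (norm (g x))\<^sup>2)"
    using assms by (auto simp: L2_def)
  show "(\<lambda>x. f x \<bullet> g x) \<in> borel_measurable N"
    using assms by (auto simp: L2_def)
  show "AE x in N. norm (f x \<bullet> g x) \<le> norm ((norm (f x))\<^sup>2 + (norm (g x))\<^sup>2)"
    by (intro AE_I2) (use abs_inner_le_sum_squares in \<open>smt (verit) real_norm_def\<close>)
qed

lemma L2_integrable_mult:
  fixes f g :: "'a \<Rightarrow> real"
  assumes "f \<in> L2 N" "g \<in> L2 N"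
  shows "integrable N (\<lambda>x. f x * g x)"
  using L2_integrable_inner[OF assms] by simp

lemma norm_lincomb_power2:
  fixes x y :: "'b::real_inner"
  shows "(norm (a *\<^sub>R x + b *\<^sub>R y))\<^sup>2 = a\<^sup>2 * (norm x)\<^sup>2 + 2 * a * b * (x \<bullet> y) + b\<^sup>2 * (norm y)\<^sup>2"
  unfolding power2_norm_eq_inner
  by (simp add: inner_add_left inner_add_right inner_commute[of y x] power2_eq_square[of a] power2_eq_square[of b] algebra_simps)

lemma L2_lincomb:
  fixes f g :: "'a \<Rightarrow> 'b::euclidean_space"
  assumes "f \<in> L2 N" "g \<in> L2 N"
  shows "(\<lambda>x. a *\<^sub>R f x + b *\<^sub>R g x) \<in> L2 N"
proof (rule L2I)
  show "(\<lambda>x. a *\<^sub>R f x + b *\<^sub>R g x) \<in> borel_measurable N"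
    using assms by (auto simp: L2_def)
  have eq: "(\<lambda>x. (norm (a *\<^sub>R f x + b *\<^sub>R g x))\<^sup>2) =
     (\<lambda>x. a\<^sup>2 * (norm (f x))\<^sup>2 + 2 * a * b * (f x \<bullet> g x) + b\<^sup>2 * (norm (g x))\<^sup>2)"
    by (intro ext norm_lincomb_power2)
  show "integrable N (\<lambda>x. (norm (a *\<^sub>R f x + b *\<^sub>R g x))\<^sup>2)"
    unfolding eq using assms L2_integrable_inner[OF assms] by (auto simp: L2_def)
qed

lemma L2_add: "f \<in> L2 N \<Longrightarrow> g \<in> L2 N \<Longrightarrow> (\<lambda>x. f x + g x) \<in> L2 N"
  using L2_lincomb[of f N g 1 1] by simp

lemma L2_diff: "f \<in> L2 N \<Longrightarrow> g \<in> L2 N \<Longrightarrow> (\<lambda>x. f x - g x) \<in> L2 N"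
  using L2_lincomb[of f N g 1 "-1"] by simp

lemma L2_zero [simp]: "(\<lambda>x. 0) \<in> L2 N"
  by (simp add: L2_def)

lemma L2_scaleR: "f \<in> L2 N \<Longrightarrow> (\<lambda>x. a *\<^sub>R f x) \<in> L2 N"
  using L2_lincomb[of f N f a 0] by simp

lemma L2_mult: "f \<in> L2 N \<Longrightarrow> (\<lambda>x. a * f x) \<in> L2 N"
  for f :: "'a \<Rightarrow> real"
  using L2_scaleR[of f N a] by simp

lemma L2_sum: "finite I \<Longrightarrow> (\<And>i. i \<in> I \<Longrightarrow> f i \<in> L2 N) \<Longrightarrow> (\<lambda>x. \<Sum>i\<in>I. f i x) \<in> L2 N"
  by (induction I rule: finite_induct) (auto intro: L2_add)

lemma L2_norm_AE_cong:
  assumes "f \<in> borel_measurable N" "g \<in> borel_measurable N" "AE x in N. f x = g x"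
  shows "L2_norm N f = L2_norm N g"
  unfolding L2_norm_def
  by (subst integral_cong_AE[where g="\<lambda>x. (norm (g x))\<^sup>2"]) (use assms in auto)

text \<open>A quadratic polynomial in \<open>t\<close> without negative values has no positive
  discriminant. It is stated for bare reals so that it serves the pairing in \<open>L2\<close> as
  well as semidefinite forms on functions, for which \<open>B\<close> may vanish.\<close>

lemma psd_form_CS:
  fixes A B c :: real
  assumes "\<And>t. 0 \<le> A + 2 * t * c + t\<^sup>2 * B" "0 \<le> B"
  shows "\<bar>c\<bar> \<le> sqrt A * sqrt B"
proof (cases "B = 0")
  case True
  have "c = 0"
  proof (rule ccontr)
    assume "c \<noteq> 0"
    \<comment> \<open>With \<open>B = 0\<close> the polynomial is affine in \<open>t\<close>, and
      this \<open>t\<close> gives it the negative value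
      \<open>A - 2 * (\<bar>A\<bar> + 1)\<close>.\<close>
    have "0 \<le> A + 2 * (-(\<bar>A\<bar>+1)/c) * c" using assms(1)[of "-(\<bar>A\<bar>+1)/c"] True by simp
    then show False using \<open>c \<noteq> 0\<close> by simp
  qed
  then show ?thesis using assms(1)[of 0] assms(2) by simp
next
  case False
  then have B: "B > 0" using assms by simp
  \<comment> \<open>The minimum is attained at \<open>t = - c / B\<close>.\<close>
  have "0 \<le> A + 2 * (-c/B) * c + (-c/B)\<^sup>2 * B" by (rule assms)
  also have "\<dots> = A - c\<^sup>2 / B" using B by (simp add: power2_eq_square)
  finally have "c\<^sup>2 \<le> A * B" using B by (simp add: field_simps)
  then have "sqrt (c\<^sup>2) \<le> sqrt (A * B)" by (rule real_sqrt_le_mono)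
  then show ?thesis by (simp add: real_sqrt_mult)
qed

lemma L2_norm_lincomb_power2:
  fixes f g :: "'a \<Rightarrow> 'b::euclidean_space"
  assumes "f \<in> L2 N" "g \<in> L2 N"
  shows "(L2_norm N (\<lambda>x. a *\<^sub>R f x + b *\<^sub>R g x))\<^sup>2 =
     a\<^sup>2 * (L2_norm N f)\<^sup>2 + 2 * a * b * (\<integral>x. f x \<bullet> g x \<partial>N) + b\<^sup>2 * (L2_norm N g)\<^sup>2"
proof -
  have eq: "(\<lambda>x. (norm (a *\<^sub>R f x + b *\<^sub>R g x))\<^sup>2) =
     (\<lambda>x. a\<^sup>2 * (norm (f x))\<^sup>2 + 2 * a * b * (f x \<bullet> g x) + b\<^sup>2 * (norm (g x))\<^sup>2)"
    by (intro ext norm_lincomb_power2)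
  show ?thesis
    unfolding L2_norm_power2 eq using assms L2_integrable_inner[OF assms] by (simp add: L2_def)
qed

lemma L2_CS:
  fixes f g :: "'a \<Rightarrow> 'b::euclidean_space"
  assumes "f \<in> L2 N" "g \<in> L2 N"
  shows "\<bar>\<integral>x. f x \<bullet> g x \<partial>N\<bar> \<le> L2_norm N f * L2_norm N g"
proof -
  have "\<bar>\<integral>x. f x \<bullet> g x \<partial>N\<bar> \<le> sqrt ((L2_norm N f)\<^sup>2) * sqrt ((L2_norm N g)\<^sup>2)"
  proof (rule psd_form_CS)
    show "0 \<le> (L2_norm N f)\<^sup>2 + 2 * t * (\<integral>x. f x \<bullet> g x \<partial>N) + t\<^sup>2 * (L2_norm N g)\<^sup>2" for t
      using L2_norm_lincomb_power2[OF assms, of 1 t] zero_le_power2[of "L2_norm N (\<lambda>x. 1 *\<^sub>R f x + t *\<^sub>R g x)"]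
      by simp
  qed simp
  then show ?thesis by simp
qed

lemma L2_norm_lincomb_le:
  fixes f g :: "'a \<Rightarrow> 'b::euclidean_space"
  assumes "f \<in> L2 N" "g \<in> L2 N"
  shows "L2_norm N (\<lambda>x. a *\<^sub>R f x + b *\<^sub>R g x) \<le> \<bar>a\<bar> * L2_norm N f + \<bar>b\<bar> * L2_norm N g"
proof (rule power2_le_imp_le)
  have "2 * (a * b * (\<integral>x. f x \<bullet> g x \<partial>N)) \<le> 2 * (\<bar>a * b\<bar> * (L2_norm N f * L2_norm N g))"
  proof -
    have "a * b * (\<integral>x. f x \<bullet> g x \<partial>N) \<le> \<bar>a * b\<bar> * \<bar>\<integral>x. f x \<bullet> g x \<partial>N\<bar>"
      by (metis abs_ge_self abs_mult)
    also have "\<dots> \<le> \<bar>a * b\<bar> * (L2_norm N f * L2_norm N g)"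
      by (rule mult_left_mono[OF L2_CS[OF assms]]) simp
    finally show ?thesis by simp
  qed
  then show "(L2_norm N (\<lambda>x. a *\<^sub>R f x + b *\<^sub>R g x))\<^sup>2 \<le> (\<bar>a\<bar> * L2_norm N f + \<bar>b\<bar> * L2_norm N g)\<^sup>2"
    unfolding L2_norm_lincomb_power2[OF assms]
    by (simp add: power2_sum power_mult_distrib abs_mult algebra_simps)
qed simp

lemma L2_norm_add_le:
  "f \<in> L2 N \<Longrightarrow> g \<in> L2 N \<Longrightarrow> L2_norm N (\<lambda>x. f x + g x) \<le> L2_norm N f + L2_norm N g"
  using L2_norm_lincomb_le[of f N g 1 1] by simp

lemma L2_norm_minus_commute: "L2_norm N (\<lambda>x. f x - g x) = L2_norm N (\<lambda>x. g x - f x)"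
  by (simp add: L2_norm_def norm_minus_commute)

lemma L2_norm_diff_triangle:
  assumes "f \<in> L2 N" "g \<in> L2 N" "h \<in> L2 N"
  shows "L2_norm N (\<lambda>x. f x - h x) \<le> L2_norm N (\<lambda>x. f x - g x) + L2_norm N (\<lambda>x. g x - h x)"
  using L2_norm_add_le[OF L2_diff[OF assms(1,2)] L2_diff[OF assms(2,3)]] by simp

lemma L2_norm_eq_0_AE:
  assumes "f \<in> L2 N" "L2_norm N f = 0"
  shows "AE x in N. f x = 0"
proof -
  have "(\<integral>x. (norm (f x))\<^sup>2 \<partial>N) = 0" using assms(2) by (simp add: L2_norm_def)
  then have "AE x in N. (norm (f x))\<^sup>2 = 0"
    using integral_nonneg_eq_0_iff_AE[OF L2_integrable_sq[OF assms(1)]] by simp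
  then show ?thesis by simp
qed

lemma L2_norm_AE_0:
  assumes "AE x in N. f x = 0"
  shows "L2_norm N f = 0"
proof -
  have "(\<integral>x. (norm (f x))\<^sup>2 \<partial>N) = 0"
    by (rule integral_eq_zero_AE) (use assms in auto)
  then show ?thesis by (simp add: L2_norm_def)
qed

lemma L2_limit_unique:
  assumes "\<And>k. f k \<in> L2 N" "g \<in> L2 N" "h \<in> L2 N"
    and "(\<lambda>k. L2_norm N (\<lambda>x. f k x - g x)) \<longlonglongrightarrow> 0" "(\<lambda>k. L2_norm N (\<lambda>x. f k x - h x)) \<longlonglongrightarrow> 0"
  shows "AE x in N. g x = h x"
proof -
  have "L2_norm N (\<lambda>x. g x - h x) \<le> L2_norm N (\<lambda>x. f k x - g x) + L2_norm N (\<lambda>x. f k x - h x)" for k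
    using L2_norm_diff_triangle[OF assms(2) assms(1)[of k] assms(3)]
    by (simp add: L2_norm_minus_commute[of N g])
  then have "L2_norm N (\<lambda>x. g x - h x) \<le> 0 + 0"
    by (intro LIMSEQ_le_const[OF tendsto_add[OF assms(4,5)]]) auto
  then have "L2_norm N (\<lambda>x. g x - h x) = 0"
    using L2_norm_nonneg[of N "\<lambda>x. g x - h x"] by simp
  from L2_norm_eq_0_AE[OF L2_diff[OF assms(2,3)] this] show ?thesis by simp
qed

lemma L2_inner_tendsto:
  fixes g :: "'a \<Rightarrow> 'b::euclidean_space"
  assumes "\<And>k. f k \<in> L2 N" "g \<in> L2 N" "h \<in> L2 N"
    and "(\<lambda>k. L2_norm N (\<lambda>x. f k x - g x)) \<longlonglongrightarrow> 0"
  shows "(\<lambda>k. \<integral>x. f k x \<bullet> h x \<partial>N) \<longlonglongrightarrow> (\<integral>x. g x \<bullet> h x \<partial>N)"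
proof -
  have eq: "(\<integral>x. f k x \<bullet> h x \<partial>N) - (\<integral>x. g x \<bullet> h x \<partial>N) = (\<integral>x. (f k x - g x) \<bullet> h x \<partial>N)" for k
    using L2_integrable_inner[OF assms(1)[of k] assms(3)] L2_integrable_inner[OF assms(2,3)]
    by (simp add: inner_diff_left)
  have "(\<lambda>k. (\<integral>x. f k x \<bullet> h x \<partial>N) - (\<integral>x. g x \<bullet> h x \<partial>N)) \<longlonglongrightarrow> 0"
  proof (rule Lim_null_comparison)
    show "\<forall>\<^sub>F k in sequentially. norm ((\<integral>x. f k x \<bullet> h x \<partial>N) - (\<integral>x. g x \<bullet> h x \<partial>N))
       \<le> L2_norm N (\<lambda>x. f k x - g x) * L2_norm N h"
      unfolding eq using L2_CS[OF L2_diff[OF assms(1,2)] assms(3)] by simp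
    show "(\<lambda>k. L2_norm N (\<lambda>x. f k x - g x) * L2_norm N h) \<longlonglongrightarrow> 0"
      using tendsto_mult_left_zero[OF assms(4)] by simp
  qed
  then show ?thesis by (simp add: LIM_zero_iff)
qed

lemma L2_component:
  fixes f :: "'a \<Rightarrow> 'b::euclidean_space^'n"
  assumes "f \<in> L2 N" shows "(\<lambda>x. f x $ i) \<in> L2 N"
proof (rule L2I)
  show m: "(\<lambda>x. f x $ i) \<in> borel_measurable N"
    using measurable_compose[OF L2_measurable[OF assms], of "\<lambda>y. y $ i" borel]
    by (simp add: borel_measurable_continuous_onI continuous_on_component)
  show "integrable N (\<lambda>x. (norm (f x $ i))\<^sup>2)"
    by (rule Bochner_Integration.integrable_bound[OF L2_integrable_sq[OF assms]])
       (use m in \<open>auto intro!: power_mono Finite_Cartesian_Product.norm_nth_le\<close>)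
qed

lemma norm_vec_power2: "(norm (x :: 'b::real_inner^'n))\<^sup>2 = (\<Sum>i\<in>UNIV. (norm (x $ i))\<^sup>2)"
  by (simp add: power2_norm_eq_inner inner_vec_def)

lemma L2_vec:
  fixes f :: "'a \<Rightarrow> 'b::euclidean_space^'n"
  assumes "\<And>i. (\<lambda>x. f x $ i) \<in> L2 N" shows "f \<in> L2 N"
proof (rule L2I)
  show "f \<in> borel_measurable N"
  proof (rule borel_measurable_euclidean_space[THEN iffD2], intro ballI)
    fix b :: "'b^'n" assume "b \<in> Basis"
    then obtain i c where b: "b = axis i c" by (auto simp: Basis_vec_def)
    have "(\<lambda>x. f x $ i \<bullet> c) \<in> borel_measurable N"
      using L2_measurable[OF assms[of i]] by simp
    then show "(\<lambda>x. f x \<bullet> b) \<in> borel_measurable N"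
      by (simp add: b inner_axis)
  qed
  show "integrable N (\<lambda>x. (norm (f x))\<^sup>2)"
    unfolding norm_vec_power2 using assms by (auto simp: L2_def)
qed

text \<open>Riesz-Fischer on a finite measure space. Finiteness turns the L2 increments of a fast
  subsequence into summable L1 increments, hence an almost everywhere limit, and Fatou's lemma makes
  it the L2 limit of the whole sequence. Face traces are obtained as such limits.\<close>

lemma L2_complete:
  fixes f :: "nat \<Rightarrow> 'a \<Rightarrow> real"
  assumes fin: "finite_measure N" and f: "\<And>k. f k \<in> L2 N"
    and Cauchy: "\<And>e. 0 < e \<Longrightarrow> \<exists>k0. \<forall>j\<ge>k0. \<forall>k\<ge>k0. L2_norm N (\<lambda>x. f j x - f k x) < e"
  shows "\<exists>g\<in>L2 N. (\<lambda>k. L2_norm N (\<lambda>x. f k x - g x)) \<longlonglongrightarrow> 0"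
proof -
  interpret finite_measure N by fact
  have [measurable]: "f k \<in> borel_measurable N" for k using f by (rule L2_measurable)
  have "\<exists>\<kappa>. \<forall>k. \<forall>i\<ge>\<kappa> k. \<forall>j\<ge>\<kappa> k. L2_norm N (\<lambda>x. f i x - f j x) < (1/2)^k"
    using Cauchy by (intro choice) simp
  then obtain \<kappa> where \<kappa>: "\<And>k i j. i \<ge> \<kappa> k \<Longrightarrow> j \<ge> \<kappa> k \<Longrightarrow> L2_norm N (\<lambda>x. f i x - f j x) < (1/2)^k"
    by blast
  \<comment> \<open>Adding up all \<open>\<kappa> i\<close> makes the indices nondecreasing and at
    least \<open>\<kappa> k\<close>; the summand \<open>k\<close> makes them pass every given
    \<open>n\<close>.\<close>
  define r where "r k = k + (\<Sum>i\<le>k. \<kappa> i)" for k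
  have r_\<kappa>: "\<kappa> k \<le> r k" for k
    unfolding r_def using member_le_sum[of k "{..k}" \<kappa>] by simp
  have r_Suc: "r k \<le> r (Suc k)" for k unfolding r_def by simp
  have r_ge: "k \<le> r k" for k unfolding r_def by simp
  have step: "L2_norm N (\<lambda>x. f (r (Suc k)) x - f (r k) x) < (1/2)^k" for k
    by (rule \<kappa>) (use r_\<kappa> r_Suc le_trans in blast)+
  have one: "(\<lambda>_. 1::real) \<in> L2 N" by (auto intro: L2I)
  let ?c = "L2_norm N (\<lambda>_. 1::real)"
  let ?h = "\<lambda>k x. \<bar>f (r (Suc k)) x - f (r k) x\<bar>"
  have h_L2: "?h k \<in> L2 N" for k
  proof (rule L2I)
    show "integrable N (\<lambda>x. (norm (?h k x))\<^sup>2)"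
      using L2_integrable_sq[OF L2_diff[OF f f, of "r (Suc k)" "r k"]] by simp
  qed measurable
  have h_int: "integrable N (?h k)" for k
    using L2_integrable_mult[OF h_L2 one] by simp
  \<comment> \<open>Pairing with the constant 1, which is square integrable on a finite measure
    space, bounds the L1 norm by the L2 norm.\<close>
  have "(\<integral>\<^sup>+x. ennreal (?h k x) \<partial>N) \<le> ennreal ((1/2)^k * ?c)" for k
  proof -
    have "(\<integral>\<^sup>+x. ennreal (?h k x) \<partial>N) = ennreal (\<integral>x. ?h k x \<partial>N)"
      by (rule nn_integral_eq_integral[OF h_int]) simp
    moreover have "(\<integral>x. ?h k x \<partial>N) \<le> L2_norm N (?h k) * ?c"
      using L2_CS[OF h_L2[of k] one] by simp
    moreover have "L2_norm N (?h k) = L2_norm N (\<lambda>x. f (r (Suc k)) x - f (r k) x)"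
      by (simp add: L2_norm_def)
    moreover have "\<dots> * ?c \<le> (1/2)^k * ?c"
      by (rule mult_right_mono) (use step[of k] in auto)
    ultimately show ?thesis by (simp add: ennreal_leI)
  qed
  then have "(\<Sum>k. \<integral>\<^sup>+x. ennreal (?h k x) \<partial>N) \<le> (\<Sum>k. ennreal ((1/2)^k * ?c))"
    by (intro suminf_le) auto
  also have "\<dots> = ennreal (\<Sum>k. (1/2)^k * ?c)"
    by (rule suminf_ennreal2) (auto intro!: summable_mult2 summable_geometric)
  also have "\<dots> < \<infinity>" by simp
  finally have "(\<integral>\<^sup>+x. (\<Sum>k. ennreal (?h k x)) \<partial>N) \<noteq> \<infinity>"
    by (subst nn_integral_suminf) auto
  then have "AE x in N. (\<Sum>k. ennreal (?h k x)) \<noteq> \<infinity>"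
    by (intro nn_integral_noteq_infinite) auto
  then have conv: "AE x in N. convergent (\<lambda>k. f (r k) x)"
  proof eventually_elim
    case (elim x)
    then have "summable (\<lambda>k. ?h k x)"
      by (intro summable_suminf_not_top) auto
    then have "summable (\<lambda>k. f (r (Suc k)) x - f (r k) x)"
      by (rule summable_rabs_cancel)
    then have "convergent (\<lambda>k. \<Sum>i<k. f (r (Suc i)) x - f (r i) x)"
      by (simp add: summable_iff_convergent)
    then have "convergent (\<lambda>k. f (r k) x - f (r 0) x)"
      using sum_lessThan_telescope[of "\<lambda>k. f (r k) x"] by simp
    then have "convergent (\<lambda>k. f (r k) x - f (r 0) x + f (r 0) x)"
      by (intro convergent_add convergent_const)
    then show ?case by simp
  qed
  define g where "g x = lim (\<lambda>k. f (r k) x)" for x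
  have g_meas [measurable]: "g \<in> borel_measurable N"
    unfolding g_def by (rule borel_measurable_lim_metric) simp
  have lim: "AE x in N. (\<lambda>k. f (r k) x) \<longlonglongrightarrow> g x"
    using conv by eventually_elim (simp add: g_def convergent_LIMSEQ_iff)
  \<comment> \<open>Fatou's lemma along the subsequence: \<open>f n\<close> is close to all later
    \<open>f (r k)\<close>, hence to their limit \<open>g\<close>. Membership in \<open>L2\<close>
    comes out of the same estimate.\<close>
  have bound: "(\<lambda>x. f n x - g x) \<in> L2 N \<and> L2_norm N (\<lambda>x. f n x - g x) \<le> e"
    if "0 < e" and n: "\<And>j. j \<ge> n \<Longrightarrow> L2_norm N (\<lambda>x. f n x - f j x) < e" for n e
  proof -
    have "(\<integral>\<^sup>+x. ennreal ((f n x - g x)\<^sup>2) \<partial>N) = (\<integral>\<^sup>+x. liminf (\<lambda>k. ennreal ((f n x - f (r k) x)\<^sup>2)) \<partial>N)"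
    proof (rule nn_integral_cong_AE)
      show "AE x in N. ennreal ((f n x - g x)\<^sup>2) = liminf (\<lambda>k. ennreal ((f n x - f (r k) x)\<^sup>2))"
        using lim
      proof eventually_elim
        case (elim x)
        then have "(\<lambda>k. ennreal ((f n x - f (r k) x)\<^sup>2)) \<longlonglongrightarrow> ennreal ((f n x - g x)\<^sup>2)"
          by (intro tendsto_intros)
        from lim_imp_Liminf[OF sequentially_bot this] show ?case by (rule sym)
      qed
    qed
    also have "\<dots> \<le> liminf (\<lambda>k. \<integral>\<^sup>+x. ennreal ((f n x - f (r k) x)\<^sup>2) \<partial>N)"
      by (rule nn_integral_liminf) measurable
    also have "\<dots> \<le> ennreal (e\<^sup>2)"
    proof (rule Liminf_le[THEN order_trans])
      show "\<forall>\<^sub>F k in sequentially. (\<integral>\<^sup>+x. ennreal ((f n x - f (r k) x)\<^sup>2) \<partial>N) \<le> ennreal (e\<^sup>2)"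
      proof (rule eventually_sequentiallyI)
        fix k assume "n \<le> k"
        then have "L2_norm N (\<lambda>x. f n x - f (r k) x) < e" using n r_ge[of k] by simp
        then have "(L2_norm N (\<lambda>x. f n x - f (r k) x))\<^sup>2 \<le> e\<^sup>2"
          by (intro power_mono) auto
        moreover have "(\<integral>\<^sup>+x. ennreal ((f n x - f (r k) x)\<^sup>2) \<partial>N) = ennreal ((L2_norm N (\<lambda>x. f n x - f (r k) x))\<^sup>2)"
          using nn_integral_eq_integral[OF L2_integrable_sq[OF L2_diff[OF f f, of n "r k"]]]
          by (simp add: L2_norm_power2)
        ultimately show "(\<integral>\<^sup>+x. ennreal ((f n x - f (r k) x)\<^sup>2) \<partial>N) \<le> ennreal (e\<^sup>2)"
          by (simp add: ennreal_leI)
      qed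
    qed simp_all
    finally have le: "(\<integral>\<^sup>+x. ennreal ((f n x - g x)\<^sup>2) \<partial>N) \<le> ennreal (e\<^sup>2)" .
    have int: "integrable N (\<lambda>x. (f n x - g x)\<^sup>2)"
      by (rule integrableI_bounded) (use le in \<open>auto simp: le_less_trans\<close>)
    have "ennreal (\<integral>x. (f n x - g x)\<^sup>2 \<partial>N) \<le> ennreal (e\<^sup>2)"
      using le by (subst nn_integral_eq_integral[symmetric, OF int]) auto
    then have "(\<integral>x. (f n x - g x)\<^sup>2 \<partial>N) \<le> e\<^sup>2" by simp
    then have "L2_norm N (\<lambda>x. f n x - g x) \<le> e"
      unfolding L2_norm_def using \<open>0 < e\<close> by (auto intro: real_le_lsqrt)
    moreover have "(\<lambda>x. f n x - g x) \<in> L2 N" using int by (auto intro!: L2I)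
    ultimately show ?thesis by simp
  qed
  have "g \<in> L2 N"
  proof -
    obtain n where "\<And>j. j \<ge> n \<Longrightarrow> L2_norm N (\<lambda>x. f n x - f j x) < 1"
      using Cauchy[of 1] by fastforce
    then have "(\<lambda>x. f n x - g x) \<in> L2 N" using bound[of 1 n] by simp
    from L2_diff[OF f[of n] this] show ?thesis by simp
  qed
  moreover have "(\<lambda>k. L2_norm N (\<lambda>x. f k x - g x)) \<longlonglongrightarrow> 0"
  proof (rule LIMSEQ_I)
    fix e :: real assume e: "0 < e"
    then obtain k0 where k0: "\<And>j k. j \<ge> k0 \<Longrightarrow> k \<ge> k0 \<Longrightarrow> L2_norm N (\<lambda>x. f j x - f k x) < e/2"
      using Cauchy[of "e/2"] by auto
    have "L2_norm N (\<lambda>x. f k x - g x) \<le> e/2" if "k \<ge> k0" for k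
      using bound[of "e/2" k] k0 e that by auto
    then show "\<exists>k0. \<forall>k\<ge>k0. norm (L2_norm N (\<lambda>x. f k x - g x) - 0) < e"
      using e by (intro exI[of _ k0]) fastforce
  qed
  ultimately show ?thesis by blast
qed

section \<open>Smooth functions and polynomials\<close>

definition smooth1 :: "(real \<Rightarrow> real) \<Rightarrow> bool" where
  "smooth1 g \<longleftrightarrow> (\<exists>d :: nat \<Rightarrow> real \<Rightarrow> real. d 0 = g \<and>
     (\<forall>k x. (d k has_real_derivative d (Suc k) x) (at x)))"

text \<open>Iterating one choice of derivative inside a class closed under differentiation yields
  all derivatives at once, so a smoothness proof reduces to guessing such a class.\<close>

lemma smooth1_coinduct:
  assumes "g \<in> S"
    and step: "\<And>g. g \<in> S \<Longrightarrow> \<exists>g'\<in>S. \<forall>x. (g has_real_derivative g' x) (at x)"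
  shows "smooth1 g"
proof -
  obtain D where D: "\<And>g. g \<in> S \<Longrightarrow> D g \<in> S \<and> (\<forall>x. (g has_real_derivative D g x) (at x))"
    using step by metis
  have "(D ^^ k) g \<in> S" for k
    by (induction k) (use assms(1) D in auto)
  then show ?thesis
    unfolding smooth1_def by (intro exI[of _ "\<lambda>k. (D ^^ k) g"]) (use D in auto)
qed

lemma smooth1_deriv:
  assumes "smooth1 g"
  obtains g' where "smooth1 g'" "\<And>x. (g has_real_derivative g' x) (at x)"
proof -
  obtain d where d: "d 0 = g" "\<And>k x. (d k has_real_derivative d (Suc k) x) (at x)"
    using assms unfolding smooth1_def by blast
  have "smooth1 (d (Suc 0))"
    unfolding smooth1_def by (intro exI[of _ "\<lambda>k. d (Suc k)"]) (use d in auto)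
  moreover have "(g has_real_derivative d (Suc 0) x) (at x)" for x
    using d(2)[of 0 x] d(1) by simp
  ultimately show ?thesis using that by blast
qed

text \<open>Differentiating a product gives a sum of products, so products alone are not closed
  under differentiation, while the generated algebra is.\<close>

inductive_set smooth1_algebra :: "(real \<Rightarrow> real) set" where
  base: "smooth1 g \<Longrightarrow> g \<in> smooth1_algebra"
| add: "f \<in> smooth1_algebra \<Longrightarrow> g \<in> smooth1_algebra \<Longrightarrow> (\<lambda>x. f x + g x) \<in> smooth1_algebra"
| mult: "f \<in> smooth1_algebra \<Longrightarrow> g \<in> smooth1_algebra \<Longrightarrow> (\<lambda>x. f x * g x) \<in> smooth1_algebra"

lemma smooth1_algebra_smooth1:
  assumes "g \<in> smooth1_algebra"
  shows "smooth1 g"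
  using assms
proof (rule smooth1_coinduct)
  fix g assume "g \<in> smooth1_algebra"
  then show "\<exists>g'\<in>smooth1_algebra. \<forall>x. (g has_real_derivative g' x) (at x)"
  proof induction
    case (base g)
    then show ?case using smooth1_algebra.base by (meson smooth1_deriv)
  next
    case (add f g)
    then obtain f' g' where "f' \<in> smooth1_algebra" "g' \<in> smooth1_algebra"
      "\<And>x. (f has_real_derivative f' x) (at x)" "\<And>x. (g has_real_derivative g' x) (at x)" by blast
    then show ?case
      by (intro bexI[of _ "\<lambda>x. f' x + g' x"]) (auto intro: smooth1_algebra.intros DERIV_add)
  next
    case (mult f g)
    then obtain f' g' where "f' \<in> smooth1_algebra" "g' \<in> smooth1_algebra"
      "\<And>x. (f has_real_derivative f' x) (at x)" "\<And>x. (g has_real_derivative g' x) (at x)" by blast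
    then show ?case using mult.hyps
      by (intro bexI[of _ "\<lambda>x. f' x * g x + g' x * f x"])
         (auto intro!: smooth1_algebra.add smooth1_algebra.mult DERIV_mult)
  qed
qed

lemma smooth1_mult: "smooth1 f \<Longrightarrow> smooth1 g \<Longrightarrow> smooth1 (\<lambda>x. f x * g x)"
  by (rule smooth1_algebra_smooth1, rule smooth1_algebra.mult) (rule smooth1_algebra.base, assumption)+

lemma smooth1_const: "smooth1 (\<lambda>_. c)"
proof (rule smooth1_coinduct)
  show "(\<lambda>_. c) \<in> range (\<lambda>c _. c :: real)" by simp
next
  fix g :: "real \<Rightarrow> real" assume "g \<in> range (\<lambda>c _. c)"
  then show "\<exists>g'\<in>range (\<lambda>c _. c). \<forall>x. (g has_real_derivative g' x) (at x)"
    by (intro bexI[of _ "\<lambda>_. 0"]) auto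
qed

lemma smooth1_antiderivative:
  assumes "smooth1 g'" "\<And>x. (g has_real_derivative g' x) (at x)"
  shows "smooth1 g"
proof (rule smooth1_coinduct)
  show "g \<in> insert g (Collect smooth1)" by simp
next
  fix f assume "f \<in> insert g (Collect smooth1)"
  then show "\<exists>f'\<in>insert g (Collect smooth1). \<forall>x. (f has_real_derivative f' x) (at x)"
    using assms by (auto elim: smooth1_deriv)
qed

lemma smooth1_id: "smooth1 (\<lambda>x. x)"
  by (rule smooth1_antiderivative[OF smooth1_const[of 1]]) (auto intro: derivative_eq_intros)

lemma smooth1_power: "smooth1 (\<lambda>x. x ^ n)"
  by (induction n) (auto intro: smooth1_const smooth1_mult smooth1_id)

lemma smooth1_affine:
  assumes "smooth1 g"
  shows "smooth1 (\<lambda>x. g (a * x + b))"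
proof (rule smooth1_coinduct)
  \<comment> \<open>The factor \<open>c\<close> in the class absorbs the powers of \<open>a\<close>
    produced by the chain rule.\<close>
  show "(\<lambda>x. g (a * x + b)) \<in> {\<lambda>x. c * g (a * x + b) | c g. smooth1 g}"
    using assms by (intro CollectI exI[of _ 1] exI[of _ g]) simp
next
  fix f assume "f \<in> {\<lambda>x. c * g (a * x + b) | c g. smooth1 g}"
  then obtain c g where f: "f = (\<lambda>x. c * g (a * x + b))" and "smooth1 g" by blast
  then obtain g' where g': "smooth1 g'" "\<And>x. (g has_real_derivative g' x) (at x)"
    by (meson smooth1_deriv)
  have "(f has_real_derivative (c * a) * g' (a * x + b)) (at x)" for x
    unfolding f by (auto intro!: derivative_eq_intros DERIV_chain2[OF g'(2)])
  then show "\<exists>f'\<in>{\<lambda>x. c * g (a * x + b) | c g. smooth1 g}. \<forall>x. (f has_real_derivative f' x) (at x)"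
    using g'(1) by (intro bexI[of _ "\<lambda>x. (c * a) * g' (a * x + b)"]) auto
qed

lemma smooth1_has_antiderivative:
  assumes "smooth1 g"
  obtains G where "smooth1 G" "\<And>x. (G has_real_derivative g x) (at x)"
proof -
  obtain g' where "\<And>x. (g has_real_derivative g' x) (at x)" using assms by (rule smooth1_deriv) blast
  then have "isCont g x" for x using DERIV_isCont by blast
  then obtain G where "\<And>x. -\<infinity> < ereal x \<Longrightarrow> ereal x < \<infinity> \<Longrightarrow> (G has_vector_derivative g x) (at x)"
    using einterval_antiderivative[of "-\<infinity>" "\<infinity>" g] by auto
  then have "(G has_real_derivative g x) (at x)" for x
    by (simp add: has_real_derivative_iff_has_vector_derivative)
  then show ?thesis using that smooth1_antiderivative[OF assms] by blast
qed

text \<open>On the positive axis, all derivatives of \<open>exp (- (1 / t))\<close> are polynomials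
  in \<open>1 / t\<close> times this function. Extended by zero, such functions form a class closed
  under differentiation.\<close>

definition flat_poly :: "real poly \<Rightarrow> real \<Rightarrow> real" where
  "flat_poly p t = (if t > 0 then poly p (1 / t) * exp (- (1 / t)) else 0)"

lemma poly_exp_tendsto_0: "((\<lambda>u. poly p u * exp (- u)) \<longlongrightarrow> (0::real)) at_top"
proof -
  have "((\<lambda>u. \<Sum>i\<le>degree p. coeff p i * (u ^ i / exp u)) \<longlongrightarrow> (\<Sum>i\<le>degree p. coeff p i * 0)) at_top"
    by (intro tendsto_sum tendsto_mult tendsto_const tendsto_power_div_exp_0)
  then show ?thesis
    by (simp add: poly_altdef exp_minus sum_distrib_right divide_inverse mult.assoc)
qed

text \<open>This is the difference quotient at the origin. After the substitution
  \<open>u = 1 / t\<close> the exponential beats every polynomial.\<close>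

lemma flat_poly_tendsto_0: "((\<lambda>t. flat_poly p t / t) \<longlongrightarrow> 0) (at 0)"
proof -
  \<comment> \<open>The factor \<open>[:0, 1:]\<close> is the variable \<open>u\<close> itself and
    stands for the division by \<open>t\<close>.\<close>
  have "((\<lambda>t. poly ([:0, 1:] * p) (inverse t) * exp (- inverse t)) \<longlongrightarrow> (0::real)) (at_right 0)"
    by (rule filterlim_compose[OF poly_exp_tendsto_0 filterlim_inverse_at_top_right])
  then have "((\<lambda>t. flat_poly p t / t) \<longlongrightarrow> 0) (at_right 0)"
    by (rule Lim_transform_eventually)
       (auto simp: eventually_at_right_field flat_poly_def divide_inverse intro!: exI[of _ 1])
  moreover have "((\<lambda>t. flat_poly p t / t) \<longlongrightarrow> 0) (at_left 0)"
    by (rule Lim_transform_eventually[OF tendsto_const])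
       (auto simp: eventually_at_left_field flat_poly_def intro!: exI[of _ "-1"])
  ultimately show ?thesis by (simp add: filterlim_split_at)
qed

text \<open>The inner derivative of \<open>1 / t\<close> contributes the square
  \<open>[:0, 0, 1:]\<close>, the exponential contributes \<open>p\<close>, and the polynomial
  factor contributes \<open>- pderiv p\<close>. Only the origin needs the limit above.\<close>

lemma flat_poly_deriv:
  "(flat_poly p has_real_derivative flat_poly ([:0, 0, 1:] * (p - pderiv p)) x) (at x)"
proof -
  consider "x > 0" | "x < 0" | "x = 0" by linarith
  then show ?thesis
  proof cases
    case 1
    have "((\<lambda>t. poly p (1 / t) * exp (- (1 / t))) has_real_derivative
        poly ([:0, 0, 1:] * (p - pderiv p)) (1 / x) * exp (- (1 / x))) (at x)"
      using 1 by (auto intro!: derivative_eq_intros DERIV_chain2[OF poly_DERIV]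
          simp: field_simps power2_eq_square)
    then have "(flat_poly p has_real_derivative
        poly ([:0, 0, 1:] * (p - pderiv p)) (1 / x) * exp (- (1 / x))) (at x)"
      by (rule has_field_derivative_transform_within_open[where S="{0<..}"])
         (use 1 in \<open>auto simp: flat_poly_def\<close>)
    then show ?thesis using 1 by (simp add: flat_poly_def)
  next
    case 2
    have "((\<lambda>t. 0) has_real_derivative 0) (at x)" by simp
    then have "(flat_poly p has_real_derivative 0) (at x)"
      by (rule has_field_derivative_transform_within_open[where S="{..<0}"])
         (use 2 in \<open>auto simp: flat_poly_def\<close>)
    then show ?thesis using 2 by (simp add: flat_poly_def)
  next
    case 3
    then show ?thesis using flat_poly_tendsto_0[of p]
      by (simp add: has_field_derivative_iff flat_poly_def)
  qed
qed

definition flat_exp :: "real \<Rightarrow> real" where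
  "flat_exp t = (if t > 0 then exp (- (1 / t)) else 0)"

lemma smooth1_flat_exp: "smooth1 flat_exp"
proof (rule smooth1_coinduct)
  have "flat_exp = flat_poly 1" by (auto simp: flat_exp_def flat_poly_def)
  then show "flat_exp \<in> range flat_poly" by simp
next
  fix g assume "g \<in> range flat_poly"
  then show "\<exists>g'\<in>range flat_poly. \<forall>x. (g has_real_derivative g' x) (at x)"
    using flat_poly_deriv by blast
qed

section \<open>Smooth functions of several variables\<close>

lemma smooth_coinduct:
  assumes "\<phi> \<in> S"
    and step: "\<And>\<phi>. \<phi> \<in> S \<Longrightarrow> \<exists>g :: 'n \<Rightarrow> real^'n \<Rightarrow> real. (\<forall>i. g i \<in> S) \<and>
      (\<forall>x. (\<phi> has_derivative (\<lambda>h. \<Sum>i\<in>UNIV. h $ i * g i x)) (at x))"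
  shows "smooth \<phi>"
proof -
  obtain G where G: "\<And>\<phi> i. \<phi> \<in> S \<Longrightarrow> G \<phi> i \<in> S"
      "\<And>\<phi> x. \<phi> \<in> S \<Longrightarrow> (\<phi> has_derivative (\<lambda>h. \<Sum>i\<in>UNIV. h $ i * G \<phi> i x)) (at x)"
  proof -
    have "\<forall>\<phi>\<in>S. \<exists>g. (\<forall>i. g i \<in> S) \<and> (\<forall>x. (\<phi> has_derivative (\<lambda>h. \<Sum>i\<in>UNIV. h $ i * g i x)) (at x))"
      using step by blast
    from bchoice[OF this] show ?thesis using that by blast
  qed
  \<comment> \<open>\<open>foldr\<close> applies the head of the list last, which is the order in
    which \<open>smooth\<close> extends the list of directions.\<close>
  define D where "D js = foldr (\<lambda>i f. G f i) js \<phi>" for js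
  have "D js \<in> S" for js
    by (induction js) (use assms(1) G(1) in \<open>auto simp: D_def\<close>)
  then show ?thesis
    unfolding smooth_def by (intro exI[of _ D]) (use G(2) in \<open>auto simp: D_def\<close>)
qed

lemma smooth_partials:
  fixes \<phi> :: "real^'n \<Rightarrow> real"
  assumes "smooth \<phi>"
  obtains g where "\<And>i. smooth (g i)"
    "\<And>x. (\<phi> has_derivative (\<lambda>h. \<Sum>i\<in>UNIV. h $ i * g i x)) (at x)"
proof -
  obtain D where D: "D [] = \<phi>" "\<And>js x. (D js has_derivative (\<lambda>h. \<Sum>i\<in>UNIV. h $ i * D (i # js) x)) (at x)"
    using assms unfolding smooth_def by blast
  \<comment> \<open>Directions are added at the head, so the derivative taken first, here
    \<open>i\<close>, is the last entry of the list.\<close>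
  have "smooth (D [i])" for i
    unfolding smooth_def by (intro exI[of _ "\<lambda>js. D (js @ [i])"]) (use D in auto)
  then show ?thesis using that[of "\<lambda>i. D [i]"] D(1) D(2)[of "[]"] by auto
qed

text \<open>The generators \<open>g (x $ i)\<close> bring tensor products of functions of one
  variable into the algebra; monomials and bump functions are of this kind.\<close>

inductive_set smooth_algebra :: "(real^'n \<Rightarrow> real) set" where
  base: "smooth \<phi> \<Longrightarrow> \<phi> \<in> smooth_algebra"
| coord: "smooth1 g \<Longrightarrow> (\<lambda>x. g (x $ i)) \<in> smooth_algebra"
| add: "f \<in> smooth_algebra \<Longrightarrow> g \<in> smooth_algebra \<Longrightarrow> (\<lambda>x. f x + g x) \<in> smooth_algebra"
| mult: "f \<in> smooth_algebra \<Longrightarrow> g \<in> smooth_algebra \<Longrightarrow> (\<lambda>x. f x * g x) \<in> smooth_algebra"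

lemma has_derivative_coord:
  assumes "(g has_real_derivative g') (at (x $ i))"
  shows "((\<lambda>x::real^'n. g (x $ i)) has_derivative (\<lambda>h. h $ i * g')) (at x)"
proof -
  have "((\<lambda>x::real^'n. x $ i) has_derivative (\<lambda>h. h $ i)) (at x)"
    by (rule bounded_linear_imp_has_derivative[OF bounded_linear_vec_nth])
  moreover have "(g has_derivative (\<lambda>h. h * g')) (at (x $ i))"
  proof -
    have "(*) g' = (\<lambda>h. h * g')" by (intro ext) (rule mult.commute)
    then show ?thesis using assms by (simp add: has_field_derivative_def)
  qed
  ultimately show ?thesis by (rule has_derivative_compose)
qed

lemma smooth_algebra_smooth:
  assumes "\<phi> \<in> smooth_algebra"
  shows "smooth \<phi>"
  using assms
proof (rule smooth_coinduct)
  fix \<phi> :: "real^'n \<Rightarrow> real" assume "\<phi> \<in> smooth_algebra"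
  then show "\<exists>g :: 'n \<Rightarrow> real^'n \<Rightarrow> real. (\<forall>i. g i \<in> smooth_algebra) \<and>
      (\<forall>x. (\<phi> has_derivative (\<lambda>h. \<Sum>i\<in>UNIV. h $ i * g i x)) (at x))"
  proof induction
    case (base \<phi>)
    then obtain g where "\<And>i. smooth (g i)"
      "\<And>x. (\<phi> has_derivative (\<lambda>h. \<Sum>i\<in>UNIV. h $ i * g i x)) (at x)" by (rule smooth_partials) blast
    then show ?case by (intro exI[of _ g]) (auto intro: smooth_algebra.base)
  next
    case (coord g i)
    then obtain g' where g': "smooth1 g'" "\<And>x. (g has_real_derivative g' x) (at x)"
      by (rule smooth1_deriv) blast
    let ?G = "\<lambda>j (x::real^'n). (if j = i then g' (x $ i) else 0)"
    have "?G j \<in> smooth_algebra" for j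
    proof (cases "j = i")
      case True
      have "(\<lambda>x. g' (x $ i)) \<in> smooth_algebra" by (rule smooth_algebra.coord[OF g'(1)])
      then show ?thesis using True by simp
    next
      case False
      have "(\<lambda>x. (\<lambda>_. 0) (x $ i)) \<in> smooth_algebra" by (rule smooth_algebra.coord[OF smooth1_const])
      then show ?thesis using False by simp
    qed
    moreover have "((\<lambda>x::real^'n. g (x $ i)) has_derivative (\<lambda>h. \<Sum>j\<in>UNIV. h $ j * ?G j x)) (at x)" for x
      using has_derivative_coord[OF g'(2)[of "x $ i"]] by (simp add: if_distrib cong: if_cong)
    ultimately show ?case by (intro exI[of _ ?G]) simp
  next
    case (add f g)
    then obtain F G where FG: "\<And>i. F i \<in> smooth_algebra" "\<And>i. G i \<in> smooth_algebra"
      "\<And>x. (f has_derivative (\<lambda>h. \<Sum>i\<in>UNIV. h $ i * F i x)) (at x)"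
      "\<And>x. (g has_derivative (\<lambda>h. \<Sum>i\<in>UNIV. h $ i * G i x)) (at x)" by blast
    have "((\<lambda>x. f x + g x) has_derivative (\<lambda>h. \<Sum>i\<in>UNIV. h $ i * (F i x + G i x))) (at x)" for x
      using has_derivative_add[OF FG(3)[of x] FG(4)[of x]] by (simp add: distrib_left sum.distrib)
    then show ?case
      using FG(1,2) by (intro exI[of _ "\<lambda>i x. F i x + G i x"]) (auto intro: smooth_algebra.intros)
  next
    case (mult f g)
    then obtain F G where FG: "\<And>i. F i \<in> smooth_algebra" "\<And>i. G i \<in> smooth_algebra"
      "\<And>x. (f has_derivative (\<lambda>h. \<Sum>i\<in>UNIV. h $ i * F i x)) (at x)"
      "\<And>x. (g has_derivative (\<lambda>h. \<Sum>i\<in>UNIV. h $ i * G i x)) (at x)" by blast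
    have "((\<lambda>x. f x * g x) has_derivative (\<lambda>h. \<Sum>i\<in>UNIV. h $ i * (f x * G i x + F i x * g x))) (at x)" for x
      using has_derivative_mult[OF FG(3)[of x] FG(4)[of x]]
      by (simp add: distrib_left sum.distrib sum_distrib_left sum_distrib_right mult_ac)
    then show ?case
      using FG(1,2) mult.hyps
      by (intro exI[of _ "\<lambda>i x. f x * G i x + F i x * g x"]) (auto intro!: smooth_algebra.add smooth_algebra.mult)
  qed
qed

lemma smooth_add: "smooth f \<Longrightarrow> smooth g \<Longrightarrow> smooth (\<lambda>x. f x + g x)"
  by (rule smooth_algebra_smooth, rule smooth_algebra.add) (rule smooth_algebra.base, assumption)+

lemma smooth_mult: "smooth f \<Longrightarrow> smooth g \<Longrightarrow> smooth (\<lambda>x. f x * g x)"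
  by (rule smooth_algebra_smooth, rule smooth_algebra.mult) (rule smooth_algebra.base, assumption)+

lemma smooth_coord: "smooth1 g \<Longrightarrow> smooth (\<lambda>x. g (x $ i))"
  by (rule smooth_algebra_smooth, rule smooth_algebra.coord)

lemma smooth_const: "smooth (\<lambda>_. c)"
  using smooth_coord[OF smooth1_const[of c]] by simp

lemma smooth_lincomb: "smooth f \<Longrightarrow> smooth g \<Longrightarrow> smooth (\<lambda>x. a * f x + b * g x)"
  by (intro smooth_add smooth_mult smooth_const)

lemma smooth_diff: "smooth f \<Longrightarrow> smooth g \<Longrightarrow> smooth (\<lambda>x. f x - g x)"
  using smooth_lincomb[of f g 1 "-1"] by simp

lemma smooth_sum: "finite I \<Longrightarrow> (\<And>i. i \<in> I \<Longrightarrow> smooth (f i)) \<Longrightarrow> smooth (\<lambda>x. \<Sum>i\<in>I. f i x)"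
  by (induction I rule: finite_induct) (auto intro: smooth_add smooth_const)

lemma smooth_prod: "finite I \<Longrightarrow> (\<And>i. i \<in> I \<Longrightarrow> smooth (f i)) \<Longrightarrow> smooth (\<lambda>x. \<Prod>i\<in>I. f i x)"
  by (induction I rule: finite_induct) (auto intro: smooth_mult smooth_const)

section \<open>Gradients of smooth functions\<close>

lemma grad_unique:
  fixes \<phi> :: "real^'n \<Rightarrow> real"
  assumes "(\<phi> has_derivative \<phi>') (at x)"
  shows "grad \<phi> x $ i = \<phi>' (axis i 1)"
  using frechet_derivative_at[OF assms] by (simp add: grad_def)

lemma grad_has_derivative:
  fixes \<phi> :: "real^'n \<Rightarrow> real"
  assumes "(\<phi> has_derivative \<phi>') (at x)"
  shows "(\<phi> has_derivative (\<lambda>h. grad \<phi> x \<bullet> h)) (at x)"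
proof -
  have "linear \<phi>'" using assms by (rule has_derivative_linear)
  have "\<phi>' h = grad \<phi> x \<bullet> h" for h
  proof -
    have "\<phi>' h = \<phi>' (\<Sum>i\<in>UNIV. h $ i *\<^sub>R axis i 1)"
      using basis_expansion[of h] by (simp add: scalar_mult_eq_scaleR)
    also have "\<dots> = (\<Sum>i\<in>UNIV. h $ i * \<phi>' (axis i 1))"
      using \<open>linear \<phi>'\<close> by (simp add: linear_sum linear_cmul)
    finally show ?thesis by (simp add: inner_vec_def grad_unique[OF assms] mult.commute)
  qed
  then have "\<phi>' = (\<lambda>h. grad \<phi> x \<bullet> h)" by blast
  then show ?thesis using assms by simp
qed

lemma smooth_has_derivative:
  fixes \<phi> :: "real^'n \<Rightarrow> real"
  assumes "smooth \<phi>"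
  shows "(\<phi> has_derivative (\<lambda>h. grad \<phi> x \<bullet> h)) (at x)"
proof -
  obtain g where "\<And>x. (\<phi> has_derivative (\<lambda>h. \<Sum>i\<in>UNIV. h $ i * g i x)) (at x)"
    using assms by (rule smooth_partials) blast
  then show ?thesis by (rule grad_has_derivative)
qed

lemma smooth_grad_component:
  fixes \<phi> :: "real^'n \<Rightarrow> real"
  assumes "smooth \<phi>"
  shows "smooth (\<lambda>x. grad \<phi> x $ i)"
proof -
  obtain g where g: "\<And>i. smooth (g i)"
      "\<And>x. (\<phi> has_derivative (\<lambda>h. \<Sum>i\<in>UNIV. h $ i * g i x)) (at x)"
    using assms by (rule smooth_partials) blast
  have "grad \<phi> x $ i = g i x" for x
    using grad_unique[OF g(2)] by (simp add: axis_def if_distrib if_distribR cong: if_cong)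
  then show ?thesis using g(1) by simp
qed

lemma smooth_continuous:
  fixes \<phi> :: "real^'n \<Rightarrow> real"
  assumes "smooth \<phi>"
  shows "continuous_on A \<phi>"
  using smooth_has_derivative[OF assms]
  by (meson has_derivative_continuous continuous_at_imp_continuous_on)

lemma smooth_grad_continuous:
  fixes \<phi> :: "real^'n \<Rightarrow> real"
  assumes "smooth \<phi>"
  shows "continuous_on A (grad \<phi>)"
proof -
  have "continuous_on A (\<lambda>x. \<chi> i. grad \<phi> x $ i)"
    by (intro continuous_on_vec_lambda smooth_continuous smooth_grad_component assms)
  then show ?thesis by simp
qed

lemma grad_lincomb:
  fixes f g :: "real^'n \<Rightarrow> real"
  assumes "smooth f" "smooth g"
  shows "grad (\<lambda>x. a * f x + b * g x) x = a *\<^sub>R grad f x + b *\<^sub>R grad g x"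
proof -
  have "((\<lambda>x. a * f x + b * g x) has_derivative (\<lambda>h. a * (grad f x \<bullet> h) + b * (grad g x \<bullet> h))) (at x)"
    by (intro derivative_intros smooth_has_derivative assms)
  from grad_unique[OF this] show ?thesis by (simp add: vec_eq_iff inner_axis)
qed

lemma grad_diff:
  fixes f g :: "real^'n \<Rightarrow> real"
  assumes "smooth f" "smooth g"
  shows "grad (\<lambda>x. f x - g x) x = grad f x - grad g x"
  using grad_lincomb[OF assms, of 1 "-1" x] by simp

lemma grad_mult:
  fixes f g :: "real^'n \<Rightarrow> real"
  assumes "smooth f" "smooth g"
  shows "grad (\<lambda>x. f x * g x) x = f x *\<^sub>R grad g x + g x *\<^sub>R grad f x"
proof -
  have "((\<lambda>x. f x * g x) has_derivative (\<lambda>h. f x * (grad g x \<bullet> h) + (grad f x \<bullet> h) * g x)) (at x)"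
    by (intro has_derivative_mult smooth_has_derivative assms)
  from grad_unique[OF this] show ?thesis by (simp add: vec_eq_iff inner_axis algebra_simps)
qed

lemma grad_tensor:
  fixes x :: "real^'n"
  assumes "\<And>j. (g j has_real_derivative g' j) (at (x $ j))"
  shows "grad (\<lambda>x. \<Prod>j\<in>UNIV. g j (x $ j)) x $ i = g' i * (\<Prod>j\<in>UNIV - {i}. g j (x $ j))"
proof -
  have "((\<lambda>x. \<Prod>j\<in>UNIV. g j (x $ j)) has_derivative
      (\<lambda>h. \<Sum>k\<in>UNIV. h $ k * g' k * (\<Prod>j\<in>UNIV - {k}. g j (x $ j)))) (at x)"
    by (intro has_derivative_prod has_derivative_coord assms)
  from grad_unique[OF this, of i] show ?thesis
    by (simp add: axis_def if_distrib if_distribR cong: if_cong)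
qed

lemma smooth_tensor:
  assumes "\<And>j. smooth1 (g j)"
  shows "smooth (\<lambda>x::real^'n. \<Prod>j\<in>UNIV. g j (x $ j))"
  by (intro smooth_prod smooth_coord assms) simp

section \<open>Polynomials of bounded total degree\<close>

definition monom_fun :: "('n \<Rightarrow> nat) \<Rightarrow> real^'n \<Rightarrow> real" where
  "monom_fun \<alpha> x = (\<Prod>i\<in>UNIV. (x $ i) ^ \<alpha> i)"

lemma smooth_monom_fun: "smooth (monom_fun \<alpha>)"
  unfolding monom_fun_def[abs_def] by (intro smooth_tensor smooth1_power)

definition multi_indices :: "int \<Rightarrow> ('n::finite \<Rightarrow> nat) set" where
  "multi_indices k = {\<alpha>. int (\<Sum>i\<in>UNIV. \<alpha> i) \<le> k}"

lemma finite_multi_indices: "finite (multi_indices k :: ('n::finite \<Rightarrow> nat) set)"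
proof (rule finite_subset)
  show "(multi_indices k :: ('n \<Rightarrow> nat) set) \<subseteq> Pi\<^sub>E UNIV (\<lambda>_. {..nat k})"
  proof (rule subsetI, rule PiE_I)
    fix \<alpha> :: "'n \<Rightarrow> nat" and i assume \<alpha>: "\<alpha> \<in> multi_indices k"
    have "int (\<alpha> i) \<le> int (\<Sum>i\<in>UNIV. \<alpha> i)" by (intro of_nat_mono member_le_sum) auto
    then show "\<alpha> i \<in> {..nat k}" using \<alpha> by (simp add: multi_indices_def del: of_nat_sum)
  qed simp
  show "finite (Pi\<^sub>E (UNIV :: 'n set) (\<lambda>_. {..nat k}))" by (rule finite_PiE) auto
qed

lemma polys_iff: "P \<in> polys k \<longleftrightarrow>
    (\<exists>c. P = (\<lambda>x. \<Sum>\<alpha>\<in>multi_indices k. c \<alpha> * monom_fun \<alpha> x))"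
  by (simp add: polys_def multi_indices_def monom_fun_def fun_eq_iff)

lemma polys_lincomb:
  assumes "P \<in> polys k" "Q \<in> polys k"
  shows "(\<lambda>x. a * P x + b * Q x) \<in> polys k"
proof -
  obtain c d where P: "P = (\<lambda>x. \<Sum>\<alpha>\<in>multi_indices k. c \<alpha> * monom_fun \<alpha> x)"
    and Q: "Q = (\<lambda>x. \<Sum>\<alpha>\<in>multi_indices k. d \<alpha> * monom_fun \<alpha> x)"
    using assms unfolding polys_iff by blast
  have "(\<lambda>x. a * P x + b * Q x) = (\<lambda>x. \<Sum>\<alpha>\<in>multi_indices k. (a * c \<alpha> + b * d \<alpha>) * monom_fun \<alpha> x)"
    unfolding P Q by (simp add: sum_distrib_left sum.distrib distrib_right mult.assoc)
  then show ?thesis unfolding polys_iff by (intro exI)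
qed

lemma polys_zero: "(\<lambda>_. 0) \<in> polys k"
  unfolding polys_iff by (intro exI[of _ "\<lambda>_. 0"]) simp

lemma polys_diff: "P \<in> polys k \<Longrightarrow> Q \<in> polys k \<Longrightarrow> (\<lambda>x. P x - Q x) \<in> polys k"
  using polys_lincomb[of P k Q 1 "-1"] by simp

lemma polys_scale: "P \<in> polys k \<Longrightarrow> (\<lambda>x. a * P x) \<in> polys k"
  using polys_lincomb[of P k P a 0] by simp

lemma polys_sum: "finite I \<Longrightarrow> (\<And>i. i \<in> I \<Longrightarrow> P i \<in> polys k) \<Longrightarrow> (\<lambda>x. \<Sum>i\<in>I. P i x) \<in> polys k"
proof (induction I rule: finite_induct)
  case (insert i I)
  then show ?case using polys_lincomb[of "P i" k "\<lambda>x. \<Sum>i\<in>I. P i x" 1 1] by simp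
qed (simp add: polys_zero)

lemma monom_fun_polys:
  assumes "\<alpha> \<in> multi_indices k"
  shows "monom_fun \<alpha> \<in> polys k"
proof -
  have "monom_fun \<alpha> x = (\<Sum>\<beta>\<in>multi_indices k. (if \<beta> = \<alpha> then 1 else 0) * monom_fun \<beta> x)" for x
    using assms by (simp add: if_distrib if_distribR sum.delta[OF finite_multi_indices] cong: if_cong)
  then show ?thesis unfolding polys_iff by (intro exI[of _ "\<lambda>\<beta>. if \<beta> = \<alpha> then 1 else 0"]) auto
qed

lemma polys_mono:
  assumes "P \<in> polys k" "k \<le> m"
  shows "P \<in> polys m"
proof -
  obtain c where P: "P = (\<lambda>x. \<Sum>\<alpha>\<in>multi_indices k. c \<alpha> * monom_fun \<alpha> x)"
    using assms(1) unfolding polys_iff by blast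
  show ?thesis unfolding P
    by (intro polys_sum polys_scale monom_fun_polys finite_multi_indices) (use assms(2) in \<open>auto simp: multi_indices_def\<close>)
qed

lemma polys_smooth: "P \<in> polys k \<Longrightarrow> smooth P"
  unfolding polys_iff
  by (auto intro!: smooth_sum smooth_mult smooth_const smooth_monom_fun finite_multi_indices)

text \<open>The case \<open>\<alpha> i = 0\<close> is separated because truncated subtraction would
  leave the exponent, and hence the degree, unchanged there.\<close>

lemma grad_monom_fun:
  "(\<lambda>x. grad (monom_fun \<alpha>) x $ i) = (if \<alpha> i = 0 then (\<lambda>_. 0) else (\<lambda>x. real (\<alpha> i) * monom_fun (\<alpha>(i := \<alpha> i - 1)) x))"
proof
  fix x
  have "grad (monom_fun \<alpha>) x $ i = (real (\<alpha> i) * (x $ i) ^ (\<alpha> i - 1)) * (\<Prod>j\<in>UNIV - {i}. (x $ j) ^ \<alpha> j)"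
    unfolding monom_fun_def[abs_def]
    by (rule grad_tensor[where g="\<lambda>j t. t ^ \<alpha> j" and g'="\<lambda>j. real (\<alpha> j) * (x $ j) ^ (\<alpha> j - 1)"])
       (auto intro!: derivative_eq_intros)
  also have "\<dots> = real (\<alpha> i) * monom_fun (\<alpha>(i := \<alpha> i - 1)) x"
    unfolding monom_fun_def by (subst (2) prod.remove[of _ i]) (auto intro!: prod.cong)
  finally show "grad (monom_fun \<alpha>) x $ i = (if \<alpha> i = 0 then (\<lambda>_. 0) else (\<lambda>x. real (\<alpha> i) * monom_fun (\<alpha>(i := \<alpha> i - 1)) x)) x"
    by simp
qed

text \<open>The exact drop of the degree matches the orders of the moments: gradients of discrete
  velocities have the degree \<open>l - 1\<close> of the face moments, and gradients of these have
  the degree \<open>l - 2\<close> of the element moments.\<close>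

lemma grad_polys:
  fixes P :: "real^'n \<Rightarrow> real"
  assumes "P \<in> polys k"
  shows "(\<lambda>x. grad P x $ i) \<in> polys (k - 1)"
proof -
  obtain c where P: "P = (\<lambda>x. \<Sum>\<alpha>\<in>multi_indices k. c \<alpha> * monom_fun \<alpha> x)"
    using assms(1) unfolding polys_iff by blast
  have der: "(P has_derivative (\<lambda>h. \<Sum>\<alpha>\<in>multi_indices k. c \<alpha> * (grad (monom_fun \<alpha>) x \<bullet> h))) (at x)" for x
    unfolding P by (intro derivative_intros smooth_has_derivative smooth_monom_fun)
  have "grad P x $ i = (\<Sum>\<alpha>\<in>multi_indices k. c \<alpha> * (\<lambda>x. grad (monom_fun \<alpha>) x $ i) x)" for x
    using grad_unique[OF der[of x], of i] by (simp add: inner_axis)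
  moreover have "(\<lambda>x. \<Sum>\<alpha>\<in>multi_indices k. c \<alpha> * (\<lambda>x. grad (monom_fun \<alpha>) x $ i) x) \<in> polys (k - 1)"
  proof (intro polys_sum polys_scale finite_multi_indices)
    fix \<alpha> :: "'n \<Rightarrow> nat" assume \<alpha>: "\<alpha> \<in> multi_indices k"
    have "(\<Sum>i\<in>UNIV. \<alpha> i) = Suc (\<Sum>j\<in>UNIV. (\<alpha>(i := \<alpha> i - 1)) j)" if "\<alpha> i \<noteq> 0"
    proof -
      have "(\<Sum>j\<in>UNIV - {i}. (\<alpha>(i := \<alpha> i - 1)) j) = (\<Sum>j\<in>UNIV - {i}. \<alpha> j)"
        by (rule sum.cong) auto
      moreover have "(\<Sum>j\<in>UNIV. (\<alpha>(i := \<alpha> i - 1)) j) = (\<alpha> i - 1) + (\<Sum>j\<in>UNIV - {i}. (\<alpha>(i := \<alpha> i - 1)) j)"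
        by (subst sum.remove[of UNIV i]) auto
      moreover have "(\<Sum>j\<in>UNIV. \<alpha> j) = \<alpha> i + (\<Sum>j\<in>UNIV - {i}. \<alpha> j)"
        by (rule sum.remove) auto
      ultimately show ?thesis using that by linarith
    qed
    then show "(\<lambda>x. grad (monom_fun \<alpha>) x $ i) \<in> polys (k - 1)"
      unfolding grad_monom_fun using \<alpha>
      by (auto intro!: polys_zero polys_scale monom_fun_polys simp: multi_indices_def simp del: of_nat_sum fun_upd_apply)
  qed
  ultimately show ?thesis by simp
qed

section \<open>The fundamental lemma of the calculus of variations\<close>

text \<open>Every \<open>bump a b k\<close> is nonzero exactly on the open box; increasing
  \<open>k\<close> only steepens the slopes, so that the functions tend to the indicator of the
  box.\<close>

definition bump :: "real^'n \<Rightarrow> real^'n \<Rightarrow> nat \<Rightarrow> real^'n \<Rightarrow> real" where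
  "bump a b k x =
    (\<Prod>j\<in>UNIV. flat_exp (real (Suc k) * (x $ j - a $ j)) * flat_exp (real (Suc k) * (b $ j - x $ j)))"

lemma smooth1_bump_factor:
  "smooth1 (\<lambda>t. flat_exp (c * (t - a)) * flat_exp (c * (b - t)))"
  using smooth1_mult[OF smooth1_affine[OF smooth1_flat_exp, of c "- (c * a)"] smooth1_affine[OF smooth1_flat_exp, of "- c" "c * b"]]
  by (simp add: algebra_simps)

lemma smooth_bump: "smooth (bump a b k)"
  unfolding bump_def[abs_def]
  by (rule smooth_tensor[of "\<lambda>j t. flat_exp (real (Suc k) * (t - a $ j)) * flat_exp (real (Suc k) * (b $ j - t))"])
     (rule smooth1_bump_factor)

lemma flat_exp_bounds: "0 \<le> flat_exp t" "flat_exp t \<le> 1"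
  by (auto simp: flat_exp_def)

lemma bump_bounds: "0 \<le> bump a b k x" "bump a b k x \<le> 1"
  unfolding bump_def by (auto intro!: prod_nonneg prod_le_1 mult_nonneg_nonneg mult_le_one flat_exp_bounds)

lemma bump_support: "{x. bump a b k x \<noteq> 0} = box a b"
proof -
  have "bump a b k x \<noteq> 0 \<longleftrightarrow> x \<in> box a b" for x
    unfolding bump_def mem_box_cart by (auto simp: flat_exp_def zero_less_mult_iff)
  then show ?thesis by blast
qed

lemma bump_test_function:
  assumes "cbox a b \<subseteq> U"
  shows "bump a b k \<in> test_functions U"
proof -
  have sub: "closure {x. bump a b k x \<noteq> 0} \<subseteq> cbox a b"
    unfolding bump_support by (intro closure_minimal box_subset_cbox closed_cbox)
  then have "compact (closure {x. bump a b k x \<noteq> 0})"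
    by (simp add: compact_eq_bounded_closed bounded_subset[OF bounded_cbox])
  then show ?thesis
    using assms sub smooth_bump[of a b k] by (auto simp: test_functions_def)
qed

lemma flat_exp_tendsto_1:
  assumes "0 < s"
  shows "(\<lambda>k. flat_exp (real (Suc k) * s)) \<longlonglongrightarrow> 1"
proof -
  have "(\<lambda>k. exp (- (inverse (real (Suc k)) * (1 / s)))) \<longlonglongrightarrow> exp (- (0 * (1 / s)))"
    by (intro tendsto_intros LIMSEQ_inverse_real_of_nat)
  moreover have "flat_exp (real (Suc k) * s) = exp (- (inverse (real (Suc k)) * (1 / s)))" for k
    using assms by (simp add: flat_exp_def zero_less_mult_iff divide_inverse)
  ultimately show ?thesis by simp
qed

lemma bump_tendsto_indicator: "(\<lambda>k. bump a b k x) \<longlonglongrightarrow> indicator (box a b) x"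
proof (cases "x \<in> box a b")
  case True
  then have "(\<lambda>k. bump a b k x) \<longlonglongrightarrow> (\<Prod>j\<in>(UNIV::'a set). 1 * 1)"
    unfolding bump_def mem_box_cart by (intro tendsto_intros flat_exp_tendsto_1) auto
  then show ?thesis using True by simp
next
  case False
  then have "bump a b k x = 0" for k using bump_support[of a b k] by blast
  then show ?thesis using False by simp
qed

text \<open>Integrating the \<open>i\<close>-th factor keeps the tensor structure. The result is
  smooth on the whole space but in general not compactly supported, so it is for use where boundary
  terms vanish for another reason.\<close>

lemma bump_eq_grad:
  fixes a b :: "real^'n"
  obtains \<psi> where "smooth \<psi>" "\<And>x. grad \<psi> x $ i = bump a b k x"
proof -
  let ?g = "\<lambda>j t. flat_exp (real (Suc k) * (t - a $ j)) * flat_exp (real (Suc k) * (b $ j - t))"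
  obtain G where G: "smooth1 G" "\<And>x. (G has_real_derivative ?g i x) (at x)"
    using smooth1_has_antiderivative[OF smooth1_bump_factor] by blast
  let ?h = "\<lambda>j. if j = i then G else ?g j"
  have h: "smooth1 (?h j)" for j using G(1) smooth1_bump_factor by auto
  obtain h' where h': "\<And>j x. (?h j has_real_derivative h' j x) (at x)"
  proof -
    have "\<forall>j. \<exists>d. \<forall>x. (?h j has_real_derivative d x) (at x)" using smooth1_deriv[OF h] by metis
    then show ?thesis using that by metis
  qed
  have "smooth (\<lambda>x::real^'n. \<Prod>j\<in>UNIV. ?h j (x $ j))" by (rule smooth_tensor) (rule h)
  moreover have "grad (\<lambda>x. \<Prod>j\<in>UNIV. ?h j (x $ j)) x $ i = bump a b k x" for x
  proof -
    have "grad (\<lambda>x. \<Prod>j\<in>UNIV. ?h j (x $ j)) x $ i = h' i (x $ i) * (\<Prod>j\<in>UNIV - {i}. ?h j (x $ j))"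
      by (rule grad_tensor) (rule h')
    also have "h' i (x $ i) = ?g i (x $ i)"
      using DERIV_unique[OF h'[of i "x $ i"]] G(2) by simp
    also have "(\<Prod>j\<in>UNIV - {i}. ?h j (x $ j)) = (\<Prod>j\<in>UNIV - {i}. ?g j (x $ j))"
      by (rule prod.cong) auto
    also have "?g i (x $ i) * \<dots> = bump a b k x"
      unfolding bump_def by (rule prod.remove[symmetric]) auto
    finally show ?thesis .
  qed
  ultimately show ?thesis by (rule that)
qed

text \<open>Open boxes generate the Borel sets and are stable under intersection, so vanishing
  integrals spread from boxes to all Borel sets. The passage to complements is what consumes the
  total integral.\<close>

lemma box_integrals_zero_AE:
  fixes g :: "'a::euclidean_space \<Rightarrow> real"
  assumes int: "integrable lborel g" and box: "\<And>a b. (\<integral>x\<in>box a b. g x \<partial>lborel) = 0"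
    and total: "(\<integral>x. g x \<partial>lborel) = 0"
  shows "AE x in lborel. g x = 0"
proof (rule density_unique_real[OF int integrable_zero])
  fix A :: "'a set" assume "A \<in> sets lborel"
  let ?G = "range (\<lambda>(a, b). box a b :: 'a set)"
  have si: "set_integrable lborel A g" if "A \<in> sets borel" for A
    using integrable_mult_indicator[OF _ int, of A] that unfolding set_integrable_def by simp
  have mem: "A \<in> sigma_sets UNIV ?G"
    using \<open>A \<in> sets lborel\<close> unfolding sets_lborel borel_eq_box by (simp add: sets_measure_of)
  have stable: "Int_stable ?G"
  proof (rule Int_stableI)
    fix X Y assume "X \<in> ?G" "Y \<in> ?G"
    then obtain a b c d where "X = box a b" "Y = box c d" by auto
    then have "X \<inter> Y = (\<lambda>(a, b). box a b) (\<Sum>i\<in>Basis. max (a\<bullet>i) (c\<bullet>i) *\<^sub>R i, \<Sum>i\<in>Basis. min (b\<bullet>i) (d\<bullet>i) *\<^sub>R i)"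
      by (simp add: box_Int_box)
    then show "X \<inter> Y \<in> ?G" by (rule range_eqI)
  qed
  have sub: "?G \<subseteq> Pow UNIV" by simp
  from stable sub mem have "(\<integral>x\<in>A. g x \<partial>lborel) = 0"
  proof (induction rule: sigma_sets_induct_disjoint)
    case (basic A)
    then show ?case using box by auto
  next
    case empty
    then show ?case by (simp add: set_lebesgue_integral_def)
  next
    case (compl A)
    then have A: "A \<in> sets borel" unfolding borel_eq_box by (simp add: sets_measure_of)
    have "(\<integral>x\<in>UNIV - A. g x \<partial>lborel) = (\<integral>x. g x - indicator A x *\<^sub>R g x \<partial>lborel)"
      unfolding set_lebesgue_integral_def by (rule Bochner_Integration.integral_cong) (auto simp: indicator_def)
    also have "\<dots> = (\<integral>x. g x \<partial>lborel) - (\<integral>x\<in>A. g x \<partial>lborel)"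
      unfolding set_lebesgue_integral_def
      using si[OF A] int by (intro Bochner_Integration.integral_diff) (auto simp: set_integrable_def)
    finally show ?case using compl total by simp
  next
    case (union A)
    then have A: "A i \<in> sets borel" for i unfolding borel_eq_box by (auto simp: sets_measure_of)
    have "(\<integral>x\<in>(\<Union>i. A i). g x \<partial>lborel) = (\<Sum>i. \<integral>x\<in>A i. g x \<partial>lborel)"
    proof (rule lebesgue_integral_countable_add)
      show "A i \<inter> A j = {}" if "i \<noteq> j" for i j
        using union(1) that by (auto simp: disjoint_family_on_def)
      show "set_integrable lborel (\<Union>i. A i) g" by (intro si sets.countable_UN) (use A in auto)
    qed (use A in auto)
    then show ?case using union by simp
  qed
  then show "(\<integral>x\<in>A. g x \<partial>lborel) = (\<integral>x\<in>A. 0 \<partial>lborel)" by simp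
qed

text \<open>Dominated convergence replaces bumps by indicators of boxes. Since only boxes inside
  \<open>U\<close> are available and \<open>g\<close> is merely Lebesgue measurable, the argument
  runs inside one closed box with a Borel representative; countably many such boxes exhaust
  \<open>U\<close>.\<close>

lemma bump_orthogonal_AE_zero:
  fixes g :: "real^'n \<Rightarrow> real"
  assumes U: "open U" and int: "integrable (lebesgue_on U) g"
    and orth: "\<And>a b k. (\<forall>j. a $ j < b $ j) \<Longrightarrow> cbox a b \<subseteq> U \<Longrightarrow> (\<integral>x. g x * bump a b k x \<partial>lebesgue_on U) = 0"
  shows "AE x in lebesgue_on U. g x = 0"
proof -
  have UL: "U \<in> sets lebesgue" using U by simp
  let ?g = "\<lambda>x. indicator U x * g x"
  have intg: "integrable lebesgue ?g"
    using int integrable_restrict_space[of U lebesgue g] UL by simp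
  have bm: "bump a b k \<in> borel_measurable borel" for a b k
    by (intro borel_measurable_continuous_onI smooth_continuous smooth_bump)
  then have [measurable]: "bump a b k \<in> borel_measurable lebesgue" for a b k
    by (metis measurable_completion measurable_lborel2)
  have box: "(\<integral>x. indicator (box a b) x * ?g x \<partial>lebesgue) = 0"
    if ab: "\<forall>j. a $ j < b $ j" "cbox a b \<subseteq> U" for a b
  proof -
    have "(\<integral>x. ?g x * bump a b k x \<partial>lebesgue) = 0" for k
      using orth[OF ab, of k] integral_restrict_space[of U lebesgue "\<lambda>x. g x * bump a b k x"] UL
      by (simp add: mult.assoc)
    moreover have "(\<lambda>k. \<integral>x. ?g x * bump a b k x \<partial>lebesgue) \<longlonglongrightarrow> (\<integral>x. ?g x * indicator (box a b) x \<partial>lebesgue)"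
    proof (rule integral_dominated_convergence[where w="\<lambda>x. norm (?g x)"])
      show "(\<lambda>x. ?g x * indicator (box a b) x) \<in> borel_measurable lebesgue"
        by (intro borel_measurable_times borel_measurable_integrable[OF intg] borel_measurable_indicator) auto
      show "(\<lambda>x. ?g x * bump a b k x) \<in> borel_measurable lebesgue" for k
        by (intro borel_measurable_times borel_measurable_integrable[OF intg]) auto
      show "integrable lebesgue (\<lambda>x. norm (?g x))" using intg by (rule integrable_norm)
      show "AE x in lebesgue. (\<lambda>k. ?g x * bump a b k x) \<longlonglongrightarrow> ?g x * indicator (box a b) x"
        by (intro AE_I2 tendsto_intros bump_tendsto_indicator)
      show "AE x in lebesgue. norm (?g x * bump a b k x) \<le> norm (?g x)" for k
        using bump_bounds[of a b k] by (intro AE_I2) (auto simp: abs_mult intro!: mult_left_le)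
    qed
    ultimately have "(\<lambda>k::nat. 0) \<longlonglongrightarrow> (\<integral>x. ?g x * indicator (box a b) x \<partial>lebesgue)"
      by (simp only:)
    then have "(\<integral>x. ?g x * indicator (box a b) x \<partial>lebesgue) = 0"
      by (rule LIMSEQ_unique[OF _ tendsto_const])
    then show ?thesis by (simp only: mult.commute[of _ "indicator (box a b) _"])
  qed
  have zero: "AE x in lborel. x \<in> cbox A B \<longrightarrow> ?g x = 0" if AB: "cbox A B \<subseteq> U" for A B
  proof -
    let ?h = "\<lambda>x. indicator (box A B) x * ?g x"
    have inth: "integrable lebesgue ?h"
      using integrable_mult_indicator[OF _ intg, of "box A B"] by simp
    \<comment> \<open>A Borel representative, because the generator argument takes place in
      \<open>lborel\<close>.\<close>
    obtain g1 where g1 [measurable]: "g1 \<in> borel_measurable lborel" and ae: "AE x in lborel. ?h x = g1 x"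
      using completion_ex_borel_measurable_real[OF borel_measurable_integrable[OF inth]] by blast
    have ae': "AE x in lebesgue. ?h x = g1 x" using ae by (rule AE_completion)
    have g1L: "g1 \<in> borel_measurable lebesgue" using g1 by (rule measurable_completion)
    have "integrable lebesgue g1" by (rule integrable_cong_AE_imp[OF inth g1L]) (use ae' in auto)
    then have int1: "integrable lborel g1" using g1 by (simp add: integrable_completion)
    have eq: "(\<integral>x. indicator C x * g1 x \<partial>lborel) = (\<integral>x. indicator C x * ?h x \<partial>lebesgue)" if "C \<in> sets borel" for C
    proof -
      have "(\<integral>x. indicator C x * g1 x \<partial>lborel) = (\<integral>x. indicator C x * g1 x \<partial>lebesgue)"
        by (intro integral_completion[symmetric] borel_measurable_times g1 borel_measurable_indicator)
           (use that in simp)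
      also have "\<dots> = (\<integral>x. indicator C x * ?h x \<partial>lebesgue)"
        by (rule integral_cong_AE)
           (use g1L borel_measurable_integrable[OF inth] ae' that in \<open>auto intro!: borel_measurable_times borel_measurable_indicator\<close>)
      finally show ?thesis .
    qed
    have "AE x in lborel. g1 x = 0"
    proof (rule box_integrals_zero_AE[OF int1])
      fix a b :: "real^'n"
      \<comment> \<open>Cutting with \<open>box A B\<close> again gives a box, whose closure stays
        inside \<open>U\<close>.\<close>
      obtain c d where cd: "box a b \<inter> box A B = box c d" by (rule that[OF box_Int_box])
      have "(\<integral>x\<in>box a b. g1 x \<partial>lborel) = (\<integral>x. indicator (box a b) x * ?h x \<partial>lebesgue)"
        using eq[of "box a b"] by (simp add: set_lebesgue_integral_def)
      also have "\<dots> = (\<integral>x. indicator (box c d) x * ?g x \<partial>lebesgue)"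
        unfolding cd[symmetric] by (simp only: indicator_inter_arith mult.assoc)
      also have "\<dots> = 0"
      proof (cases "box c d = {}")
        case False
        then have "cbox c d = closure (box c d)" by (simp add: closure_box)
        also have "\<dots> \<subseteq> cbox A B" unfolding cd[symmetric]
          by (intro closure_minimal closed_cbox) (use box_subset_cbox in blast)
        finally have "cbox c d \<subseteq> U" using AB by blast
        moreover have "\<forall>j. c $ j < d $ j" using False by (meson interval_ne_empty_cart(2))
        ultimately show ?thesis by (intro box)
      qed simp
      finally show "(\<integral>x\<in>box a b. g1 x \<partial>lborel) = 0" .
    next
      have "(\<integral>x. g1 x \<partial>lborel) = (\<integral>x. indicator (box A B) x * ?g x \<partial>lebesgue)"
        using eq[of UNIV] by simp
      also have "\<dots> = 0"
      proof (cases "box A B = {}")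
        case False
        then have "\<forall>j. A $ j < B $ j" by (meson interval_ne_empty_cart(2))
        then show ?thesis by (intro box AB)
      qed simp
      finally show "(\<integral>x. g1 x \<partial>lborel) = 0" .
    qed
    moreover have "AE x in lborel. x \<notin> cbox A B - box A B"
    proof -
      have "cbox A B - box A B \<in> null_sets lebesgue"
        using negligible_frontier_interval[of A B] by (simp only: negligible_iff_null_sets)
      from AE_not_in[OF this] show ?thesis by (simp only: AE_completion_iff)
    qed
    ultimately show ?thesis using ae
    proof eventually_elim
      case (elim x)
      show ?case
      proof
        assume "x \<in> cbox A B"
        then have "x \<in> box A B" using elim by blast
        then show "?g x = 0" using elim by (simp only: indicator_simps mult_1)
      qed
    qed
  qed
  obtain D where D: "countable D" "D \<subseteq> Pow U" "\<And>X. X \<in> D \<Longrightarrow> \<exists>a b. X = cbox a b" "\<Union>D = U"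
    using U by (rule open_countable_Union_open_cbox) blast
  have "AE x in lborel. \<forall>X\<in>D. x \<in> X \<longrightarrow> ?g x = 0"
  proof (subst AE_ball_countable[OF D(1)], intro ballI)
    fix X assume X: "X \<in> D"
    then obtain A B where "X = cbox A B" using D(3) by blast
    then show "AE x in lborel. x \<in> X \<longrightarrow> ?g x = 0" using zero[of A B] X D(2) by blast
  qed
  then have "AE x in lborel. x \<in> U \<longrightarrow> g x = 0"
  proof eventually_elim
    case (elim x)
    show ?case
    proof
      assume x: "x \<in> U"
      then have "x \<in> \<Union>D" using D(4) by simp
      then have "?g x = 0" using elim by blast
      then show "g x = 0" using x by simp
    qed
  qed
  then have "AE x in lebesgue. x \<in> U \<longrightarrow> g x = 0" by (rule AE_completion)
  then show ?thesis using UL by (simp add: AE_restrict_space_iff)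
qed

section \<open>Square integrability of bounded functions and uniqueness of weak gradients\<close>

lemma L2_bounded:
  fixes f :: "'a \<Rightarrow> 'b::euclidean_space"
  assumes "finite_measure N" "f \<in> borel_measurable N" "AE x in N. norm (f x) \<le> B"
  shows "f \<in> L2 N"
proof (rule L2I)
  interpret finite_measure N by fact
  show "integrable N (\<lambda>x. (norm (f x))\<^sup>2)"
  proof (rule integrable_const_bound)
    show "AE x in N. norm ((norm (f x))\<^sup>2) \<le> B\<^sup>2"
      using assms(3) by eventually_elim (simp add: power_mono)
  qed (use assms(2) in measurable)
qed fact

lemma continuous_L2:
  fixes f :: "real^'n \<Rightarrow> 'b::euclidean_space"
  assumes U: "bounded U" "U \<in> sets lebesgue" and f: "continuous_on UNIV f"
  shows "f \<in> L2 (lebesgue_on U)"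
proof -
  have "bounded (f ` closure U)"
    by (intro compact_imp_bounded compact_continuous_image continuous_on_subset[OF f])
       (use U in \<open>auto simp: compact_closure\<close>)
  then obtain B where B: "\<And>x. x \<in> closure U \<Longrightarrow> norm (f x) \<le> B" by (auto simp: bounded_iff)
  show ?thesis
  proof (rule L2_bounded)
    show "finite_measure (lebesgue_on U)"
      by (intro finite_measure_lebesgue_on bounded_set_imp_lmeasurable U)
    show "f \<in> borel_measurable (lebesgue_on U)"
      by (intro measurable_restrict_space1 measurable_completion) (use f in \<open>simp add: borel_measurable_continuous_onI\<close>)
    show "AE x in lebesgue_on U. norm (f x) \<le> B"
      using B closure_subset[of U] U(2) by (intro AE_I2) auto
  qed
qed

lemma L2_integrable:
  fixes f :: "'a \<Rightarrow> real"
  assumes "finite_measure N" "f \<in> L2 N"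
  shows "integrable N f"
proof -
  interpret finite_measure N by fact
  have "(\<lambda>_. 1) \<in> L2 N" by (auto intro: L2I)
  from L2_integrable_mult[OF assms(2) this] show ?thesis by simp
qed

text \<open>The fundamental lemma in each component. Since \<open>weak_grad\<close> is an arbitrary
  choice, this is what permits replacing it by a concrete gradient almost everywhere.\<close>

lemma weak_grad_unique:
  fixes G G' :: "real^'n \<Rightarrow> real^'n"
  assumes U: "open U" "bounded U" and G: "is_weak_grad U v G" "is_weak_grad U v G'"
  shows "AE x in lebesgue_on U. G x = G' x"
proof -
  have fin: "finite_measure (lebesgue_on U)" using U by (intro finite_measure_lebesgue_on lmeasurable_open)
  have L2: "G \<in> L2 (lebesgue_on U)" "G' \<in> L2 (lebesgue_on U)" using G by (auto simp: is_weak_grad_def)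
  have "AE x in lebesgue_on U. G x $ i - G' x $ i = 0" for i
  proof (rule bump_orthogonal_AE_zero[OF U(1)])
    show "integrable (lebesgue_on U) (\<lambda>x. G x $ i - G' x $ i)"
      by (intro L2_integrable fin L2_diff L2_component L2)
    fix a b :: "real^'n" and k assume "cbox a b \<subseteq> U"
    then have t: "bump a b k \<in> test_functions U" by (rule bump_test_function)
    have b: "bump a b k \<in> L2 (lebesgue_on U)"
      using U by (intro continuous_L2 smooth_continuous smooth_bump) auto
    have "(\<integral>x. G x $ i * bump a b k x \<partial>lebesgue_on U) = (\<integral>x. G' x $ i * bump a b k x \<partial>lebesgue_on U)"
    proof -
      have "(\<integral>x. v x * grad (bump a b k) x $ i \<partial>lebesgue_on U) = - (\<integral>x. G x $ i * bump a b k x \<partial>lebesgue_on U)"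
        "(\<integral>x. v x * grad (bump a b k) x $ i \<partial>lebesgue_on U) = - (\<integral>x. G' x $ i * bump a b k x \<partial>lebesgue_on U)"
        using G t unfolding is_weak_grad_def by blast+
      then show ?thesis by simp
    qed
    then show "(\<integral>x. (G x $ i - G' x $ i) * bump a b k x \<partial>lebesgue_on U) = 0"
      using L2_integrable_mult[OF L2_component[OF L2(1)] b, of i] L2_integrable_mult[OF L2_component[OF L2(2)] b, of i]
      by (simp add: left_diff_distrib)
  qed
  then have "AE x in lebesgue_on U. \<forall>i\<in>UNIV. G x $ i - G' x $ i = 0"
    by (intro AE_finite_allI) auto
  then show ?thesis by eventually_elim (simp add: vec_eq_iff)
qed

section \<open>Integration over cones\<close>

text \<open>For a unit vector \<open>\<nu>\<close>, the orthogonal projection onto the hyperplane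
  \<open>\<nu> \<bullet> x = c\<close>. Together with \<open>slab\<close>, the layer of thickness 1
  around that hyperplane, it makes the cylinder in \<open>face_measure\<close> explicit.\<close>

definition hproj :: "real^'n \<Rightarrow> real \<Rightarrow> real^'n \<Rightarrow> real^'n" where
  "hproj \<nu> c x = x - (\<nu> \<bullet> x - c) *\<^sub>R \<nu>"

definition slab :: "real^'n \<Rightarrow> real \<Rightarrow> (real^'n) set" where
  "slab \<nu> c = {x. \<bar>\<nu> \<bullet> x - c\<bar> \<le> 1/2}"

lemma mem_slab: "x \<in> slab \<nu> c \<longleftrightarrow> - 1/2 \<le> \<nu> \<bullet> x - c \<and> \<nu> \<bullet> x - c \<le> 1/2"
  by (simp only: slab_def mem_Collect_eq abs_le_iff) linarith

lemma continuous_hproj: "continuous_on A (hproj \<nu> c)"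
  unfolding hproj_def by (intro continuous_intros)

lemma hproj_measurable [measurable]: "hproj \<nu> c \<in> borel_measurable borel"
  by (rule borel_measurable_continuous_onI[OF continuous_hproj])

lemma closed_slab: "closed (slab \<nu> c)"
  unfolding slab_def by (intro closed_Collect_le continuous_intros)

lemma slab_measurable [measurable]: "slab \<nu> c \<in> sets borel"
  using closed_slab by (rule borel_closed)

lemma inner_hproj: "norm \<nu> = 1 \<Longrightarrow> \<nu> \<bullet> hproj \<nu> c x = c"
  by (simp add: hproj_def inner_diff_right dot_square_norm)

lemma hproj_shift:
  assumes "norm \<nu> = 1" shows "hproj \<nu> c (hproj \<nu> c x + r *\<^sub>R \<nu>) = hproj \<nu> c x"
  using assms inner_hproj[OF assms, of c x]
  by (simp add: hproj_def[of \<nu> c "hproj \<nu> c x + r *\<^sub>R \<nu>"] inner_add_right dot_square_norm)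

lemma nn_integral_lborel_translate:
  fixes f :: "'a::euclidean_space \<Rightarrow> ennreal"
  assumes "f \<in> borel_measurable borel"
  shows "(\<integral>\<^sup>+x. f x \<partial>lborel) = (\<integral>\<^sup>+x. f (c + x) \<partial>lborel)"
  by (subst lborel_distr_plus[of c, symmetric], subst nn_integral_distr) (use assms in auto)

lemma nn_integral_lborel_affine:
  fixes f :: "'a::euclidean_space \<Rightarrow> ennreal"
  assumes [measurable]: "f \<in> borel_measurable borel" and "0 < c"
  shows "(\<integral>\<^sup>+x. f x \<partial>lborel) = ennreal (c ^ DIM('a)) * (\<integral>\<^sup>+x. f (t + c *\<^sub>R x) \<partial>lborel)"
  using assms(2)
  by (subst lborel_affine[of c t], simp, subst nn_integral_density, simp, simp, subst nn_integral_distr)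
     (simp_all add: nn_integral_cmult)

text \<open>Fubini along the direction \<open>\<nu>\<close>, from translation invariance and Tonelli alone.\<close>

lemma nn_integral_fubini_direction:
  fixes \<nu> :: "real^'n"
  assumes g [measurable]: "g \<in> borel_measurable borel" and \<nu>: "norm \<nu> = 1"
  shows "(\<integral>\<^sup>+x. g x \<partial>lborel) =
    (\<integral>\<^sup>+x. indicator (slab \<nu> c) x * (\<integral>\<^sup>+r. g (hproj \<nu> c x + r *\<^sub>R \<nu>) \<partial>lborel) \<partial>lborel)"
proof -
  let ?S = "slab \<nu> c"
  have line: "(\<integral>\<^sup>+r. g (hproj \<nu> c x + r *\<^sub>R \<nu>) \<partial>lborel) = (\<integral>\<^sup>+r. g (x + r *\<^sub>R \<nu>) \<partial>lborel)" for x
    by (subst nn_integral_lborel_translate[where c="\<nu> \<bullet> x - c"])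
       (auto simp: hproj_def algebra_simps)
  have "(\<integral>\<^sup>+x. indicator ?S x * (\<integral>\<^sup>+r. g (hproj \<nu> c x + r *\<^sub>R \<nu>) \<partial>lborel) \<partial>lborel)
      = (\<integral>\<^sup>+x. (\<integral>\<^sup>+r. indicator ?S x * g (x + r *\<^sub>R \<nu>) \<partial>lborel) \<partial>lborel)"
    unfolding line by (intro nn_integral_cong nn_integral_cmult[symmetric]) measurable
  also have "\<dots> = (\<integral>\<^sup>+r. (\<integral>\<^sup>+x. indicator ?S x * g (x + r *\<^sub>R \<nu>) \<partial>lborel) \<partial>lborel)"
    by (rule lborel_pair.Fubini'[symmetric]) measurable
  \<comment> \<open>Translation by \<open>r *\<^sub>R \<nu>\<close> moves the slab instead of the
    argument of \<open>g\<close>. For fixed \<open>x\<close> the admissible \<open>r\<close> then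
    fill an interval of length 1, so integrating over \<open>r\<close> first returns
    \<open>g x\<close>.\<close>
  also have "\<dots> = (\<integral>\<^sup>+r. (\<integral>\<^sup>+x. indicator {r - 1/2..r + 1/2} (\<nu> \<bullet> x - c) * g x \<partial>lborel) \<partial>lborel)"
  proof (rule nn_integral_cong)
    fix r :: real
    show "(\<integral>\<^sup>+x. indicator ?S x * g (x + r *\<^sub>R \<nu>) \<partial>lborel) = (\<integral>\<^sup>+x. indicator {r - 1/2..r + 1/2} (\<nu> \<bullet> x - c) * g x \<partial>lborel)"
      using \<nu> by (subst (2) nn_integral_lborel_translate[where c="r *\<^sub>R \<nu>"])
         (auto simp: mem_slab inner_add_right dot_square_norm add.commute intro!: nn_integral_cong split: split_indicator)
  qed
  also have "\<dots> = (\<integral>\<^sup>+x. (\<integral>\<^sup>+r. indicator {r - 1/2..r + 1/2} (\<nu> \<bullet> x - c) * g x \<partial>lborel) \<partial>lborel)"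
  proof (rule lborel_pair.Fubini')
    have "(\<lambda>(r, x). indicator {r - 1/2..r + 1/2} (\<nu> \<bullet> x - c) * g x) =
       (\<lambda>(r, x). indicator {z. r - 1/2 \<le> \<nu> \<bullet> snd z - c \<and> \<nu> \<bullet> snd z - c \<le> r + 1/2} (r, x) * g x)"
      by (auto split: split_indicator)
    show "(\<lambda>(x, r). indicator {r - 1/2..r + 1/2} (\<nu> \<bullet> x - c) * g x) \<in> borel_measurable (lborel \<Otimes>\<^sub>M lborel)"
      unfolding indicator_def atLeastAtMost_iff by measurable
  qed
  also have "\<dots> = (\<integral>\<^sup>+x. g x \<partial>lborel)"
  proof (rule nn_integral_cong)
    fix x :: "real^'n"
    let ?s = "\<nu> \<bullet> x - c"
    have "(\<integral>\<^sup>+r. indicator {r - 1/2..r + 1/2} ?s * g x \<partial>lborel) = (\<integral>\<^sup>+r. g x * indicator {?s - 1/2..?s + 1/2} r \<partial>lborel)"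
      by (intro nn_integral_cong) (auto split: split_indicator)
    also have "\<dots> = g x * emeasure lborel {?s - 1/2..?s + 1/2}"
      by (rule nn_integral_cmult_indicator) simp
    also have "\<dots> = g x" by simp
    finally show "(\<integral>\<^sup>+r. indicator {r - 1/2..r + 1/2} ?s * g x \<partial>lborel) = g x" .
  qed
  finally show ?thesis by simp
qed

text \<open>Height and projection are independent coordinates, so a profile \<open>\<theta>\<close>
  in the height contributes only its integral. This accounts for slabs whose thickness is changed by
  a homothety.\<close>

lemma nn_integral_slab:
  fixes \<nu> :: "real^'n"
  assumes [measurable]: "\<theta> \<in> borel_measurable borel" "\<Psi> \<in> borel_measurable borel" and \<nu>: "norm \<nu> = 1"
  shows "(\<integral>\<^sup>+x. \<theta> (\<nu> \<bullet> x - c) * \<Psi> (hproj \<nu> c x) \<partial>lborel) =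
    (\<integral>\<^sup>+r. \<theta> r \<partial>lborel) * (\<integral>\<^sup>+x. indicator (slab \<nu> c) x * \<Psi> (hproj \<nu> c x) \<partial>lborel)"
proof -
  have ht: "\<nu> \<bullet> (hproj \<nu> c x + r *\<^sub>R \<nu>) - c = r" for x r
    using \<nu> by (simp add: inner_add_right inner_hproj dot_square_norm)
  have "(\<integral>\<^sup>+x. \<theta> (\<nu> \<bullet> x - c) * \<Psi> (hproj \<nu> c x) \<partial>lborel) =
     (\<integral>\<^sup>+x. indicator (slab \<nu> c) x * (\<integral>\<^sup>+r. \<theta> r * \<Psi> (hproj \<nu> c x) \<partial>lborel) \<partial>lborel)"
    by (subst nn_integral_fubini_direction[OF _ \<nu>, of _ c]) (simp_all add: ht hproj_shift[OF \<nu>])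
  also have "\<dots> = (\<integral>\<^sup>+x. (\<integral>\<^sup>+r. \<theta> r \<partial>lborel) * (indicator (slab \<nu> c) x * \<Psi> (hproj \<nu> c x)) \<partial>lborel)"
    by (intro nn_integral_cong) (simp add: nn_integral_multc mult_ac)
  also have "\<dots> = (\<integral>\<^sup>+r. \<theta> r \<partial>lborel) * (\<integral>\<^sup>+x. indicator (slab \<nu> c) x * \<Psi> (hproj \<nu> c x) \<partial>lborel)"
    by (rule nn_integral_cmult) measurable
  finally show ?thesis .
qed

section \<open>The measure on a face as an integral over a slab\<close>

lemma closest_point_hyperplane:
  assumes \<nu>: "norm \<nu> = 1"
  shows "closest_point {x. \<nu> \<bullet> x = c} = hproj \<nu> c"
proof
  fix x
  have "hproj \<nu> c x = closest_point {x. \<nu> \<bullet> x = c} x"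
  proof (rule closest_point_unique)
    show "\<forall>z\<in>{x. \<nu> \<bullet> x = c}. dist x (hproj \<nu> c x) \<le> dist x z"
    proof
      fix z assume "z \<in> {x. \<nu> \<bullet> x = c}"
      then have "\<bar>\<nu> \<bullet> x - c\<bar> = \<bar>\<nu> \<bullet> (x - z)\<bar>" by (simp add: inner_diff_right)
      also have "\<dots> \<le> norm \<nu> * norm (x - z)" by (rule Cauchy_Schwarz_ineq2)
      finally show "dist x (hproj \<nu> c x) \<le> dist x z" using \<nu> by (simp add: dist_norm hproj_def)
    qed
  qed (auto simp: inner_hproj[OF \<nu>] convex_hyperplane closed_hyperplane)
  then show "closest_point {x. \<nu> \<bullet> x = c} x = hproj \<nu> c x" by simp
qed

lemma face_measure_sets [simp]: "sets (face_measure F) = sets borel" "space (face_measure F) = UNIV"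
  by (auto simp: face_measure_def Let_def)

lemma nn_integral_face_measure:
  fixes F :: "(real^'n) set"
  assumes F [measurable]: "closed F" and H: "affine hull F = {x. \<nu> \<bullet> x = c}" and \<nu>: "norm \<nu> = 1"
    and g [measurable]: "g \<in> borel_measurable borel"
  shows "(\<integral>\<^sup>+x. g x \<partial>face_measure F) =
    (\<integral>\<^sup>+x. indicator (slab \<nu> c) x * (indicator F (hproj \<nu> c x) * g (hproj \<nu> c x)) \<partial>lborel)"
proof -
  have [measurable]: "F \<in> sets borel" using F by simp
  let ?C = "{y. hproj \<nu> c y \<in> F \<and> dist y (hproj \<nu> c y) \<le> 1/2}"
  have C: "?C = {y. y \<in> slab \<nu> c \<and> hproj \<nu> c y \<in> F}"
    using \<nu> by (auto simp: slab_def dist_norm hproj_def)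
  have Cm: "?C \<in> sets borel" unfolding C by measurable
  have "face_measure F = distr (lebesgue_on ?C) borel (hproj \<nu> c)"
    unfolding face_measure_def H closest_point_hyperplane[OF \<nu>] Let_def ..
  then have "(\<integral>\<^sup>+x. g x \<partial>face_measure F) = (\<integral>\<^sup>+x. g (hproj \<nu> c x) \<partial>lebesgue_on ?C)"
    by (simp only:) (rule nn_integral_distr, auto intro!: measurable_restrict_space1 measurable_completion)
  also have "\<dots> = (\<integral>\<^sup>+x. g (hproj \<nu> c x) * indicator ?C x \<partial>lebesgue)"
    by (rule nn_integral_restrict_space) (use Cm in simp)
  also have "\<dots> = (\<integral>\<^sup>+x. g (hproj \<nu> c x) * indicator ?C x \<partial>lborel)"
    by (rule nn_integral_completion)
  also have "\<dots> = (\<integral>\<^sup>+x. indicator (slab \<nu> c) x * (indicator F (hproj \<nu> c x) * g (hproj \<nu> c x)) \<partial>lborel)"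
    unfolding C by (intro nn_integral_cong) (auto split: split_indicator)
  finally show ?thesis .
qed

lemma face_measure_finite:
  fixes F :: "(real^'n) set"
  assumes F: "compact F" and H: "affine hull F = {x. \<nu> \<bullet> x = c}" and \<nu>: "norm \<nu> = 1"
  shows "finite_measure (face_measure F)"
proof
  let ?C = "{y. y \<in> slab \<nu> c \<and> hproj \<nu> c y \<in> F}"
  have [measurable]: "F \<in> sets borel" and cl: "closed F" using F by (auto simp: compact_imp_closed)
  obtain B where B: "\<And>x. x \<in> F \<Longrightarrow> norm x \<le> B"
    using compact_imp_bounded[OF F] by (auto simp: bounded_iff)
  have "norm y \<le> B + 1/2" if "y \<in> ?C" for y
  proof -
    have "y = hproj \<nu> c y + (\<nu> \<bullet> y - c) *\<^sub>R \<nu>" by (simp add: hproj_def)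
    then have "norm y \<le> norm (hproj \<nu> c y) + norm ((\<nu> \<bullet> y - c) *\<^sub>R \<nu>)" by (metis norm_triangle_ineq)
    also have "\<dots> \<le> B + 1/2" using that B \<nu> by (intro add_mono) (auto simp: slab_def)
    finally show ?thesis .
  qed
  then have bdd: "bounded ?C" by (auto simp: bounded_iff)
  have "emeasure (face_measure F) (space (face_measure F)) = (\<integral>\<^sup>+x. 1 \<partial>face_measure F)" by simp
  also have "\<dots> = (\<integral>\<^sup>+x. indicator (slab \<nu> c) x * (indicator F (hproj \<nu> c x) * 1) \<partial>lborel)"
    by (rule nn_integral_face_measure[OF cl H \<nu>]) measurable
  also have "\<dots> = (\<integral>\<^sup>+x. indicator ?C x \<partial>lborel)"
    by (intro nn_integral_cong) (auto split: split_indicator)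
  also have "\<dots> = emeasure lborel ?C" by (rule nn_integral_indicator) measurable
  also have "\<dots> < \<infinity>" by (rule emeasure_bounded_finite[OF bdd])
  finally show "emeasure (face_measure F) (space (face_measure F)) \<noteq> \<infinity>" by simp
qed

lemma AE_face_measure:
  fixes F :: "(real^'n) set"
  assumes F: "closed F" and H: "affine hull F = {x. \<nu> \<bullet> x = c}" and \<nu>: "norm \<nu> = 1"
  shows "AE x in face_measure F. x \<in> F"
proof -
  have [measurable]: "F \<in> sets borel" using F by simp
  have "(\<integral>\<^sup>+x. indicator (- F) x \<partial>face_measure F) =
      (\<integral>\<^sup>+x. indicator (slab \<nu> c) x * (indicator F (hproj \<nu> c x) * indicator (- F) (hproj \<nu> c x)) \<partial>lborel)"
    by (rule nn_integral_face_measure[OF assms]) measurable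
  also have "\<dots> = (\<integral>\<^sup>+(x::real^'n). 0 \<partial>lborel)"
    by (intro nn_integral_cong) (auto split: split_indicator)
  finally have "(\<integral>\<^sup>+x. indicator (- F) x \<partial>face_measure F) = 0" by simp
  then have "emeasure (face_measure F) (- F) = 0"
    by (subst (asm) nn_integral_indicator) auto
  then show ?thesis
    by (intro AE_I[where N="- F"]) auto
qed

text \<open>The homothety with centre \<open>a\<close> and ratio \<open>t\<close> carries the base
  onto a whole section of the cone, so membership in the section can be tested on the base.\<close>

lemma cone_point_mem:
  fixes a :: "real^'n"
  assumes "convex F" "F \<noteq> {}" and F: "F \<subseteq> {x. \<nu> \<bullet> x = c}" and a: "\<nu> \<bullet> a = c - h" "0 < h"
    and t: "0 < t" "t \<le> 1" and y: "\<nu> \<bullet> y = c"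
  shows "a + t *\<^sub>R (y - a) \<in> convex hull insert a F \<longleftrightarrow> y \<in> F"
proof
  assume "a + t *\<^sub>R (y - a) \<in> convex hull insert a F"
  then obtain u v b where uv: "u + v = 1" "b \<in> F" "a + t *\<^sub>R (y - a) = u *\<^sub>R a + v *\<^sub>R b"
    using assms(1,2) by (auto simp: convex_hull_insert hull_same)
  then have "u = 1 - v" by simp
  with uv(3) have eq: "t *\<^sub>R (y - a) = v *\<^sub>R (b - a)" by (simp add: algebra_simps)
  have "\<nu> \<bullet> b = c" using uv(2) F by blast
  \<comment> \<open>Comparing heights above the apex in direction \<open>\<nu>\<close> identifies
    the convex weight \<open>v\<close> with the ratio \<open>t\<close>.\<close>
  then have "t * h = v * h"
    using arg_cong[OF eq, of "\<lambda>z. \<nu> \<bullet> z"] y a by (simp add: inner_diff_right)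
  then have "t = v" using a by simp
  with eq t have "y = b" by simp
  then show "y \<in> F" using uv by simp
next
  assume "y \<in> F"
  then have "y \<in> convex hull insert a F" "a \<in> convex hull insert a F" by (auto intro: hull_inc)
  from convexD[OF convex_convex_hull this(2,1), of "1 - t" t] t
  show "a + t *\<^sub>R (y - a) \<in> convex hull insert a F" by (simp add: algebra_simps)
qed

lemma cone_height:
  fixes a :: "real^'n"
  assumes F: "F \<subseteq> {x. \<nu> \<bullet> x = c}" and a: "\<nu> \<bullet> a = c - h" "0 < h"
    and x: "x \<in> convex hull insert a F"
  shows "c - h \<le> \<nu> \<bullet> x" "\<nu> \<bullet> x \<le> c"
proof -
  have "convex hull insert a F \<subseteq> {x. c - h \<le> \<nu> \<bullet> x} \<inter> {x. \<nu> \<bullet> x \<le> c}"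
    using F a by (intro hull_minimal convex_Int convex_halfspace_ge convex_halfspace_le) auto
  then show "c - h \<le> \<nu> \<bullet> x" "\<nu> \<bullet> x \<le> c" using x by auto
qed

text \<open>Polar coordinates with pole \<open>a\<close>. The section at parameter \<open>t\<close>
  is a copy of \<open>F\<close> scaled by \<open>t\<close>, which gives the power of
  \<open>t\<close>, and the spacing of the sections gives the factor \<open>h\<close>.\<close>

lemma nn_integral_cone:
  fixes a :: "real^'n"
  assumes F: "compact F" "convex F" "F \<noteq> {}" and H: "affine hull F = {x. \<nu> \<bullet> x = c}" and \<nu>: "norm \<nu> = 1"
    and a: "\<nu> \<bullet> a = c - h" "0 < h" and f [measurable]: "f \<in> borel_measurable borel"
  shows "(\<integral>\<^sup>+x. indicator (convex hull insert a F) x * f x \<partial>lborel) =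
    (\<integral>\<^sup>+t. indicator {0..1} t * ennreal (h * t ^ (CARD('n) - 1)) * (\<integral>\<^sup>+y. f (a + t *\<^sub>R (y - a)) \<partial>face_measure F) \<partial>lborel)"
proof -
  let ?K = "convex hull insert a F" and ?S = "slab \<nu> c" and ?\<pi> = "hproj \<nu> c"
  have FH: "F \<subseteq> {x. \<nu> \<bullet> x = c}" using hull_subset[of F affine] H by simp
  have cF: "closed F" using F by (simp add: compact_imp_closed)
  have [measurable]: "F \<in> sets borel" using cF by simp
  have "compact ?K" using F(1) by (intro compact_convex_hull compact_insert)
  then have [measurable]: "?K \<in> sets borel" by (simp add: compact_imp_closed)
  define k where "k x = indicator ?K x * f x" for x
  have k [measurable]: "k \<in> borel_measurable borel" unfolding k_def by measurable
  \<comment> \<open>Scaling the space towards \<open>a\<close> costs the full power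
    \<open>t ^ CARD('n)\<close>, but the preimage of the slab has thickness \<open>1 / t\<close>,
    which takes one power back.\<close>
  have fiber: "(\<integral>\<^sup>+x. indicator ?S x * k (?\<pi> x + (h * (t - 1)) *\<^sub>R \<nu>) \<partial>lborel) =
      ennreal (t ^ (CARD('n) - 1)) * (\<integral>\<^sup>+y. f (a + t *\<^sub>R (y - a)) \<partial>face_measure F)"
    if t: "0 < t" "t < 1" for t
  proof -
    define \<Phi> where "\<Phi> y = k (y + (h * (t - 1)) *\<^sub>R \<nu>)" for y
    have [measurable]: "\<Phi> \<in> borel_measurable borel" unfolding \<Phi>_def by measurable
    let ?A = "\<lambda>x. (1 - t) *\<^sub>R a + t *\<^sub>R x"
    define \<theta> where "\<theta> s = (indicator {- 1/2..1/2} (t * s + h * (t - 1)) :: ennreal)" for s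
    have [measurable]: "\<theta> \<in> borel_measurable borel" unfolding \<theta>_def by measurable
    have height: "\<nu> \<bullet> ?A x - c = t * (\<nu> \<bullet> x - c) + h * (t - 1)" for x
      by (simp add: inner_add_right a(1)) (simp add: algebra_simps)
    have \<pi>A: "?\<pi> (?A x) + (h * (t - 1)) *\<^sub>R \<nu> = a + t *\<^sub>R (?\<pi> x - a)" for x
      unfolding hproj_def[of _ _ "?A x"] height by (simp add: hproj_def algebra_simps)
    have \<theta>: "(\<integral>\<^sup>+s. \<theta> s \<partial>lborel) = ennreal (1 / t)"
    proof -
      have "(\<integral>\<^sup>+s. \<theta> s \<partial>lborel) = (\<integral>\<^sup>+s. indicator {(- 1/2 - h * (t - 1)) / t..(1/2 - h * (t - 1)) / t} s \<partial>lborel)"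
        using t by (intro nn_integral_cong) (auto simp: \<theta>_def field_simps split: split_indicator)
      also have "\<dots> = emeasure lborel {(- 1/2 - h * (t - 1)) / t..(1/2 - h * (t - 1)) / t}"
        by (rule nn_integral_indicator) simp
      also have "\<dots> = ennreal ((1/2 - h * (t - 1)) / t - (- 1/2 - h * (t - 1)) / t)"
        using t by (intro emeasure_lborel_Icc divide_right_mono) auto
      also have "(1/2 - h * (t - 1)) / t - (- 1/2 - h * (t - 1)) / t = 1 / t"
        using t by (simp add: field_simps)
      finally show ?thesis .
    qed
    have "(\<integral>\<^sup>+x. indicator ?S x * \<Phi> (?\<pi> x) \<partial>lborel) =
        ennreal (t ^ CARD('n)) * (\<integral>\<^sup>+x. indicator ?S (?A x) * \<Phi> (?\<pi> (?A x)) \<partial>lborel)"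
      using nn_integral_lborel_affine[of "\<lambda>x. indicator ?S x * \<Phi> (?\<pi> x)" t "(1 - t) *\<^sub>R a"] t by simp
    also have "(\<integral>\<^sup>+x. indicator ?S (?A x) * \<Phi> (?\<pi> (?A x)) \<partial>lborel) =
        (\<integral>\<^sup>+x. \<theta> (\<nu> \<bullet> x - c) * (indicator F (?\<pi> x) * f (a + t *\<^sub>R (?\<pi> x - a))) \<partial>lborel)"
    proof (rule nn_integral_cong)
      fix x :: "real^'n"
      have "indicator ?S (?A x) = \<theta> (\<nu> \<bullet> x - c)"
        unfolding \<theta>_def indicator_def mem_slab height by simp
      moreover have "\<Phi> (?\<pi> (?A x)) = indicator F (?\<pi> x) * f (a + t *\<^sub>R (?\<pi> x - a))"
        unfolding \<Phi>_def \<pi>A k_def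
        using cone_point_mem[OF F(2,3) FH a, of t "?\<pi> x"] t inner_hproj[OF \<nu>, of c x]
        by (simp add: indicator_def)
      ultimately show "indicator ?S (?A x) * \<Phi> (?\<pi> (?A x)) =
          \<theta> (\<nu> \<bullet> x - c) * (indicator F (?\<pi> x) * f (a + t *\<^sub>R (?\<pi> x - a)))" by simp
    qed
    also have "\<dots> = ennreal (1 / t) * (\<integral>\<^sup>+x. indicator ?S x * (indicator F (?\<pi> x) * f (a + t *\<^sub>R (?\<pi> x - a))) \<partial>lborel)"
      using nn_integral_slab[of \<theta> "\<lambda>y. indicator F y * f (a + t *\<^sub>R (y - a))" \<nu> c, OF _ _ \<nu>] \<theta> by simp
    also have "(\<integral>\<^sup>+x. indicator ?S x * (indicator F (?\<pi> x) * f (a + t *\<^sub>R (?\<pi> x - a))) \<partial>lborel) =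
        (\<integral>\<^sup>+y. f (a + t *\<^sub>R (y - a)) \<partial>face_measure F)"
      by (rule nn_integral_face_measure[OF cF H \<nu>, symmetric]) measurable
    also have "ennreal (t ^ CARD('n)) * (ennreal (1 / t) * X) = ennreal (t ^ (CARD('n) - 1)) * X" for X
    proof -
      have "t ^ CARD('n) * (1 / t) = t ^ (CARD('n) - 1)" using t by (simp add: power_diff)
      then show ?thesis using t by (simp add: mult.assoc[symmetric] ennreal_mult[symmetric])
    qed
    finally show ?thesis unfolding \<Phi>_def .
  qed
  have outside: "k (?\<pi> x + (h * (t - 1)) *\<^sub>R \<nu>) = 0" if "t < 0 \<or> 1 < t" for t x
  proof -
    have ht: "\<nu> \<bullet> (?\<pi> x + (h * (t - 1)) *\<^sub>R \<nu>) = c + h * (t - 1)"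
      using \<nu> by (simp add: inner_add_right inner_hproj dot_square_norm)
    have "?\<pi> x + (h * (t - 1)) *\<^sub>R \<nu> \<notin> ?K"
    proof
      assume "?\<pi> x + (h * (t - 1)) *\<^sub>R \<nu> \<in> ?K"
      from cone_height[OF FH a this] have "h * t \<ge> 0" "h * (t - 1) \<le> 0"
        unfolding ht by (auto simp: algebra_simps)
      then show False using that a(2) by (auto simp: zero_le_mult_iff mult_le_0_iff)
    qed
    then show ?thesis by (simp add: k_def)
  qed
  have "(\<integral>\<^sup>+x. k x \<partial>lborel) = (\<integral>\<^sup>+x. indicator ?S x * (\<integral>\<^sup>+r. k (?\<pi> x + r *\<^sub>R \<nu>) \<partial>lborel) \<partial>lborel)"
    by (rule nn_integral_fubini_direction[OF k \<nu>])
  \<comment> \<open>The height over the hyperplane of \<open>F\<close> is substituted as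
    \<open>h * (t - 1)\<close>, so that \<open>t = 1\<close> is the base and \<open>t = 0\<close>
    the level of the apex.\<close>
  also have "\<dots> = (\<integral>\<^sup>+x. (\<integral>\<^sup>+t. ennreal h * (indicator ?S x * k (?\<pi> x + (h * (t - 1)) *\<^sub>R \<nu>)) \<partial>lborel) \<partial>lborel)"
  proof (rule nn_integral_cong)
    fix x :: "real^'n"
    have "(\<integral>\<^sup>+r. k (?\<pi> x + r *\<^sub>R \<nu>) \<partial>lborel) = ennreal h * (\<integral>\<^sup>+t. k (?\<pi> x + (h * (t - 1)) *\<^sub>R \<nu>) \<partial>lborel)"
      using nn_integral_real_affine[of "\<lambda>r. k (?\<pi> x + r *\<^sub>R \<nu>)" h "- h"] a(2) by (simp add: algebra_simps)
    then show "indicator ?S x * (\<integral>\<^sup>+r. k (?\<pi> x + r *\<^sub>R \<nu>) \<partial>lborel) =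
        (\<integral>\<^sup>+t. ennreal h * (indicator ?S x * k (?\<pi> x + (h * (t - 1)) *\<^sub>R \<nu>)) \<partial>lborel)"
      by (simp add: nn_integral_cmult mult_ac)
  qed
  also have "\<dots> = (\<integral>\<^sup>+t. (\<integral>\<^sup>+x. ennreal h * (indicator ?S x * k (?\<pi> x + (h * (t - 1)) *\<^sub>R \<nu>)) \<partial>lborel) \<partial>lborel)"
    by (rule lborel_pair.Fubini'[symmetric]) (unfold hproj_def, measurable)
  also have "\<dots> = (\<integral>\<^sup>+t. ennreal h * (\<integral>\<^sup>+x. indicator ?S x * k (?\<pi> x + (h * (t - 1)) *\<^sub>R \<nu>) \<partial>lborel) \<partial>lborel)"
    by (intro nn_integral_cong nn_integral_cmult) measurable
  also have "\<dots> = (\<integral>\<^sup>+t. indicator {0..1} t * ennreal (h * t ^ (CARD('n) - 1)) * (\<integral>\<^sup>+y. f (a + t *\<^sub>R (y - a)) \<partial>face_measure F) \<partial>lborel)"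
  proof (rule nn_integral_cong_AE)
    show "AE t in lborel. ennreal h * (\<integral>\<^sup>+x. indicator ?S x * k (?\<pi> x + (h * (t - 1)) *\<^sub>R \<nu>) \<partial>lborel) =
        indicator {0..1} t * ennreal (h * t ^ (CARD('n) - 1)) * (\<integral>\<^sup>+y. f (a + t *\<^sub>R (y - a)) \<partial>face_measure F)"
      using AE_lborel_singleton[of 0] AE_lborel_singleton[of 1]
    proof eventually_elim
      case (elim t)
      then consider "0 < t" "t < 1" | "t < 0 \<or> 1 < t" by linarith
      then show ?case
      proof cases
        case 1
        then show ?thesis using a(2) by (simp add: fiber[OF 1] ennreal_mult mult.assoc)
      next
        case 2
        then show ?thesis by (auto simp: outside[OF 2])
      qed
    qed
  qed
  finally show ?thesis by (simp add: k_def)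
qed

section \<open>The divergence theorem on simplices\<close>

lemma measurable_pair_face_measure:
  "measurable (lborel \<Otimes>\<^sub>M face_measure F) N = measurable (borel \<Otimes>\<^sub>M borel) N"
  by (intro measurable_cong_sets sets_pair_measure_cong) auto

text \<open>The formula for nonnegative integrands identifies the volume on the cone as the image of
  a weighted product measure, and in that form it extends to signed integrands. The integral along
  each ray is left innermost, ready for the fundamental theorem of calculus.\<close>

lemma integral_cone:
  fixes a :: "real^'n" and f :: "real^'n \<Rightarrow> real"
  assumes F: "compact F" "convex F" "F \<noteq> {}" and H: "affine hull F = {x. \<nu> \<bullet> x = c}" and \<nu>: "norm \<nu> = 1"
    and a: "\<nu> \<bullet> a = c - h" "0 < h" and f: "continuous_on UNIV f"
  shows "(\<integral>x. f x \<partial>lebesgue_on (convex hull insert a F)) =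
    (\<integral>y. \<integral>t. indicator {0..1} t * (h * t ^ (CARD('n) - 1)) * f (a + t *\<^sub>R (y - a)) \<partial>lborel \<partial>face_measure F)"
proof -
  let ?K = "convex hull insert a F" and ?p = "\<lambda>(t, y). a + t *\<^sub>R (y - a)"
  let ?w = "\<lambda>(t, y). indicator {0..1} t * (h * t ^ (CARD('n) - 1)) :: real"
  let ?P = "lborel \<Otimes>\<^sub>M face_measure F"
  interpret F: finite_measure "face_measure F" by (rule face_measure_finite[OF F(1) H \<nu>])
  interpret P: pair_sigma_finite lborel "face_measure F" ..
  have cK: "compact ?K" using F(1) by (intro compact_convex_hull compact_insert)
  then have [measurable]: "?K \<in> sets borel" by (simp add: compact_imp_closed)
  have [measurable]: "f \<in> borel_measurable borel" using f by (rule borel_measurable_continuous_onI)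
  have pm: "?p \<in> measurable ?P borel" unfolding measurable_pair_face_measure by measurable
  have wm: "?w \<in> borel_measurable ?P" unfolding measurable_pair_face_measure by measurable
  have fpm: "(\<lambda>z. f (?p z)) \<in> borel_measurable ?P" using pm by (rule measurable_compose) measurable
  have w0: "AE z in ?P. 0 \<le> ?w z" using a(2) by (intro AE_I2) (auto split: split_indicator)
  have eq: "density lborel (\<lambda>x. ennreal (indicator ?K x)) = distr (density ?P (\<lambda>z. ennreal (?w z))) borel ?p"
  proof (rule measure_eqI)
    fix A assume "A \<in> sets (density lborel (\<lambda>x. ennreal (indicator ?K x)))"
    then have A [measurable]: "A \<in> sets borel" by simp
    have pm': "?p \<in> measurable (density ?P (\<lambda>z. ennreal (?w z))) borel" using pm by simp
    have "emeasure (density lborel (\<lambda>x. ennreal (indicator ?K x))) A = (\<integral>\<^sup>+x. indicator ?K x * indicator A x \<partial>lborel)"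
      by (subst emeasure_density) (auto intro!: nn_integral_cong split: split_indicator)
    also have "\<dots> = (\<integral>\<^sup>+t. indicator {0..1} t * ennreal (h * t ^ (CARD('n) - 1)) *
        (\<integral>\<^sup>+y. indicator A (a + t *\<^sub>R (y - a)) \<partial>face_measure F) \<partial>lborel)"
      by (rule nn_integral_cone[OF F H \<nu> a]) measurable
    also have "\<dots> = (\<integral>\<^sup>+t. (\<integral>\<^sup>+y. ennreal (?w (t, y)) * indicator A (?p (t, y)) \<partial>face_measure F) \<partial>lborel)"
    proof (rule nn_integral_cong)
      fix t :: real
      have m: "(\<lambda>y. indicator A (a + t *\<^sub>R (y - a)) :: ennreal) \<in> borel_measurable (face_measure F)"
        by (subst measurable_cong_sets[of _ borel]) (auto, measurable)
      show "indicator {0..1} t * ennreal (h * t ^ (CARD('n) - 1)) * (\<integral>\<^sup>+y. indicator A (a + t *\<^sub>R (y - a)) \<partial>face_measure F)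
         = (\<integral>\<^sup>+y. ennreal (?w (t, y)) * indicator A (?p (t, y)) \<partial>face_measure F)"
        by (subst nn_integral_cmult[OF m, symmetric]) (auto intro!: nn_integral_cong split: split_indicator)
    qed
    also have "\<dots> = (\<integral>\<^sup>+z. ennreal (?w z) * indicator A (?p z) \<partial>?P)"
    proof (rule F.nn_integral_fst[where f="\<lambda>z. ennreal (?w z) * indicator A (?p z)"])
      show "(\<lambda>z. ennreal (?w z) * indicator A (?p z)) \<in> borel_measurable ?P"
      proof (rule borel_measurable_times_ennreal)
        show "(\<lambda>z. ennreal (?w z)) \<in> borel_measurable ?P" using wm by simp
        show "(\<lambda>z. indicator A (?p z)) \<in> borel_measurable ?P"
          by (rule measurable_compose[OF pm borel_measurable_indicator[OF A]])
      qed
    qed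
    also have "\<dots> = (\<integral>\<^sup>+z. indicator A (?p z) \<partial>density ?P (\<lambda>z. ennreal (?w z)))"
    proof (rule nn_integral_density[symmetric])
      show "(\<lambda>z. ennreal (?w z)) \<in> borel_measurable ?P" using wm by simp
      show "(\<lambda>z. indicator A (?p z)) \<in> borel_measurable ?P"
        by (rule measurable_compose[OF pm borel_measurable_indicator[OF A]])
    qed
    also have "\<dots> = (\<integral>\<^sup>+x. indicator A x \<partial>distr (density ?P (\<lambda>z. ennreal (?w z))) borel ?p)"
      by (rule nn_integral_distr[OF pm', symmetric]) simp
    also have "\<dots> = emeasure (distr (density ?P (\<lambda>z. ennreal (?w z))) borel ?p) A"
      by (rule nn_integral_indicator) simp
    finally show "emeasure (density lborel (\<lambda>x. ennreal (indicator ?K x))) A =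
      emeasure (distr (density ?P (\<lambda>z. ennreal (?w z))) borel ?p) A" .
  qed simp
  have "integrable lborel (\<lambda>x. indicator ?K x *\<^sub>R f x)"
    by (rule borel_integrable_compact[OF cK]) (rule continuous_on_subset[OF f], simp)
  then have "integrable (density lborel (\<lambda>x. ennreal (indicator ?K x))) f"
    by (subst integrable_density) auto
  then have "integrable (density ?P (\<lambda>z. ennreal (?w z))) (\<lambda>z. f (?p z))"
    unfolding eq by (subst (asm) integrable_distr_eq) (use pm in auto)
  then have int: "integrable ?P (\<lambda>z. ?w z *\<^sub>R f (?p z))"
    by (subst (asm) integrable_density) (use wm w0 fpm in auto)
  have "(\<integral>x. f x \<partial>lebesgue_on ?K) = (\<integral>x. indicator ?K x *\<^sub>R f x \<partial>lebesgue)"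
    by (rule integral_restrict_space) simp
  also have "\<dots> = (\<integral>x. indicator ?K x *\<^sub>R f x \<partial>lborel)"
    by (rule integral_completion) measurable
  also have "\<dots> = (\<integral>x. f x \<partial>density lborel (\<lambda>x. ennreal (indicator ?K x)))"
    by (rule integral_density[symmetric]) auto
  also have "\<dots> = (\<integral>z. f (?p z) \<partial>density ?P (\<lambda>z. ennreal (?w z)))"
    unfolding eq by (rule integral_distr) (use pm in auto)
  also have "\<dots> = (\<integral>z. ?w z *\<^sub>R f (?p z) \<partial>?P)"
    by (rule integral_density) (use wm w0 fpm in auto)
  also have "\<dots> = (\<integral>y. (\<integral>t. ?w (t, y) *\<^sub>R f (?p (t, y)) \<partial>lborel) \<partial>face_measure F)"
    using P.integral_snd[of "\<lambda>t y. ?w (t, y) *\<^sub>R f (?p (t, y))"] int by (simp add: case_prod_beta')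
  finally show ?thesis by simp
qed

text \<open>The integrand on the left is the divergence of \<open>\<psi>(x) (x - a)\<close>. This
  field is tangential to the lateral boundary of the cone and has normal component
  \<open>h * \<psi>\<close> on \<open>F\<close>. Along a ray the weighted integrand is the
  derivative of \<open>h * t ^ ?d * \<psi>\<close>, which vanishes at the apex.\<close>

lemma cone_divergence:
  fixes a :: "real^'n" and \<psi> :: "real^'n \<Rightarrow> real"
  assumes F: "compact F" "convex F" "F \<noteq> {}" and H: "affine hull F = {x. \<nu> \<bullet> x = c}" and \<nu>: "norm \<nu> = 1"
    and a: "\<nu> \<bullet> a = c - h" "0 < h" and \<psi>: "smooth \<psi>"
  shows "(\<integral>x. real CARD('n) * \<psi> x + grad \<psi> x \<bullet> (x - a) \<partial>lebesgue_on (convex hull insert a F)) =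
    h * (\<integral>y. \<psi> y \<partial>face_measure F)"
proof -
  let ?d = "CARD('n)" and ?f = "\<lambda>x. real CARD('n) * \<psi> x + grad \<psi> x \<bullet> (x - a)"
  have cf: "continuous_on A ?f" for A
    by (intro continuous_intros smooth_continuous smooth_grad_continuous \<psi>)
  have "(\<integral>t. indicator {0..1} t * (h * t ^ (?d - 1)) * ?f (a + t *\<^sub>R (y - a)) \<partial>lborel) = h * \<psi> y" for y
  proof -
    let ?x = "\<lambda>t. a + t *\<^sub>R (y - a)"
    have "(\<integral>t. indicator {0..1} t *\<^sub>R ((h * t ^ (?d - 1)) * ?f (?x t)) \<partial>lborel) =
        h * 1 ^ ?d * \<psi> (?x 1) - h * 0 ^ ?d * \<psi> (?x 0)"
    proof (rule integral_FTC_Icc)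
      fix t :: real assume "0 \<le> t" "t \<le> 1"
      have "((\<lambda>t. \<psi> (?x t)) has_derivative (\<lambda>s. grad \<psi> (?x t) \<bullet> (s *\<^sub>R (y - a)))) (at t within {0..1})"
        by (rule has_derivative_compose[OF _ smooth_has_derivative[OF \<psi>]]) (auto intro!: derivative_eq_intros)
      then have "((\<lambda>t. \<psi> (?x t)) has_field_derivative (grad \<psi> (?x t) \<bullet> (y - a))) (at t within {0..1})"
        by (simp add: has_field_derivative_def mult_commute_abs)
      from DERIV_mult[OF DERIV_cmult[OF DERIV_power[OF DERIV_ident[of "at t within {0..1}"], of ?d], of h] this]
      have "((\<lambda>t. h * t ^ ?d * \<psi> (?x t)) has_field_derivative
          (h * (real ?d * (1 * t ^ (?d - Suc 0)))) * \<psi> (?x t) + grad \<psi> (?x t) \<bullet> (y - a) * (h * t ^ ?d)) (at t within {0..1})" .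
      moreover have "t ^ ?d = t * t ^ (?d - 1)"
        by (metis One_nat_def power_minus_mult mult.commute zero_less_card_finite)
      ultimately show "((\<lambda>t. h * t ^ ?d * \<psi> (?x t)) has_vector_derivative
          (h * t ^ (?d - 1)) * ?f (?x t)) (at t within {0..1})"
        by (simp add: has_real_derivative_iff_has_vector_derivative[symmetric] algebra_simps)
    next
      have "continuous_on {0..1} (\<lambda>t. ?f (?x t))"
        by (rule continuous_on_compose2[OF cf[of UNIV]]) (auto intro!: continuous_intros)
      then show "continuous_on {0..1} (\<lambda>t. (h * t ^ (?d - 1)) * ?f (?x t))"
        by (rule continuous_on_mult[rotated]) (intro continuous_intros)
    qed simp
    then show ?thesis by (simp add: mult.assoc)
  qed
  then show ?thesis
    unfolding integral_cone[OF F H \<nu> a cf] by simp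
qed

text \<open>Presents a simplex as a cone over a facet. Affine independence keeps the vertex
  \<open>b\<close> off the hyperplane of the opposite facet, so its height \<open>h\<close> is
  strictly positive.\<close>

lemma facet_simplex_apex:
  fixes C :: "(real^'n) set"
  assumes C: "\<not> affine_dependent C" "card C = CARD('n) + 1" and b: "b \<in> C"
    and \<nu>: "norm \<nu> = 1" "\<And>x y. x \<in> convex hull (C - {b}) \<Longrightarrow> y \<in> convex hull (C - {b}) \<Longrightarrow> \<nu> \<bullet> (y - x) = 0"
    and out: "points_outside (convex hull C) (convex hull (C - {b})) \<nu>"
  obtains c h where "affine hull (convex hull (C - {b})) = {x. \<nu> \<bullet> x = c}" "\<nu> \<bullet> b = c - h" "0 < h"
proof -
  let ?F = "convex hull (C - {b})"
  have fin: "finite C" using C(2) by (simp add: card_ge_0_finite)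
  have "card (C - {b}) = CARD('n)" using fin C(2) b by simp
  then have "C - {b} \<noteq> {}" by (metis card.empty zero_less_card_finite less_irrefl)
  then obtain x0 where x0: "x0 \<in> C - {b}" by blast
  then have x0F: "x0 \<in> ?F" by (rule hull_inc)
  let ?c = "\<nu> \<bullet> x0"
  have indep: "\<not> affine_dependent (C - {b})" using C(1) by (rule affine_independent_Diff)
  have "aff_dim (C - {b}) = int (CARD('n)) - 1"
    using aff_dim_affine_independent[OF indep] \<open>card (C - {b}) = CARD('n)\<close> by simp
  then have dim: "aff_dim (affine hull ?F) = int (CARD('n)) - 1" by (simp add: aff_dim_convex_hull)
  have sub: "?F \<subseteq> {x. \<nu> \<bullet> x = ?c}" using \<nu>(2)[OF x0F] by (auto simp: inner_diff_right)
  have "affine hull ?F \<subseteq> {x. \<nu> \<bullet> x = ?c}"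
    by (rule hull_minimal) (use sub in blast, rule affine_hyperplane)
  moreover have "aff_dim {x. \<nu> \<bullet> x = ?c} = int (CARD('n)) - 1"
    using \<nu>(1) by (subst aff_dim_hyperplane) auto
  ultimately have H: "affine hull ?F = {x. \<nu> \<bullet> x = ?c}"
    using x0F dim hull_inc[OF x0F, of affine]
    by (intro affine_dim_equal affine_affine_hull affine_hyperplane) (blast, assumption, simp only:)
  have "\<nu> \<bullet> (b - x0) \<le> 0"
    using out x0F b unfolding points_outside_def by (meson hull_inc)
  moreover have "\<nu> \<bullet> b \<noteq> ?c"
  proof
    assume "\<nu> \<bullet> b = ?c"
    then have "b \<in> affine hull ?F" using H by simp
    then have "b \<in> affine hull (C - {b})" by (simp add: affine_hull_convex_hull)
    then show False using C(1) b by (auto simp: affine_dependent_def)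
  qed
  ultimately have "0 < ?c - \<nu> \<bullet> b" by (simp add: inner_diff_right)
  then show ?thesis using that[OF H, of "?c - \<nu> \<bullet> b"] by simp
qed

text \<open>Normals relative to a single element, in contrast to the normals of a mesh, which serve
  two neighbours and are outward for only one of them.\<close>

definition outward_normals :: "(real^'n) set \<Rightarrow> ((real^'n) set \<Rightarrow> real^'n) \<Rightarrow> bool" where
  "outward_normals K N \<longleftrightarrow> (\<forall>F. F facet_of K \<longrightarrow>
     norm (N F) = 1 \<and> (\<forall>x\<in>F. \<forall>y\<in>F. N F \<bullet> (y - x) = 0) \<and> points_outside K F (N F))"

text \<open>Labelling facets by their opposite vertices turns sums over facets into sums over
  vertices.\<close>

lemma simplex_facets:
  fixes C :: "(real^'n) set"
  assumes C: "\<not> affine_dependent C" "card C = CARD('n) + 1"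
  shows "bij_betw (\<lambda>b. convex hull (C - {b})) C {F. F facet_of convex hull C}"
proof -
  have fin: "finite C" using C(2) by (simp add: card_ge_0_finite)
  have inj: "inj_on (\<lambda>b. convex hull (C - {b})) C"
  proof (rule inj_onI, rule ccontr)
    fix b b' assume b: "b \<in> C" "b' \<in> C" "convex hull (C - {b}) = convex hull (C - {b'})" "b \<noteq> b'"
    then have "b \<in> convex hull (C - {b})" by (auto intro: hull_inc)
    then have "b \<in> affine hull (C - {b})" using convex_hull_subset_affine_hull by blast
    then show False using C(1) b(1) by (auto simp: affine_dependent_def)
  qed
  have "F facet_of convex hull C \<longleftrightarrow> F \<in> (\<lambda>b. convex hull (C - {b})) ` C" for F
    using facet_of_convex_hull_affine_independent_alt[OF C(1), of F] C(2)
    by (auto simp: Suc_le_eq)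
  then show ?thesis using inj by (auto simp: bij_betw_def)
qed

text \<open>
  A constant field \<open>e\<close> is a combination of the radial fields \<open>x - b\<close> of the vertices \<open>b\<close>, with
  coefficients of sum zero, and each radial field is tangential to all facets but the one opposite
  to \<open>b\<close>.
\<close>

lemma simplex_divergence:
  fixes K :: "(real^'n) set" and \<psi> :: "real^'n \<Rightarrow> real"
  assumes K: "int CARD('n) simplex K" and N: "outward_normals K N" and \<psi>: "smooth \<psi>"
  shows "(\<integral>x. grad \<psi> x \<bullet> e \<partial>lebesgue_on K) = (\<Sum>F | F facet_of K. (N F \<bullet> e) * (\<integral>y. \<psi> y \<partial>face_measure F))"
proof -
  obtain C where C: "\<not> affine_dependent C" "int (card C) = int CARD('n) + 1" and KC: "K = convex hull C"
    using K by (auto simp: simplex_def)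
  have cC: "card C = CARD('n) + 1" using C(2) by linarith
  have fin: "finite C" using cC by (simp add: card_ge_0_finite)
  let ?F = "\<lambda>b. convex hull (C - {b})"
  have bij: "bij_betw ?F C {F. F facet_of K}" unfolding KC by (rule simplex_facets[OF C(1) cC])
  have facet: "?F b facet_of K" if "b \<in> C" for b using bij_betwE[OF bij] that by blast
  have "\<exists>c h. affine hull (?F b) = {x. N (?F b) \<bullet> x = c} \<and> N (?F b) \<bullet> b = c - h \<and> 0 < h" if b: "b \<in> C" for b
  proof -
    note N' = N[unfolded outward_normals_def, rule_format, OF facet[OF b]]
    obtain c h where "affine hull (?F b) = {x. N (?F b) \<bullet> x = c}" "N (?F b) \<bullet> b = c - h" "0 < h"
      by (rule facet_simplex_apex[OF C(1) cC b, of "N (?F b)"]) (use N' KC in blast)+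
    then show ?thesis by blast
  qed
  then obtain c h where H: "\<And>b. b \<in> C \<Longrightarrow> affine hull (?F b) = {x. N (?F b) \<bullet> x = c b}"
    and h: "\<And>b. b \<in> C \<Longrightarrow> N (?F b) \<bullet> b = c b - h b" "\<And>b. b \<in> C \<Longrightarrow> 0 < h b" by metis
  have cone: "(\<integral>x. real CARD('n) * \<psi> x + grad \<psi> x \<bullet> (x - b) \<partial>lebesgue_on K) = h b * (\<integral>y. \<psi> y \<partial>face_measure (?F b))"
    if b: "b \<in> C" for b
  proof -
    have "K = convex hull insert b (?F b)"
      using hull_insert[of convex b "C - {b}"] b KC by (simp add: insert_absorb)
    moreover have "?F b \<noteq> {}" using facet[OF b] by (auto simp: facet_of_def)
    moreover have "compact (?F b)" using fin by (simp add: finite_imp_compact_convex_hull)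
    ultimately show ?thesis
      using cone_divergence[of "?F b" "N (?F b)" "c b" b "h b" \<psi>] H[OF b] h[OF b] \<psi>
        N[unfolded outward_normals_def, rule_format, OF facet[OF b]] by simp
  qed
  have full: "affine hull C = UNIV"
    using affine_independent_span_eq[OF C(1)] cC by simp
  obtain a0 where a0: "a0 \<in> C" using cC by (metis card.empty add_is_0 one_neq_zero ex_in_conv)
  \<comment> \<open>Barycentric coordinates of the point \<open>a0 - e\<close>, possibly negative.
    Subtracting those of \<open>a0\<close> leaves coefficients \<open>\<gamma>\<close> of sum zero
    that represent \<open>- e\<close>.\<close>
  obtain u where u: "(\<Sum>b\<in>C. u b) = 1" "(\<Sum>b\<in>C. u b *\<^sub>R b) = a0 - e"
  proof -
    have "a0 - e \<in> affine hull C" using full by simp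
    then show thesis using that a0 unfolding affine_hull_finite[OF fin] by blast
  qed
  define \<gamma> where "\<gamma> b = u b - (if b = a0 then 1 else 0)" for b
  have \<gamma>0: "(\<Sum>b\<in>C. \<gamma> b) = 0" unfolding \<gamma>_def using u(1) a0 fin by (simp add: sum_subtractf)
  have \<gamma>e: "(\<Sum>b\<in>C. \<gamma> b *\<^sub>R b) = - e"
  proof -
    have "(\<Sum>b\<in>C. (if b = a0 then 1 else 0) *\<^sub>R b) = a0"
      using a0 fin by (simp add: if_distrib[of "\<lambda>t. t *\<^sub>R _"] cong: if_cong)
    then show ?thesis unfolding \<gamma>_def using u(2) by (simp add: scaleR_left_diff_distrib sum_subtractf)
  qed
  have "compact K" using fin KC by (simp add: finite_imp_compact_convex_hull)
  then have bK: "bounded K" "K \<in> sets lebesgue" by (auto simp: compact_imp_bounded compact_imp_closed)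
  have fm: "finite_measure (lebesgue_on K)"
    by (intro finite_measure_lebesgue_on bounded_set_imp_lmeasurable bK)
  have int: "integrable (lebesgue_on K) (\<lambda>x. real CARD('n) * \<psi> x + grad \<psi> x \<bullet> (x - b))" for b
    by (intro L2_integrable[OF fm] continuous_L2 bK continuous_intros smooth_continuous smooth_grad_continuous \<psi>)
  \<comment> \<open>Because the coefficients sum to zero, all terms that do not contain the vertex
    \<open>b\<close> cancel.\<close>
  have pt: "(\<Sum>b\<in>C. \<gamma> b * (real CARD('n) * \<psi> x + grad \<psi> x \<bullet> (x - b))) = grad \<psi> x \<bullet> e" for x
  proof -
    have "(\<Sum>b\<in>C. \<gamma> b * (real CARD('n) * \<psi> x + grad \<psi> x \<bullet> (x - b))) =
        (\<Sum>b\<in>C. \<gamma> b * (real CARD('n) * \<psi> x + grad \<psi> x \<bullet> x) - grad \<psi> x \<bullet> (\<gamma> b *\<^sub>R b))"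
      by (intro sum.cong refl) (simp add: inner_diff_right algebra_simps)
    also have "\<dots> = (\<Sum>b\<in>C. \<gamma> b) * (real CARD('n) * \<psi> x + grad \<psi> x \<bullet> x) - grad \<psi> x \<bullet> (\<Sum>b\<in>C. \<gamma> b *\<^sub>R b)"
      by (simp only: sum_subtractf sum_distrib_right inner_sum_right)
    finally have "(\<Sum>b\<in>C. \<gamma> b * (real CARD('n) * \<psi> x + grad \<psi> x \<bullet> (x - b))) =
        (\<Sum>b\<in>C. \<gamma> b) * (real CARD('n) * \<psi> x + grad \<psi> x \<bullet> x) - grad \<psi> x \<bullet> (\<Sum>b\<in>C. \<gamma> b *\<^sub>R b)" .
    then show ?thesis using \<gamma>0 \<gamma>e by simp
  qed
  have "(\<integral>x. grad \<psi> x \<bullet> e \<partial>lebesgue_on K) = (\<Sum>b\<in>C. \<gamma> b * (\<integral>x. real CARD('n) * \<psi> x + grad \<psi> x \<bullet> (x - b) \<partial>lebesgue_on K))"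
    unfolding pt[symmetric] using int
    by (subst Bochner_Integration.integral_sum) (auto intro!: sum.cong integral_mult_right_zero)
  also have "\<dots> = (\<Sum>b\<in>C. (N (?F b) \<bullet> e) * (\<integral>y. \<psi> y \<partial>face_measure (?F b)))"
  proof (rule sum.cong[OF refl])
    fix b assume b: "b \<in> C"
    \<comment> \<open>All vertices other than \<open>b\<close> share the height \<open>c b\<close>,
      and \<open>b\<close> itself lies lower by \<open>h b\<close>; with coefficients of sum zero
      this leaves \<open>N (?F b) \<bullet> e = \<gamma> b * h b\<close>.\<close>
    have "N (?F b) \<bullet> b' = c b" if "b' \<in> C" "b' \<noteq> b" for b'
    proof -
      have "b' \<in> affine hull (?F b)" using that by (auto intro: hull_inc)
      then show ?thesis using H[OF b] by blast
    qed
    then have "(\<Sum>b'\<in>C - {b}. \<gamma> b' * (N (?F b) \<bullet> b')) = (\<Sum>b'\<in>C - {b}. \<gamma> b') * c b"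
      by (auto simp: sum_distrib_right intro!: sum.cong)
    moreover have "(\<Sum>b'\<in>C - {b}. \<gamma> b') = - \<gamma> b" using \<gamma>0 sum.remove[OF fin b, of \<gamma>] by simp
    moreover have "N (?F b) \<bullet> e = - (\<Sum>b'\<in>C. \<gamma> b' * (N (?F b) \<bullet> b'))"
      using arg_cong[OF \<gamma>e, of "\<lambda>z. N (?F b) \<bullet> z"] by (simp add: inner_sum_right)
    ultimately have "N (?F b) \<bullet> e = \<gamma> b * h b"
      using sum.remove[OF fin b, of "\<lambda>b'. \<gamma> b' * (N (?F b) \<bullet> b')"] h(1)[OF b] by (simp add: algebra_simps)
    then show "\<gamma> b * (\<integral>x. real CARD('n) * \<psi> x + grad \<psi> x \<bullet> (x - b) \<partial>lebesgue_on K) =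
      (N (?F b) \<bullet> e) * (\<integral>y. \<psi> y \<partial>face_measure (?F b))" using cone[OF b] by simp
  qed
  also have "\<dots> = (\<Sum>F | F facet_of K. (N F \<bullet> e) * (\<integral>y. \<psi> y \<partial>face_measure F))"
    by (rule sum.reindex_bij_betw[OF bij])
  finally show ?thesis .
qed

section \<open>Sobolev functions on a simplex\<close>

text \<open>Lebesgue measure is complete, so even measurability is invariant under changes on null sets.\<close>

lemma lebesgue_null_change:
  fixes f g :: "real^'n \<Rightarrow> 'b::euclidean_space"
  assumes S: "S \<in> sets lebesgue" "T \<in> sets lebesgue"
    and ae: "AE x in lebesgue. (x \<in> S \<longleftrightarrow> x \<in> T) \<and> (x \<in> S \<longrightarrow> f x = g x)"
  shows lebesgue_on_measurable_change: "f \<in> borel_measurable (lebesgue_on S) \<longleftrightarrow> g \<in> borel_measurable (lebesgue_on T)"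
    and lebesgue_on_integrable_change: "integrable (lebesgue_on S) f \<longleftrightarrow> integrable (lebesgue_on T) g"
    and lebesgue_on_integral_change: "integral\<^sup>L (lebesgue_on S) f = integral\<^sup>L (lebesgue_on T) g"
proof -
  let ?f = "\<lambda>x. indicator S x *\<^sub>R f x" and ?g = "\<lambda>x. indicator T x *\<^sub>R g x"
  have ae': "AE x in lebesgue. ?f x = ?g x" using ae by eventually_elim (auto split: split_indicator)
  then have ae'': "AE x in lebesgue. ?g x = ?f x" by eventually_elim simp
  have meas: "?f \<in> borel_measurable lebesgue \<longleftrightarrow> ?g \<in> borel_measurable lebesgue"
    using borel_measurable_AE[OF _ ae'] borel_measurable_AE[OF _ ae''] by blast
  then show m: "f \<in> borel_measurable (lebesgue_on S) \<longleftrightarrow> g \<in> borel_measurable (lebesgue_on T)"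
    using S by (simp add: borel_measurable_restrict_space_iff)
  have int: "integrable lebesgue ?f \<longleftrightarrow> integrable lebesgue ?g"
    using meas integrable_cong_AE[OF _ _ ae'] by (meson borel_measurable_integrable)
  then show "integrable (lebesgue_on S) f \<longleftrightarrow> integrable (lebesgue_on T) g"
    using S by (simp add: integrable_restrict_space)
  have "integral\<^sup>L lebesgue ?f = integral\<^sup>L lebesgue ?g"
  proof (cases "?f \<in> borel_measurable lebesgue")
    case True
    show ?thesis by (rule integral_cong_AE[OF True meas[THEN iffD1, OF True] ae'])
  next
    case False
    then have "\<not> integrable lebesgue ?f" "\<not> integrable lebesgue ?g"
      using meas borel_measurable_integrable by blast+
    then show ?thesis by (metis not_integrable_integral_eq)
  qed
  then show "integral\<^sup>L (lebesgue_on S) f = integral\<^sup>L (lebesgue_on T) g"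
    using S by (simp add: integral_restrict_space)
qed

lemma lebesgue_on_AE_cong:
  fixes f g :: "real^'n \<Rightarrow> 'b::euclidean_space"
  assumes S: "S \<in> sets lebesgue" and ae: "AE x in lebesgue_on S. f x = g x"
  shows lebesgue_on_measurable_AE_cong: "f \<in> borel_measurable (lebesgue_on S) \<longleftrightarrow> g \<in> borel_measurable (lebesgue_on S)"
    and lebesgue_on_integral_AE_cong: "integral\<^sup>L (lebesgue_on S) f = integral\<^sup>L (lebesgue_on S) g"
    and lebesgue_on_integrable_AE_cong: "integrable (lebesgue_on S) f \<longleftrightarrow> integrable (lebesgue_on S) g"
proof -
  have ae': "AE x in lebesgue. (x \<in> S \<longleftrightarrow> x \<in> S) \<and> (x \<in> S \<longrightarrow> f x = g x)"
    using ae S by (simp add: AE_restrict_space_iff)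
  note * = lebesgue_null_change[OF S S ae']
  show "f \<in> borel_measurable (lebesgue_on S) \<longleftrightarrow> g \<in> borel_measurable (lebesgue_on S)"
    "integral\<^sup>L (lebesgue_on S) f = integral\<^sup>L (lebesgue_on S) g"
    "integrable (lebesgue_on S) f \<longleftrightarrow> integrable (lebesgue_on S) g" by (fact *)+
qed

lemma L2_lebesgue_on_AE_cong:
  fixes f g :: "real^'n \<Rightarrow> 'b::euclidean_space"
  assumes S: "S \<in> sets lebesgue" and ae: "AE x in lebesgue_on S. f x = g x"
  shows "f \<in> L2 (lebesgue_on S) \<longleftrightarrow> g \<in> L2 (lebesgue_on S)"
    and L2_norm_lebesgue_on_AE_cong: "L2_norm (lebesgue_on S) f = L2_norm (lebesgue_on S) g"
proof -
  have ae2: "AE x in lebesgue_on S. (norm (f x))\<^sup>2 = (norm (g x))\<^sup>2" using ae by eventually_elim simp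
  show "f \<in> L2 (lebesgue_on S) \<longleftrightarrow> g \<in> L2 (lebesgue_on S)"
    unfolding L2_def using lebesgue_on_measurable_AE_cong[OF S ae] lebesgue_on_integrable_AE_cong[OF S ae2] by simp
  show "L2_norm (lebesgue_on S) f = L2_norm (lebesgue_on S) g"
    unfolding L2_norm_def using lebesgue_on_integral_AE_cong[OF S ae2] by simp
qed

lemma is_weak_grad_AE_cong:
  assumes U: "open U" and ae: "AE x in lebesgue_on U. v x = w x"
  shows "is_weak_grad U v = is_weak_grad U w"
proof -
  have "(\<integral>x. v x * grad \<phi> x $ i \<partial>lebesgue_on U) = (\<integral>x. w x * grad \<phi> x $ i \<partial>lebesgue_on U)" for \<phi> i
  proof (rule lebesgue_on_integral_AE_cong)
    show "AE x in lebesgue_on U. v x * grad \<phi> x $ i = w x * grad \<phi> x $ i"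
      using ae by eventually_elim simp
  qed (use U in simp)
  then show ?thesis by (simp add: is_weak_grad_def fun_eq_iff)
qed

text \<open>The defining predicates coincide, hence so do the choices made by \<open>SOME\<close>:
  the two functions are literally equal and not merely almost everywhere.\<close>

lemma weak_grad_AE_cong:
  assumes "open U" "AE x in lebesgue_on U. v x = w x"
  shows "weak_grad U v = weak_grad U w"
  unfolding weak_grad_def is_weak_grad_AE_cong[OF assms] ..

lemma is_weak_grad_weak_grad: "is_weak_grad U v G \<Longrightarrow> is_weak_grad U v (weak_grad U v)"
  unfolding weak_grad_def by (rule someI[of "is_weak_grad U v"])

lemma weak_grad_AE:
  assumes "open U" "bounded U" "is_weak_grad U v G"
  shows "AE x in lebesgue_on U. weak_grad U v x = G x"
  by (rule weak_grad_unique[OF assms(1,2) is_weak_grad_weak_grad[OF assms(3)] assms(3)])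

lemma test_functionsD:
  assumes "\<phi> \<in> test_functions U"
  shows "smooth \<phi>" "x \<notin> U \<Longrightarrow> \<phi> x = 0"
  using assms closure_subset[of "{x. \<phi> x \<noteq> 0}"] by (auto simp: test_functions_def)

lemma is_weak_grad_lincomb:
  fixes v w :: "real^'n \<Rightarrow> real"
  assumes U: "open U" "bounded U" and v: "v \<in> L2 (lebesgue_on U)" "is_weak_grad U v G"
    and w: "w \<in> L2 (lebesgue_on U)" "is_weak_grad U w H"
  shows "is_weak_grad U (\<lambda>x. a * v x + b * w x) (\<lambda>x. a *\<^sub>R G x + b *\<^sub>R H x)"
  unfolding is_weak_grad_def
proof (intro conjI ballI allI)
  have L2: "G \<in> L2 (lebesgue_on U)" "H \<in> L2 (lebesgue_on U)" using v w by (auto simp: is_weak_grad_def)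
  then show "(\<lambda>x. a *\<^sub>R G x + b *\<^sub>R H x) \<in> L2 (lebesgue_on U)" by (rule L2_lincomb)
  fix \<phi> i assume \<phi>: "\<phi> \<in> test_functions U"
  have [simp]: "U \<in> sets lebesgue" using U by simp
  have sm: "smooth \<phi>" using \<phi> by (rule test_functionsD)
  have p: "\<phi> \<in> L2 (lebesgue_on U)" "(\<lambda>x. grad \<phi> x $ i) \<in> L2 (lebesgue_on U)"
    using U by (auto intro!: continuous_L2 smooth_continuous sm smooth_grad_component)
  have "(\<integral>x. (a * v x + b * w x) * grad \<phi> x $ i \<partial>lebesgue_on U) =
      a * (\<integral>x. v x * grad \<phi> x $ i \<partial>lebesgue_on U) + b * (\<integral>x. w x * grad \<phi> x $ i \<partial>lebesgue_on U)"
    using L2_integrable_mult[OF v(1) p(2)] L2_integrable_mult[OF w(1) p(2)]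
    by (simp add: distrib_right mult.assoc)
  also have "\<dots> = - (a * (\<integral>x. G x $ i * \<phi> x \<partial>lebesgue_on U) + b * (\<integral>x. H x $ i * \<phi> x \<partial>lebesgue_on U))"
    using v(2) w(2) \<phi> by (simp add: is_weak_grad_def)
  also have "\<dots> = - (\<integral>x. (a *\<^sub>R G x + b *\<^sub>R H x) $ i * \<phi> x \<partial>lebesgue_on U)"
    using L2_integrable_mult[OF L2_component[OF L2(1)] p(1), of i] L2_integrable_mult[OF L2_component[OF L2(2)] p(1), of i]
    by (simp add: distrib_right mult.assoc)
  finally show "(\<integral>x. (a * v x + b * w x) * grad \<phi> x $ i \<partial>lebesgue_on U) =
      - (\<integral>x. (a *\<^sub>R G x + b *\<^sub>R H x) $ i * \<phi> x \<partial>lebesgue_on U)" .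
qed

locale simplex_element =
  fixes K :: "(real^'n) set" and N :: "(real^'n) set \<Rightarrow> real^'n"
  assumes simplex: "int CARD('n) simplex K" and normals: "outward_normals K N"
begin

abbreviation "LK \<equiv> lebesgue_on (interior K)"

lemma compact_K: "compact K"
proof -
  obtain C where "finite C" "K = convex hull C" using simplex unfolding Polytope.simplex by blast
  then show ?thesis by (simp add: finite_imp_compact_convex_hull)
qed

lemma convex_K: "convex K"
  using simplex by (auto simp: simplex_def)

lemma bounded_interior: "bounded (interior K)"
  using compact_K interior_subset by (meson bounded_subset compact_imp_bounded)

lemma interior_lmeasurable [simp]: "interior K \<in> sets lebesgue" "K \<in> sets lebesgue"
  using compact_K by (auto simp: compact_imp_closed)

lemma AE_interior: "AE x in lebesgue. x \<in> K \<longleftrightarrow> x \<in> interior K"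
proof -
  have "negligible (K - interior K)"
    using negligible_convex_frontier[OF convex_K] compact_K
    by (simp add: frontier_def compact_imp_closed closure_closed)
  then have "AE x in lebesgue. x \<notin> K - interior K"
    by (intro AE_not_in) (simp add: negligible_iff_null_sets)
  then show ?thesis by eventually_elim (use interior_subset in blast)
qed

lemma continuous_L2_interior:
  fixes f :: "real^'n \<Rightarrow> 'b::euclidean_space"
  shows "continuous_on UNIV f \<Longrightarrow> f \<in> L2 LK"
  by (intro continuous_L2 bounded_interior) auto

lemmas smooth_L2 = continuous_L2_interior[OF smooth_continuous]
lemmas smooth_grad_L2 = continuous_L2_interior[OF smooth_grad_continuous]

lemma facet_geometry:
  assumes F: "F facet_of K"
  obtains b c h where "K = convex hull insert b F" "compact F" "convex F" "F \<noteq> {}" "norm (N F) = 1"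
    "affine hull F = {x. N F \<bullet> x = c}" "N F \<bullet> b = c - h" "0 < h"
proof -
  obtain C where C: "\<not> affine_dependent C" "int (card C) = int CARD('n) + 1" and KC: "K = convex hull C"
    using simplex by (auto simp: simplex_def)
  have cC: "card C = CARD('n) + 1" using C(2) by linarith
  have fin: "finite C" using cC by (simp add: card_ge_0_finite)
  obtain b where b: "b \<in> C" "F = convex hull (C - {b})"
    using simplex_facets[OF C(1) cC] F KC by (auto simp: bij_betw_def image_iff)
  note N' = normals[unfolded outward_normals_def, rule_format, OF F]
  obtain c h where "affine hull F = {x. N F \<bullet> x = c}" "N F \<bullet> b = c - h" "0 < h"
    unfolding b(2)
    by (rule facet_simplex_apex[OF C(1) cC b(1), of "N F"]) (use N' KC b in blast)+
  moreover have "K = convex hull insert b F"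
    using hull_insert[of convex b "C - {b}"] b KC by (simp add: insert_absorb)
  moreover have "compact F" unfolding b(2) using fin by (simp add: finite_imp_compact_convex_hull)
  moreover have "F \<noteq> {}" using F by (simp add: facet_of_def)
  moreover have "convex F" unfolding b(2) by simp
  ultimately show ?thesis using that N' by blast
qed

lemma facet_finite_measure: "F facet_of K \<Longrightarrow> finite_measure (face_measure F)"
  by (erule facet_geometry) (rule face_measure_finite)

lemma facet_AE: "F facet_of K \<Longrightarrow> AE x in face_measure F. x \<in> F"
  by (erule facet_geometry) (rule AE_face_measure, auto simp: compact_imp_closed)

lemma continuous_L2_facet:
  fixes f :: "real^'n \<Rightarrow> 'b::euclidean_space"
  assumes F: "F facet_of K" and f: "continuous_on UNIV f"
  shows "f \<in> L2 (face_measure F)"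
proof -
  have "compact F" using F by (rule facet_geometry)
  then have "bounded (f ` F)"
    by (intro compact_imp_bounded compact_continuous_image continuous_on_subset[OF f]) auto
  then obtain B where B: "\<And>x. x \<in> F \<Longrightarrow> norm (f x) \<le> B" by (auto simp: bounded_iff)
  show ?thesis
  proof (rule L2_bounded[OF facet_finite_measure[OF F]])
    show "f \<in> borel_measurable (face_measure F)"
      using borel_measurable_continuous_onI[OF f] by (simp cong: measurable_cong_sets)
    show "AE x in face_measure F. norm (f x) \<le> B" using facet_AE[OF F] by eventually_elim (rule B)
  qed
qed

lemmas smooth_L2_facet = continuous_L2_facet[OF _ smooth_continuous]

lemma finite_facets: "finite {F. F facet_of K}"
proof -
  have "polytope K" using simplex by (rule simplex_imp_polytope)
  then show ?thesis by (rule finite_polytope_facets)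
qed

lemma smooth_integration_by_parts:
  assumes "smooth \<phi>" "smooth \<psi>"
  shows "(\<integral>x. \<phi> x * grad \<psi> x $ i \<partial>LK) + (\<integral>x. grad \<phi> x $ i * \<psi> x \<partial>LK) =
    (\<Sum>F | F facet_of K. N F $ i * (\<integral>x. \<phi> x * \<psi> x \<partial>face_measure F))"
proof -
  have "(\<integral>x. \<phi> x * grad \<psi> x $ i \<partial>LK) + (\<integral>x. grad \<phi> x $ i * \<psi> x \<partial>LK) =
      (\<integral>x. \<phi> x * grad \<psi> x $ i + grad \<phi> x $ i * \<psi> x \<partial>LK)"
    using assms by (intro Bochner_Integration.integral_add[symmetric] L2_integrable_mult smooth_L2 smooth_grad_component)
  also have "\<dots> = (\<integral>x. grad (\<lambda>x. \<phi> x * \<psi> x) x \<bullet> axis i 1 \<partial>LK)"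
    by (simp add: grad_mult[OF assms] inner_add_left inner_axis mult.commute)
  also have "\<dots> = (\<integral>x. grad (\<lambda>x. \<phi> x * \<psi> x) x \<bullet> axis i 1 \<partial>lebesgue_on K)"
    by (rule lebesgue_on_integral_change) (use AE_interior in auto)
  also have "\<dots> = (\<Sum>F | F facet_of K. (N F \<bullet> axis i 1) * (\<integral>x. \<phi> x * \<psi> x \<partial>face_measure F))"
    by (rule simplex_divergence[OF simplex normals smooth_mult[OF assms]])
  finally show ?thesis by (simp add: inner_axis)
qed

lemma facet_disjoint_interior: "F facet_of K \<Longrightarrow> F \<inter> interior K = {}"
  by (rule face_of_disjoint_interior[OF facet_of_imp_face_of]) (auto simp: facet_of_def)

lemma smooth_is_weak_grad:
  assumes "smooth \<phi>"
  shows "is_weak_grad (interior K) \<phi> (grad \<phi>)"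
  unfolding is_weak_grad_def
proof (intro conjI ballI allI)
  show "grad \<phi> \<in> L2 LK" using assms by (rule smooth_grad_L2)
  fix \<xi> i assume \<xi>: "\<xi> \<in> test_functions (interior K)"
  \<comment> \<open>A test function vanishes outside the interior, in particular on every facet, so
    integration by parts leaves no boundary term.\<close>
  have "(\<integral>x. \<phi> x * \<xi> x \<partial>face_measure F) = 0" if F: "F facet_of K" for F
  proof (rule integral_eq_zero_AE)
    show "AE x in face_measure F. \<phi> x * \<xi> x = 0"
      using facet_AE[OF F]
    proof eventually_elim
      case (elim x)
      then have "x \<notin> interior K" using facet_disjoint_interior[OF F] by blast
      then show ?case using test_functionsD(2)[OF \<xi>] by simp
    qed
  qed
  then show "(\<integral>x. \<phi> x * grad \<xi> x $ i \<partial>LK) = - (\<integral>x. grad \<phi> x $ i * \<xi> x \<partial>LK)"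
    using smooth_integration_by_parts[OF assms test_functionsD(1)[OF \<xi>], of i] by simp
qed

lemma smooth_weak_grad: "smooth \<phi> \<Longrightarrow> AE x in LK. weak_grad (interior K) \<phi> x = grad \<phi> x"
  by (intro weak_grad_AE smooth_is_weak_grad bounded_interior open_interior)

text \<open>\<open>cone_divergence\<close> for the square of \<open>\<phi>\<close> bounds its
  integral over the facet by volume integrals of \<open>\<phi>\<close> and its gradient. The
  constant may depend on the element and the facet, since it serves only to pass to limits.\<close>

lemma trace_inequality:
  assumes F: "F facet_of K"
  obtains c where "0 \<le> c"
    "\<And>\<phi>. smooth \<phi> \<Longrightarrow> L2_norm (face_measure F) \<phi> \<le> c * (L2_norm LK \<phi> + L2_norm LK (grad \<phi>))"
proof -
  obtain b c h where K: "K = convex hull insert b F" and g: "compact F" "convex F" "F \<noteq> {}"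
    "affine hull F = {x. N F \<bullet> x = c}" "norm (N F) = 1" "N F \<bullet> b = c - h" and h: "0 < h"
    using F by (rule facet_geometry) blast
  obtain R where R: "\<And>x. x \<in> K \<Longrightarrow> norm (x - b) \<le> R" and R0: "0 \<le> R"
  proof -
    have "bounded ((\<lambda>x. x - b) ` K)"
      by (intro compact_imp_bounded compact_continuous_image compact_K continuous_intros)
    then obtain R where "\<And>x. x \<in> K \<Longrightarrow> norm (x - b) \<le> R" by (auto simp: bounded_iff)
    moreover have "b \<in> K" unfolding K by (simp add: hull_inc)
    ultimately show ?thesis using that[of R] by force
  qed
  \<comment> \<open>The dimension comes from the divergence of \<open>x - b\<close>, the radius
    \<open>R\<close> from bounding \<open>x - b\<close> on the element, and the height
    \<open>h\<close> from the flux through the facet.\<close>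
  let ?D = "(real CARD('n) + R) / h"
  have D0: "0 \<le> ?D" using h R0 by simp
  have main: "L2_norm (face_measure F) \<phi> \<le> sqrt ?D * (L2_norm LK \<phi> + L2_norm LK (grad \<phi>))" if \<phi>: "smooth \<phi>" for \<phi>
  proof -
    let ?\<psi> = "\<lambda>x. \<phi> x * \<phi> x" and ?A = "L2_norm LK \<phi>" and ?B = "L2_norm LK (grad \<phi>)"
    have gr: "grad ?\<psi> x = (2 * \<phi> x) *\<^sub>R grad \<phi> x" for x
      using grad_mult[OF \<phi> \<phi>, of x] by (simp add: scaleR_add_left[symmetric])
    have "h * (\<integral>y. ?\<psi> y \<partial>face_measure F) = (\<integral>x. real CARD('n) * ?\<psi> x + grad ?\<psi> x \<bullet> (x - b) \<partial>lebesgue_on K)"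
      unfolding K by (rule cone_divergence[OF g(1-6) h smooth_mult[OF \<phi> \<phi>], symmetric])
    also have "\<dots> = (\<integral>x. real CARD('n) * ?\<psi> x + grad ?\<psi> x \<bullet> (x - b) \<partial>LK)"
      by (rule lebesgue_on_integral_change) (use AE_interior in auto)
    also have "\<dots> \<le> (\<integral>x. (real CARD('n) + R) * (norm (\<phi> x))\<^sup>2 + R * (norm (grad \<phi> x))\<^sup>2 \<partial>LK)"
    proof (rule integral_mono)
      show "integrable LK (\<lambda>x. real CARD('n) * ?\<psi> x + grad ?\<psi> x \<bullet> (x - b))"
        unfolding gr using \<phi>
        by (intro L2_integrable finite_measure_lebesgue_on lmeasurable_open bounded_interior open_interior
            continuous_L2_interior continuous_intros smooth_continuous smooth_grad_continuous)
      show "integrable LK (\<lambda>x. (real CARD('n) + R) * (norm (\<phi> x))\<^sup>2 + R * (norm (grad \<phi> x))\<^sup>2)"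
        using smooth_L2[OF \<phi>] smooth_grad_L2[OF \<phi>] by (auto simp: L2_def)
      fix x assume "x \<in> space LK"
      then have x: "x \<in> K" using interior_subset[of K] by auto
      have "grad ?\<psi> x \<bullet> (x - b) \<le> norm (grad ?\<psi> x) * norm (x - b)" by (rule norm_cauchy_schwarz)
      also have "\<dots> \<le> norm (grad ?\<psi> x) * R" by (intro mult_left_mono R x) simp
      also have "norm (grad ?\<psi> x) = 2 * norm (\<phi> x) * norm (grad \<phi> x)" unfolding gr by (simp add: abs_mult)
      also have "\<dots> * R \<le> ((norm (\<phi> x))\<^sup>2 + (norm (grad \<phi> x))\<^sup>2) * R"
        by (intro mult_right_mono R0) (rule sum_squares_bound)
      finally show "real CARD('n) * ?\<psi> x + grad ?\<psi> x \<bullet> (x - b) \<le> (real CARD('n) + R) * (norm (\<phi> x))\<^sup>2 + R * (norm (grad \<phi> x))\<^sup>2"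
        by (simp add: algebra_simps power2_eq_square)
    qed
    also have "\<dots> = (real CARD('n) + R) * ?A\<^sup>2 + R * ?B\<^sup>2"
      unfolding L2_norm_power2 using smooth_L2[OF \<phi>] smooth_grad_L2[OF \<phi>] by (simp add: L2_def)
    also have "\<dots> \<le> (real CARD('n) + R) * (?A + ?B)\<^sup>2"
    proof -
      have "?A\<^sup>2 + ?B\<^sup>2 \<le> (?A + ?B)\<^sup>2" by (simp add: power2_sum)
      then have "(real CARD('n) + R) * (?A\<^sup>2 + ?B\<^sup>2) \<le> (real CARD('n) + R) * (?A + ?B)\<^sup>2"
        using R0 by (intro mult_left_mono) auto
      then show ?thesis by (simp add: algebra_simps) (smt (verit) zero_le_power2 of_nat_0_le_iff mult_nonneg_nonneg)
    qed
    finally have "(\<integral>y. ?\<psi> y \<partial>face_measure F) \<le> ?D * (?A + ?B)\<^sup>2" using h by (simp add: field_simps)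
    then have "sqrt (\<integral>y. ?\<psi> y \<partial>face_measure F) \<le> sqrt (?D * (?A + ?B)\<^sup>2)" by (rule real_sqrt_le_mono)
    also have "\<dots> = sqrt ?D * sqrt ((?A + ?B)\<^sup>2)" by (rule real_sqrt_mult)
    also have "\<dots> = sqrt ?D * (?A + ?B)" by simp
    finally show ?thesis by (simp add: L2_norm_def power2_eq_square)
  qed
  show ?thesis by (rule that[of "sqrt ?D"]) (use D0 main in auto)
qed

end

text \<open>Exactly the data from which \<open>is_face_trace\<close> builds a trace: a weak gradient
  and an approximation by functions that are smooth on the whole space. Taking the approximation
  into the definition makes it available for every element of the class.\<close>

definition H1_elem :: "(real^'n) set \<Rightarrow> (real^'n \<Rightarrow> real) \<Rightarrow> bool" where
  "H1_elem K v \<longleftrightarrow> v \<in> L2 (lebesgue_on (interior K)) \<and> (\<exists>G. is_weak_grad (interior K) v G) \<and>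
    (\<exists>\<phi> :: nat \<Rightarrow> real^'n \<Rightarrow> real. (\<forall>k. smooth (\<phi> k)) \<and>
       (\<lambda>k. L2_norm (lebesgue_on (interior K)) (\<lambda>x. \<phi> k x - v x)) \<longlonglongrightarrow> 0 \<and>
       (\<lambda>k. L2_norm (lebesgue_on (interior K)) (\<lambda>x. grad (\<phi> k) x - weak_grad (interior K) v x)) \<longlonglongrightarrow> 0)"

lemma H1_elem_L2: "H1_elem K v \<Longrightarrow> v \<in> L2 (lebesgue_on (interior K))"
  by (simp add: H1_elem_def)

lemma H1_elem_is_weak_grad: "H1_elem K v \<Longrightarrow> is_weak_grad (interior K) v (weak_grad (interior K) v)"
  by (auto simp: H1_elem_def intro: is_weak_grad_weak_grad)

lemma H1_elem_weak_grad_L2: "H1_elem K v \<Longrightarrow> weak_grad (interior K) v \<in> L2 (lebesgue_on (interior K))"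
  using H1_elem_is_weak_grad[of K v] by (simp add: is_weak_grad_def)

lemma H1_elem_AE_cong:
  assumes ae: "AE x in lebesgue_on (interior K). v x = w x"
  shows "H1_elem K v \<longleftrightarrow> H1_elem K w"
proof -
  have "L2_norm (lebesgue_on (interior K)) (\<lambda>x. \<phi> x - v x) = L2_norm (lebesgue_on (interior K)) (\<lambda>x. \<phi> x - w x)" for \<phi>
    by (rule L2_norm_lebesgue_on_AE_cong) (use ae in auto)
  then show ?thesis
    unfolding H1_elem_def using L2_lebesgue_on_AE_cong[OF _ ae] is_weak_grad_AE_cong[OF _ ae] weak_grad_AE_cong[OF _ ae]
    by simp
qed

lemma face_trace_AE_cong:
  assumes ae: "AE x in lebesgue_on (interior K). v x = w x"
  shows "face_trace K F v = face_trace K F w"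
proof -
  have "L2_norm (lebesgue_on (interior K)) (\<lambda>x. \<phi> x - v x) = L2_norm (lebesgue_on (interior K)) (\<lambda>x. \<phi> x - w x)" for \<phi>
    by (rule L2_norm_lebesgue_on_AE_cong) (use ae in auto)
  then have "is_face_trace K F v g = is_face_trace K F w g" for g
    unfolding is_face_trace_def using weak_grad_AE_cong[OF _ ae] by simp
  then show ?thesis by (simp add: face_trace_def)
qed

lemma lincomb_limits:
  fixes v w :: "real^'n \<Rightarrow> 'b::euclidean_space"
  assumes L2: "v \<in> L2 M" "w \<in> L2 M" "\<And>k. f k \<in> L2 M" "\<And>k. g k \<in> L2 M"
    and lim: "(\<lambda>k. L2_norm M (\<lambda>x. f k x - v x)) \<longlonglongrightarrow> 0" "(\<lambda>k. L2_norm M (\<lambda>x. g k x - w x)) \<longlonglongrightarrow> 0"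
  shows "(\<lambda>k. L2_norm M (\<lambda>x. (a *\<^sub>R f k x + b *\<^sub>R g k x) - (a *\<^sub>R v x + b *\<^sub>R w x))) \<longlonglongrightarrow> 0"
proof (rule Lim_null_comparison)
  have "L2_norm M (\<lambda>x. a *\<^sub>R (f k x - v x) + b *\<^sub>R (g k x - w x)) \<le>
      \<bar>a\<bar> * L2_norm M (\<lambda>x. f k x - v x) + \<bar>b\<bar> * L2_norm M (\<lambda>x. g k x - w x)" for k
    by (intro L2_norm_lincomb_le L2_diff L2)
  then show "\<forall>\<^sub>F k in sequentially. norm (L2_norm M (\<lambda>x. (a *\<^sub>R f k x + b *\<^sub>R g k x) - (a *\<^sub>R v x + b *\<^sub>R w x)))
      \<le> \<bar>a\<bar> * L2_norm M (\<lambda>x. f k x - v x) + \<bar>b\<bar> * L2_norm M (\<lambda>x. g k x - w x)"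
    by (simp add: algebra_simps)
  show "(\<lambda>k. \<bar>a\<bar> * L2_norm M (\<lambda>x. f k x - v x) + \<bar>b\<bar> * L2_norm M (\<lambda>x. g k x - w x)) \<longlonglongrightarrow> 0"
    using tendsto_add[OF tendsto_mult_left[OF lim(1), of "\<bar>a\<bar>"] tendsto_mult_left[OF lim(2), of "\<bar>b\<bar>"]] by simp
qed

context simplex_element
begin

lemma H1_elemI:
  assumes v: "v \<in> L2 LK" and G: "is_weak_grad (interior K) v G"
    and \<phi>: "\<And>k. smooth (\<phi> k)" "(\<lambda>k. L2_norm LK (\<lambda>x. \<phi> k x - v x)) \<longlonglongrightarrow> 0"
      "(\<lambda>k. L2_norm LK (\<lambda>x. grad (\<phi> k) x - G x)) \<longlonglongrightarrow> 0"
  shows "H1_elem K v"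
proof -
  have "AE x in LK. weak_grad (interior K) v x = G x"
    by (intro weak_grad_AE bounded_interior open_interior G)
  then have "L2_norm LK (\<lambda>x. grad (\<phi> k) x - weak_grad (interior K) v x) = L2_norm LK (\<lambda>x. grad (\<phi> k) x - G x)" for k
    by (intro L2_norm_lebesgue_on_AE_cong) auto
  then show ?thesis unfolding H1_elem_def using v G \<phi> by (intro conjI exI[of _ G] exI[of _ \<phi>]) auto
qed

lemma smooth_H1_elem:
  assumes "smooth \<phi>" shows "H1_elem K \<phi>"
  by (rule H1_elemI[OF smooth_L2[OF assms] smooth_is_weak_grad[OF assms], where \<phi>="\<lambda>_. \<phi>"])
     (use assms in \<open>auto simp: L2_norm_def\<close>)

lemma weak_grad_lincomb:
  assumes "H1_elem K v" "H1_elem K w"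
  shows "AE x in LK. weak_grad (interior K) (\<lambda>x. a * v x + b * w x) x =
    a *\<^sub>R weak_grad (interior K) v x + b *\<^sub>R weak_grad (interior K) w x"
  using assms by (intro weak_grad_AE is_weak_grad_lincomb H1_elem_L2 H1_elem_is_weak_grad bounded_interior open_interior)

lemma H1_elem_lincomb:
  assumes "H1_elem K v" "H1_elem K w"
  shows "H1_elem K (\<lambda>x. a * v x + b * w x)"
proof -
  obtain \<phi> where \<phi>: "\<And>k. smooth (\<phi> k)" "(\<lambda>k. L2_norm LK (\<lambda>x. \<phi> k x - v x)) \<longlonglongrightarrow> 0"
      "(\<lambda>k. L2_norm LK (\<lambda>x. grad (\<phi> k) x - weak_grad (interior K) v x)) \<longlonglongrightarrow> 0"
    using assms(1) unfolding H1_elem_def by blast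
  obtain \<psi> where \<psi>: "\<And>k. smooth (\<psi> k)" "(\<lambda>k. L2_norm LK (\<lambda>x. \<psi> k x - w x)) \<longlonglongrightarrow> 0"
      "(\<lambda>k. L2_norm LK (\<lambda>x. grad (\<psi> k) x - weak_grad (interior K) w x)) \<longlonglongrightarrow> 0"
    using assms(2) unfolding H1_elem_def by blast
  show ?thesis
  proof (rule H1_elemI)
    show "(\<lambda>x. a * v x + b * w x) \<in> L2 LK"
      using L2_lincomb[OF H1_elem_L2[OF assms(1)] H1_elem_L2[OF assms(2)], of a b] by simp
    show "is_weak_grad (interior K) (\<lambda>x. a * v x + b * w x)
        (\<lambda>x. a *\<^sub>R weak_grad (interior K) v x + b *\<^sub>R weak_grad (interior K) w x)"
      using assms by (intro is_weak_grad_lincomb H1_elem_L2 H1_elem_is_weak_grad bounded_interior open_interior)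
    show "smooth (\<lambda>x. a * \<phi> k x + b * \<psi> k x)" for k by (intro smooth_lincomb \<phi> \<psi>)
    show "(\<lambda>k. L2_norm LK (\<lambda>x. (a * \<phi> k x + b * \<psi> k x) - (a * v x + b * w x))) \<longlonglongrightarrow> 0"
      using lincomb_limits[OF H1_elem_L2[OF assms(1)] H1_elem_L2[OF assms(2)] smooth_L2[OF \<phi>(1)] smooth_L2[OF \<psi>(1)] \<phi>(2) \<psi>(2), of a b]
      by simp
    show "(\<lambda>k. L2_norm LK (\<lambda>x. grad (\<lambda>x. a * \<phi> k x + b * \<psi> k x) x -
        (a *\<^sub>R weak_grad (interior K) v x + b *\<^sub>R weak_grad (interior K) w x))) \<longlonglongrightarrow> 0"
      unfolding grad_lincomb[OF \<phi>(1) \<psi>(1)]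
      by (intro lincomb_limits H1_elem_weak_grad_L2 assms smooth_grad_L2 \<phi> \<psi>)
  qed
qed

text \<open>Two smooth functions are compared through a common pair \<open>v\<close>,
  \<open>G\<close>. The one estimate yields both the Cauchy property of traces and their
  independence of the approximating sequence.\<close>

lemma trace_diff_inequality:
  assumes F: "F facet_of K"
  obtains c where "0 \<le> c"
    "\<And>\<phi> \<psi> v G. smooth \<phi> \<Longrightarrow> smooth \<psi> \<Longrightarrow> v \<in> L2 LK \<Longrightarrow> G \<in> L2 LK \<Longrightarrow>
      L2_norm (face_measure F) (\<lambda>x. \<phi> x - \<psi> x) \<le>
        c * ((L2_norm LK (\<lambda>x. \<phi> x - v x) + L2_norm LK (\<lambda>x. grad \<phi> x - G x)) +
             (L2_norm LK (\<lambda>x. \<psi> x - v x) + L2_norm LK (\<lambda>x. grad \<psi> x - G x)))"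
proof -
  obtain c where c: "0 \<le> c" and tr:
    "\<And>\<phi>. smooth \<phi> \<Longrightarrow> L2_norm (face_measure F) \<phi> \<le> c * (L2_norm LK \<phi> + L2_norm LK (grad \<phi>))"
    using F by (rule trace_inequality) blast
  show ?thesis
  proof (rule that[OF c])
    fix \<phi> \<psi> v :: "real^'n \<Rightarrow> real" and G :: "real^'n \<Rightarrow> real^'n" assume *: "smooth \<phi>" "smooth \<psi>" "v \<in> L2 LK" "G \<in> L2 LK"
    have "L2_norm LK (\<lambda>x. \<phi> x - \<psi> x) \<le> L2_norm LK (\<lambda>x. \<phi> x - v x) + L2_norm LK (\<lambda>x. \<psi> x - v x)"
      using L2_norm_diff_triangle[OF smooth_L2[OF *(1)] *(3) smooth_L2[OF *(2)]]
      by (simp add: L2_norm_minus_commute[of _ v])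
    moreover have "L2_norm LK (grad (\<lambda>x. \<phi> x - \<psi> x)) \<le> L2_norm LK (\<lambda>x. grad \<phi> x - G x) + L2_norm LK (\<lambda>x. grad \<psi> x - G x)"
      using L2_norm_diff_triangle[OF smooth_grad_L2[OF *(1)] *(4) smooth_grad_L2[OF *(2)]]
      by (simp add: L2_norm_minus_commute[of _ G] grad_diff[OF *(1,2), abs_def])
    ultimately show "L2_norm (face_measure F) (\<lambda>x. \<phi> x - \<psi> x) \<le>
        c * ((L2_norm LK (\<lambda>x. \<phi> x - v x) + L2_norm LK (\<lambda>x. grad \<phi> x - G x)) +
             (L2_norm LK (\<lambda>x. \<psi> x - v x) + L2_norm LK (\<lambda>x. grad \<psi> x - G x)))"
      using order_trans[OF tr[OF smooth_diff[OF *(1,2)]]] mult_left_mono[OF _ c] by (smt (verit))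
  qed
qed

text \<open>The given sequence itself converges to the trace. This stronger conclusion allows one
  global sequence to determine the traces taken from several elements.\<close>

lemma is_face_traceI:
  assumes v: "v \<in> L2 LK" "is_weak_grad (interior K) v G" and F: "F facet_of K"
    and \<phi>: "\<And>k. smooth (\<phi> k)" "(\<lambda>k. L2_norm LK (\<lambda>x. \<phi> k x - v x)) \<longlonglongrightarrow> 0"
      "(\<lambda>k. L2_norm LK (\<lambda>x. grad (\<phi> k) x - G x)) \<longlonglongrightarrow> 0"
  shows "\<exists>g. is_face_trace K F v g \<and> (\<lambda>k. L2_norm (face_measure F) (\<lambda>x. \<phi> k x - g x)) \<longlonglongrightarrow> 0"
proof -
  obtain c where c: "0 \<le> c" and tr: "\<And>\<phi> \<psi> v G. smooth \<phi> \<Longrightarrow> smooth \<psi> \<Longrightarrow> v \<in> L2 LK \<Longrightarrow> G \<in> L2 LK \<Longrightarrow>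
      L2_norm (face_measure F) (\<lambda>x. \<phi> x - \<psi> x) \<le>
        c * ((L2_norm LK (\<lambda>x. \<phi> x - v x) + L2_norm LK (\<lambda>x. grad \<phi> x - G x)) +
             (L2_norm LK (\<lambda>x. \<psi> x - v x) + L2_norm LK (\<lambda>x. grad \<psi> x - G x)))"
    using F by (rule trace_diff_inequality) blast
  have GL2: "G \<in> L2 LK" using v(2) by (simp add: is_weak_grad_def)
  define A where "A k = L2_norm LK (\<lambda>x. \<phi> k x - v x) + L2_norm LK (\<lambda>x. grad (\<phi> k) x - G x)" for k
  have A: "A \<longlonglongrightarrow> 0" unfolding A_def using tendsto_add[OF \<phi>(2,3)] by simp
  have diff: "L2_norm (face_measure F) (\<lambda>x. \<phi> j x - \<phi> k x) \<le> c * (A j + A k)" for j k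
    unfolding A_def by (intro tr \<phi> v GL2)
  have "\<exists>g\<in>L2 (face_measure F). (\<lambda>k. L2_norm (face_measure F) (\<lambda>x. \<phi> k x - g x)) \<longlonglongrightarrow> 0"
  proof (rule L2_complete[OF facet_finite_measure[OF F] smooth_L2_facet[OF F \<phi>(1)]])
    fix e :: real assume e: "0 < e"
    \<comment> \<open>Dividing by \<open>c + 1\<close> instead of \<open>c\<close> covers the case
      \<open>c = 0\<close>.\<close>
    define d where "d = e / (c + 1)"
    have d: "0 < d" "(c + 1) * d = e" using e c by (auto simp: d_def)
    then have "0 < d / 2" by simp
    then obtain k0 where k0: "\<And>k. k \<ge> k0 \<Longrightarrow> norm (A k - 0) < d / 2"
      using LIMSEQ_D[OF A] by blast
    have "L2_norm (face_measure F) (\<lambda>x. \<phi> j x - \<phi> k x) < e" if "j \<ge> k0" "k \<ge> k0" for j k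
    proof -
      have "A j + A k < d" using k0[OF that(1)] k0[OF that(2)] by simp
      moreover have "0 \<le> A j + A k" by (simp add: A_def)
      ultimately have "(c + 1) * (A j + A k) < e" using c d(2) mult_strict_left_mono[of "A j + A k" d "c + 1"] by simp
      moreover have "c * (A j + A k) \<le> (c + 1) * (A j + A k)" using \<open>0 \<le> A j + A k\<close> by (intro mult_right_mono) auto
      ultimately show ?thesis using diff[of j k] by linarith
    qed
    then show "\<exists>k0. \<forall>j\<ge>k0. \<forall>k\<ge>k0. L2_norm (face_measure F) (\<lambda>x. \<phi> j x - \<phi> k x) < e" by blast
  qed
  then obtain g where g: "g \<in> L2 (face_measure F)" "(\<lambda>k. L2_norm (face_measure F) (\<lambda>x. \<phi> k x - g x)) \<longlonglongrightarrow> 0" by blast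
  have "AE x in LK. weak_grad (interior K) v x = G x"
    by (intro weak_grad_AE bounded_interior open_interior v)
  then have "L2_norm LK (\<lambda>x. grad (\<phi> k) x - weak_grad (interior K) v x) = L2_norm LK (\<lambda>x. grad (\<phi> k) x - G x)" for k
    by (intro L2_norm_lebesgue_on_AE_cong) auto
  then have "is_face_trace K F v g"
    unfolding is_face_trace_def using g \<phi> by (intro conjI exI[of _ \<phi>]) auto
  then show ?thesis using g by blast
qed

lemma face_trace_is_face_trace:
  assumes "H1_elem K v" "F facet_of K"
  shows "is_face_trace K F v (face_trace K F v)"
proof -
  obtain \<phi> where "\<And>k. smooth (\<phi> k)" "(\<lambda>k. L2_norm LK (\<lambda>x. \<phi> k x - v x)) \<longlonglongrightarrow> 0"
      "(\<lambda>k. L2_norm LK (\<lambda>x. grad (\<phi> k) x - weak_grad (interior K) v x)) \<longlonglongrightarrow> 0"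
    using assms(1) unfolding H1_elem_def by blast
  from is_face_traceI[OF H1_elem_L2[OF assms(1)] H1_elem_is_weak_grad[OF assms(1)] assms(2) this]
  obtain g where "is_face_trace K F v g" by blast
  then show ?thesis unfolding face_trace_def by (rule someI[of "is_face_trace K F v"])
qed

lemma face_trace_L2: "H1_elem K v \<Longrightarrow> F facet_of K \<Longrightarrow> face_trace K F v \<in> L2 (face_measure F)"
  using face_trace_is_face_trace[of v F] by (simp add: is_face_trace_def)

lemma is_face_trace_unique:
  assumes v: "H1_elem K v" and F: "F facet_of K" and g: "is_face_trace K F v g" "is_face_trace K F v g'"
  shows "AE x in face_measure F. g x = g' x"
proof -
  let ?G = "weak_grad (interior K) v"
  obtain c where c: "0 \<le> c" and tr: "\<And>\<phi> \<psi> v G. smooth \<phi> \<Longrightarrow> smooth \<psi> \<Longrightarrow> v \<in> L2 LK \<Longrightarrow> G \<in> L2 LK \<Longrightarrow>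
      L2_norm (face_measure F) (\<lambda>x. \<phi> x - \<psi> x) \<le>
        c * ((L2_norm LK (\<lambda>x. \<phi> x - v x) + L2_norm LK (\<lambda>x. grad \<phi> x - G x)) +
             (L2_norm LK (\<lambda>x. \<psi> x - v x) + L2_norm LK (\<lambda>x. grad \<psi> x - G x)))"
    using F by (rule trace_diff_inequality) blast
  obtain \<phi> where \<phi>: "\<And>k. smooth (\<phi> k)" "(\<lambda>k. L2_norm LK (\<lambda>x. \<phi> k x - v x)) \<longlonglongrightarrow> 0"
      "(\<lambda>k. L2_norm LK (\<lambda>x. grad (\<phi> k) x - ?G x)) \<longlonglongrightarrow> 0" "(\<lambda>k. L2_norm (face_measure F) (\<lambda>x. \<phi> k x - g x)) \<longlonglongrightarrow> 0"
    using g(1) unfolding is_face_trace_def by blast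
  obtain \<psi> where \<psi>: "\<And>k. smooth (\<psi> k)" "(\<lambda>k. L2_norm LK (\<lambda>x. \<psi> k x - v x)) \<longlonglongrightarrow> 0"
      "(\<lambda>k. L2_norm LK (\<lambda>x. grad (\<psi> k) x - ?G x)) \<longlonglongrightarrow> 0" "(\<lambda>k. L2_norm (face_measure F) (\<lambda>x. \<psi> k x - g' x)) \<longlonglongrightarrow> 0"
    using g(2) unfolding is_face_trace_def by blast
  have gL2: "g \<in> L2 (face_measure F)" "g' \<in> L2 (face_measure F)" using g by (auto simp: is_face_trace_def)
  have "(\<lambda>k. L2_norm (face_measure F) (\<lambda>x. \<phi> k x - g' x)) \<longlonglongrightarrow> 0"
  proof (rule Lim_null_comparison)
    let ?B = "\<lambda>k. c * ((L2_norm LK (\<lambda>x. \<phi> k x - v x) + L2_norm LK (\<lambda>x. grad (\<phi> k) x - ?G x)) +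
             (L2_norm LK (\<lambda>x. \<psi> k x - v x) + L2_norm LK (\<lambda>x. grad (\<psi> k) x - ?G x))) + L2_norm (face_measure F) (\<lambda>x. \<psi> k x - g' x)"
    have "L2_norm (face_measure F) (\<lambda>x. \<phi> k x - g' x) \<le> ?B k" for k
      using L2_norm_diff_triangle[OF smooth_L2_facet[OF F \<phi>(1)] smooth_L2_facet[OF F \<psi>(1)] gL2(2), of k k]
        tr[OF \<phi>(1)[of k] \<psi>(1)[of k] H1_elem_L2[OF v] H1_elem_weak_grad_L2[OF v]] by linarith
    then show "\<forall>\<^sub>F k in sequentially. norm (L2_norm (face_measure F) (\<lambda>x. \<phi> k x - g' x)) \<le> ?B k" by simp
    have "?B \<longlonglongrightarrow> c * ((0 + 0) + (0 + 0)) + 0"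
      by (intro tendsto_intros \<phi> \<psi>)
    then show "?B \<longlonglongrightarrow> 0" by simp
  qed
  then show ?thesis by (rule L2_limit_unique[OF smooth_L2_facet[OF F \<phi>(1)] gL2 \<phi>(4)])
qed

lemma face_trace_AE: "H1_elem K v \<Longrightarrow> F facet_of K \<Longrightarrow> is_face_trace K F v g \<Longrightarrow> AE x in face_measure F. face_trace K F v x = g x"
  by (rule is_face_trace_unique[OF _ _ face_trace_is_face_trace])

lemma smooth_face_trace:
  assumes \<phi>: "smooth \<phi>" and F: "F facet_of K"
  shows "AE x in face_measure F. face_trace K F \<phi> x = \<phi> x"
proof (rule face_trace_AE[OF smooth_H1_elem[OF \<phi>] F])
  have "L2_norm LK (\<lambda>x. grad \<phi> x - weak_grad (interior K) \<phi> x) = 0"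
    by (rule L2_norm_AE_0) (use smooth_weak_grad[OF \<phi>] in auto)
  then show "is_face_trace K F \<phi> \<phi>"
    unfolding is_face_trace_def using \<phi> smooth_L2_facet[OF F \<phi>]
    by (intro conjI exI[of _ "\<lambda>_. \<phi>"]) (auto simp: L2_norm_AE_0)
qed

lemma face_trace_lincomb:
  assumes v: "H1_elem K v" and w: "H1_elem K w" and F: "F facet_of K"
  shows "AE x in face_measure F. face_trace K F (\<lambda>x. a * v x + b * w x) x = a * face_trace K F v x + b * face_trace K F w x"
proof (rule face_trace_AE[OF H1_elem_lincomb[OF v w] F])
  let ?g = "face_trace K F v" and ?h = "face_trace K F w"
  obtain \<phi> where \<phi>: "\<And>k. smooth (\<phi> k)" "(\<lambda>k. L2_norm LK (\<lambda>x. \<phi> k x - v x)) \<longlonglongrightarrow> 0"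
      "(\<lambda>k. L2_norm LK (\<lambda>x. grad (\<phi> k) x - weak_grad (interior K) v x)) \<longlonglongrightarrow> 0"
      "(\<lambda>k. L2_norm (face_measure F) (\<lambda>x. \<phi> k x - ?g x)) \<longlonglongrightarrow> 0"
    using face_trace_is_face_trace[OF v F] unfolding is_face_trace_def by blast
  obtain \<psi> where \<psi>: "\<And>k. smooth (\<psi> k)" "(\<lambda>k. L2_norm LK (\<lambda>x. \<psi> k x - w x)) \<longlonglongrightarrow> 0"
      "(\<lambda>k. L2_norm LK (\<lambda>x. grad (\<psi> k) x - weak_grad (interior K) w x)) \<longlonglongrightarrow> 0"
      "(\<lambda>k. L2_norm (face_measure F) (\<lambda>x. \<psi> k x - ?h x)) \<longlonglongrightarrow> 0"
    using face_trace_is_face_trace[OF w F] unfolding is_face_trace_def by blast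
  show "is_face_trace K F (\<lambda>x. a * v x + b * w x) (\<lambda>x. a * ?g x + b * ?h x)"
    unfolding is_face_trace_def
  proof (intro conjI exI[of _ "\<lambda>k x. a * \<phi> k x + b * \<psi> k x"] allI)
    show "(\<lambda>x. a * ?g x + b * ?h x) \<in> L2 (face_measure F)"
      using L2_lincomb[OF face_trace_L2[OF v F] face_trace_L2[OF w F], of a b] by simp
    show "smooth (\<lambda>x. a * \<phi> k x + b * \<psi> k x)" for k by (intro smooth_lincomb \<phi> \<psi>)
    show "(\<lambda>k. L2_norm LK (\<lambda>x. (a * \<phi> k x + b * \<psi> k x) - (a * v x + b * w x))) \<longlonglongrightarrow> 0"
      using lincomb_limits[OF H1_elem_L2[OF v] H1_elem_L2[OF w] smooth_L2[OF \<phi>(1)] smooth_L2[OF \<psi>(1)] \<phi>(2) \<psi>(2), of a b]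
      by simp
    have "L2_norm LK (\<lambda>x. grad (\<lambda>x. a * \<phi> k x + b * \<psi> k x) x - weak_grad (interior K) (\<lambda>x. a * v x + b * w x) x) =
        L2_norm LK (\<lambda>x. (a *\<^sub>R grad (\<phi> k) x + b *\<^sub>R grad (\<psi> k) x) -
        (a *\<^sub>R weak_grad (interior K) v x + b *\<^sub>R weak_grad (interior K) w x))" for k
      unfolding grad_lincomb[OF \<phi>(1) \<psi>(1)]
      by (rule L2_norm_lebesgue_on_AE_cong) (use weak_grad_lincomb[OF v w, of a b] in auto)
    moreover have "(\<lambda>k. L2_norm LK (\<lambda>x. (a *\<^sub>R grad (\<phi> k) x + b *\<^sub>R grad (\<psi> k) x) -
        (a *\<^sub>R weak_grad (interior K) v x + b *\<^sub>R weak_grad (interior K) w x))) \<longlonglongrightarrow> 0"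
      by (intro lincomb_limits H1_elem_weak_grad_L2 v w smooth_grad_L2 \<phi> \<psi>)
    ultimately show "(\<lambda>k. L2_norm LK (\<lambda>x. grad (\<lambda>x. a * \<phi> k x + b * \<psi> k x) x -
        weak_grad (interior K) (\<lambda>x. a * v x + b * w x) x)) \<longlonglongrightarrow> 0" by simp
    show "(\<lambda>k. L2_norm (face_measure F) (\<lambda>x. (a * \<phi> k x + b * \<psi> k x) - (a * ?g x + b * ?h x))) \<longlonglongrightarrow> 0"
      using lincomb_limits[OF face_trace_L2[OF v F] face_trace_L2[OF w F] smooth_L2_facet[OF F \<phi>(1)] smooth_L2_facet[OF F \<psi>(1)] \<phi>(4) \<psi>(4), of a b]
      by simp
  qed
qed

text \<open>The identity for smooth functions passes to the limit: the volume terms by convergence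
  of the functions and their gradients, the facet terms because the same sequence converges to the
  trace.\<close>

lemma integration_by_parts:
  assumes v: "H1_elem K v" and \<psi>: "smooth \<psi>"
  shows "(\<integral>x. v x * grad \<psi> x $ i \<partial>LK) + (\<integral>x. weak_grad (interior K) v x $ i * \<psi> x \<partial>LK) =
    (\<Sum>F | F facet_of K. N F $ i * (\<integral>x. face_trace K F v x * \<psi> x \<partial>face_measure F))"
proof -
  let ?G = "weak_grad (interior K) v"
  obtain \<phi> where \<phi>: "\<And>k. smooth (\<phi> k)" "(\<lambda>k. L2_norm LK (\<lambda>x. \<phi> k x - v x)) \<longlonglongrightarrow> 0"
      "(\<lambda>k. L2_norm LK (\<lambda>x. grad (\<phi> k) x - ?G x)) \<longlonglongrightarrow> 0"
    using v unfolding H1_elem_def by blast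
  have tr: "(\<lambda>k. L2_norm (face_measure F) (\<lambda>x. \<phi> k x - face_trace K F v x)) \<longlonglongrightarrow> 0" if F: "F facet_of K" for F
  proof -
    obtain g where g: "is_face_trace K F v g" "(\<lambda>k. L2_norm (face_measure F) (\<lambda>x. \<phi> k x - g x)) \<longlonglongrightarrow> 0"
      using is_face_traceI[OF H1_elem_L2[OF v] H1_elem_is_weak_grad[OF v] F \<phi>] by blast
    have "L2_norm (face_measure F) (\<lambda>x. \<phi> k x - face_trace K F v x) = L2_norm (face_measure F) (\<lambda>x. \<phi> k x - g x)" for k
    proof (rule L2_norm_AE_cong)
      show "(\<lambda>x. \<phi> k x - face_trace K F v x) \<in> borel_measurable (face_measure F)"
        "(\<lambda>x. \<phi> k x - g x) \<in> borel_measurable (face_measure F)"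
        using g(1) smooth_L2_facet[OF F \<phi>(1)[of k]] face_trace_L2[OF v F]
        by (auto simp: is_face_trace_def intro!: L2_measurable L2_diff)
      show "AE x in face_measure F. \<phi> k x - face_trace K F v x = \<phi> k x - g x"
        using face_trace_AE[OF v F g(1)] by eventually_elim simp
    qed
    then show ?thesis using g(2) by simp
  qed
  have "(\<lambda>k. (\<integral>x. \<phi> k x * grad \<psi> x $ i \<partial>LK) + (\<integral>x. grad (\<phi> k) x $ i * \<psi> x \<partial>LK)) \<longlonglongrightarrow>
      (\<integral>x. v x * grad \<psi> x $ i \<partial>LK) + (\<integral>x. ?G x $ i * \<psi> x \<partial>LK)"
  proof (rule tendsto_add)
    show "(\<lambda>k. \<integral>x. \<phi> k x * grad \<psi> x $ i \<partial>LK) \<longlonglongrightarrow> (\<integral>x. v x * grad \<psi> x $ i \<partial>LK)"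
      using L2_inner_tendsto[OF smooth_L2[OF \<phi>(1)] H1_elem_L2[OF v] smooth_L2[OF smooth_grad_component[OF \<psi>]] \<phi>(2)] by simp
    have "(\<lambda>x. \<psi> x *\<^sub>R axis i 1 :: real^'n) \<in> L2 LK"
      by (intro continuous_L2_interior continuous_intros smooth_continuous \<psi>)
    from L2_inner_tendsto[OF smooth_grad_L2[OF \<phi>(1)] H1_elem_weak_grad_L2[OF v] this \<phi>(3)]
    show "(\<lambda>k. \<integral>x. grad (\<phi> k) x $ i * \<psi> x \<partial>LK) \<longlonglongrightarrow> (\<integral>x. ?G x $ i * \<psi> x \<partial>LK)"
      by (simp add: inner_axis mult.commute)
  qed
  moreover have "(\<lambda>k. \<Sum>F | F facet_of K. N F $ i * (\<integral>x. \<phi> k x * \<psi> x \<partial>face_measure F)) \<longlonglongrightarrow>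
      (\<Sum>F | F facet_of K. N F $ i * (\<integral>x. face_trace K F v x * \<psi> x \<partial>face_measure F))"
  proof (intro tendsto_sum tendsto_mult tendsto_const)
    fix F assume "F \<in> {F. F facet_of K}"
    then have F: "F facet_of K" by simp
    show "(\<lambda>k. \<integral>x. \<phi> k x * \<psi> x \<partial>face_measure F) \<longlonglongrightarrow> (\<integral>x. face_trace K F v x * \<psi> x \<partial>face_measure F)"
      using L2_inner_tendsto[OF smooth_L2_facet[OF F \<phi>(1)] face_trace_L2[OF v F] smooth_L2_facet[OF F \<psi>] tr[OF F]] by simp
  qed
  ultimately show ?thesis
    unfolding smooth_integration_by_parts[OF \<phi>(1) \<psi>] by (rule LIMSEQ_unique)
qed

end

section \<open>Faces of simplicial meshes\<close>

text \<open>Excludes slits and punctures. The elements cover only the closure of the domain, and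
  this property places their interiors in the domain itself. It holds because points strictly above
  a Lipschitz graph have neighbourhoods that miss the domain.\<close>

lemma lipschitz_boundary_regular_open:
  fixes U :: "(real^'n) set"
  assumes U: "open U" "lipschitz_boundary U"
  shows "interior (closure U) = U"
proof
  show "U \<subseteq> interior (closure U)" by (intro interior_maximal closure_subset U)
  show "interior (closure U) \<subseteq> U"
  proof (rule ccontr)
    assume "\<not> interior (closure U) \<subseteq> U"
    then obtain z where z: "z \<in> interior (closure U)" "z \<notin> U" by blast
    then have zU: "z \<in> frontier U"
      using interior_subset[of "closure U"] U(1) by (simp add: frontier_def interior_open subset_iff)
    obtain V e L \<psi> where V: "open V" "z \<in> V" and e: "norm e = 1" and \<psi>: "L-lipschitz_on UNIV \<psi>"
      and UV: "U \<inter> V = {x \<in> V. x \<bullet> e < \<psi> (x - (x \<bullet> e) *\<^sub>R e)}"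
      using bspec[OF U(2)[unfolded lipschitz_boundary_def] zU] by (elim exE conjE) (rule that; assumption)
    have "continuous_on UNIV (\<lambda>x. \<psi> (x - (x \<bullet> e) *\<^sub>R e))"
      by (rule continuous_on_compose2[OF lipschitz_on_continuous_on[OF \<psi>]]) (auto intro!: continuous_intros)
    then have cont: "continuous_on UNIV (\<lambda>x. x \<bullet> e - \<psi> (x - (x \<bullet> e) *\<^sub>R e))"
      by (intro continuous_on_diff continuous_on_inner continuous_on_id continuous_on_const)
    let ?W = "V \<inter> interior (closure U)"
    have "open ?W" "z \<in> ?W" using V z by auto
    then obtain r where r: "0 < r" "ball z r \<subseteq> ?W" by (meson open_contains_ball)
    let ?y = "z + (r/2) *\<^sub>R e"
    have y: "?y \<in> ?W" using r e by (intro subsetD[OF r(2)]) (simp add: dist_norm)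
    \<comment> \<open>Since \<open>z\<close> is not in \<open>U\<close>, it lies on or above the
      graph. Moving along \<open>e\<close> keeps the projection, so \<open>?y\<close> lies strictly
      above.\<close>
    have "z \<bullet> e \<ge> \<psi> (z - (z \<bullet> e) *\<^sub>R e)" using UV V(2) z(2) by fastforce
    then have gt: "?y \<bullet> e - \<psi> (?y - (?y \<bullet> e) *\<^sub>R e) > 0"
      using e r(1) by (simp add: inner_add_left dot_square_norm algebra_simps)
    let ?X = "{x. x \<bullet> e - \<psi> (x - (x \<bullet> e) *\<^sub>R e) > 0} \<inter> ?W"
    have "open ?X" by (rule open_Int[OF open_Collect_less[OF continuous_on_const cont] \<open>open ?W\<close>])
    moreover have "?X \<inter> U = {}"
    proof (rule equals0I)
      fix x assume x: "x \<in> ?X \<inter> U"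
      then have "x \<in> U \<inter> V" by blast
      then have "x \<bullet> e < \<psi> (x - (x \<bullet> e) *\<^sub>R e)" unfolding UV by simp
      moreover have "x \<bullet> e - \<psi> (x - (x \<bullet> e) *\<^sub>R e) > 0" using x by simp
      ultimately show False by simp
    qed
    ultimately have "?X \<inter> closure U = {}" by (simp add: open_Int_closure_eq_empty)
    moreover have "?y \<in> ?X" using gt y by simp
    moreover have "?y \<in> closure U" using y interior_subset by blast
    ultimately show False by blast
  qed
qed

locale mesh =
  fixes \<Omega> :: "(real^'n) set" and M :: "(real^'n) set set" and n :: "(real^'n) set \<Rightarrow> real^'n"
  assumes dim: "2 \<le> CARD('n)" and domain: "polyhedral_domain \<Omega>"
    and mesh: "simplicial_mesh \<Omega> M" and normal: "normal_field \<Omega> M n"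
begin

lemma open_\<Omega>: "open \<Omega>" and bounded_\<Omega>: "bounded \<Omega>"
  using domain by (auto simp: polyhedral_domain_def)

lemma lebesgue_\<Omega> [simp]: "\<Omega> \<in> sets lebesgue"
  using open_\<Omega> by simp

lemma finite_M: "finite M" and Union_M: "\<Union>M = closure \<Omega>"
  using mesh by (auto simp: simplicial_mesh_def triangulation_def)

lemma M_simplex: "K \<in> M \<Longrightarrow> int CARD('n) simplex K"
  using mesh by (auto simp: simplicial_mesh_def)

lemma M_Int_face: "K \<in> M \<Longrightarrow> K' \<in> M \<Longrightarrow> (K \<inter> K') face_of K"
  using mesh by (auto simp: simplicial_mesh_def triangulation_def)

lemma M_aff_dim: "K \<in> M \<Longrightarrow> aff_dim K = int CARD('n)"
  using M_simplex aff_dim_simplex by blast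

lemma M_convex: "K \<in> M \<Longrightarrow> convex K"
  using M_simplex by (auto simp: simplex_def)

lemma M_compact: "K \<in> M \<Longrightarrow> compact K"
proof -
  assume "K \<in> M"
  then obtain C where "finite C" "K = convex hull C" using M_simplex unfolding simplex by blast
  then show ?thesis by (simp add: finite_imp_compact_convex_hull)
qed

lemma interior_subset_\<Omega>: "K \<in> M \<Longrightarrow> interior K \<subseteq> \<Omega>"
proof -
  assume "K \<in> M"
  then have "interior K \<subseteq> interior (closure \<Omega>)" using Union_M by (intro interior_mono) blast
  then show ?thesis
    using lipschitz_boundary_regular_open[of \<Omega>] domain by (simp add: polyhedral_domain_def)
qed

lemma M_Int_eq:
  assumes "K \<in> M" "K' \<in> M" "K \<inter> K' = K" shows "K = K'"
proof (rule ccontr)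
  assume "K \<noteq> K'"
  have "K face_of K'" using M_Int_face[OF assms(2,1)] assms(3) by (simp add: Int_commute)
  then have "aff_dim K < aff_dim K'"
    using \<open>K \<noteq> K'\<close> M_convex[OF assms(2)] by (intro face_of_aff_dim_lt)
  then show False using M_aff_dim assms by simp
qed

lemma interiors_disjoint:
  assumes "K \<in> M" "K' \<in> M" "K \<noteq> K'" shows "interior K \<inter> interior K' = {}"
proof -
  have "(K \<inter> K') \<inter> interior K = {}"
    using M_Int_face[OF assms(1,2)] M_Int_eq[OF assms(1,2)] assms(3) by (intro face_of_disjoint_interior) auto
  then show ?thesis using interior_subset by blast
qed

text \<open>The intersection is a proper face of \<open>K\<close> that has the facet
  \<open>F\<close> as a face, and the dimensions leave no room for anything between \<open>F\<close>
  and \<open>K\<close>.\<close>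

lemma shared_facet:
  assumes K: "K \<in> M" "K' \<in> M" "K \<noteq> K'" and F: "F facet_of K" "F \<subseteq> K'"
  shows "K \<inter> K' = F"
proof (rule ccontr)
  assume ne: "K \<inter> K' \<noteq> F"
  have FK: "F \<subseteq> K" using F(1) by (rule facet_of_imp_subset)
  have lt: "aff_dim (K \<inter> K') < aff_dim K"
    using M_Int_eq[OF K(1,2)] K by (intro face_of_aff_dim_lt M_convex M_Int_face) auto
  have "F face_of (K \<inter> K')"
    using F FK by (intro face_of_subset[OF facet_of_imp_face_of[OF F(1)]]) auto
  then have "aff_dim F < aff_dim (K \<inter> K')"
    using ne M_convex K by (intro face_of_aff_dim_lt convex_Int) auto
  then show False using lt F(1) by (simp add: facet_of_def)
qed

lemma shared_facet_interior_face:
  assumes K: "K \<in> M" "K' \<in> M" "K \<noteq> K'" and F: "F facet_of K" "F \<subseteq> K'"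
  shows "F facet_of K'" "F \<in> interior_faces M"
proof -
  have eq: "K \<inter> K' = F" by (rule shared_facet[OF assms])
  have "F face_of K'" using M_Int_face[OF K(2,1)] eq by (simp add: Int_commute)
  then show F': "F facet_of K'"
    using F(1) M_aff_dim K by (simp add: facet_of_def)
  show "F \<in> interior_faces M" unfolding interior_faces_def using K F F' eq by blast
qed

section \<open>Orientation of faces relative to their elements\<close>

lemma interior_faces_subset: "interior_faces M \<subseteq> faces M"
  by (auto simp: interior_faces_def faces_def)

lemma n_face:
  assumes "F \<in> faces M"
  shows norm_n: "norm (n F) = 1" and n_orthogonal: "x \<in> F \<Longrightarrow> y \<in> F \<Longrightarrow> n F \<bullet> (y - x) = 0"
  using normal assms by (auto simp: normal_field_def)

lemma n_neq_uminus: "F \<in> faces M \<Longrightarrow> n F \<noteq> - n F"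
proof
  assume F: "F \<in> faces M" and "n F = - n F"
  from arg_cong[OF this(2), of "\<lambda>x. n F \<bullet> x"] have "n F \<bullet> n F = - (n F \<bullet> n F)" by simp
  then show False using norm_n[OF F] by (simp add: dot_square_norm)
qed

definition outer :: "(real^'n) set \<Rightarrow> (real^'n) set \<Rightarrow> real^'n" where
  "outer K F = (if points_outside K F (n F) then n F else - n F)"

text \<open>All vertices of \<open>K\<close> but one lie in the hyperplane of \<open>F\<close>, so
  the side of the remaining vertex decides.\<close>

lemma one_sided:
  assumes K: "K \<in> M" and F: "F facet_of K"
  shows "points_outside K F (n F) \<or> points_outside K F (- n F)"
proof -
  have FM: "F \<in> faces M" using K F by (auto simp: faces_def)
  obtain C where C: "\<not> affine_dependent C" "int (card C) = int CARD('n) + 1" and KC: "K = convex hull C"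
    using M_simplex[OF K] by (auto simp: simplex_def)
  have cC: "card C = CARD('n) + 1" using C(2) by linarith
  obtain b where b: "b \<in> C" "F = convex hull (C - {b})"
    using simplex_facets[OF C(1) cC] F KC by (auto simp: bij_betw_def image_iff)
  have "F \<noteq> {}" using F by (simp add: facet_of_def)
  then obtain x0 where x0: "x0 \<in> F" by blast
  have Fc: "n F \<bullet> x = n F \<bullet> x0" if "x \<in> F" for x
    using n_orthogonal[OF FM x0 that] by (simp add: inner_diff_right)
  have CF: "C \<subseteq> insert b F" unfolding b(2) by (auto intro: hull_inc)
  show ?thesis
  proof (cases "n F \<bullet> b \<le> n F \<bullet> x0")
    case True
    have "C \<subseteq> {x. n F \<bullet> x \<le> n F \<bullet> x0}" using CF Fc True by (auto simp: order_eq_refl)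
    then have "K \<subseteq> {x. n F \<bullet> x \<le> n F \<bullet> x0}" unfolding KC by (intro hull_minimal convex_halfspace_le)
    then have "points_outside K F (n F)" using Fc by (auto simp: points_outside_def inner_diff_right)
    then show ?thesis ..
  next
    case False
    have "C \<subseteq> {x. n F \<bullet> x \<ge> n F \<bullet> x0}" using CF Fc False by (auto simp: order_eq_refl)
    then have "K \<subseteq> {x. n F \<bullet> x \<ge> n F \<bullet> x0}" unfolding KC by (intro hull_minimal convex_halfspace_ge)
    then have "points_outside K F (- n F)" using Fc by (auto simp: points_outside_def inner_diff_right)
    then show ?thesis ..
  qed
qed

lemma outer_normals: "K \<in> M \<Longrightarrow> outward_normals K (outer K)"
  unfolding outward_normals_def
proof (intro allI impI)
  fix F assume K: "K \<in> M" and F: "F facet_of K"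
  have FM: "F \<in> faces M" using K F by (auto simp: faces_def)
  show "norm (outer K F) = 1 \<and> (\<forall>x\<in>F. \<forall>y\<in>F. outer K F \<bullet> (y - x) = 0) \<and> points_outside K F (outer K F)"
    using one_sided[OF K F] norm_n[OF FM] n_orthogonal[OF FM] by (auto simp: outer_def)
qed

lemma element: "K \<in> M \<Longrightarrow> simplex_element K (outer K)"
  by (simp add: simplex_element_def M_simplex outer_normals)

text \<open>The vertex opposite to \<open>F\<close> has positive height, so the element is not
  contained in the hyperplane of its facet.\<close>

lemma not_two_sided:
  assumes K: "K \<in> M" and F: "F facet_of K" and that: "e = n F \<or> e = - n F"
  shows "\<not> (points_outside K F e \<and> points_outside K F (- e))"
proof -
  interpret simplex_element K "outer K" using K by (rule element)
  obtain b c h where b: "K = convex hull insert b F" "F \<noteq> {}" "affine hull F = {x. outer K F \<bullet> x = c}"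
    "outer K F \<bullet> b = c - h" "0 < h"
    using F by (rule facet_geometry) blast
  obtain x where x: "x \<in> F" using b(2) by blast
  then have "outer K F \<bullet> x = c" using b(3) hull_inc[OF x, of affine] by blast
  moreover have "b \<in> K" unfolding b(1) by (simp add: hull_inc)
  ultimately have "\<not> points_outside K F (- outer K F)"
  proof -
    have "- outer K F \<bullet> (b - x) = h" using \<open>outer K F \<bullet> x = c\<close> b(4) by (simp add: inner_diff_right)
    then show ?thesis using b(5) x \<open>b \<in> K\<close> unfolding points_outside_def by (metis not_le)
  qed
  then show ?thesis using that by (auto simp: outer_def split: if_splits)
qed

text \<open>Close to a relative interior point of a facet the element fills one side. The shifted
  point is a convex combination of the opposite vertex \<open>b\<close> and a point \<open>y\<close>
  of the hyperplane that is still so close to \<open>x\<close> that it belongs to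
  \<open>F\<close>.\<close>

lemma below_facet:
  assumes K: "K \<in> M" and F: "F facet_of K" and x: "x \<in> rel_interior F"
  obtains \<epsilon> where "0 < \<epsilon>" "\<And>\<delta>. 0 < \<delta> \<Longrightarrow> \<delta> < \<epsilon> \<Longrightarrow> x - \<delta> *\<^sub>R outer K F \<in> K"
proof -
  interpret simplex_element K "outer K" using K by (rule element)
  let ?N = "outer K F"
  obtain b c h where b: "K = convex hull insert b F" "norm ?N = 1" "affine hull F = {x. ?N \<bullet> x = c}"
    "?N \<bullet> b = c - h" "0 < h"
    using F by (rule facet_geometry) blast
  obtain e where e: "0 < e" "ball x e \<inter> affine hull F \<subseteq> F" and xF: "x \<in> F"
    using x by (auto simp: mem_rel_interior_ball)
  have xc: "?N \<bullet> x = c" using b(3) hull_inc[OF xF, of affine] by blast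
  \<comment> \<open>The component of \<open>b - x\<close> parallel to the facet.\<close>
  define w where "w = b - x + h *\<^sub>R ?N"
  have Nw: "?N \<bullet> w = 0" using b(2,4) xc by (simp add: w_def inner_add_right inner_diff_right dot_square_norm)
  \<comment> \<open>Keeps the weight \<open>s = \<delta> / h\<close> of the vertex below 1/2, hence
    \<open>s / (1 - s) \<le> 2 * s\<close>, and keeps \<open>y\<close> within distance
    \<open>e\<close> of \<open>x\<close>. The added 1 covers \<open>w = 0\<close>.\<close>
  define \<epsilon> where "\<epsilon> = h * min (1/2) (e / (2 * (norm w + 1)))"
  have "0 < e / (2 * (norm w + 1))" using e(1) by (intro divide_pos_pos) (auto simp: add_nonneg_pos)
  then have \<epsilon>: "0 < \<epsilon>" unfolding \<epsilon>_def using b(5) by (intro mult_pos_pos) auto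
  have "x - \<delta> *\<^sub>R ?N \<in> K" if \<delta>: "0 < \<delta>" "\<delta> < \<epsilon>" for \<delta>
  proof -
    define s where "s = \<delta> / h"
    have s: "0 < s" "s < 1/2" "s < e / (2 * (norm w + 1))"
    proof -
      have "s < min (1/2) (e / (2 * (norm w + 1)))"
        using \<delta>(2) b(5) unfolding s_def \<epsilon>_def by (simp only: pos_divide_less_eq mult.commute)
      then show "s < 1/2" "s < e / (2 * (norm w + 1))" by simp_all
      show "0 < s" using \<delta>(1) b(5) by (simp add: s_def)
    qed
    define y where "y = x - (s / (1 - s)) *\<^sub>R w"
    have "s / (1 - s) \<le> 2 * s" using s by (simp add: field_simps)
    then have "(s / (1 - s)) * norm w \<le> 2 * s * (norm w + 1)"
      using s by (intro mult_mono) auto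
    moreover have "norm ((s / (1 - s)) *\<^sub>R w) = (s / (1 - s)) * norm w" using s by simp
    ultimately have "norm ((s / (1 - s)) *\<^sub>R w) \<le> 2 * s * (norm w + 1)" by linarith
    also have "\<dots> < e" using s(3) by (simp add: field_simps add_pos_nonneg)
    finally have "y \<in> ball x e" by (simp add: y_def dist_norm)
    moreover have "y \<in> affine hull F" using b(3) xc Nw by (simp add: y_def inner_diff_right)
    ultimately have "y \<in> K" using e(2) b(1) by (auto intro: hull_inc)
    moreover have "b \<in> K" unfolding b(1) by (simp add: hull_inc)
    ultimately have "s *\<^sub>R b + (1 - s) *\<^sub>R y \<in> K"
      using convexD[OF convex_K] s by simp
    also have "s *\<^sub>R b + (1 - s) *\<^sub>R y = x - \<delta> *\<^sub>R ?N"
    proof -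
      have "(1 - s) *\<^sub>R y = (1 - s) *\<^sub>R x - s *\<^sub>R w" using s by (simp add: y_def scaleR_diff_right)
      moreover have "s *\<^sub>R b = s *\<^sub>R x + s *\<^sub>R w - \<delta> *\<^sub>R ?N"
        using b(5) by (simp add: w_def s_def algebra_simps)
      ultimately show ?thesis by (simp add: algebra_simps)
    qed
    finally show ?thesis .
  qed
  then show ?thesis using \<epsilon> that by blast
qed

lemma facet_rel_interior:
  assumes "K \<in> M" "F facet_of K"
  shows "rel_interior F \<noteq> {}" "F \<subseteq> closure (rel_interior F)"
proof -
  have "convex F" "F \<noteq> {}"
    using assms M_convex by (auto simp: facet_of_def face_of_imp_convex)
  then show "rel_interior F \<noteq> {}" "F \<subseteq> closure (rel_interior F)"
    using convex_closure_rel_interior[of F] closure_subset[of F] by (auto simp: rel_interior_eq_empty)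
qed

text \<open>If both elements lay on the same side, they would share points just below a relative
  interior point of \<open>F\<close>, although their intersection is \<open>F\<close>.\<close>

lemma opposite_sides:
  assumes K: "K \<in> M" "K' \<in> M" "K \<noteq> K'" and F: "F facet_of K" "F facet_of K'"
  shows "outer K' F = - outer K F"
proof (rule ccontr)
  assume "outer K' F \<noteq> - outer K F"
  then have same: "outer K' F = outer K F" by (auto simp: outer_def split: if_splits)
  have FM: "F \<in> faces M" using K F by (auto simp: faces_def)
  obtain x where x: "x \<in> rel_interior F" using facet_rel_interior[OF K(1) F(1)] by blast
  then have xF: "x \<in> F" using rel_interior_subset by blast
  obtain \<epsilon> where \<epsilon>: "0 < \<epsilon>" "\<And>\<delta>. 0 < \<delta> \<Longrightarrow> \<delta> < \<epsilon> \<Longrightarrow> x - \<delta> *\<^sub>R outer K F \<in> K"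
    using below_facet[OF K(1) F(1) x] by blast
  obtain \<epsilon>' where \<epsilon>': "0 < \<epsilon>'" "\<And>\<delta>. 0 < \<delta> \<Longrightarrow> \<delta> < \<epsilon>' \<Longrightarrow> x - \<delta> *\<^sub>R outer K' F \<in> K'"
    using below_facet[OF K(2) F(2) x] by blast
  define \<delta> where "\<delta> = min \<epsilon> \<epsilon>' / 2"
  have \<delta>: "0 < \<delta>" "\<delta> < \<epsilon>" "\<delta> < \<epsilon>'" using \<epsilon>(1) \<epsilon>'(1) by (auto simp: \<delta>_def)
  have "x - \<delta> *\<^sub>R outer K F \<in> K \<inter> K'" using \<epsilon>(2)[OF \<delta>(1,2)] \<epsilon>'(2)[OF \<delta>(1,3)] same by simp
  also have "K \<inter> K' = F" using K F facet_of_imp_subset by (intro shared_facet) auto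
  finally have "n F \<bullet> (\<delta> *\<^sub>R outer K F) = 0" using n_orthogonal[OF FM xF] by fastforce
  then have "\<delta> * (norm (n F))\<^sup>2 = 0" by (auto simp: outer_def power2_norm_eq_inner split: if_splits)
  then show False using \<delta>(1) norm_n[OF FM] by simp
qed

text \<open>Suppose a relative interior point of \<open>F\<close> lies in the domain. Nearby points
  on the far side of \<open>F\<close> are covered by the other elements; these are finitely many
  closed sets, so one of them contains the point itself and then all of \<open>F\<close>, which
  makes \<open>F\<close> an interior face.\<close>

lemma boundary_face_disjoint:
  assumes F: "F \<in> faces M" "F \<notin> interior_faces M"
  shows "F \<inter> \<Omega> = {}"
proof -
  obtain K where K: "K \<in> M" "F facet_of K" using F(1) by (auto simp: faces_def)
  have "rel_interior F \<inter> \<Omega> = {}"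
  proof (rule ccontr)
    assume "rel_interior F \<inter> \<Omega> \<noteq> {}"
    then obtain x where x: "x \<in> rel_interior F" "x \<in> \<Omega>" by blast
    then have xF: "x \<in> F" using rel_interior_subset by blast
    let ?N = "outer K F"
    have N1: "norm ?N = 1" and out: "points_outside K F ?N"
      using outer_normals[OF K(1)] K(2) by (auto simp: outward_normals_def)
    let ?R = "\<Union>(M - {K})"
    obtain r where r: "0 < r" "ball x r \<subseteq> \<Omega>" using open_\<Omega> x(2) by (meson open_contains_ball)
    have inR: "x + \<delta> *\<^sub>R ?N \<in> ?R" if \<delta>: "0 < \<delta>" "\<delta> < r" for \<delta>
    proof -
      have "x + \<delta> *\<^sub>R ?N \<in> \<Omega>" using \<delta> N1 by (intro subsetD[OF r(2)]) (simp add: dist_norm)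
      then have "x + \<delta> *\<^sub>R ?N \<in> \<Union>M" unfolding Union_M using closure_subset by blast
      moreover have "x + \<delta> *\<^sub>R ?N \<notin> K"
      proof
        assume "x + \<delta> *\<^sub>R ?N \<in> K"
        then have "?N \<bullet> (x + \<delta> *\<^sub>R ?N - x) \<le> 0" using out xF unfolding points_outside_def by blast
        then show False using \<delta> N1 by (simp add: dot_square_norm)
      qed
      ultimately show ?thesis by blast
    qed
    have cl: "closed ?R" using finite_M M_compact by (intro closed_Union) (auto simp: compact_imp_closed)
    \<comment> \<open>The denominators start at 2, so every step is strictly shorter than
      \<open>r\<close>.\<close>
    have lim: "(\<lambda>k. x + (r / real (Suc (Suc k))) *\<^sub>R ?N) \<longlonglongrightarrow> x + 0 *\<^sub>R ?N"
    proof (intro tendsto_intros)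
      have "(\<lambda>k. r * inverse (real (Suc (Suc k)))) \<longlonglongrightarrow> r * 0"
        by (intro tendsto_mult tendsto_const LIMSEQ_Suc[OF LIMSEQ_inverse_real_of_nat])
      then show "(\<lambda>k. r / real (Suc (Suc k))) \<longlonglongrightarrow> 0" by (simp add: divide_inverse)
    qed
    have mem: "x + (r / real (Suc (Suc k))) *\<^sub>R ?N \<in> ?R" for k
    proof (rule inR)
      show "0 < r / real (Suc (Suc k))" using r(1) by simp
      have "0 < r + r * real k" using r(1) by (intro add_pos_nonneg) auto
      then show "r / real (Suc (Suc k)) < r" by (simp add: divide_less_eq algebra_simps)
    qed
    have "x + 0 *\<^sub>R ?N \<in> ?R" by (rule closed_sequentially[OF cl mem lim])
    then obtain K' where K': "K' \<in> M" "K' \<noteq> K" "x \<in> K'" by auto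
    have FK: "F \<subseteq> K" using K(2) by (rule facet_of_imp_subset)
    have "F \<subseteq> K \<inter> K'"
    proof (rule subset_of_face_of[OF M_Int_face[OF K(1) K'(1)] FK])
      show "K \<inter> K' \<inter> rel_interior F \<noteq> {}" using x(1) K'(3) xF FK by blast
    qed
    then have "F \<in> interior_faces M" using shared_facet_interior_face(2)[OF K(1) K'(1) K'(2)[symmetric] K(2)] by blast
    then show False using F(2) by simp
  qed
  \<comment> \<open>An open set that misses the relative interior also misses its closure, which
    contains \<open>F\<close>.\<close>
  then have "closure (rel_interior F) \<inter> \<Omega> = {}"
    using open_Int_closure_eq_empty[OF open_\<Omega>, of "rel_interior F"] by blast
  then show ?thesis using facet_rel_interior(2)[OF K] by blast
qed

section \<open>The elements on the two sides of a face\<close>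

abbreviation "front F \<equiv> element_behind M F (n F)"
abbreviation "back F \<equiv> element_behind M F (- n F)"

lemma element_behind_eq:
  assumes K: "K \<in> M" "F facet_of K" "points_outside K F e" and e: "e = n F \<or> e = - n F"
  shows "element_behind M F e = K"
  unfolding element_behind_def
proof (rule the_equality)
  show "K \<in> M \<and> F facet_of K \<and> points_outside K F e" using K by simp
  fix K' assume K': "K' \<in> M \<and> F facet_of K' \<and> points_outside K' F e"
  have FM: "F \<in> faces M" using K by (auto simp: faces_def)
  have "outer K F = e" "outer K' F = e"
    using not_two_sided[OF K(1,2) e] not_two_sided[of K' F e] K K' e by (auto simp: outer_def)
  moreover have "e \<noteq> - e" using n_neq_uminus[OF FM] e by auto
  ultimately show "K' = K" using opposite_sides[of K K' F] K K' by auto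
qed

text \<open>Such a face lies in the frontier of the domain, where \<open>normal_field\<close>
  prescribes the outward orientation; a second element containing it would make it an interior
  face.\<close>

lemma boundary_face_front:
  assumes F: "F \<in> faces M" "F \<notin> interior_faces M"
  shows "{K \<in> M. F facet_of K} = {front F}" "outer (front F) F = n F"
proof -
  obtain K where K: "K \<in> M" "F facet_of K" using F(1) by (auto simp: faces_def)
  have "F \<subseteq> closure \<Omega>" using K facet_of_imp_subset Union_M by blast
  then have "F \<subseteq> frontier \<Omega>"
    using boundary_face_disjoint[OF F] open_\<Omega> by (auto simp: frontier_def interior_open)
  then have out: "points_outside K F (n F)" using normal F(1) K by (auto simp: normal_field_def)
  then have front: "front F = K" using K by (intro element_behind_eq) auto
  then show "outer (front F) F = n F" using out by (simp add: outer_def)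
  have "K' = K" if "K' \<in> M" "F facet_of K'" for K'
    using shared_facet_interior_face(2)[OF K(1) that(1) _ K(2) facet_of_imp_subset[OF that(2)]] F(2) by blast
  then show "{K \<in> M. F facet_of K} = {front F}" unfolding front using K by blast
qed

lemma interior_face_front_back:
  assumes F: "F \<in> interior_faces M"
  shows "{K \<in> M. F facet_of K} = {front F, back F}" "front F \<noteq> back F"
    "outer (front F) F = n F" "outer (back F) F = - n F"
proof -
  obtain K1 K2 where K: "K1 \<in> M" "K2 \<in> M" "K1 \<noteq> K2" "F facet_of K1" "F facet_of K2"
    using F by (auto simp: interior_faces_def)
  have FM: "F \<in> faces M" using K by (auto simp: faces_def)
  have ne: "n F \<noteq> - n F" using FM by (rule n_neq_uminus)
  have *: "\<exists>Ka Kb. Ka \<in> M \<and> Kb \<in> M \<and> Ka \<noteq> Kb \<and> F facet_of Ka \<and> F facet_of Kb \<and> outer Ka F = n F \<and> outer Kb F = - n F"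
  proof (cases "outer K1 F = n F")
    case True
    then show ?thesis using K opposite_sides[OF K] by auto
  next
    case False
    then have "outer K1 F = - n F" by (auto simp: outer_def)
    then show ?thesis using K opposite_sides[OF K] by auto
  qed
  then obtain Ka Kb where K: "Ka \<in> M" "Kb \<in> M" "Ka \<noteq> Kb" "F facet_of Ka" "F facet_of Kb"
    and o: "outer Ka F = n F" "outer Kb F = - n F" by blast
  have "points_outside Ka F (n F)" "points_outside Kb F (- n F)"
    using outer_normals[OF K(1)] outer_normals[OF K(2)] K o by (auto simp: outward_normals_def)
  then have fb: "front F = Ka" "back F = Kb" using K element_behind_eq[OF K(1,4), of "n F"] element_behind_eq[OF K(2,5), of "- n F"] by blast+
  then show "front F \<noteq> back F" "outer (front F) F = n F" "outer (back F) F = - n F" using K o by auto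
  have "K' = Ka \<or> K' = Kb" if K': "K' \<in> M" "F facet_of K'" for K'
  proof (rule ccontr)
    assume "\<not> ?thesis"
    then have "outer K' F = - n F" "outer K' F = n F"
      using opposite_sides[of Ka K' F] opposite_sides[of Kb K' F] K K' o by auto
    then show False using ne by simp
  qed
  then show "{K \<in> M. F facet_of K} = {front F, back F}" unfolding fb using K by blast
qed

lemma front_facet: "F \<in> faces M \<Longrightarrow> front F \<in> M \<and> F facet_of (front F)"
  using boundary_face_front(1) interior_face_front_back(1) by blast

lemma back_facet: "F \<in> interior_faces M \<Longrightarrow> back F \<in> M \<and> F facet_of (back F)"
  using interior_face_front_back(1) by blast

lemma finite_faces: "finite (faces M)"
proof -
  have "faces M = (\<Union>K\<in>M. {F. F facet_of K})" by (auto simp: faces_def)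
  then show ?thesis using finite_M simplex_element.finite_facets[OF element] by auto
qed

text \<open>Regroups the boundary terms of elementwise integration by parts according to
  faces.\<close>

lemma sum_element_facets:
  fixes g :: "(real^'n) set \<Rightarrow> (real^'n) set \<Rightarrow> real"
  shows "(\<Sum>K\<in>M. \<Sum>F | F facet_of K. g K F) =
    (\<Sum>F\<in>faces M. if F \<in> interior_faces M then g (front F) F + g (back F) F else g (front F) F)"
proof -
  have "(\<Sum>K\<in>M. \<Sum>F | F facet_of K. g K F) = (\<Sum>K\<in>M. \<Sum>F | F \<in> faces M \<and> F facet_of K. g K F)"
    by (intro sum.cong refl) (auto simp: faces_def)
  also have "\<dots> = (\<Sum>F\<in>faces M. \<Sum>K | K \<in> M \<and> F facet_of K. g K F)"
    by (rule sum.swap_restrict[OF finite_M finite_faces])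
  also have "\<dots> = (\<Sum>F\<in>faces M. if F \<in> interior_faces M then g (front F) F + g (back F) F else g (front F) F)"
    using boundary_face_front(1) interior_face_front_back(1,2) by (intro sum.cong refl) auto
  finally show ?thesis .
qed

end

section \<open>Broken Sobolev functions\<close>

lemma L2_lebesgue_on_subset:
  fixes f :: "real^'n \<Rightarrow> 'b::euclidean_space"
  assumes S: "S \<in> sets lebesgue" "T \<in> sets lebesgue" "S \<subseteq> T" and f: "f \<in> L2 (lebesgue_on T)"
  shows "f \<in> L2 (lebesgue_on S)" "L2_norm (lebesgue_on S) f \<le> L2_norm (lebesgue_on T) f"
proof -
  have m: "f \<in> borel_measurable (lebesgue_on S)"
    using L2_measurable[OF f] S(3) by (rule measurable_restrict_mono)
  have i: "integrable lebesgue (\<lambda>x. indicator T x *\<^sub>R (norm (f x))\<^sup>2)"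
    using L2_integrable_sq[OF f] S(2) by (simp add: integrable_restrict_space)
  have eq: "indicator S x *\<^sub>R (indicator T x *\<^sub>R (norm (f x))\<^sup>2) = indicator S x *\<^sub>R (norm (f x))\<^sup>2" for x
    using S(3) by (auto split: split_indicator)
  have i': "integrable lebesgue (\<lambda>x. indicator S x *\<^sub>R (norm (f x))\<^sup>2)"
    using integrable_mult_indicator[OF S(1) i] unfolding eq .
  then show "f \<in> L2 (lebesgue_on S)" using m S(1) by (intro L2I) (simp_all add: integrable_restrict_space)
  have "(\<integral>x. indicator S x *\<^sub>R (norm (f x))\<^sup>2 \<partial>lebesgue) \<le> (\<integral>x. indicator T x *\<^sub>R (norm (f x))\<^sup>2 \<partial>lebesgue)"
    using S(3) by (intro integral_mono i i') (auto split: split_indicator)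
  then show "L2_norm (lebesgue_on S) f \<le> L2_norm (lebesgue_on T) f"
    unfolding L2_norm_def using S by (simp add: integral_restrict_space)
qed

lemma test_functions_grad_outside:
  fixes \<phi> :: "real^'n \<Rightarrow> real"
  assumes \<phi>: "\<phi> \<in> test_functions U" and x: "x \<notin> U"
  shows "grad \<phi> x = 0"
proof -
  let ?S = "- closure {x. \<phi> x \<noteq> 0}"
  have xS: "x \<in> ?S" using \<phi> x by (auto simp: test_functions_def)
  have "(\<phi> has_derivative (\<lambda>h. 0)) (at x)"
  proof (rule has_derivative_transform_within_open[OF has_derivative_const])
    show "open ?S" by (intro open_Compl closed_closure)
    show "0 = \<phi> y" if "y \<in> ?S" for y
    proof -
      have "y \<notin> {x. \<phi> x \<noteq> 0}" using that closure_subset[of "{x. \<phi> x \<noteq> 0}"] by (meson ComplD subsetD)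
      then show ?thesis by simp
    qed
  qed (fact xS)
  from grad_unique[OF this] show ?thesis by (simp add: vec_eq_iff)
qed

text \<open>Test functions of the smaller set are test functions of the larger one. They and their
  gradients vanish outside the smaller set, the gradients because the support is closed and
  contained in it.\<close>

lemma is_weak_grad_subset:
  fixes G :: "real^'n \<Rightarrow> real^'n"
  assumes U: "open U" "open V" "U \<subseteq> V" and G: "is_weak_grad V v G"
  shows "is_weak_grad U v G"
  unfolding is_weak_grad_def
proof (intro conjI ballI allI)
  show "G \<in> L2 (lebesgue_on U)"
    using G U by (intro L2_lebesgue_on_subset(1)[of U V]) (auto simp: is_weak_grad_def)
  fix \<phi> i assume \<phi>: "\<phi> \<in> test_functions U"
  then have \<phi>V: "\<phi> \<in> test_functions V" using U(3) by (auto simp: test_functions_def)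
  have *: "(\<integral>x. g x \<partial>lebesgue_on V) = (\<integral>x. g x \<partial>lebesgue_on U)" if "\<And>x. x \<notin> U \<Longrightarrow> g x = 0" for g :: "real^'n \<Rightarrow> real"
  proof -
    have "(\<lambda>x. indicator V x *\<^sub>R g x) = (\<lambda>x. indicator U x *\<^sub>R g x)"
      using that U(3) by (intro ext) (auto split: split_indicator)
    moreover have "U \<inter> space lebesgue \<in> sets lebesgue" "V \<inter> space lebesgue \<in> sets lebesgue" using U by auto
    ultimately show ?thesis by (simp only: integral_restrict_space)
  qed
  have "(\<integral>x. v x * grad \<phi> x $ i \<partial>lebesgue_on V) = - (\<integral>x. G x $ i * \<phi> x \<partial>lebesgue_on V)"
    using G \<phi>V by (simp add: is_weak_grad_def)
  then show "(\<integral>x. v x * grad \<phi> x $ i \<partial>lebesgue_on U) = - (\<integral>x. G x $ i * \<phi> x \<partial>lebesgue_on U)"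
    using test_functions_grad_outside[OF \<phi>] test_functionsD(2)[OF \<phi>]
    by (simp add: *[of "\<lambda>x. v x * grad \<phi> x $ i"] *[of "\<lambda>x. G x $ i * \<phi> x"])
qed

context mesh
begin

abbreviation "L\<Omega> \<equiv> lebesgue_on \<Omega>"
abbreviation "LI K \<equiv> lebesgue_on (interior K)"

lemma AE_element_interior: "K \<in> M \<Longrightarrow> AE x in lebesgue. x \<in> K \<longleftrightarrow> x \<in> interior K"
  using simplex_element.AE_interior[OF element] .

text \<open>Frontiers of convex sets are negligible and there are finitely many elements, so
  integrals over the domain may be split over element interiors.\<close>

lemma AE_\<Omega>_iff: "AE x in lebesgue. x \<in> \<Omega> \<longleftrightarrow> (\<exists>K\<in>M. x \<in> interior K)"
proof -
  have "AE x in lebesgue. \<forall>K\<in>M. x \<in> K \<longleftrightarrow> x \<in> interior K"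
    using AE_element_interior finite_M by (intro AE_finite_allI) auto
  then show ?thesis
  proof eventually_elim
    case (elim x)
    have "\<exists>K\<in>M. x \<in> interior K" if "x \<in> \<Omega>"
    proof -
      have "x \<in> \<Union>M" using that closure_subset Union_M by blast
      then show ?thesis using elim by blast
    qed
    then show ?case using interior_subset_\<Omega> by blast
  qed
qed

lemma AE_\<Omega>I:
  assumes "\<And>K. K \<in> M \<Longrightarrow> AE x in LI K. P x"
  shows "AE x in L\<Omega>. P x"
proof -
  have "AE x in lebesgue. \<forall>K\<in>M. x \<in> interior K \<longrightarrow> P x"
    using assms finite_M by (intro AE_finite_allI) (auto simp: AE_restrict_space_iff)
  then have "AE x in lebesgue. x \<in> \<Omega> \<longrightarrow> P x" using AE_\<Omega>_iff by eventually_elim blast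
  then show ?thesis by (simp add: AE_restrict_space_iff)
qed

lemma AE_\<Omega>D:
  assumes "AE x in L\<Omega>. P x" "K \<in> M"
  shows "AE x in LI K. P x"
proof -
  have "AE x in lebesgue. x \<in> \<Omega> \<longrightarrow> P x" using assms(1) by (simp add: AE_restrict_space_iff)
  then have "AE x in lebesgue. x \<in> interior K \<longrightarrow> P x"
    by eventually_elim (use interior_subset_\<Omega>[OF assms(2)] in blast)
  then show ?thesis by (simp add: AE_restrict_space_iff)
qed

lemma indicator_Union_interior:
  fixes f :: "real^'n \<Rightarrow> 'b::real_vector"
  shows "indicator (\<Union>K\<in>M. interior K) x *\<^sub>R f x = (\<Sum>K\<in>M. indicator (interior K) x *\<^sub>R f x)"
proof (cases "\<exists>K\<in>M. x \<in> interior K")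
  case True
  then obtain K where K: "K \<in> M" "x \<in> interior K" by blast
  have "(\<Sum>K'\<in>M. indicator (interior K') x *\<^sub>R f x) = (\<Sum>K'\<in>M. if K' = K then f x else 0)"
    using interiors_disjoint[OF K(1)] K by (intro sum.cong refl) (auto split: split_indicator)
  then show ?thesis using K finite_M by (auto simp: sum.delta split: split_indicator)
qed (auto intro!: sum.neutral[symmetric])

lemma
  fixes f :: "real^'n \<Rightarrow> 'b::euclidean_space"
  shows measurable_mesh: "(\<And>K. K \<in> M \<Longrightarrow> f \<in> borel_measurable (LI K)) \<Longrightarrow> f \<in> borel_measurable L\<Omega>"
    and integrable_mesh: "(\<And>K. K \<in> M \<Longrightarrow> integrable (LI K) f) \<Longrightarrow> integrable L\<Omega> f"
    and integral_mesh: "(\<And>K. K \<in> M \<Longrightarrow> integrable (LI K) f) \<Longrightarrow> (\<integral>x. f x \<partial>L\<Omega>) = (\<Sum>K\<in>M. \<integral>x. f x \<partial>LI K)"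
proof -
  let ?T = "\<Union>K\<in>M. interior K"
  have "open ?T" by blast
  then have T: "?T \<in> sets lebesgue" by simp
  have ae: "AE x in lebesgue. (x \<in> \<Omega> \<longleftrightarrow> x \<in> ?T) \<and> (x \<in> \<Omega> \<longrightarrow> f x = f x)"
    using AE_\<Omega>_iff by eventually_elim auto
  note change = lebesgue_null_change[OF lebesgue_\<Omega> T ae]
  show "f \<in> borel_measurable L\<Omega>" if "\<And>K. K \<in> M \<Longrightarrow> f \<in> borel_measurable (LI K)"
    unfolding change(1) using T that
    by (simp add: borel_measurable_restrict_space_iff indicator_Union_interior)
  show "integrable L\<Omega> f" if "\<And>K. K \<in> M \<Longrightarrow> integrable (LI K) f"
    unfolding change(2) using T that
    by (simp add: integrable_restrict_space indicator_Union_interior)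
  show "(\<integral>x. f x \<partial>L\<Omega>) = (\<Sum>K\<in>M. \<integral>x. f x \<partial>LI K)" if "\<And>K. K \<in> M \<Longrightarrow> integrable (LI K) f"
    unfolding change(3) using T that
    by (simp add: integral_restrict_space integrable_restrict_space indicator_Union_interior)
qed

lemma L2_mesh:
  fixes f :: "real^'n \<Rightarrow> 'b::euclidean_space"
  assumes "\<And>K. K \<in> M \<Longrightarrow> f \<in> L2 (LI K)"
  shows "f \<in> L2 L\<Omega>"
  using assms by (intro L2I measurable_mesh integrable_mesh) (auto simp: L2_def)

lemma L2_\<Omega>_element:
  fixes f :: "real^'n \<Rightarrow> 'b::euclidean_space"
  assumes "f \<in> L2 L\<Omega>" "K \<in> M"
  shows "f \<in> L2 (LI K)" "L2_norm (LI K) f \<le> L2_norm L\<Omega> f"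
  using L2_lebesgue_on_subset[of "interior K" \<Omega> f] interior_subset_\<Omega>[OF assms(2)] assms(1) by auto

section \<open>Sobolev functions with zero boundary values and their traces\<close>

lemma H10_D:
  assumes "u \<in> H10 \<Omega>"
  shows "u \<in> L2 L\<Omega>" "is_weak_grad \<Omega> u (weak_grad \<Omega> u)" "weak_grad \<Omega> u \<in> L2 L\<Omega>"
proof -
  show "u \<in> L2 L\<Omega>" using assms by (simp add: H10_def H1_def)
  obtain G where "is_weak_grad \<Omega> u G" using assms by (auto simp: H10_def H1_def)
  then show "is_weak_grad \<Omega> u (weak_grad \<Omega> u)" by (rule is_weak_grad_weak_grad)
  then show "weak_grad \<Omega> u \<in> L2 L\<Omega>" by (simp add: is_weak_grad_def)
qed

lemma H10_element_weak_grad: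
  assumes u: "u \<in> H10 \<Omega>" and K: "K \<in> M"
  shows "is_weak_grad (interior K) u (weak_grad \<Omega> u)"
  using is_weak_grad_subset[OF open_interior open_\<Omega> interior_subset_\<Omega>[OF K] H10_D(2)[OF u]] .

lemma H10_approximation:
  assumes u: "u \<in> H10 \<Omega>"
  obtains \<phi> where "\<And>k. \<phi> k \<in> test_functions \<Omega>"
    "\<And>K. K \<in> M \<Longrightarrow> (\<lambda>k. L2_norm (LI K) (\<lambda>x. \<phi> k x - u x)) \<longlonglongrightarrow> 0"
    "\<And>K. K \<in> M \<Longrightarrow> (\<lambda>k. L2_norm (LI K) (\<lambda>x. grad (\<phi> k) x - weak_grad \<Omega> u x)) \<longlonglongrightarrow> 0"
proof -
  obtain \<phi> where \<phi>: "\<And>k. \<phi> k \<in> test_functions \<Omega>"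
    "(\<lambda>k. L2_norm L\<Omega> (\<lambda>x. \<phi> k x - u x)) \<longlonglongrightarrow> 0"
    "(\<lambda>k. L2_norm L\<Omega> (\<lambda>x. grad (\<phi> k) x - weak_grad \<Omega> u x)) \<longlonglongrightarrow> 0"
    using u unfolding H10_def by blast
  have sm: "smooth (\<phi> k)" for k using \<phi>(1) by (rule test_functionsD)
  have L2: "\<phi> k \<in> L2 L\<Omega>" "grad (\<phi> k) \<in> L2 L\<Omega>" for k
    by (intro continuous_L2 bounded_\<Omega> lebesgue_\<Omega> smooth_continuous smooth_grad_continuous sm)+
  show ?thesis
  proof (rule that[OF \<phi>(1)])
    fix K assume K: "K \<in> M"
    show "(\<lambda>k. L2_norm (LI K) (\<lambda>x. \<phi> k x - u x)) \<longlonglongrightarrow> 0"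
      by (rule Lim_null_comparison[OF _ \<phi>(2)])
         (use L2_\<Omega>_element(2)[OF L2_diff[OF L2(1) H10_D(1)[OF u]] K] in simp)
    show "(\<lambda>k. L2_norm (LI K) (\<lambda>x. grad (\<phi> k) x - weak_grad \<Omega> u x)) \<longlonglongrightarrow> 0"
      by (rule Lim_null_comparison[OF _ \<phi>(3)])
         (use L2_\<Omega>_element(2)[OF L2_diff[OF L2(2) H10_D(3)[OF u]] K] in simp)
  qed
qed

lemma H10_H1_elem:
  assumes u: "u \<in> H10 \<Omega>" and K: "K \<in> M"
  shows "H1_elem K u"
proof -
  interpret simplex_element K "outer K" using K by (rule element)
  obtain \<phi> where \<phi>: "\<And>k. \<phi> k \<in> test_functions \<Omega>"
    "\<And>K. K \<in> M \<Longrightarrow> (\<lambda>k. L2_norm (LI K) (\<lambda>x. \<phi> k x - u x)) \<longlonglongrightarrow> 0"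
    "\<And>K. K \<in> M \<Longrightarrow> (\<lambda>k. L2_norm (LI K) (\<lambda>x. grad (\<phi> k) x - weak_grad \<Omega> u x)) \<longlonglongrightarrow> 0"
    using u by (rule H10_approximation) blast
  show ?thesis
    by (rule H1_elemI[OF L2_\<Omega>_element(1)[OF H10_D(1)[OF u] K] H10_element_weak_grad[OF u K] test_functionsD(1)[OF \<phi>(1)] \<phi>(2,3)[OF K]])
qed

text \<open>One sequence of global test functions approximates on all elements simultaneously, so
  its restrictions to a face converge to the traces from both sides. Equality of these traces on
  interior faces and their vanishing on the boundary both follow from this.\<close>

lemma H10_face_trace_common:
  assumes u: "u \<in> H10 \<Omega>"
  obtains \<phi> where "\<And>k. \<phi> k \<in> test_functions \<Omega>"
    "\<And>K F. K \<in> M \<Longrightarrow> F facet_of K \<Longrightarrow> (\<lambda>k. L2_norm (face_measure F) (\<lambda>x. \<phi> k x - face_trace K F u x)) \<longlonglongrightarrow> 0"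
proof -
  obtain \<phi> where \<phi>: "\<And>k. \<phi> k \<in> test_functions \<Omega>"
    "\<And>K. K \<in> M \<Longrightarrow> (\<lambda>k. L2_norm (LI K) (\<lambda>x. \<phi> k x - u x)) \<longlonglongrightarrow> 0"
    "\<And>K. K \<in> M \<Longrightarrow> (\<lambda>k. L2_norm (LI K) (\<lambda>x. grad (\<phi> k) x - weak_grad \<Omega> u x)) \<longlonglongrightarrow> 0"
    using u by (rule H10_approximation) blast
  have sm: "smooth (\<phi> k)" for k using \<phi>(1) by (rule test_functionsD)
  show ?thesis
  proof (rule that[OF \<phi>(1)])
    fix K F assume K: "K \<in> M" and F: "F facet_of K"
    interpret simplex_element K "outer K" using K by (rule element)
    have v: "H1_elem K u" by (rule H10_H1_elem[OF u K])
    obtain g where g: "is_face_trace K F u g" "(\<lambda>k. L2_norm (face_measure F) (\<lambda>x. \<phi> k x - g x)) \<longlonglongrightarrow> 0"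
      using is_face_traceI[OF H1_elem_L2[OF v] H10_element_weak_grad[OF u K] F sm \<phi>(2,3)[OF K]] by blast
    have "L2_norm (face_measure F) (\<lambda>x. \<phi> k x - face_trace K F u x) = L2_norm (face_measure F) (\<lambda>x. \<phi> k x - g x)" for k
    proof (rule L2_norm_AE_cong)
      show "(\<lambda>x. \<phi> k x - face_trace K F u x) \<in> borel_measurable (face_measure F)"
        "(\<lambda>x. \<phi> k x - g x) \<in> borel_measurable (face_measure F)"
        using g(1) smooth_L2_facet[OF F sm[of k]] face_trace_L2[OF v F]
        by (auto simp: is_face_trace_def intro!: L2_measurable L2_diff)
      show "AE x in face_measure F. \<phi> k x - face_trace K F u x = \<phi> k x - g x"
        using face_trace_AE[OF v F g(1)] by eventually_elim simp
    qed
    then show "(\<lambda>k. L2_norm (face_measure F) (\<lambda>x. \<phi> k x - face_trace K F u x)) \<longlonglongrightarrow> 0" using g(2) by simp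
  qed
qed

lemma H10_face_trace_eq:
  assumes u: "u \<in> H10 \<Omega>" and K: "K \<in> M" "K' \<in> M" and F: "F facet_of K" "F facet_of K'"
  shows "AE x in face_measure F. face_trace K F u x = face_trace K' F u x"
proof -
  interpret K: simplex_element K "outer K" using K(1) by (rule element)
  interpret K': simplex_element K' "outer K'" using K(2) by (rule element)
  obtain \<phi> where \<phi>: "\<And>k. \<phi> k \<in> test_functions \<Omega>"
    "\<And>K F. K \<in> M \<Longrightarrow> F facet_of K \<Longrightarrow> (\<lambda>k. L2_norm (face_measure F) (\<lambda>x. \<phi> k x - face_trace K F u x)) \<longlonglongrightarrow> 0"
    using u by (rule H10_face_trace_common) blast
  show ?thesis
    by (rule L2_limit_unique[OF K.smooth_L2_facet[OF F(1) test_functionsD(1)[OF \<phi>(1)]]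
        K.face_trace_L2[OF H10_H1_elem[OF u K(1)] F(1)] K'.face_trace_L2[OF H10_H1_elem[OF u K(2)] F(2)]
        \<phi>(2)[OF K(1) F(1)] \<phi>(2)[OF K(2) F(2)]])
qed

lemma H10_boundary_trace:
  assumes u: "u \<in> H10 \<Omega>" and F: "F \<in> faces M" "F \<notin> interior_faces M" and K: "K \<in> M" "F facet_of K"
  shows "AE x in face_measure F. face_trace K F u x = 0"
proof -
  interpret K: simplex_element K "outer K" using K(1) by (rule element)
  obtain \<phi> where \<phi>: "\<And>k. \<phi> k \<in> test_functions \<Omega>"
    "\<And>K F. K \<in> M \<Longrightarrow> F facet_of K \<Longrightarrow> (\<lambda>k. L2_norm (face_measure F) (\<lambda>x. \<phi> k x - face_trace K F u x)) \<longlonglongrightarrow> 0"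
    using u by (rule H10_face_trace_common) blast
  have "L2_norm (face_measure F) (\<lambda>x. \<phi> k x - 0) = 0" for k
  proof (rule L2_norm_AE_0)
    show "AE x in face_measure F. \<phi> k x - 0 = 0"
      using K.facet_AE[OF K(2)]
    proof eventually_elim
      case (elim x)
      then have "x \<notin> \<Omega>" using boundary_face_disjoint[OF F] by blast
      then show ?case using test_functionsD(2)[OF \<phi>(1)] by simp
    qed
  qed
  then have "(\<lambda>k. L2_norm (face_measure F) (\<lambda>x. \<phi> k x - 0)) \<longlonglongrightarrow> 0" by simp
  then show ?thesis
    by (rule L2_limit_unique[OF K.smooth_L2_facet[OF K(2) test_functionsD(1)[OF \<phi>(1)]]
        K.face_trace_L2[OF H10_H1_elem[OF u K(1)] K(2)] L2_zero \<phi>(2)[OF K]])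
qed

section \<open>Elementwise Sobolev functions, their jumps and averages\<close>

definition broken_H1 :: "(real^'n \<Rightarrow> real) \<Rightarrow> bool" where
  "broken_H1 v \<longleftrightarrow> (\<forall>K\<in>M. H1_elem K v)"

lemma broken_H1_elem: "broken_H1 v \<Longrightarrow> K \<in> M \<Longrightarrow> H1_elem K v"
  by (simp add: broken_H1_def)

lemma H10_broken_H1: "u \<in> H10 \<Omega> \<Longrightarrow> broken_H1 u"
  by (simp add: broken_H1_def H10_H1_elem)

lemma broken_H1_lincomb: "broken_H1 v \<Longrightarrow> broken_H1 w \<Longrightarrow> broken_H1 (\<lambda>x. a * v x + b * w x)"
  unfolding broken_H1_def using simplex_element.H1_elem_lincomb[OF element] by blast

lemma broken_H1_L2: "broken_H1 v \<Longrightarrow> v \<in> L2 L\<Omega>"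
  by (intro L2_mesh H1_elem_L2 broken_H1_elem)

lemma broken_grad_eq:
  assumes "K \<in> M" "x \<in> interior K"
  shows "broken_grad M v x = weak_grad (interior K) v x"
proof -
  have "(THE K. K \<in> M \<and> x \<in> interior K) = K"
    by (rule the_equality) (use assms interiors_disjoint in blast)+
  then show ?thesis using assms by (auto simp: broken_grad_def)
qed

lemma broken_grad_AE: "K \<in> M \<Longrightarrow> AE x in LI K. broken_grad M v x = weak_grad (interior K) v x"
  by (intro AE_I2) (simp add: broken_grad_eq)

lemma broken_grad_L2: "broken_H1 v \<Longrightarrow> broken_grad M v \<in> L2 L\<Omega>"
proof (rule L2_mesh)
  fix K assume "broken_H1 v" and K: "K \<in> M"
  then have "weak_grad (interior K) v \<in> L2 (LI K)" by (intro H1_elem_weak_grad_L2 broken_H1_elem)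
  then show "broken_grad M v \<in> L2 (LI K)"
    using L2_lebesgue_on_AE_cong[OF _ broken_grad_AE[OF K, of v]] by simp
qed

lemma broken_grad_lincomb:
  assumes "broken_H1 v" "broken_H1 w"
  shows "AE x in L\<Omega>. broken_grad M (\<lambda>x. a * v x + b * w x) x = a *\<^sub>R broken_grad M v x + b *\<^sub>R broken_grad M w x"
proof (rule AE_\<Omega>I)
  fix K assume K: "K \<in> M"
  show "AE x in LI K. broken_grad M (\<lambda>x. a * v x + b * w x) x = a *\<^sub>R broken_grad M v x + b *\<^sub>R broken_grad M w x"
    using simplex_element.weak_grad_lincomb[OF element[OF K], of v w a b] assms K
      broken_grad_AE[OF K, of v] broken_grad_AE[OF K, of w] broken_grad_AE[OF K, of "\<lambda>x. a * v x + b * w x"]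
    by (auto simp: broken_H1_elem elim!: eventually_elim2[rotated])
qed

lemma broken_grad_AE_cong:
  assumes "AE x in L\<Omega>. v x = w x"
  shows "broken_grad M v = broken_grad M w"
proof
  fix x
  show "broken_grad M v x = broken_grad M w x"
  proof (cases "\<exists>K\<in>M. x \<in> interior K")
    case True
    then obtain K where K: "K \<in> M" "x \<in> interior K" by blast
    then show ?thesis using weak_grad_AE_cong[OF open_interior AE_\<Omega>D[OF assms K(1)]] by (simp add: broken_grad_eq)
  qed (simp add: broken_grad_def)
qed

lemma H10_broken_grad:
  assumes "u \<in> H10 \<Omega>"
  shows "AE x in L\<Omega>. broken_grad M u x = weak_grad \<Omega> u x"
proof (rule AE_\<Omega>I)
  fix K assume K: "K \<in> M"
  have "AE x in LI K. weak_grad (interior K) u x = weak_grad \<Omega> u x"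
    by (intro weak_grad_AE H10_element_weak_grad assms K open_interior simplex_element.bounded_interior[OF element])
  then show "AE x in LI K. broken_grad M u x = weak_grad \<Omega> u x"
    using broken_grad_AE[OF K, of u] by eventually_elim simp
qed

lemma front_trace_L2: "broken_H1 v \<Longrightarrow> F \<in> faces M \<Longrightarrow> face_trace (front F) F v \<in> L2 (face_measure F)"
  using simplex_element.face_trace_L2[OF element] front_facet broken_H1_elem by blast

lemma back_trace_L2: "broken_H1 v \<Longrightarrow> F \<in> interior_faces M \<Longrightarrow> face_trace (back F) F v \<in> L2 (face_measure F)"
  using simplex_element.face_trace_L2[OF element] back_facet broken_H1_elem by blast

lemma jump_L2: "broken_H1 v \<Longrightarrow> F \<in> faces M \<Longrightarrow> jump M n v F \<in> L2 (face_measure F)"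
  using L2_diff[OF front_trace_L2 back_trace_L2, of v F v] front_trace_L2[of v F]
  by (cases "F \<in> interior_faces M") (simp_all add: jump_def[abs_def])

lemma average_L2: "broken_H1 v \<Longrightarrow> F \<in> faces M \<Longrightarrow> average M n v F \<in> L2 (face_measure F)"
  using L2_lincomb[OF front_trace_L2 back_trace_L2, of v F v "1/2" "1/2"] front_trace_L2[of v F]
  by (cases "F \<in> interior_faces M") (simp_all add: average_def[abs_def] add_divide_distrib)

lemma front_trace_lincomb:
  assumes "broken_H1 v" "broken_H1 w" "F \<in> faces M"
  shows "AE x in face_measure F. face_trace (front F) F (\<lambda>x. a * v x + b * w x) x =
    a * face_trace (front F) F v x + b * face_trace (front F) F w x"
  using simplex_element.face_trace_lincomb[OF element] front_facet[OF assms(3)] broken_H1_elem assms by blast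

lemma back_trace_lincomb:
  assumes "broken_H1 v" "broken_H1 w" "F \<in> interior_faces M"
  shows "AE x in face_measure F. face_trace (back F) F (\<lambda>x. a * v x + b * w x) x =
    a * face_trace (back F) F v x + b * face_trace (back F) F w x"
  using simplex_element.face_trace_lincomb[OF element] back_facet[OF assms(3)] broken_H1_elem assms by blast

lemma jump_lincomb:
  assumes v: "broken_H1 v" "broken_H1 w" and F: "F \<in> faces M"
  shows "AE x in face_measure F. jump M n (\<lambda>x. a * v x + b * w x) F x = a * jump M n v F x + b * jump M n w F x"
proof (cases "F \<in> interior_faces M")
  case True
  show ?thesis
    using front_trace_lincomb[OF v F, of a b] back_trace_lincomb[OF v True, of a b]
    by eventually_elim (simp add: jump_def True algebra_simps)
next
  case False
  then show ?thesis using front_trace_lincomb[OF v F, of a b] by (simp add: jump_def)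
qed

lemma jump_AE_cong:
  assumes ae: "AE x in L\<Omega>. v x = w x" and F: "F \<in> faces M"
  shows "jump M n v F = jump M n w F"
proof -
  have "face_trace (front F) F v = face_trace (front F) F w"
    using front_facet[OF F] by (intro face_trace_AE_cong AE_\<Omega>D[OF ae]) auto
  moreover have "face_trace (back F) F v = face_trace (back F) F w" if "F \<in> interior_faces M"
    using back_facet[OF that] by (intro face_trace_AE_cong AE_\<Omega>D[OF ae]) auto
  ultimately show ?thesis by (auto simp: jump_def fun_eq_iff)
qed

lemma H10_jump:
  assumes u: "u \<in> H10 \<Omega>" and F: "F \<in> faces M"
  shows "AE x in face_measure F. jump M n u F x = 0"
proof (cases "F \<in> interior_faces M")
  case True
  then have "AE x in face_measure F. face_trace (front F) F u x = face_trace (back F) F u x"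
    using front_facet[OF F] back_facet by (intro H10_face_trace_eq[OF u]) auto
  then show ?thesis using True by (simp add: jump_def)
next
  case False
  then have "AE x in face_measure F. face_trace (front F) F u x = 0"
    using front_facet[OF F] by (intro H10_boundary_trace[OF u F]) auto
  then show ?thesis using False by (simp add: jump_def)
qed

section \<open>Piecewise polynomials\<close>

lemma dG_space_polys:
  assumes "v \<in> dG_space M k"
  obtains P where "\<And>K. K \<in> M \<Longrightarrow> P K \<in> polys k" "\<And>K. K \<in> M \<Longrightarrow> AE x in lebesgue_on K. v x = P K x"
    "\<And>K. K \<in> M \<Longrightarrow> AE x in LI K. v x = P K x"
proof -
  obtain P where P: "\<And>K. K \<in> M \<Longrightarrow> P K \<in> polys k" "\<And>K. K \<in> M \<Longrightarrow> AE x in lebesgue_on K. v x = P K x"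
  proof -
    have "\<forall>K\<in>M. \<exists>P. P \<in> polys k \<and> (AE x in lebesgue_on K. v x = P x)"
      using assms unfolding dG_space_def by blast
    from bchoice[OF this] show ?thesis using that by blast
  qed
  have "AE x in LI K. v x = P K x" if K: "K \<in> M" for K
  proof -
    have "AE x in lebesgue. x \<in> K \<longrightarrow> v x = P K x"
      using P(2)[OF K] M_compact[OF K] by (simp add: AE_restrict_space_iff compact_imp_closed)
    then have "AE x in lebesgue. x \<in> interior K \<longrightarrow> v x = P K x"
      by eventually_elim (use interior_subset in blast)
    then show ?thesis by (simp add: AE_restrict_space_iff)
  qed
  from that[OF P this] show ?thesis .
qed

lemma dG_spaceI:
  assumes "\<And>K. K \<in> M \<Longrightarrow> P K \<in> polys k" "\<And>K. K \<in> M \<Longrightarrow> AE x in LI K. v x = P K x"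
  shows "v \<in> dG_space M k"
  unfolding dG_space_def
proof (intro CollectI ballI bexI[rotated])
  fix K assume K: "K \<in> M"
  show "P K \<in> polys k" by (rule assms(1)[OF K])
  have "AE x in lebesgue. x \<in> interior K \<longrightarrow> v x = P K x" using assms(2)[OF K] by (simp add: AE_restrict_space_iff)
  then have "AE x in lebesgue. x \<in> K \<longrightarrow> v x = P K x"
    using AE_element_interior[OF K] by eventually_elim simp
  then show "AE x in lebesgue_on K. v x = P K x"
    using M_compact[OF K] by (simp add: AE_restrict_space_iff compact_imp_closed)
qed

lemma dG_broken_H1: "v \<in> dG_space M k \<Longrightarrow> broken_H1 v"
proof -
  assume "v \<in> dG_space M k"
  then obtain P where P: "\<And>K. K \<in> M \<Longrightarrow> P K \<in> polys k" "\<And>K. K \<in> M \<Longrightarrow> AE x in LI K. v x = P K x"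
    by (rule dG_space_polys) blast
  then show ?thesis
    unfolding broken_H1_def
    using H1_elem_AE_cong simplex_element.smooth_H1_elem[OF element] polys_smooth by blast
qed

lemma dG_space_lincomb:
  assumes "v \<in> dG_space M k" "w \<in> dG_space M k"
  shows "(\<lambda>x. a * v x + b * w x) \<in> dG_space M k"
proof -
  obtain P where P: "\<And>K. K \<in> M \<Longrightarrow> P K \<in> polys k" "\<And>K. K \<in> M \<Longrightarrow> AE x in LI K. v x = P K x"
    using assms(1) by (rule dG_space_polys) blast
  obtain Q where Q: "\<And>K. K \<in> M \<Longrightarrow> Q K \<in> polys k" "\<And>K. K \<in> M \<Longrightarrow> AE x in LI K. w x = Q K x"
    using assms(2) by (rule dG_space_polys) blast
  show ?thesis
  proof (rule dG_spaceI)
    show "(\<lambda>x. a * P K x + b * Q K x) \<in> polys k" if "K \<in> M" for K using that P Q by (intro polys_lincomb)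
    show "AE x in LI K. a * v x + b * w x = a * P K x + b * Q K x" if "K \<in> M" for K
      using P(2)[OF that] Q(2)[OF that] by eventually_elim simp
  qed
qed

lemma dG_space_mono: "v \<in> dG_space M k \<Longrightarrow> k \<le> m \<Longrightarrow> v \<in> dG_space M m"
  unfolding dG_space_def using polys_mono by blast

lemma dG_broken_grad:
  assumes "v \<in> dG_space M k"
  shows "(\<lambda>x. broken_grad M v x $ i) \<in> dG_space M (k - 1)"
proof -
  obtain P where P: "\<And>K. K \<in> M \<Longrightarrow> P K \<in> polys k" "\<And>K. K \<in> M \<Longrightarrow> AE x in LI K. v x = P K x"
    using assms(1) by (rule dG_space_polys) blast
  show ?thesis
  proof (rule dG_spaceI)
    show "(\<lambda>x. grad (P K) x $ i) \<in> polys (k - 1)" if "K \<in> M" for K using that P by (intro grad_polys)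
    show "AE x in LI K. broken_grad M v x $ i = grad (P K) x $ i" if K: "K \<in> M" for K
      using simplex_element.smooth_weak_grad[OF element[OF K] polys_smooth[OF P(1)[OF K]]] broken_grad_AE[OF K, of v]
      unfolding weak_grad_AE_cong[OF open_interior P(2)[OF K]] by eventually_elim simp
  qed
qed

lemma smooth_elem_face_trace:
  assumes K: "K \<in> M" and F: "F facet_of K" and P: "smooth P" "AE x in LI K. v x = P x"
  shows "AE x in face_measure F. face_trace K F v x = P x"
  unfolding face_trace_AE_cong[OF P(2)]
  by (rule simplex_element.smooth_face_trace[OF element[OF K] P(1) F])

end

section \<open>Integration by parts and the smoothing operator\<close>

lemma powD: "v \<in> pow X \<Longrightarrow> (\<lambda>x. v x $ i) \<in> X"
  by (simp add: pow_def)

text \<open>Fields with one nonzero component extract scalar moments from the vectorial moment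
  conditions.\<close>

lemma single_component_pow:
  assumes "P \<in> polys k"
  shows "(\<lambda>x. axis j (P x)) \<in> pow (polys k)"
  unfolding pow_def
proof (intro CollectI allI)
  fix i show "(\<lambda>x. axis j (P x) $ i) \<in> polys k"
    using assms polys_zero by (cases "i = j") (auto simp: axis_def)
qed

lemma inner_axis_mult: "(x :: real^'n) \<bullet> axis j c = x $ j * c"
  by (simp add: inner_axis)

lemma matrix_vector_inner:
  fixes A :: "real^'n^'n"
  shows "(A *v e) \<bullet> z = (\<Sum>j\<in>UNIV. \<Sum>i\<in>UNIV. e $ i * (A $ j $ i * z $ j))"
  by (simp add: inner_vec_def matrix_vector_mult_def sum_distrib_left sum_distrib_right mult_ac)

lemma matrix_inner:
  fixes A B :: "real^'n^'n"
  shows "A \<bullet> B = (\<Sum>j\<in>UNIV. \<Sum>i\<in>UNIV. A $ j $ i * B $ j $ i)"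
  by (simp add: inner_vec_def)

context mesh
begin

text \<open>On an interior face, the two elements contribute the product rule
  \<open>q1 y1 - q2 y2 = {{q}} [[y]] + [[q]] {{y}}\<close>. The terms are arranged so that on the
  right \<open>y\<close> enters only through integrals over elements and through averages on
  interior faces, which are the quantities controlled by the moment conditions.\<close>

lemma broken_integration_by_parts:
  assumes y: "broken_H1 y" and P: "\<And>K. K \<in> M \<Longrightarrow> smooth (P K)" and q: "\<And>K. K \<in> M \<Longrightarrow> AE x in LI K. q x = P K x"
  shows "(\<integral>x. q x * broken_grad M y x $ i \<partial>L\<Omega>)
      - (\<Sum>F\<in>faces M. n F $ i * (\<integral>x. average M n q F x * jump M n y F x \<partial>face_measure F)) =
    - (\<Sum>K\<in>M. \<integral>x. y x * grad (P K) x $ i \<partial>LI K)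
      + (\<Sum>F\<in>interior_faces M. n F $ i * (\<integral>x. (P (front F) x - P (back F) x) * average M n y F x \<partial>face_measure F))"
proof -
  have q1: "broken_H1 q"
    unfolding broken_H1_def using q P H1_elem_AE_cong simplex_element.smooth_H1_elem[OF element] by blast
  have vol: "(\<integral>x. q x * broken_grad M y x $ i \<partial>L\<Omega>) = (\<Sum>K\<in>M. \<integral>x. weak_grad (interior K) y x $ i * P K x \<partial>LI K)"
  proof -
    have "(\<integral>x. q x * broken_grad M y x $ i \<partial>L\<Omega>) = (\<Sum>K\<in>M. \<integral>x. q x * broken_grad M y x $ i \<partial>LI K)"
      using L2_\<Omega>_element(1)[OF broken_grad_L2[OF y]] H1_elem_L2 q1
      by (intro integral_mesh L2_integrable_mult L2_component) (auto simp: broken_H1_def)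
    also have "\<dots> = (\<Sum>K\<in>M. \<integral>x. weak_grad (interior K) y x $ i * P K x \<partial>LI K)"
    proof (rule sum.cong[OF refl], rule lebesgue_on_integral_AE_cong)
      fix K assume K: "K \<in> M"
      show "AE x in LI K. q x * broken_grad M y x $ i = weak_grad (interior K) y x $ i * P K x"
        using q[OF K] broken_grad_AE[OF K, of y] by eventually_elim simp
    qed simp
    finally show ?thesis .
  qed
  define T where "T K F = (\<integral>x. face_trace K F y x * P K x \<partial>face_measure F)" for K F
  have elem: "(\<integral>x. weak_grad (interior K) y x $ i * P K x \<partial>LI K) =
      - (\<integral>x. y x * grad (P K) x $ i \<partial>LI K) + (\<Sum>F | F facet_of K. outer K F $ i * T K F)" if K: "K \<in> M" for K
    using simplex_element.integration_by_parts[OF element[OF K] broken_H1_elem[OF y K] P[OF K], of i]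
    unfolding T_def by linarith
  \<comment> \<open>The product rule on a single face. On a boundary face jump and average coincide,
    and only the product of \<open>{{q}}\<close> and \<open>[[y]]\<close> occurs.\<close>
  have face: "(if F \<in> interior_faces M then outer (front F) F $ i * T (front F) F + outer (back F) F $ i * T (back F) F
        else outer (front F) F $ i * T (front F) F) =
      n F $ i * (\<integral>x. average M n q F x * jump M n y F x \<partial>face_measure F) +
      (if F \<in> interior_faces M then n F $ i * (\<integral>x. (P (front F) x - P (back F) x) * average M n y F x \<partial>face_measure F) else 0)"
    if F: "F \<in> faces M" for F
  proof -
    have ff: "front F \<in> M" "F facet_of (front F)" using front_facet[OF F] by auto
    have qf: "AE x in face_measure F. face_trace (front F) F q x = P (front F) x"
      by (rule smooth_elem_face_trace[OF ff P[OF ff(1)] q[OF ff(1)]])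
    have aq: "average M n q F \<in> L2 (face_measure F)" "jump M n y F \<in> L2 (face_measure F)" "average M n y F \<in> L2 (face_measure F)"
      by (intro average_L2 jump_L2 q1 y F)+
    have PL2: "P K \<in> L2 (face_measure F)" if "K \<in> M" "F facet_of K" for K
      by (rule simplex_element.smooth_L2_facet[OF element[OF that(1)] that(2) P[OF that(1)]])
    show ?thesis
    proof (cases "F \<in> interior_faces M")
      case True
      have fb: "back F \<in> M" "F facet_of (back F)" using back_facet[OF True] by auto
      have qb: "AE x in face_measure F. face_trace (back F) F q x = P (back F) x"
        by (rule smooth_elem_face_trace[OF fb P[OF fb(1)] q[OF fb(1)]])
      have "T (front F) F - T (back F) F =
          (\<integral>x. face_trace (front F) F y x * P (front F) x - face_trace (back F) F y x * P (back F) x \<partial>face_measure F)"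
        unfolding T_def
        by (intro Bochner_Integration.integral_diff[symmetric] L2_integrable_mult front_trace_L2 back_trace_L2 y F True PL2 ff fb)
      also have "\<dots> = (\<integral>x. average M n q F x * jump M n y F x + (P (front F) x - P (back F) x) * average M n y F x \<partial>face_measure F)"
      proof (rule integral_cong_AE)
        show "AE x in face_measure F. face_trace (front F) F y x * P (front F) x - face_trace (back F) F y x * P (back F) x =
            average M n q F x * jump M n y F x + (P (front F) x - P (back F) x) * average M n y F x"
          using qf qb by eventually_elim (simp add: average_def jump_def True field_simps)
      qed (use aq PL2[OF ff] PL2[OF fb] front_trace_L2[OF y F] back_trace_L2[OF y True] in
            \<open>auto dest!: L2_measurable intro!: borel_measurable_diff borel_measurable_add borel_measurable_times\<close>)
      also have "\<dots> = (\<integral>x. average M n q F x * jump M n y F x \<partial>face_measure F) +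
          (\<integral>x. (P (front F) x - P (back F) x) * average M n y F x \<partial>face_measure F)"
        by (intro Bochner_Integration.integral_add L2_integrable_mult aq L2_diff PL2 ff fb)
      finally show ?thesis using True interior_face_front_back(3,4)[OF True] by (simp add: algebra_simps)
    next
      case False
      have "T (front F) F = (\<integral>x. average M n q F x * jump M n y F x \<partial>face_measure F)"
        unfolding T_def
      proof (rule integral_cong_AE)
        show "AE x in face_measure F. face_trace (front F) F y x * P (front F) x = average M n q F x * jump M n y F x"
          using qf by eventually_elim (simp add: average_def jump_def False)
      qed (use aq PL2[OF ff] front_trace_L2[OF y F] in \<open>auto dest!: L2_measurable intro!: borel_measurable_times\<close>)
      then show ?thesis using False boundary_face_front(2)[OF F False] by simp
    qed
  qed
  have "(\<Sum>K\<in>M. \<Sum>F | F facet_of K. outer K F $ i * T K F) =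
      (\<Sum>F\<in>faces M. n F $ i * (\<integral>x. average M n q F x * jump M n y F x \<partial>face_measure F)) +
      (\<Sum>F\<in>faces M. if F \<in> interior_faces M then n F $ i * (\<integral>x. (P (front F) x - P (back F) x) * average M n y F x \<partial>face_measure F) else 0)"
    unfolding sum_element_facets sum.distrib[symmetric] using face by (intro sum.cong refl) auto
  also have "(\<Sum>F\<in>faces M. if F \<in> interior_faces M then n F $ i * (\<integral>x. (P (front F) x - P (back F) x) * average M n y F x \<partial>face_measure F) else 0) =
      (\<Sum>F\<in>interior_faces M. n F $ i * (\<integral>x. (P (front F) x - P (back F) x) * average M n y F x \<partial>face_measure F))"
    using interior_faces_subset finite_faces
    by (subst sum.inter_restrict[symmetric]) (auto simp: inf_absorb2 intro!: sum.cong)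
  finally show ?thesis
    unfolding vol using elem by (simp add: sum.distrib sum_negf sum_subtractf)
qed

lemma smoother_H10: "linear_smoother \<Omega> M l E \<Longrightarrow> v \<in> pow (dG_space M (int l)) \<Longrightarrow> (\<lambda>x. E v x $ j) \<in> H10 \<Omega>"
  unfolding linear_smoother_def using powD by blast

lemma preserves_moments_element:
  assumes "preserves_moments M n l E" "v \<in> pow (dG_space M (int l))" "K \<in> M" "m \<in> pow (polys (int l - 2))"
  shows "(\<integral>x. E v x \<bullet> m x \<partial>lebesgue_on K) = (\<integral>x. v x \<bullet> m x \<partial>lebesgue_on K)"
  using assms by (simp add: preserves_moments_def)

lemma preserves_moments_face:
  assumes "preserves_moments M n l E" "v \<in> pow (dG_space M (int l))" "F \<in> interior_faces M"
    "m \<in> pow (polys (int l - 1))"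
  shows "(\<integral>x. vec_average M n (E v) F x \<bullet> m x \<partial>face_measure F) = (\<integral>x. vec_average M n v F x \<bullet> m x \<partial>face_measure F)"
  using assms by (simp add: preserves_moments_def)

text \<open>
  Elementwise integration by parts turns both sides into moments of \<open>v\<close> and \<open>E v\<close>, respectively,
  on elements and interior faces, and these agree.
\<close>

lemma smoother_identity:
  assumes E: "linear_smoother \<Omega> M l E" "preserves_moments M n l E"
    and v: "v \<in> pow (dG_space M (int l))" and q: "q \<in> dG_space M (int l - 1)"
  shows "(\<integral>x. q x * broken_grad M (\<lambda>y. v y $ j) x $ i \<partial>L\<Omega>)
      - (\<Sum>F\<in>faces M. n F $ i * (\<integral>x. average M n q F x * jump M n (\<lambda>y. v y $ j) F x \<partial>face_measure F)) =
    (\<integral>x. q x * weak_grad \<Omega> (\<lambda>y. E v y $ j) x $ i \<partial>L\<Omega>)"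
proof -
  obtain P where P: "\<And>K. K \<in> M \<Longrightarrow> P K \<in> polys (int l - 1)" "\<And>K. K \<in> M \<Longrightarrow> AE x in LI K. q x = P K x"
    using q by (rule dG_space_polys) blast
  let ?v = "\<lambda>y. v y $ j" and ?e = "\<lambda>y. E v y $ j"
  have e: "?e \<in> H10 \<Omega>" by (rule smoother_H10[OF E(1) v])
  note ibp_v = broken_integration_by_parts[OF dG_broken_H1[OF powD[OF v, of j]] polys_smooth[OF P(1)] P(2), of i]
  note ibp_e = broken_integration_by_parts[OF H10_broken_H1[OF e] polys_smooth[OF P(1)] P(2), of i]
  have vol: "(\<integral>x. ?e x * grad (P K) x $ i \<partial>LI K) = (\<integral>x. ?v x * grad (P K) x $ i \<partial>LI K)" if K: "K \<in> M" for K
  proof -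
    \<comment> \<open>Differentiating a polynomial of degree \<open>l - 1\<close> yields an
      admissible element moment; on faces the difference of two such polynomials is already
      admissible.\<close>
    have "(\<lambda>x. grad (P K) x $ i) \<in> polys (int l - 2)"
      using grad_polys[OF P(1)[OF K], of i] by simp
    then have "(\<integral>x. E v x \<bullet> axis j (grad (P K) x $ i) \<partial>lebesgue_on K) = (\<integral>x. v x \<bullet> axis j (grad (P K) x $ i) \<partial>lebesgue_on K)"
      by (intro preserves_moments_element[OF E(2) v K, where m="\<lambda>x. axis j (grad (P K) x $ i)"] single_component_pow)
    then have "(\<integral>x. ?e x * grad (P K) x $ i \<partial>lebesgue_on K) = (\<integral>x. ?v x * grad (P K) x $ i \<partial>lebesgue_on K)"
      by (simp add: inner_axis_mult)
    moreover have "(\<integral>x. g x \<partial>lebesgue_on K) = (\<integral>x. g x \<partial>LI K)" for g :: "real^'n \<Rightarrow> real"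
      by (rule lebesgue_on_integral_change) (use AE_element_interior[OF K] M_compact[OF K] in \<open>auto simp: compact_imp_closed\<close>)
    ultimately show ?thesis by simp
  qed
  have face: "(\<integral>x. (P (front F) x - P (back F) x) * average M n ?e F x \<partial>face_measure F) =
      (\<integral>x. (P (front F) x - P (back F) x) * average M n ?v F x \<partial>face_measure F)" if F: "F \<in> interior_faces M" for F
  proof -
    have "(\<lambda>x. P (front F) x - P (back F) x) \<in> polys (int l - 1)"
      using front_facet[of F] back_facet[OF F] F interior_faces_subset by (intro polys_diff P(1)) auto
    then have "(\<integral>x. vec_average M n (E v) F x \<bullet> axis j (P (front F) x - P (back F) x) \<partial>face_measure F) =
        (\<integral>x. vec_average M n v F x \<bullet> axis j (P (front F) x - P (back F) x) \<partial>face_measure F)"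
      by (intro preserves_moments_face[OF E(2) v F, where m="\<lambda>x. axis j (P (front F) x - P (back F) x)"] single_component_pow)
    then show ?thesis by (simp add: inner_axis_mult vec_average_def mult.commute)
  qed
  \<comment> \<open>Functions in \<open>H10\<close> have no jumps, so the face sum on the left
    disappears for \<open>E v\<close>.\<close>
  have "(\<integral>x. average M n q F x * jump M n ?e F x \<partial>face_measure F) = 0" if F: "F \<in> faces M" for F
    by (rule integral_eq_zero_AE) (use H10_jump[OF e F] in auto)
  then have "(\<integral>x. q x * broken_grad M ?v x $ i \<partial>L\<Omega>)
      - (\<Sum>F\<in>faces M. n F $ i * (\<integral>x. average M n q F x * jump M n ?v F x \<partial>face_measure F)) =
      (\<integral>x. q x * broken_grad M ?e x $ i \<partial>L\<Omega>)"
    using ibp_v ibp_e vol face by simp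
  also have "\<dots> = (\<integral>x. q x * weak_grad \<Omega> ?e x $ i \<partial>L\<Omega>)"
    by (rule lebesgue_on_integral_AE_cong) (use H10_broken_grad[OF e] in auto)
  finally show ?thesis .
qed

text \<open>The identity for \<open>E\<close> is applied with \<open>q\<close> running through the
  partial derivatives of the components of \<open>w\<close>, which are piecewise polynomials of
  degree \<open>l - 1\<close>, and summed over all entries of the Jacobian.\<close>

lemma a_dG_consistency:
  assumes E: "linear_smoother \<Omega> M l E" "preserves_moments M n l E"
    and v: "v \<in> pow (dG_space M (int l))" and w: "w \<in> pow (dG_space M (int l))"
  shows "(\<integral>x. broken_jac M w x \<bullet> broken_jac M v x \<partial>L\<Omega>)
     - skeleton_integral M (\<lambda>F x. (mat_average M n (broken_jac M w) F x *v n F) \<bullet> vec_jump M n v F x) =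
    (\<integral>x. broken_jac M w x \<bullet> weak_jac \<Omega> (E v) x \<partial>L\<Omega>)"
proof -
  define q where "q j i x = broken_grad M (\<lambda>y. w y $ j) x $ i" for j i x
  have q: "q j i \<in> dG_space M (int l - 1)" for j i
    unfolding q_def[abs_def] by (rule dG_broken_grad[OF powD[OF w]])
  have q1: "broken_H1 (q j i)" for j i using q by (rule dG_broken_H1)
  have v1: "broken_H1 (\<lambda>y. v y $ j)" for j by (rule dG_broken_H1[OF powD[OF v]])
  have e1: "weak_grad \<Omega> (\<lambda>y. E v y $ j) \<in> L2 L\<Omega>" for j by (rule H10_D(3)[OF smoother_H10[OF E(1) v]])
  have 1: "(\<integral>x. broken_jac M w x \<bullet> broken_jac M v x \<partial>L\<Omega>) =
      (\<Sum>j\<in>UNIV. \<Sum>i\<in>UNIV. \<integral>x. q j i x * broken_grad M (\<lambda>y. v y $ j) x $ i \<partial>L\<Omega>)"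
    unfolding matrix_inner broken_jac_def q_def[symmetric] vec_lambda_beta
    using L2_integrable_mult[OF broken_H1_L2[OF q1] L2_component[OF broken_grad_L2[OF v1]]]
    by (subst Bochner_Integration.integral_sum; simp add: q_def)
  have 2: "(\<integral>x. broken_jac M w x \<bullet> weak_jac \<Omega> (E v) x \<partial>L\<Omega>) =
      (\<Sum>j\<in>UNIV. \<Sum>i\<in>UNIV. \<integral>x. q j i x * weak_grad \<Omega> (\<lambda>y. E v y $ j) x $ i \<partial>L\<Omega>)"
    unfolding matrix_inner broken_jac_def weak_jac_def q_def[symmetric] vec_lambda_beta
    using L2_integrable_mult[OF broken_H1_L2[OF q1] L2_component[OF e1]]
    by (subst Bochner_Integration.integral_sum; simp add: q_def)
  have "(\<integral>x. (mat_average M n (broken_jac M w) F x *v n F) \<bullet> vec_jump M n v F x \<partial>face_measure F) =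
      (\<Sum>j\<in>UNIV. \<Sum>i\<in>UNIV. n F $ i * (\<integral>x. average M n (q j i) F x * jump M n (\<lambda>y. v y $ j) F x \<partial>face_measure F))"
    if F: "F \<in> faces M" for F
    unfolding matrix_vector_inner mat_average_def vec_jump_def broken_jac_def vec_lambda_beta
    using L2_integrable_mult[OF average_L2[OF q1 F] jump_L2[OF v1 F]]
    by (subst Bochner_Integration.integral_sum; simp add: q_def[abs_def])
  then have 3: "skeleton_integral M (\<lambda>F x. (mat_average M n (broken_jac M w) F x *v n F) \<bullet> vec_jump M n v F x) =
      (\<Sum>j\<in>UNIV. \<Sum>i\<in>UNIV. \<Sum>F\<in>faces M. n F $ i * (\<integral>x. average M n (q j i) F x * jump M n (\<lambda>y. v y $ j) F x \<partial>face_measure F))"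
    unfolding skeleton_integral_def by (simp add: sum.swap[of _ _ "faces M"] cong: sum.cong)
  show ?thesis
    unfolding 1 2 3 sum_subtractf[symmetric] using smoother_identity[OF E v q] by simp
qed

text \<open>The divergence is the trace of the Jacobian, so the identity for \<open>E\<close> enters
  with equal component and direction.\<close>

lemma b_dG_consistency:
  assumes E: "linear_smoother \<Omega> M l E" "preserves_moments M n l E"
    and v: "v \<in> pow (dG_space M (int l))" and q: "q \<in> dG_space M (int l - 1)"
  shows "b_dG \<Omega> M n v q = - (\<integral>x. q x * trace (weak_jac \<Omega> (E v) x) \<partial>L\<Omega>)"
proof -
  have q1: "broken_H1 q" using q by (rule dG_broken_H1)
  have v1: "broken_H1 (\<lambda>y. v y $ j)" for j by (rule dG_broken_H1[OF powD[OF v]])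
  have e1: "weak_grad \<Omega> (\<lambda>y. E v y $ j) \<in> L2 L\<Omega>" for j by (rule H10_D(3)[OF smoother_H10[OF E(1) v]])
  have 1: "(\<integral>x. q x * broken_div M v x \<partial>L\<Omega>) = (\<Sum>i\<in>UNIV. \<integral>x. q x * broken_grad M (\<lambda>y. v y $ i) x $ i \<partial>L\<Omega>)"
    using L2_integrable_mult[OF broken_H1_L2[OF q1] L2_component[OF broken_grad_L2[OF v1]]]
    by (simp add: broken_div_def trace_def broken_jac_def sum_distrib_left)
  have 2: "(\<integral>x. q x * trace (weak_jac \<Omega> (E v) x) \<partial>L\<Omega>) = (\<Sum>i\<in>UNIV. \<integral>x. q x * weak_grad \<Omega> (\<lambda>y. E v y $ i) x $ i \<partial>L\<Omega>)"
    using L2_integrable_mult[OF broken_H1_L2[OF q1] L2_component[OF e1]]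
    by (simp add: trace_def weak_jac_def sum_distrib_left)
  have "(\<integral>x. (vec_jump M n v F x \<bullet> n F) * average M n q F x \<partial>face_measure F) =
      (\<Sum>i\<in>UNIV. n F $ i * (\<integral>x. average M n q F x * jump M n (\<lambda>y. v y $ i) F x \<partial>face_measure F))"
    if F: "F \<in> faces M" for F
  proof -
    have "(\<lambda>x. (vec_jump M n v F x \<bullet> n F) * average M n q F x) =
        (\<lambda>x. \<Sum>i\<in>UNIV. n F $ i * (average M n q F x * jump M n (\<lambda>y. v y $ i) F x))"
      by (simp add: vec_jump_def inner_vec_def sum_distrib_left sum_distrib_right mult_ac)
    then show ?thesis using L2_integrable_mult[OF average_L2[OF q1 F] jump_L2[OF v1 F]] by simp
  qed
  then have 3: "skeleton_integral M (\<lambda>F x. (vec_jump M n v F x \<bullet> n F) * average M n q F x) =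
      (\<Sum>i\<in>UNIV. \<Sum>F\<in>faces M. n F $ i * (\<integral>x. average M n q F x * jump M n (\<lambda>y. v y $ i) F x \<partial>face_measure F))"
    unfolding skeleton_integral_def by (simp add: sum.swap[of _ _ "faces M"] cong: sum.cong)
  have "(\<integral>x. q x * broken_div M v x \<partial>L\<Omega>) - skeleton_integral M (\<lambda>F x. (vec_jump M n v F x \<bullet> n F) * average M n q F x) =
      (\<integral>x. q x * trace (weak_jac \<Omega> (E v) x) \<partial>L\<Omega>)"
    unfolding 1 2 3 sum_subtractf[symmetric] using smoother_identity[OF E v q] by simp
  then show ?thesis unfolding b_dG_def by linarith
qed

end

section \<open>Seminorms on finite-dimensional function spaces\<close>

text \<open>Functions stand for classes modulo null sets, so a form on a set of functions can only
  be semidefinite here; statements about its kernel are added where they are required.\<close>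

locale function_form =
  fixes S :: "('x \<Rightarrow> 'y::real_vector) set" and Q :: "('x \<Rightarrow> 'y) \<Rightarrow> ('x \<Rightarrow> 'y) \<Rightarrow> real"
  assumes S_zero: "(\<lambda>_. 0) \<in> S"
    and S_lincomb: "v \<in> S \<Longrightarrow> w \<in> S \<Longrightarrow> (\<lambda>x. a *\<^sub>R v x + b *\<^sub>R w x) \<in> S"
    and Q_sym: "v \<in> S \<Longrightarrow> w \<in> S \<Longrightarrow> Q v w = Q w v"
    and Q_lincomb: "v \<in> S \<Longrightarrow> w \<in> S \<Longrightarrow> z \<in> S \<Longrightarrow> Q (\<lambda>x. a *\<^sub>R v x + b *\<^sub>R w x) z = a * Q v z + b * Q w z"
    and Q_nonneg: "v \<in> S \<Longrightarrow> 0 \<le> Q v v"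
begin

lemma Q_lincomb_right:
  assumes "v \<in> S" "w \<in> S" "z \<in> S"
  shows "Q z (\<lambda>x. a *\<^sub>R v x + b *\<^sub>R w x) = a * Q z v + b * Q z w"
  using Q_lincomb[OF assms] Q_sym[OF _ assms(3)] S_lincomb assms by simp

lemma Q_lincomb_self:
  assumes "v \<in> S" "w \<in> S"
  shows "Q (\<lambda>x. a *\<^sub>R v x + b *\<^sub>R w x) (\<lambda>x. a *\<^sub>R v x + b *\<^sub>R w x) = a\<^sup>2 * Q v v + 2 * a * b * Q v w + b\<^sup>2 * Q w w"
  using Q_lincomb[OF assms S_lincomb[OF assms]] Q_lincomb_right[OF assms(1,2)] Q_sym[OF assms] assms
  by (simp add: power2_eq_square algebra_simps)

lemma Q_CS:
  assumes "v \<in> S" "w \<in> S"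
  shows "\<bar>Q v w\<bar> \<le> sqrt (Q v v) * sqrt (Q w w)"
proof (rule psd_form_CS)
  show "0 \<le> Q v v + 2 * t * Q v w + t\<^sup>2 * Q w w" for t
    using Q_nonneg[OF S_lincomb[OF assms, of 1 t]] Q_lincomb_self[OF assms, of 1 t] by simp
qed (rule Q_nonneg[OF assms(2)])

lemma Q_norm_lincomb_le:
  assumes "v \<in> S" "w \<in> S"
  shows "sqrt (Q (\<lambda>x. a *\<^sub>R v x + b *\<^sub>R w x) (\<lambda>x. a *\<^sub>R v x + b *\<^sub>R w x)) \<le> \<bar>a\<bar> * sqrt (Q v v) + \<bar>b\<bar> * sqrt (Q w w)"
proof (rule real_le_lsqrt)
  let ?v = "sqrt (Q v v)" and ?w = "sqrt (Q w w)"
  have sq: "?v\<^sup>2 = Q v v" "?w\<^sup>2 = Q w w" using Q_nonneg assms by auto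
  have "a * b * Q v w \<le> \<bar>a * b\<bar> * \<bar>Q v w\<bar>" by (metis abs_ge_self abs_mult)
  also have "\<dots> \<le> \<bar>a * b\<bar> * (?v * ?w)" by (rule mult_left_mono[OF Q_CS[OF assms]]) simp
  finally have "2 * a * b * Q v w \<le> 2 * (\<bar>a\<bar> * ?v) * (\<bar>b\<bar> * ?w)" by (simp add: abs_mult algebra_simps)
  then show "Q (\<lambda>x. a *\<^sub>R v x + b *\<^sub>R w x) (\<lambda>x. a *\<^sub>R v x + b *\<^sub>R w x) \<le> (\<bar>a\<bar> * ?v + \<bar>b\<bar> * ?w)\<^sup>2"
    unfolding Q_lincomb_self[OF assms] power2_sum power_mult_distrib sq by simp
qed (use Q_nonneg assms in auto)

text \<open>Combinations with explicit coefficients of an arbitrary finite family. Linear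
  independence of the generators is not part of the picture, so no basis has to be
  extracted.\<close>

definition span_of :: "'i set \<Rightarrow> ('i \<Rightarrow> 'x \<Rightarrow> 'y) \<Rightarrow> ('x \<Rightarrow> 'y) set" where
  "span_of I f = {v. \<exists>c. v = (\<lambda>x. \<Sum>i\<in>I. c i *\<^sub>R f i x)}"

lemma span_ofI: "(\<lambda>x. \<Sum>i\<in>I. c i *\<^sub>R f i x) \<in> span_of I f"
  unfolding span_of_def by (intro CollectI exI[of _ c] refl)

lemma span_ofE:
  assumes "v \<in> span_of I f"
  obtains c where "v = (\<lambda>x. \<Sum>i\<in>I. c i *\<^sub>R f i x)"
  using assms unfolding span_of_def by blast

lemma span_of_lincomb:
  assumes "v \<in> span_of I f" "w \<in> span_of I f"
  shows "(\<lambda>x. a *\<^sub>R v x + b *\<^sub>R w x) \<in> span_of I f"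
proof -
  obtain c where v: "v = (\<lambda>x. \<Sum>i\<in>I. c i *\<^sub>R f i x)" using assms(1) by (rule span_ofE)
  obtain d where w: "w = (\<lambda>x. \<Sum>i\<in>I. d i *\<^sub>R f i x)" using assms(2) by (rule span_ofE)
  have "(\<lambda>x. a *\<^sub>R v x + b *\<^sub>R w x) = (\<lambda>x. \<Sum>i\<in>I. (a * c i + b * d i) *\<^sub>R f i x)"
    unfolding v w by (simp add: scaleR_sum_right sum.distrib scaleR_add_left)
  then show ?thesis by (simp only: span_ofI)
qed

lemma span_of_insert:
  assumes "finite I" "i \<notin> I"
  shows "v \<in> span_of (insert i I) f \<longleftrightarrow> (\<exists>t. \<exists>y\<in>span_of I f. v = (\<lambda>x. t *\<^sub>R f i x + 1 *\<^sub>R y x))"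
proof
  assume "v \<in> span_of (insert i I) f"
  then obtain c where v: "v = (\<lambda>x. \<Sum>i\<in>insert i I. c i *\<^sub>R f i x)" by (rule span_ofE)
  show "\<exists>t. \<exists>y\<in>span_of I f. v = (\<lambda>x. t *\<^sub>R f i x + 1 *\<^sub>R y x)"
    by (rule exI[of _ "c i"], rule bexI[OF _ span_ofI[where c=c and I=I and f=f]]) (use assms in \<open>simp add: v\<close>)
next
  assume "\<exists>t. \<exists>y\<in>span_of I f. v = (\<lambda>x. t *\<^sub>R f i x + 1 *\<^sub>R y x)"
  then obtain t y where y: "y \<in> span_of I f" and v: "v = (\<lambda>x. t *\<^sub>R f i x + 1 *\<^sub>R y x)" by (elim exE bexE)
  obtain c where c: "y = (\<lambda>x. \<Sum>i\<in>I. c i *\<^sub>R f i x)" using y by (rule span_ofE)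
  have "v = (\<lambda>x. \<Sum>j\<in>insert i I. (if j = i then t else c j) *\<^sub>R f j x)"
  proof
    fix x
    have "(\<Sum>j\<in>I. (if j = i then t else c j) *\<^sub>R f j x) = (\<Sum>j\<in>I. c j *\<^sub>R f j x)"
      by (rule sum.cong) (use assms in auto)
    then show "v x = (\<Sum>j\<in>insert i I. (if j = i then t else c j) *\<^sub>R f j x)" using assms v c by simp
  qed
  then show "v \<in> span_of (insert i I) f" by (simp only: span_ofI)
qed

lemma span_of_subset:
  assumes "finite I" "\<And>i. i \<in> I \<Longrightarrow> f i \<in> S"
  shows "span_of I f \<subseteq> S"
  using assms
proof (induction I rule: finite_induct)
  case empty
  then show ?case using S_zero by (auto simp: span_of_def)
next
  case (insert i I)
  show ?case
  proof
    fix v assume "v \<in> span_of (insert i I) f"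
    then obtain t y where y: "y \<in> span_of I f" and v: "v = (\<lambda>x. t *\<^sub>R f i x + 1 *\<^sub>R y x)"
      unfolding span_of_insert[OF insert(1,2)] by (elim exE bexE)
    show "v \<in> S" unfolding v using insert y by (intro S_lincomb) auto
  qed
qed

text \<open>
  The induction carries along the orthogonal projection, which splits off the component of a new
  generator.
\<close>

lemma finite_dimensional_seminorm_bound:
  assumes I: "finite I" "\<And>i. i \<in> I \<Longrightarrow> f i \<in> S"
    and r0: "\<And>v. v \<in> S \<Longrightarrow> 0 \<le> r v"
    and r: "\<And>v w a b. v \<in> S \<Longrightarrow> w \<in> S \<Longrightarrow> r (\<lambda>x. a *\<^sub>R v x + b *\<^sub>R w x) \<le> \<bar>a\<bar> * r v + \<bar>b\<bar> * r w"
    and ker: "\<And>v. v \<in> S \<Longrightarrow> Q v v = 0 \<Longrightarrow> r v = 0"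
  shows "(\<exists>C\<ge>0. \<forall>v\<in>span_of I f. r v \<le> C * sqrt (Q v v)) \<and>
    (\<forall>z\<in>S. \<exists>p\<in>span_of I f. \<forall>y\<in>span_of I f. Q (\<lambda>x. 1 *\<^sub>R z x + (-1) *\<^sub>R p x) y = 0)"
  using I
proof (induction I rule: finite_induct)
  case empty
  have span: "span_of {} f = {\<lambda>x. 0}" by (auto simp: span_of_def)
  have Q0: "Q (\<lambda>x. 0) z = 0" if "z \<in> S" for z
    using Q_lincomb[OF S_zero S_zero that, of 0 0] by simp
  have "Q (\<lambda>x. 1 *\<^sub>R z x + (-1) *\<^sub>R 0) (\<lambda>x. 0) = 0" if "z \<in> S" for z
    using Q0[OF that] Q_sym[OF that S_zero] by simp
  moreover have "r (\<lambda>x. 0) = 0" by (rule ker[OF S_zero Q0[OF S_zero]])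
  ultimately show ?case unfolding span by (auto intro!: exI[of _ 0])
next
  case (insert i I)
  let ?W = "span_of I f"
  obtain C where C: "0 \<le> C" "\<And>v. v \<in> ?W \<Longrightarrow> r v \<le> C * sqrt (Q v v)" using insert by auto
  have proj: "\<exists>p\<in>?W. \<forall>y\<in>?W. Q (\<lambda>x. 1 *\<^sub>R z x + (-1) *\<^sub>R p x) y = 0" if "z \<in> S" for z
    using insert that by auto
  have W: "?W \<subseteq> S" using insert by (intro span_of_subset) auto
  have b: "f i \<in> S" using insert by simp
  obtain p where p: "p \<in> ?W" "\<And>y. y \<in> ?W \<Longrightarrow> Q (\<lambda>x. 1 *\<^sub>R f i x + (-1) *\<^sub>R p x) y = 0"
    using proj[OF b] by blast
  \<comment> \<open>The component of the new generator that is orthogonal to the old span. Its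
    seminorm may vanish.\<close>
  define b' where "b' = (\<lambda>x. 1 *\<^sub>R f i x + (-1) *\<^sub>R p x)"
  have b'S: "b' \<in> S" unfolding b'_def using b p W by (intro S_lincomb) auto
  have orth: "Q b' y = 0" if "y \<in> ?W" for y using p(2)[OF that] by (simp add: b'_def)
  let ?\<beta> = "Q b' b'"
  have \<beta>0: "0 \<le> ?\<beta>" by (rule Q_nonneg[OF b'S])
  have split: "\<exists>t. \<exists>y\<in>?W. v = (\<lambda>x. t *\<^sub>R b' x + 1 *\<^sub>R y x)" if v: "v \<in> span_of (insert i I) f" for v
  proof -
    obtain t y where y: "y \<in> ?W" "v = (\<lambda>x. t *\<^sub>R f i x + 1 *\<^sub>R y x)"
      using v unfolding span_of_insert[OF insert(1,2)] by (elim exE bexE)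
    have mem: "(\<lambda>x. 1 *\<^sub>R y x + t *\<^sub>R p x) \<in> ?W" by (rule span_of_lincomb[OF y(1) p(1)])
    have "v = (\<lambda>x. t *\<^sub>R b' x + 1 *\<^sub>R (1 *\<^sub>R y x + t *\<^sub>R p x))"
      unfolding y(2) b'_def by (simp add: scaleR_diff_right)
    then show ?thesis by (intro exI bexI[OF _ mem])
  qed
  have Qv: "Q (\<lambda>x. t *\<^sub>R b' x + 1 *\<^sub>R y x) (\<lambda>x. t *\<^sub>R b' x + 1 *\<^sub>R y x) = t\<^sup>2 * ?\<beta> + Q y y" if "y \<in> ?W" for t y
    using Q_lincomb_self[OF b'S, of y t 1] that W orth[OF that] by auto
  have bound: "\<exists>C\<ge>0. \<forall>v\<in>span_of (insert i I) f. r v \<le> C * sqrt (Q v v)"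
  \<comment> \<open>The part along \<open>b'\<close> costs the quotient of the two seminorms of
    \<open>b'\<close>. If \<open>?\<beta>\<close> is zero, then so is \<open>r b'\<close> by the
    kernel condition, and the quotient is zero.\<close>
  proof (intro exI[of _ "r b' / sqrt ?\<beta> + C"] conjI ballI)
    show "0 \<le> r b' / sqrt ?\<beta> + C" using r0[OF b'S] C(1) \<beta>0 by simp
    fix v assume "v \<in> span_of (insert i I) f"
    then obtain t y where y: "y \<in> ?W" and v: "v = (\<lambda>x. t *\<^sub>R b' x + 1 *\<^sub>R y x)" using split by meson
    have yS: "y \<in> S" using y W by blast
    have Qvv: "Q v v = t\<^sup>2 * ?\<beta> + Q y y" unfolding v by (rule Qv[OF y])
    have rv: "r v \<le> \<bar>t\<bar> * r b' + C * sqrt (Q y y)" unfolding v using r[OF b'S yS, of t 1] C(2)[OF y] by simp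
    have 1: "C * sqrt (Q y y) \<le> C * sqrt (Q v v)"
      using C(1) Qvv \<beta>0 by (intro mult_left_mono real_sqrt_le_mono) auto
    have 2: "\<bar>t\<bar> * r b' \<le> r b' / sqrt ?\<beta> * sqrt (Q v v)"
    proof (cases "?\<beta> = 0")
      case True
      then show ?thesis using ker[OF b'S] by simp
    next
      case False
      then have \<beta>: "0 < ?\<beta>" using \<beta>0 by simp
      have "sqrt (t\<^sup>2 * ?\<beta>) \<le> sqrt (Q v v)" using Qvv Q_nonneg[OF yS] by (intro real_sqrt_le_mono) simp
      then have "\<bar>t\<bar> * sqrt ?\<beta> \<le> sqrt (Q v v)" by (simp add: real_sqrt_mult)
      then have "\<bar>t\<bar> \<le> sqrt (Q v v) / sqrt ?\<beta>" using \<beta> by (simp add: pos_le_divide_eq)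
      then have "\<bar>t\<bar> * r b' \<le> sqrt (Q v v) / sqrt ?\<beta> * r b'" by (rule mult_right_mono[OF _ r0[OF b'S]])
      then show ?thesis by (simp add: mult.commute)
    qed
    show "r v \<le> (r b' / sqrt ?\<beta> + C) * sqrt (Q v v)" using rv 1 2 by (simp add: distrib_right)
  qed
  have "\<exists>p\<in>span_of (insert i I) f. \<forall>y\<in>span_of (insert i I) f. Q (\<lambda>x. 1 *\<^sub>R z x + (-1) *\<^sub>R p x) y = 0" if z: "z \<in> S" for z
  proof -
    obtain p0 where p0: "p0 \<in> ?W" "\<And>y. y \<in> ?W \<Longrightarrow> Q (\<lambda>x. 1 *\<^sub>R z x + (-1) *\<^sub>R p0 x) y = 0"
      using proj[OF z] by blast
    define z' where "z' = (\<lambda>x. 1 *\<^sub>R z x + (-1) *\<^sub>R p0 x)"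
    have z'S: "z' \<in> S" unfolding z'_def using z p0 W by (intro S_lincomb) auto
    \<comment> \<open>The Gram-Schmidt coefficient. If \<open>?\<beta>\<close> is zero, division
      yields 0, and the Cauchy-Schwarz inequality gives \<open>Q z' b' = 0\<close>, so the defining
      equation still holds.\<close>
    define s where "s = Q z' b' / ?\<beta>"
    have s: "Q z' b' = s * ?\<beta>"
    proof (cases "?\<beta> = 0")
      case True
      then show ?thesis using Q_CS[OF z'S b'S] by simp
    qed (simp add: s_def)
    \<comment> \<open>This is \<open>p0\<close> plus \<open>s\<close> times \<open>b'\<close>,
      written with \<open>f i\<close> and \<open>p\<close> so that its membership in the enlarged
      span is visible.\<close>
    define p1 where "p1 = (\<lambda>x. s *\<^sub>R f i x + 1 *\<^sub>R (1 *\<^sub>R p0 x + (-s) *\<^sub>R p x))"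
    have "p1 \<in> span_of (insert i I) f"
      unfolding span_of_insert[OF insert(1,2)] p1_def
      by (intro exI[of _ s] bexI[of _ "\<lambda>x. 1 *\<^sub>R p0 x + (-s) *\<^sub>R p x"] refl span_of_lincomb[OF p0(1) p(1)])
    moreover have "(\<lambda>x. 1 *\<^sub>R z x + (-1) *\<^sub>R p1 x) = (\<lambda>x. 1 *\<^sub>R z' x + (-s) *\<^sub>R b' x)"
      by (simp add: p1_def z'_def b'_def algebra_simps)
    moreover have "Q (\<lambda>x. 1 *\<^sub>R z' x + (-s) *\<^sub>R b' x) v = 0" if vs: "v \<in> span_of (insert i I) f" for v
    proof -
      obtain t y where y: "y \<in> ?W" and v: "v = (\<lambda>x. t *\<^sub>R b' x + 1 *\<^sub>R y x)" using split[OF vs] by (elim exE bexE)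
      have yS: "y \<in> S" using y W by blast
      have "Q z' v = t * (s * ?\<beta>)" unfolding v
        using Q_lincomb_right[OF b'S yS z'S, of t 1] p0(2)[OF y] s by (simp add: z'_def)
      moreover have "Q b' v = t * ?\<beta>" unfolding v
        using Q_lincomb_right[OF b'S yS b'S, of t 1] orth[OF y] by simp
      moreover have "v \<in> S" unfolding v by (rule S_lincomb[OF b'S yS])
      ultimately show ?thesis using Q_lincomb[OF z'S b'S, of v 1 "-s"] by simp
    qed
    ultimately show ?thesis by (intro bexI[of _ p1]) auto
  qed
  then show ?case using bound by blast
qed

end

lemma L2_norm_mono:
  assumes "f \<in> L2 N" "g \<in> L2 N" "\<And>x. norm (f x) \<le> norm (g x)"
  shows "L2_norm N f \<le> L2_norm N g"
  unfolding L2_norm_def using assms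
  by (intro real_sqrt_le_mono integral_mono L2_integrable_sq power_mono) auto

lemma norm_matrix_vector_mult_le:
  fixes A :: "real^'n^'m"
  shows "norm (A *v x) \<le> norm A * norm x"
proof -
  have "(norm (A *v x))\<^sup>2 = (\<Sum>i\<in>UNIV. (A $ i \<bullet> x)\<^sup>2)"
    by (simp add: norm_vec_power2 matrix_vector_mult_def inner_vec_def)
  also have "\<dots> \<le> (\<Sum>i\<in>UNIV. (norm (A $ i))\<^sup>2 * (norm x)\<^sup>2)"
    using Cauchy_Schwarz_ineq[of _ x] by (intro sum_mono) (simp add: power2_norm_eq_inner)
  also have "\<dots> = (norm A * norm x)\<^sup>2"
    by (simp add: norm_vec_power2[of A] power_mult_distrib sum_distrib_right)
  finally show ?thesis by (rule power2_le_imp_le) simp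
qed

text \<open>The trace is the Frobenius product with the identity matrix, whose norm is the square
  root of the dimension. This is the source of the factor 2 in the pressure terms.\<close>

lemma abs_trace_le:
  fixes A :: "real^'n^'n"
  assumes "CARD('n) \<le> 4"
  shows "\<bar>trace A\<bar> \<le> 2 * norm A"
proof -
  have "\<bar>trace A\<bar> = \<bar>A \<bullet> mat 1\<bar>"
    by (simp add: trace_def inner_vec_def mat_def if_distrib[of "\<lambda>t. _ * t"] cong: if_cong)
  also have "\<dots> \<le> norm A * norm (mat 1 :: real^'n^'n)" by (rule Cauchy_Schwarz_ineq2)
  also have "norm A * norm (mat 1 :: real^'n^'n) \<le> norm A * sqrt 4"
  proof (rule mult_left_mono)
    have "norm (mat 1 :: real^'n^'n) = sqrt (real CARD('n))"
      by (simp add: norm_eq_sqrt_inner inner_vec_def mat_def if_distrib[of "\<lambda>t. _ * t"] cong: if_cong)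
    also have "\<dots> \<le> sqrt 4" using assms by (intro real_sqrt_le_mono) simp
    finally show "norm (mat 1 :: real^'n^'n) \<le> sqrt 4" .
  qed simp
  finally show ?thesis by (simp add: mult.commute[of _ "norm A"] mult_left_mono)
qed

section \<open>The discontinuous Galerkin norm\<close>

lemma pow_lincomb:
  assumes "\<And>f g. f \<in> X \<Longrightarrow> g \<in> X \<Longrightarrow> (\<lambda>x. a * f x + b * g x) \<in> X" "v \<in> pow X" "w \<in> pow X"
  shows "(\<lambda>x. a *\<^sub>R v x + b *\<^sub>R w x) \<in> pow X"
  using assms by (simp add: pow_def)

context mesh
begin

abbreviation "VH \<equiv> pow (Collect broken_H1) :: (real^'n \<Rightarrow> real^'n) set"

lemma dG_VH: "v \<in> pow (dG_space M k) \<Longrightarrow> v \<in> VH"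
  unfolding pow_def using dG_broken_H1 by blast

lemma H10_VH: "v \<in> pow (H10 \<Omega>) \<Longrightarrow> v \<in> VH"
  unfolding pow_def using H10_broken_H1 by blast

lemma VH_component: "v \<in> VH \<Longrightarrow> broken_H1 (\<lambda>x. v x $ i)"
  by (simp add: pow_def)

lemma VH_lincomb: "v \<in> VH \<Longrightarrow> w \<in> VH \<Longrightarrow> (\<lambda>x. a *\<^sub>R v x + b *\<^sub>R w x) \<in> VH"
  by (rule pow_lincomb) (simp_all add: broken_H1_lincomb)

lemma dG_lincomb: "v \<in> pow (dG_space M k) \<Longrightarrow> w \<in> pow (dG_space M k) \<Longrightarrow> (\<lambda>x. a *\<^sub>R v x + b *\<^sub>R w x) \<in> pow (dG_space M k)"
  by (rule pow_lincomb) (simp_all add: dG_space_lincomb)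

lemma dG_zero: "(\<lambda>_. 0) \<in> pow (dG_space M k)"
  unfolding pow_def by (auto intro!: dG_spaceI[where P="\<lambda>_ _. 0"] polys_zero)

lemma broken_jac_L2: "v \<in> VH \<Longrightarrow> broken_jac M v \<in> L2 L\<Omega>"
  by (rule L2_vec) (simp add: broken_jac_def broken_grad_L2 VH_component)

lemma broken_jac_lincomb:
  assumes "v \<in> VH" "w \<in> VH"
  shows "AE x in L\<Omega>. broken_jac M (\<lambda>x. a *\<^sub>R v x + b *\<^sub>R w x) x = a *\<^sub>R broken_jac M v x + b *\<^sub>R broken_jac M w x"
proof -
  have "AE x in L\<Omega>. \<forall>i\<in>UNIV. broken_grad M (\<lambda>x. a * v x $ i + b * w x $ i) x =
      a *\<^sub>R broken_grad M (\<lambda>x. v x $ i) x + b *\<^sub>R broken_grad M (\<lambda>x. w x $ i) x"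
    by (intro AE_finite_allI broken_grad_lincomb VH_component assms) simp
  then show ?thesis by eventually_elim (simp add: broken_jac_def vec_eq_iff)
qed

lemma broken_jac_AE_cong: "AE x in L\<Omega>. v x = w x \<Longrightarrow> broken_jac M v = broken_jac M w"
proof -
  assume ae: "AE x in L\<Omega>. v x = w x"
  have "broken_grad M (\<lambda>y. v y $ i) = broken_grad M (\<lambda>y. w y $ i)" for i
    by (rule broken_grad_AE_cong) (use ae in eventually_elim, simp)
  then show ?thesis by (simp add: broken_jac_def fun_eq_iff)
qed

lemma vec_jump_L2: "v \<in> VH \<Longrightarrow> F \<in> faces M \<Longrightarrow> vec_jump M n v F \<in> L2 (face_measure F)"
  by (rule L2_vec) (simp add: vec_jump_def jump_L2 VH_component)

lemma vec_jump_lincomb: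
  assumes "v \<in> VH" "w \<in> VH" "F \<in> faces M"
  shows "AE x in face_measure F. vec_jump M n (\<lambda>x. a *\<^sub>R v x + b *\<^sub>R w x) F x = a *\<^sub>R vec_jump M n v F x + b *\<^sub>R vec_jump M n w F x"
proof -
  have "AE x in face_measure F. \<forall>i\<in>UNIV. jump M n (\<lambda>x. a * v x $ i + b * w x $ i) F x =
      a * jump M n (\<lambda>x. v x $ i) F x + b * jump M n (\<lambda>x. w x $ i) F x"
    by (intro AE_finite_allI jump_lincomb VH_component assms) simp
  then show ?thesis by eventually_elim (simp add: vec_jump_def vec_eq_iff)
qed

lemma vec_jump_AE_cong: "AE x in L\<Omega>. v x = w x \<Longrightarrow> F \<in> faces M \<Longrightarrow> vec_jump M n v F = vec_jump M n w F"
proof -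
  assume ae: "AE x in L\<Omega>. v x = w x" and F: "F \<in> faces M"
  have "jump M n (\<lambda>y. v y $ i) F = jump M n (\<lambda>y. w y $ i) F" for i
    by (rule jump_AE_cong[OF _ F]) (use ae in eventually_elim, simp)
  then show ?thesis by (simp add: vec_jump_def fun_eq_iff)
qed

lemma H10_vec_jump:
  assumes "u \<in> pow (H10 \<Omega>)" "F \<in> faces M"
  shows "AE x in face_measure F. vec_jump M n u F x = 0"
proof -
  have "AE x in face_measure F. \<forall>i\<in>UNIV. jump M n (\<lambda>x. u x $ i) F x = 0"
    using assms by (intro AE_finite_allI H10_jump powD[OF assms(1)]) auto
  then show ?thesis by eventually_elim (simp add: vec_jump_def vec_eq_iff)
qed

lemma H10_broken_jac:
  assumes "u \<in> pow (H10 \<Omega>)"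
  shows "AE x in L\<Omega>. broken_jac M u x = weak_jac \<Omega> u x"
proof -
  have "AE x in L\<Omega>. \<forall>i\<in>UNIV. broken_grad M (\<lambda>x. u x $ i) x = weak_grad \<Omega> (\<lambda>x. u x $ i) x"
    using assms by (intro AE_finite_allI H10_broken_grad powD[OF assms(1)]) auto
  then show ?thesis by eventually_elim (simp add: broken_jac_def weak_jac_def vec_eq_iff)
qed

lemma weak_jac_L2: "u \<in> pow (H10 \<Omega>) \<Longrightarrow> weak_jac \<Omega> u \<in> L2 L\<Omega>"
  by (rule L2_vec) (simp add: weak_jac_def H10_D(3) powD)

text \<open>In dimension at least two a face has dimension at least one and is more than a point.
  Positivity makes the weights \<open>\<eta> / diameter F\<close> genuine.\<close>

lemma face_diameter_pos: "F \<in> faces M \<Longrightarrow> 0 < diameter F"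
proof -
  assume "F \<in> faces M"
  then obtain K where K: "K \<in> M" "F facet_of K" by (auto simp: faces_def)
  have dimF: "aff_dim F = int CARD('n) - 1" using K M_aff_dim by (simp add: facet_of_def)
  obtain x where x: "x \<in> F" using K by (auto simp: facet_of_def)
  have "F \<noteq> {x}" using dimF dim by auto
  then obtain y where y: "y \<in> F" "y \<noteq> x" using x by blast
  have "bounded F" using K M_compact compact_imp_bounded facet_of_imp_subset bounded_subset by meson
  then have "dist x y \<le> diameter F" using x y by (intro diameter_bounded_bound)
  then show ?thesis using y(2) by (smt (verit) zero_less_dist_iff)
qed

section \<open>The bilinear form behind the discontinuous Galerkin norm\<close>

definition dG_form :: "real \<Rightarrow> (real^'n \<Rightarrow> real^'n) \<Rightarrow> (real^'n \<Rightarrow> real^'n) \<Rightarrow> real" where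
  "dG_form \<eta> v w = (\<integral>x. broken_jac M v x \<bullet> broken_jac M w x \<partial>L\<Omega>) +
    (\<Sum>F\<in>faces M. \<eta> / diameter F * (\<integral>x. vec_jump M n v F x \<bullet> vec_jump M n w F x \<partial>face_measure F))"

definition jump_norm :: "real \<Rightarrow> (real^'n \<Rightarrow> real^'n) \<Rightarrow> real" where
  "jump_norm \<eta> v = sqrt (\<Sum>F\<in>faces M. \<eta> / diameter F * (L2_norm (face_measure F) (vec_jump M n v F))\<^sup>2)"

lemma dG_form_self: "dG_form \<eta> v v = (L2_norm L\<Omega> (broken_jac M v))\<^sup>2 +
    (\<Sum>F\<in>faces M. \<eta> / diameter F * (L2_norm (face_measure F) (vec_jump M n v F))\<^sup>2)"
  by (simp add: dG_form_def L2_norm_power2 power2_norm_eq_inner)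

lemma dG_norm_eq: "dG_norm \<Omega> M n \<eta> v = sqrt (dG_form \<eta> v v)"
  by (simp add: dG_norm_def dG_form_def skeleton_integral_def power2_norm_eq_inner)

lemma jump_norm_power2:
  assumes "0 < \<eta>"
  shows "(jump_norm \<eta> v)\<^sup>2 = (\<Sum>F\<in>faces M. \<eta> / diameter F * (L2_norm (face_measure F) (vec_jump M n v F))\<^sup>2)"
  unfolding jump_norm_def using assms face_diameter_pos
  by (intro real_sqrt_pow2 sum_nonneg mult_nonneg_nonneg divide_nonneg_nonneg) (auto intro: less_imp_le)

lemma dG_norm_power2:
  assumes "0 < \<eta>"
  shows "(dG_norm \<Omega> M n \<eta> v)\<^sup>2 = (L2_norm L\<Omega> (broken_jac M v))\<^sup>2 + (jump_norm \<eta> v)\<^sup>2"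
  unfolding dG_norm_eq dG_form_self jump_norm_power2[OF assms, symmetric] by simp

lemma dG_norm_ge:
  assumes "0 < \<eta>"
  shows "L2_norm L\<Omega> (broken_jac M v) \<le> dG_norm \<Omega> M n \<eta> v" "jump_norm \<eta> v \<le> dG_norm \<Omega> M n \<eta> v" "0 \<le> dG_norm \<Omega> M n \<eta> v"
proof -
  show 0: "0 \<le> dG_norm \<Omega> M n \<eta> v"
    unfolding dG_norm_eq dG_form_self jump_norm_power2[OF assms, symmetric] by simp
  show "L2_norm L\<Omega> (broken_jac M v) \<le> dG_norm \<Omega> M n \<eta> v" "jump_norm \<eta> v \<le> dG_norm \<Omega> M n \<eta> v"
    by (rule power2_le_imp_le[OF _ 0], simp add: dG_norm_power2[OF assms])+
qed

lemma vec_jump_integral_lincomb: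
  assumes "v \<in> VH" "w \<in> VH" "F \<in> faces M" and g: "g \<in> L2 (face_measure F)"
  shows "(\<integral>x. vec_jump M n (\<lambda>x. a *\<^sub>R v x + b *\<^sub>R w x) F x \<bullet> g x \<partial>face_measure F) =
    a * (\<integral>x. vec_jump M n v F x \<bullet> g x \<partial>face_measure F) + b * (\<integral>x. vec_jump M n w F x \<bullet> g x \<partial>face_measure F)"
proof -
  have L2: "vec_jump M n v F \<in> L2 (face_measure F)" "vec_jump M n w F \<in> L2 (face_measure F)"
    "vec_jump M n (\<lambda>x. a *\<^sub>R v x + b *\<^sub>R w x) F \<in> L2 (face_measure F)"
    using assms by (auto intro!: vec_jump_L2 VH_lincomb)
  have "(\<integral>x. vec_jump M n (\<lambda>x. a *\<^sub>R v x + b *\<^sub>R w x) F x \<bullet> g x \<partial>face_measure F) =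
      (\<integral>x. (a *\<^sub>R vec_jump M n v F x + b *\<^sub>R vec_jump M n w F x) \<bullet> g x \<partial>face_measure F)"
  proof (rule integral_cong_AE)
    show "AE x in face_measure F. vec_jump M n (\<lambda>x. a *\<^sub>R v x + b *\<^sub>R w x) F x \<bullet> g x =
        (a *\<^sub>R vec_jump M n v F x + b *\<^sub>R vec_jump M n w F x) \<bullet> g x"
      using vec_jump_lincomb[OF assms(1-3), of a b] by eventually_elim simp
  qed (use L2_integrable_inner[OF L2(3) g] L2_integrable_inner[OF L2_lincomb[OF L2(1,2)] g] in auto)
  also have "\<dots> = a * (\<integral>x. vec_jump M n v F x \<bullet> g x \<partial>face_measure F) + b * (\<integral>x. vec_jump M n w F x \<bullet> g x \<partial>face_measure F)"
    using L2_integrable_inner[OF L2(1) g] L2_integrable_inner[OF L2(2) g] by (simp add: inner_add_left)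
  finally show ?thesis .
qed

lemma broken_jac_integral_lincomb:
  assumes "v \<in> VH" "w \<in> VH" and g: "g \<in> L2 L\<Omega>"
  shows "(\<integral>x. broken_jac M (\<lambda>x. a *\<^sub>R v x + b *\<^sub>R w x) x \<bullet> g x \<partial>L\<Omega>) =
    a * (\<integral>x. broken_jac M v x \<bullet> g x \<partial>L\<Omega>) + b * (\<integral>x. broken_jac M w x \<bullet> g x \<partial>L\<Omega>)"
proof -
  have "(\<integral>x. broken_jac M (\<lambda>x. a *\<^sub>R v x + b *\<^sub>R w x) x \<bullet> g x \<partial>L\<Omega>) =
      (\<integral>x. (a *\<^sub>R broken_jac M v x + b *\<^sub>R broken_jac M w x) \<bullet> g x \<partial>L\<Omega>)"
    by (rule lebesgue_on_integral_AE_cong) (use broken_jac_lincomb[OF assms(1,2), of a b] in auto)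
  also have "\<dots> = a * (\<integral>x. broken_jac M v x \<bullet> g x \<partial>L\<Omega>) + b * (\<integral>x. broken_jac M w x \<bullet> g x \<partial>L\<Omega>)"
    using L2_integrable_inner[OF broken_jac_L2[OF assms(1)] g] L2_integrable_inner[OF broken_jac_L2[OF assms(2)] g]
    by (simp add: inner_add_left)
  finally show ?thesis .
qed

lemma dG_form_lincomb:
  assumes "v \<in> VH" "w \<in> VH" "z \<in> VH"
  shows "dG_form \<eta> (\<lambda>x. a *\<^sub>R v x + b *\<^sub>R w x) z = a * dG_form \<eta> v z + b * dG_form \<eta> w z"
  using broken_jac_integral_lincomb[OF assms(1,2) broken_jac_L2[OF assms(3)], of a b]
    vec_jump_integral_lincomb[OF assms(1,2) _ vec_jump_L2[OF assms(3)], of _ a b]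
  by (simp add: dG_form_def sum_distrib_left sum.distrib algebra_simps)

lemma dG_form_sym: "dG_form \<eta> v w = dG_form \<eta> w v"
  by (simp add: dG_form_def inner_commute)

lemma function_form_VH:
  assumes "0 < \<eta>" shows "function_form VH (dG_form \<eta>)"
proof
  show "(\<lambda>_. 0) \<in> VH" using dG_VH[OF dG_zero] .
  show "0 \<le> dG_form \<eta> v v" for v
    unfolding dG_form_self jump_norm_power2[OF assms, symmetric] by simp
qed (rule VH_lincomb dG_form_sym dG_form_lincomb; assumption)+

lemma function_form_dG:
  assumes "0 < \<eta>" shows "function_form (pow (dG_space M k)) (dG_form \<eta>)"
proof
  show "0 \<le> dG_form \<eta> v v" for v
    unfolding dG_form_self jump_norm_power2[OF assms, symmetric] by simp
qed (rule dG_zero dG_lincomb dG_form_sym dG_form_lincomb[OF dG_VH dG_VH dG_VH]; assumption)+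

lemma dG_norm_triangle:
  assumes "0 < \<eta>" "v \<in> VH" "w \<in> VH" "z \<in> VH"
  shows "dG_norm \<Omega> M n \<eta> (\<lambda>x. v x - z x) \<le> dG_norm \<Omega> M n \<eta> (\<lambda>x. v x - w x) + dG_norm \<Omega> M n \<eta> (\<lambda>x. z x - w x)"
proof -
  have *: "(\<lambda>x. v x - w x) \<in> VH" "(\<lambda>x. z x - w x) \<in> VH"
    using VH_lincomb[OF assms(2,3), of 1 "-1"] VH_lincomb[OF assms(4,3), of 1 "-1"] by auto
  show ?thesis
    using function_form.Q_norm_lincomb_le[OF function_form_VH[OF assms(1)] *, of 1 "-1"] by (simp add: dG_norm_eq)
qed

lemma dG_form_AE_cong:
  assumes "AE x in L\<Omega>. v x = w x" shows "dG_form \<eta> v v = dG_form \<eta> w w"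
  by (simp add: dG_form_def broken_jac_AE_cong[OF assms] vec_jump_AE_cong[OF assms])

text \<open>
  A broken function without gradient and jumps is orthogonal to all derivatives of smooth functions.
\<close>

lemma dG_form_definite:
  assumes \<eta>: "0 < \<eta>" and v: "v \<in> VH" and 0: "dG_form \<eta> v v = 0"
  shows "AE x in L\<Omega>. v x = 0"
proof -
  have nonneg: "0 \<le> \<eta> / diameter F * (L2_norm (face_measure F) (vec_jump M n v F))\<^sup>2" if "F \<in> faces M" for F
    using \<eta> face_diameter_pos[OF that] by simp
  have sum0: "(\<Sum>F\<in>faces M. \<eta> / diameter F * (L2_norm (face_measure F) (vec_jump M n v F))\<^sup>2) = 0"
    and "(L2_norm L\<Omega> (broken_jac M v))\<^sup>2 = 0"
  proof -
    have "0 \<le> (\<Sum>F\<in>faces M. \<eta> / diameter F * (L2_norm (face_measure F) (vec_jump M n v F))\<^sup>2)"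
      by (rule sum_nonneg) (rule nonneg)
    moreover have "0 \<le> (L2_norm L\<Omega> (broken_jac M v))\<^sup>2" by simp
    ultimately show "(\<Sum>F\<in>faces M. \<eta> / diameter F * (L2_norm (face_measure F) (vec_jump M n v F))\<^sup>2) = 0"
      "(L2_norm L\<Omega> (broken_jac M v))\<^sup>2 = 0"
      using 0 unfolding dG_form_self by linarith+
  qed
  then have jac: "AE x in L\<Omega>. broken_jac M v x = 0" using L2_norm_eq_0_AE[OF broken_jac_L2[OF v]] by simp
  have jump: "AE x in face_measure F. vec_jump M n v F x = 0" if F: "F \<in> faces M" for F
  proof -
    have "\<eta> / diameter F * (L2_norm (face_measure F) (vec_jump M n v F))\<^sup>2 = 0"
      by (rule sum_nonneg_0[OF finite_faces _ sum0 F]) (rule nonneg)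
    then have "L2_norm (face_measure F) (vec_jump M n v F) = 0" using \<eta> face_diameter_pos[OF F] by simp
    then show ?thesis by (rule L2_norm_eq_0_AE[OF vec_jump_L2[OF v F]])
  qed
  have "AE x in L\<Omega>. v x $ j = 0" for j
  proof (rule bump_orthogonal_AE_zero[OF open_\<Omega>])
    let ?y = "\<lambda>x. v x $ j"
    have y: "broken_H1 ?y" by (rule VH_component[OF v])
    have fin: "finite_measure L\<Omega>" by (intro finite_measure_lebesgue_on lmeasurable_open bounded_\<Omega> open_\<Omega>)
    show "integrable L\<Omega> ?y" by (rule L2_integrable[OF fin broken_H1_L2[OF y]])
    fix a b :: "real^'n" and k
    \<comment> \<open>A single coordinate direction suffices, since every bump is a partial
      derivative of some smooth function in that direction.\<close>
    obtain i :: 'n where True by simp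
    obtain \<psi> where \<psi>: "smooth \<psi>" "\<And>x. grad \<psi> x $ i = bump a b k x"
      by (rule bump_eq_grad[where i=i and a=a and b=b and k=k]) blast
    have "(\<integral>x. \<psi> x * broken_grad M ?y x $ i \<partial>L\<Omega>) = 0"
    proof (rule integral_eq_zero_AE)
      show "AE x in L\<Omega>. \<psi> x * broken_grad M ?y x $ i = 0"
        using jac by eventually_elim (auto simp: broken_jac_def vec_eq_iff)
    qed
    moreover have "(\<integral>x. average M n \<psi> F x * jump M n ?y F x \<partial>face_measure F) = 0" if F: "F \<in> faces M" for F
    proof (rule integral_eq_zero_AE)
      show "AE x in face_measure F. average M n \<psi> F x * jump M n ?y F x = 0"
        using jump[OF F] by eventually_elim (auto simp: vec_jump_def vec_eq_iff)
    qed
    \<comment> \<open>Gradient and jumps of \<open>v\<close> vanish, and the interior face term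
      drops because \<open>\<psi>\<close> is the same smooth function on both sides. Only the volume
      term is left.\<close>
    ultimately have "(\<Sum>K\<in>M. \<integral>x. ?y x * grad \<psi> x $ i \<partial>LI K) = 0"
      using broken_integration_by_parts[OF y, of "\<lambda>_. \<psi>" \<psi> i] \<psi>(1) by simp
    moreover have "(\<integral>x. ?y x * grad \<psi> x $ i \<partial>L\<Omega>) = (\<Sum>K\<in>M. \<integral>x. ?y x * grad \<psi> x $ i \<partial>LI K)"
      using simplex_element.smooth_L2[OF element smooth_grad_component[OF \<psi>(1)]] H1_elem_L2[OF broken_H1_elem[OF y]]
      by (intro integral_mesh L2_integrable_mult) auto
    ultimately show "(\<integral>x. v x $ j * bump a b k x \<partial>L\<Omega>) = 0" using \<psi>(2) by simp
  qed
  then have "AE x in L\<Omega>. \<forall>j\<in>UNIV. v x $ j = 0" by (intro AE_finite_allI) auto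
  then show ?thesis by eventually_elim (simp add: vec_eq_iff)
qed

text \<open>Generators of the discrete velocities up to null sets. Interiors in place of the
  elements make the supports of different elements disjoint.\<close>

definition basis_fun :: "(real^'n) set \<times> ('n \<Rightarrow> nat) \<times> 'n \<Rightarrow> real^'n \<Rightarrow> real^'n" where
  "basis_fun = (\<lambda>(K, \<alpha>, j) x. (indicator (interior K) x * monom_fun \<alpha> x) *\<^sub>R axis j 1)"

lemma basis_fun_dG:
  assumes "K \<in> M" "\<alpha> \<in> multi_indices k"
  shows "basis_fun (K, \<alpha>, j) \<in> pow (dG_space M k)"
  unfolding pow_def
proof (intro CollectI allI)
  fix i
  let ?P = "\<lambda>K'. if K' = K \<and> i = j then monom_fun \<alpha> else (\<lambda>_. 0)"
  show "(\<lambda>x. basis_fun (K, \<alpha>, j) x $ i) \<in> dG_space M k"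
  proof (rule dG_spaceI[where P="?P"])
    show "?P K' \<in> polys k" for K' using assms(2) by (auto intro: monom_fun_polys polys_zero)
    fix K' assume K': "K' \<in> M"
    have "basis_fun (K, \<alpha>, j) x $ i = ?P K' x" if "x \<in> interior K'" for x
      using interiors_disjoint[OF assms(1) K'] that
      by (cases "K' = K") (auto simp: basis_fun_def axis_def indicator_def)
    then show "AE x in LI K'. basis_fun (K, \<alpha>, j) x $ i = ?P K' x" by (intro AE_I2) simp
  qed
qed

lemma basis_fun_span:
  assumes v: "v \<in> pow (dG_space M k)"
  obtains c where "AE x in L\<Omega>. v x = (\<Sum>z\<in>M \<times> multi_indices k \<times> UNIV. c z *\<^sub>R basis_fun z x)"
proof -
  have "\<forall>j. \<exists>P. \<forall>K\<in>M. P K \<in> polys k \<and> (AE x in LI K. v x $ j = P K x)"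
  proof
    fix j
    obtain P where "\<And>K. K \<in> M \<Longrightarrow> P K \<in> polys k" "\<And>K. K \<in> M \<Longrightarrow> AE x in LI K. v x $ j = P K x"
      using powD[OF v, of j] by (rule dG_space_polys) blast
    then show "\<exists>P. \<forall>K\<in>M. P K \<in> polys k \<and> (AE x in LI K. v x $ j = P K x)"
      by (intro exI[of _ P]) simp
  qed
  from choice[OF this] obtain P where PP: "\<forall>j. \<forall>K\<in>M. P j K \<in> polys k \<and> (AE x in LI K. v x $ j = P j K x)" ..
  have P: "P j K \<in> polys k" "AE x in LI K. v x $ j = P j K x" if "K \<in> M" for j K
    using PP that by simp_all
  define c where "c j K = (SOME c. P j K = (\<lambda>x. \<Sum>\<alpha>\<in>multi_indices k. c \<alpha> * monom_fun \<alpha> x))" for j K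
  have c: "P j K x = (\<Sum>\<alpha>\<in>multi_indices k. c j K \<alpha> * monom_fun \<alpha> x)" if "K \<in> M" for j K x
    using someI_ex[OF P(1)[OF that, of j, unfolded polys_iff]] unfolding c_def[symmetric] by (rule fun_cong)
  define d where "d = (\<lambda>(K, \<alpha>, j). c j K \<alpha>)"
  have "AE x in L\<Omega>. v x = (\<Sum>z\<in>M \<times> multi_indices k \<times> UNIV. d z *\<^sub>R basis_fun z x)"
  proof (rule AE_\<Omega>I)
    fix K assume K: "K \<in> M"
    have "AE x in LI K. \<forall>j\<in>UNIV. v x $ j = P j K x"
      using P(2)[OF K] by (intro AE_finite_allI) auto
    moreover have "AE x in LI K. x \<in> interior K" by (intro AE_I2) simp
    ultimately show "AE x in LI K. v x = (\<Sum>z\<in>M \<times> multi_indices k \<times> UNIV. d z *\<^sub>R basis_fun z x)"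
    proof eventually_elim
      case (elim x)
      have ind: "indicator (interior K') x = (if K' = K then 1 else 0 :: real)" if "K' \<in> M" for K'
        using interiors_disjoint[OF K that] elim(2) by (auto simp: indicator_def)
      have "(\<Sum>z\<in>M \<times> multi_indices k \<times> UNIV. d z *\<^sub>R basis_fun z x) $ i = v x $ i" for i
      proof -
        have "(\<Sum>z\<in>M \<times> multi_indices k \<times> UNIV. d z *\<^sub>R basis_fun z x) $ i =
            (\<Sum>K'\<in>M. \<Sum>\<alpha>\<in>multi_indices k. \<Sum>j\<in>UNIV. c j K' \<alpha> * (indicator (interior K') x * monom_fun \<alpha> x) * (if i = j then 1 else 0))"
          by (simp add: sum_component sum.cartesian_product' d_def basis_fun_def axis_def mult.assoc)
        also have "\<dots> = (\<Sum>K'\<in>M. \<Sum>\<alpha>\<in>multi_indices k. c i K' \<alpha> * (indicator (interior K') x * monom_fun \<alpha> x))"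
          by (simp add: if_distrib[of "\<lambda>t. _ * t"] cong: if_cong)
        also have "\<dots> = (\<Sum>K'\<in>M. if K' = K then (\<Sum>\<alpha>\<in>multi_indices k. c i K' \<alpha> * monom_fun \<alpha> x) else 0)"
          by (intro sum.cong refl) (simp add: ind)
        also have "\<dots> = v x $ i" using K finite_M elim(1) c[OF K] by simp
        finally show ?thesis .
      qed
      then show ?case by (simp add: vec_eq_iff)
    qed
  qed
  then show ?thesis by (rule that)
qed

end

section \<open>Bounds for the bilinear forms\<close>

lemma weak_jac_AE_cong:
  assumes "open U" "AE x in lebesgue_on U. v x = w x"
  shows "weak_jac U v = weak_jac U w"
proof -
  have "weak_grad U (\<lambda>y. v y $ i) = weak_grad U (\<lambda>y. w y $ i)" for i
    by (rule weak_grad_AE_cong[OF assms(1)]) (use assms(2) in eventually_elim, simp)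
  then show ?thesis by (simp add: weak_jac_def fun_eq_iff)
qed

context mesh
begin

lemma weak_jac_lincomb:
  assumes "v \<in> pow (H10 \<Omega>)" "w \<in> pow (H10 \<Omega>)"
  shows "AE x in L\<Omega>. weak_jac \<Omega> (\<lambda>x. a *\<^sub>R v x + b *\<^sub>R w x) x = a *\<^sub>R weak_jac \<Omega> v x + b *\<^sub>R weak_jac \<Omega> w x"
proof -
  have "AE x in L\<Omega>. weak_grad \<Omega> (\<lambda>x. a * v x $ i + b * w x $ i) x =
      a *\<^sub>R weak_grad \<Omega> (\<lambda>x. v x $ i) x + b *\<^sub>R weak_grad \<Omega> (\<lambda>x. w x $ i) x" for i
    by (intro weak_grad_AE open_\<Omega> bounded_\<Omega> is_weak_grad_lincomb H10_D powD[OF assms(1)] powD[OF assms(2)])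
  then have "AE x in L\<Omega>. \<forall>i\<in>UNIV. weak_grad \<Omega> (\<lambda>x. a * v x $ i + b * w x $ i) x =
      a *\<^sub>R weak_grad \<Omega> (\<lambda>x. v x $ i) x + b *\<^sub>R weak_grad \<Omega> (\<lambda>x. w x $ i) x"
    by (intro AE_finite_allI) auto
  then show ?thesis by eventually_elim (simp add: weak_jac_def vec_eq_iff)
qed

end

locale smoothed_mesh = mesh \<Omega> M n
  for \<Omega> :: "(real^'n) set" and M :: "(real^'n) set set" and n :: "(real^'n) set \<Rightarrow> real^'n" +
  fixes l :: nat and E :: "(real^'n \<Rightarrow> real^'n) \<Rightarrow> (real^'n \<Rightarrow> real^'n)" and \<eta> etabar :: real
  assumes small_dim: "CARD('n) \<le> 4"
    and smoother: "linear_smoother \<Omega> M l E" and moments: "preserves_moments M n l E"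
    and trace_bound: "trace_const \<Omega> M n l etabar" and eta: "etabar < \<eta>"
begin

abbreviation "V \<equiv> pow (dG_space M (int l))"
abbreviation "Dq \<equiv> dG_space_0 \<Omega> M (int l - 1)"
abbreviation "nrm \<equiv> dG_norm \<Omega> M n \<eta>"
abbreviation "gradE v \<equiv> weak_jac \<Omega> (E v)"
abbreviation "\<kappa> \<equiv> sqrt (etabar / \<eta>)"

lemma etabar_pos: "0 < etabar" and eta_pos: "0 < \<eta>"
  using trace_bound eta by (auto simp: trace_const_def)

lemma \<kappa>_bounds: "0 \<le> \<kappa>" "\<kappa> < 1"
  using etabar_pos eta_pos eta by auto

lemma E_H10: "v \<in> V \<Longrightarrow> E v \<in> pow (H10 \<Omega>)"
  using smoother by (simp add: linear_smoother_def)

lemma gradE_L2: "v \<in> V \<Longrightarrow> gradE v \<in> L2 L\<Omega>"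
  by (intro weak_jac_L2 E_H10)

lemma gradE_AE_cong:
  assumes "v \<in> V" "w \<in> V" "AE x in L\<Omega>. v x = w x"
  shows "gradE v = gradE w"
  by (rule weak_jac_AE_cong[OF open_\<Omega>]) (use smoother assms in \<open>simp add: linear_smoother_def\<close>)

lemma gradE_lincomb:
  assumes "v \<in> V" "w \<in> V"
  shows "AE x in L\<Omega>. gradE (\<lambda>x. a *\<^sub>R v x + b *\<^sub>R w x) x = a *\<^sub>R gradE v x + b *\<^sub>R gradE w x"
proof -
  have "AE x in L\<Omega>. E (\<lambda>x. a *\<^sub>R v x + b *\<^sub>R w x) x = a *\<^sub>R E v x + b *\<^sub>R E w x"
    using smoother assms unfolding linear_smoother_def by blast
  from weak_jac_AE_cong[OF open_\<Omega> this] show ?thesis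
    using weak_jac_lincomb[OF E_H10[OF assms(1)] E_H10[OF assms(2)], of a b] by simp
qed

lemma gradE_norm_lincomb:
  assumes "v \<in> V" "w \<in> V"
  shows "L2_norm L\<Omega> (gradE (\<lambda>x. a *\<^sub>R v x + b *\<^sub>R w x)) \<le> \<bar>a\<bar> * L2_norm L\<Omega> (gradE v) + \<bar>b\<bar> * L2_norm L\<Omega> (gradE w)"
  using L2_norm_lebesgue_on_AE_cong[OF lebesgue_\<Omega> gradE_lincomb[OF assms, of a b]]
    L2_norm_lincomb_le[OF gradE_L2[OF assms(1)] gradE_L2[OF assms(2)], of a b] by simp

lemma gradE_zero_if_AE_zero:
  assumes "v \<in> V" "AE x in L\<Omega>. v x = 0"
  shows "L2_norm L\<Omega> (gradE v) = 0"
proof -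
  have "L2_norm L\<Omega> (gradE (\<lambda>_. 0)) \<le> 0"
    using gradE_norm_lincomb[OF dG_zero dG_zero, of 0 0] by simp
  moreover have "gradE v = gradE (\<lambda>_. 0)" by (rule gradE_AE_cong[OF assms(1) dG_zero assms(2)])
  ultimately show ?thesis by (simp add: order_antisym)
qed

text \<open>Finite-dimensionality is applied to the seminorm that sends \<open>v\<close> to the norm
  of \<open>gradE v\<close>. Where \<open>dG_form\<close> vanishes, \<open>v\<close> vanishes almost
  everywhere, and so does the gradient of \<open>E v\<close>. The constant may depend on all data;
  its existence makes the supremum in \<open>smoother_norm\<close> finite.\<close>

lemma smoother_bounded:
  obtains C where "0 \<le> C" "\<And>v. v \<in> V \<Longrightarrow> L2_norm L\<Omega> (gradE v) \<le> C * nrm v"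
proof -
  interpret function_form V "dG_form \<eta>" by (rule function_form_dG[OF eta_pos])
  let ?I = "M \<times> multi_indices (int l) \<times> (UNIV :: 'n set)"
  have I: "finite ?I" by (intro finite_cartesian_product finite_M finite_multi_indices finite)
  have f: "basis_fun z \<in> V" if "z \<in> ?I" for z
    using that basis_fun_dG by (cases z) auto
  have "(\<exists>C\<ge>0. \<forall>v\<in>span_of ?I basis_fun. L2_norm L\<Omega> (gradE v) \<le> C * sqrt (dG_form \<eta> v v)) \<and>
    (\<forall>z\<in>V. \<exists>p\<in>span_of ?I basis_fun. \<forall>y\<in>span_of ?I basis_fun. dG_form \<eta> (\<lambda>x. 1 *\<^sub>R z x + (-1) *\<^sub>R p x) y = 0)"
  proof (rule finite_dimensional_seminorm_bound[OF I f])
    show "L2_norm L\<Omega> (gradE v) = 0" if "v \<in> V" "dG_form \<eta> v v = 0" for v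
      using dG_form_definite[OF eta_pos dG_VH that(2)] that by (intro gradE_zero_if_AE_zero) auto
  qed (auto intro: gradE_norm_lincomb)
  then obtain C where C: "0 \<le> C" "\<And>v. v \<in> span_of ?I basis_fun \<Longrightarrow> L2_norm L\<Omega> (gradE v) \<le> C * sqrt (dG_form \<eta> v v)"
    by blast
  have "L2_norm L\<Omega> (gradE v) \<le> C * nrm v" if v: "v \<in> V" for v
  proof -
    obtain c where c: "AE x in L\<Omega>. v x = (\<Sum>z\<in>?I. c z *\<^sub>R basis_fun z x)"
      using v by (rule basis_fun_span)
    \<comment> \<open>A discrete function agrees with a combination of the generators only almost
      everywhere; \<open>gradE\<close> and the norm do not see the difference.\<close>
    let ?s = "\<lambda>x. \<Sum>z\<in>?I. c z *\<^sub>R basis_fun z x"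
    have s: "?s \<in> span_of ?I basis_fun" by (rule span_ofI)
    have "?s \<in> V" by (rule subsetD[OF span_of_subset[OF I f] s])
    then have "gradE v = gradE ?s" using v c by (intro gradE_AE_cong)
    then show ?thesis using C(2)[OF s] dG_form_AE_cong[OF c, of \<eta>] by (simp add: dG_norm_eq)
  qed
  from that[OF C(1) this] show ?thesis .
qed

abbreviation "normE \<equiv> smoother_norm \<Omega> M n l \<eta> E"

text \<open>A supremum of reals is an upper bound only for a set that is bounded above, which
  \<open>smoother_bounded\<close> provides.\<close>

lemma
  shows smoother_norm_bound: "v \<in> V \<Longrightarrow> L2_norm L\<Omega> (gradE v) \<le> normE * nrm v" and normE_nonneg: "0 \<le> normE"
proof -
  obtain C where C: "0 \<le> C" "\<And>v. v \<in> V \<Longrightarrow> L2_norm L\<Omega> (gradE v) \<le> C * nrm v" by (rule smoother_bounded) blast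
  let ?q = "\<lambda>v. L2_norm L\<Omega> (gradE v) / nrm v"
  have q: "?q v \<le> C" if "v \<in> V" for v
    using C(2)[OF that] C(1) dG_norm_ge(3)[OF eta_pos, of v] by (cases "nrm v = 0") (auto simp: divide_le_eq)
  then have "bdd_above (?q ` V)" by (intro bdd_aboveI2) (rule q)
  then have upper: "?q v \<le> normE" if "v \<in> V" for v
    unfolding smoother_norm_def using that by (rule cSUP_upper[rotated])
  have "0 \<le> ?q (\<lambda>_. 0)" using dG_norm_ge(3)[OF eta_pos] by simp
  then show "0 \<le> normE" using upper[OF dG_zero] by linarith
  show "L2_norm L\<Omega> (gradE v) \<le> normE * nrm v" if "v \<in> V"
  proof (cases "nrm v = 0")
    case True
    \<comment> \<open>Here the quotient is 0 by convention and carries no information, so the bound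
      with \<open>C\<close> is used directly.\<close>
    then show ?thesis using C(2)[OF that] by simp
  next
    case False
    then have "0 < nrm v" using dG_norm_ge(3)[OF eta_pos, of v] by simp
    then show ?thesis using upper[OF that] by (simp add: divide_le_eq)
  qed
qed

section \<open>Estimates for face fluxes and for the extended form\<close>

definition flux :: "(real^'n \<Rightarrow> real^'n) \<Rightarrow> (real^'n) set \<Rightarrow> real^'n \<Rightarrow> real^'n" where
  "flux v F x = mat_average M n (broken_jac M v) F x *v n F"

lemma broken_jac_dG:
  assumes "v \<in> V" shows "broken_jac M v \<in> pow (pow (dG_space M (int l)))"
  unfolding pow_def using dG_space_mono[OF dG_broken_grad[OF powD[OF assms]]] by (simp add: broken_jac_def)

lemma mat_average_L2:
  assumes "v \<in> V" "F \<in> faces M"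
  shows "mat_average M n (broken_jac M v) F \<in> L2 (face_measure F)"
proof (rule L2_vec, rule L2_vec)
  fix i j
  have "(\<lambda>x. broken_jac M v x $ i $ j) \<in> dG_space M (int l)"
    using powD[OF powD[OF broken_jac_dG[OF assms(1)]]] .
  from average_L2[OF dG_broken_H1[OF this] assms(2)]
  show "(\<lambda>x. mat_average M n (broken_jac M v) F x $ i $ j) \<in> L2 (face_measure F)"
    by (simp add: mat_average_def)
qed

lemma
  assumes "v \<in> V" "F \<in> faces M"
  shows flux_L2: "flux v F \<in> L2 (face_measure F)"
    and flux_norm: "L2_norm (face_measure F) (flux v F) \<le> L2_norm (face_measure F) (mat_average M n (broken_jac M v) F)"
proof -
  note A = mat_average_L2[OF assms]
  show f: "flux v F \<in> L2 (face_measure F)"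
  proof (rule L2_vec)
    fix i
    have "(\<lambda>x. \<Sum>j\<in>UNIV. n F $ j * mat_average M n (broken_jac M v) F x $ i $ j) \<in> L2 (face_measure F)"
      by (intro L2_sum L2_mult L2_component A) simp
    then show "(\<lambda>x. flux v F x $ i) \<in> L2 (face_measure F)"
      by (simp add: flux_def matrix_vector_mult_def mult.commute)
  qed
  show "L2_norm (face_measure F) (flux v F) \<le> L2_norm (face_measure F) (mat_average M n (broken_jac M v) F)"
    by (rule L2_norm_mono[OF f A])
       (use norm_matrix_vector_mult_le[of _ "n F"] norm_n[OF assms(2)] in \<open>simp add: flux_def\<close>)
qed

lemma jump_norm_nonneg: "0 \<le> jump_norm \<eta> w"
  unfolding jump_norm_def using eta_pos face_diameter_pos
  by (intro real_sqrt_ge_zero sum_nonneg mult_nonneg_nonneg divide_nonneg_nonneg) (auto intro: less_imp_le)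

text \<open>The Cauchy-Schwarz inequality with the weight \<open>\<eta> / diameter F\<close> on the
  jumps and its inverse on the fluxes. The discrete trace inequality for the fluxes then leaves
  \<open>etabar / \<eta>\<close>, whose root is \<open>\<kappa>\<close>.\<close>

lemma flux_jump_bound:
  assumes v: "v \<in> V" and w: "w \<in> VH"
  shows "\<bar>\<Sum>F\<in>faces M. \<integral>x. vec_jump M n w F x \<bullet> flux v F x \<partial>face_measure F\<bar> \<le>
    \<kappa> * L2_norm L\<Omega> (broken_jac M v) * jump_norm \<eta> w"
proof -
  let ?j = "\<lambda>F. sqrt (\<eta> / diameter F) * L2_norm (face_measure F) (vec_jump M n w F)"
  let ?f = "\<lambda>F. sqrt (diameter F / \<eta>) * L2_norm (face_measure F) (flux v F)"
  have d: "0 < diameter F" if "F \<in> faces M" for F using that by (rule face_diameter_pos)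
  have "\<bar>\<Sum>F\<in>faces M. \<integral>x. vec_jump M n w F x \<bullet> flux v F x \<partial>face_measure F\<bar> \<le>
      (\<Sum>F\<in>faces M. \<bar>\<integral>x. vec_jump M n w F x \<bullet> flux v F x \<partial>face_measure F\<bar>)" by (rule sum_abs)
  also have "\<dots> \<le> (\<Sum>F\<in>faces M. \<bar>?j F\<bar> * \<bar>?f F\<bar>)"
  proof (rule sum_mono)
    fix F assume F: "F \<in> faces M"
    have one: "sqrt (\<eta> / diameter F) * sqrt (diameter F / \<eta>) = 1"
      using d[OF F] eta_pos by (simp add: real_sqrt_mult[symmetric])
    have nonneg: "0 \<le> ?j F" "0 \<le> ?f F" using d[OF F] eta_pos by auto
    have "\<bar>\<integral>x. vec_jump M n w F x \<bullet> flux v F x \<partial>face_measure F\<bar> \<le>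
        L2_norm (face_measure F) (vec_jump M n w F) * L2_norm (face_measure F) (flux v F)"
      by (rule L2_CS[OF vec_jump_L2[OF w F] flux_L2[OF v F]])
    also have "\<dots> = (sqrt (\<eta> / diameter F) * sqrt (diameter F / \<eta>)) *
        (L2_norm (face_measure F) (vec_jump M n w F) * L2_norm (face_measure F) (flux v F))"
      unfolding one by simp
    also have "\<dots> = ?j F * ?f F" by (simp only: mult_ac)
    also have "\<dots> = \<bar>?j F\<bar> * \<bar>?f F\<bar>" using nonneg by (simp only: abs_of_nonneg)
    finally show "\<bar>\<integral>x. vec_jump M n w F x \<bullet> flux v F x \<partial>face_measure F\<bar> \<le> \<bar>?j F\<bar> * \<bar>?f F\<bar>" .
  qed
  also have "\<dots> \<le> L2_set ?j (faces M) * L2_set ?f (faces M)" by (rule L2_set_mult_ineq)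
  also have "L2_set ?j (faces M) = jump_norm \<eta> w"
    unfolding L2_set_def jump_norm_def using d eta_pos
    by (intro arg_cong[where f=sqrt] sum.cong refl) (simp add: power_mult_distrib less_imp_le)
  also have "jump_norm \<eta> w * L2_set ?f (faces M) \<le> jump_norm \<eta> w * (\<kappa> * L2_norm L\<Omega> (broken_jac M v))"
  proof (rule mult_left_mono[OF _ jump_norm_nonneg])
    have "(\<Sum>F\<in>faces M. (?f F)\<^sup>2) = (\<Sum>F\<in>faces M. diameter F * (L2_norm (face_measure F) (flux v F))\<^sup>2) / \<eta>"
      unfolding sum_divide_distrib using d eta_pos
      by (intro sum.cong refl) (simp add: power_mult_distrib less_imp_le)
    also have "\<dots> \<le> (\<Sum>F\<in>faces M. diameter F * (L2_norm (face_measure F) (mat_average M n (broken_jac M v) F))\<^sup>2) / \<eta>"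
      using d eta_pos flux_norm[OF v]
      by (intro divide_right_mono sum_mono mult_left_mono power_mono) (auto intro: less_imp_le)
    also have "\<dots> = skeleton_integral M (\<lambda>F x. diameter F * (norm (mat_average M n (broken_jac M v) F x))\<^sup>2) / \<eta>"
      by (simp add: skeleton_integral_def L2_norm_power2)
    also have "\<dots> \<le> etabar * (L2_norm L\<Omega> (broken_jac M v))\<^sup>2 / \<eta>"
      using trace_bound broken_jac_dG[OF v] eta_pos by (intro divide_right_mono) (auto simp: trace_const_def)
    finally have "sqrt (\<Sum>F\<in>faces M. (?f F)\<^sup>2) \<le> sqrt (etabar / \<eta> * (L2_norm L\<Omega> (broken_jac M v))\<^sup>2)"
      by (intro real_sqrt_le_mono) simp
    also have "\<dots> = \<kappa> * sqrt ((L2_norm L\<Omega> (broken_jac M v))\<^sup>2)" by (rule real_sqrt_mult)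
    also have "\<dots> = \<kappa> * L2_norm L\<Omega> (broken_jac M v)" by simp
    finally show "L2_set ?f (faces M) \<le> \<kappa> * L2_norm L\<Omega> (broken_jac M v)" unfolding L2_set_def .
  qed
  finally show ?thesis by (simp only: mult_ac)
qed

text \<open>
  By the moment conditions, \<open>a_dG\<close> agrees on discrete functions with a form that is also defined,
  and consistent, for Sobolev functions in the first argument.
\<close>

definition extended_a :: "(real^'n \<Rightarrow> real^'n) \<Rightarrow> (real^'n \<Rightarrow> real^'n) \<Rightarrow> real" where
  "extended_a w v = (\<integral>x. broken_jac M w x \<bullet> gradE v x \<partial>L\<Omega>)
     - (\<Sum>F\<in>faces M. \<integral>x. vec_jump M n w F x \<bullet> flux v F x \<partial>face_measure F)
     + (\<Sum>F\<in>faces M. \<eta> / diameter F * (\<integral>x. vec_jump M n w F x \<bullet> vec_jump M n v F x \<partial>face_measure F))"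

lemma a_dG_eq_extended:
  assumes "w \<in> V" "v \<in> V"
  shows "a_dG \<Omega> M n \<eta> w v = extended_a w v"
  using a_dG_consistency[OF smoother moments assms(2,1)]
  by (simp add: a_dG_def extended_a_def skeleton_integral_def flux_def)

lemma extended_a_lincomb:
  assumes "w \<in> VH" "z \<in> VH" "v \<in> V"
  shows "extended_a (\<lambda>x. a *\<^sub>R w x + b *\<^sub>R z x) v = a * extended_a w v + b * extended_a z v"
  using broken_jac_integral_lincomb[OF assms(1,2) gradE_L2[OF assms(3)], of a b]
    vec_jump_integral_lincomb[OF assms(1,2) _ flux_L2[OF assms(3)], of _ a b]
    vec_jump_integral_lincomb[OF assms(1,2) _ vec_jump_L2[OF dG_VH[OF assms(3)]], of _ a b]
  by (simp add: extended_a_def sum_distrib_left sum.distrib algebra_simps)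

lemma extended_a_H10:
  assumes "u \<in> pow (H10 \<Omega>)" "v \<in> V"
  shows "extended_a u v = (\<integral>x. weak_jac \<Omega> u x \<bullet> gradE v x \<partial>L\<Omega>)"
proof -
  have "(\<integral>x. vec_jump M n u F x \<bullet> g x \<partial>face_measure F) = 0" if "F \<in> faces M" for F and g :: "real^'n \<Rightarrow> real^'n"
    by (rule integral_eq_zero_AE) (use H10_vec_jump[OF assms(1) that] in auto)
  moreover have "(\<integral>x. broken_jac M u x \<bullet> gradE v x \<partial>L\<Omega>) = (\<integral>x. weak_jac \<Omega> u x \<bullet> gradE v x \<partial>L\<Omega>)"
    by (rule lebesgue_on_integral_AE_cong) (use H10_broken_jac[OF assms(1)] in auto)
  ultimately show ?thesis by (simp add: extended_a_def)
qed

lemma jump_form_bound: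
  assumes "w \<in> VH" "v \<in> VH"
  shows "\<bar>\<Sum>F\<in>faces M. \<eta> / diameter F * (\<integral>x. vec_jump M n w F x \<bullet> vec_jump M n v F x \<partial>face_measure F)\<bar> \<le> jump_norm \<eta> w * jump_norm \<eta> v"
proof -
  let ?j = "\<lambda>w F. sqrt (\<eta> / diameter F) * L2_norm (face_measure F) (vec_jump M n w F)"
  have d: "0 < diameter F" if "F \<in> faces M" for F using that by (rule face_diameter_pos)
  have "\<bar>\<Sum>F\<in>faces M. \<eta> / diameter F * (\<integral>x. vec_jump M n w F x \<bullet> vec_jump M n v F x \<partial>face_measure F)\<bar> \<le>
      (\<Sum>F\<in>faces M. \<bar>\<eta> / diameter F * (\<integral>x. vec_jump M n w F x \<bullet> vec_jump M n v F x \<partial>face_measure F)\<bar>)" by (rule sum_abs)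
  also have "\<dots> \<le> (\<Sum>F\<in>faces M. \<bar>?j w F\<bar> * \<bar>?j v F\<bar>)"
  proof (rule sum_mono)
    fix F assume F: "F \<in> faces M"
    have e: "0 \<le> \<eta> / diameter F" using d[OF F] eta_pos by simp
    have "\<bar>\<eta> / diameter F * (\<integral>x. vec_jump M n w F x \<bullet> vec_jump M n v F x \<partial>face_measure F)\<bar> =
        \<eta> / diameter F * \<bar>\<integral>x. vec_jump M n w F x \<bullet> vec_jump M n v F x \<partial>face_measure F\<bar>"
      using e by (simp only: abs_mult abs_of_nonneg)
    also have "\<dots> \<le> \<eta> / diameter F * (L2_norm (face_measure F) (vec_jump M n w F) * L2_norm (face_measure F) (vec_jump M n v F))"
      by (rule mult_left_mono[OF L2_CS[OF vec_jump_L2[OF assms(1) F] vec_jump_L2[OF assms(2) F]] e])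
    also have "\<dots> = (sqrt (\<eta> / diameter F) * sqrt (\<eta> / diameter F)) * (L2_norm (face_measure F) (vec_jump M n w F) * L2_norm (face_measure F) (vec_jump M n v F))"
      using e by (simp only: real_sqrt_mult_self abs_of_nonneg)
    also have "\<dots> = ?j w F * ?j v F" by (simp only: mult_ac)
    also have "\<dots> \<le> \<bar>?j w F\<bar> * \<bar>?j v F\<bar>" by (metis abs_ge_self abs_mult)
    finally show "\<bar>\<eta> / diameter F * (\<integral>x. vec_jump M n w F x \<bullet> vec_jump M n v F x \<partial>face_measure F)\<bar> \<le> \<bar>?j w F\<bar> * \<bar>?j v F\<bar>" .
  qed
  also have "\<dots> \<le> L2_set (?j w) (faces M) * L2_set (?j v) (faces M)" by (rule L2_set_mult_ineq)
  also have "\<dots> = jump_norm \<eta> w * jump_norm \<eta> v"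
  proof -
    have "L2_set (?j w) (faces M) = jump_norm \<eta> w" for w
      unfolding L2_set_def jump_norm_def using d eta_pos
      by (intro arg_cong[where f=sqrt] sum.cong refl) (simp add: power_mult_distrib less_imp_le)
    then show ?thesis by simp
  qed
  finally show ?thesis .
qed

text \<open>The volume term contributes \<open>normE\<close>; the flux term contributes
  \<open>\<kappa>\<close>, which is at most 1, and the penalty term contributes 1.\<close>

lemma extended_a_bound:
  assumes "w \<in> VH" "v \<in> V"
  shows "\<bar>extended_a w v\<bar> \<le> nrm w * ((normE + 2) * nrm v)"
proof -
  let ?G = "\<lambda>w. L2_norm L\<Omega> (broken_jac M w)" and ?J = "jump_norm \<eta>"
  note ge = dG_norm_ge[OF eta_pos]
  note J0 = jump_norm_nonneg
  have 1: "\<bar>\<integral>x. broken_jac M w x \<bullet> gradE v x \<partial>L\<Omega>\<bar> \<le> nrm w * (normE * nrm v)"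
    using L2_CS[OF broken_jac_L2[OF assms(1)] gradE_L2[OF assms(2)]]
      mult_mono[OF ge(1)[of w] smoother_norm_bound[OF assms(2)] ge(3)] by simp
  have "\<kappa> * ?G v * ?J w \<le> 1 * nrm v * nrm w"
    using \<kappa>_bounds J0 ge by (intro mult_mono mult_nonneg_nonneg) auto
  then have 2: "\<bar>\<Sum>F\<in>faces M. \<integral>x. vec_jump M n w F x \<bullet> flux v F x \<partial>face_measure F\<bar> \<le> nrm w * nrm v"
    using flux_jump_bound[OF assms(2,1)] by (simp add: mult.commute)
  have "?J w * ?J v \<le> nrm w * nrm v" using J0 ge by (intro mult_mono) auto
  then have 3: "\<bar>\<Sum>F\<in>faces M. \<eta> / diameter F * (\<integral>x. vec_jump M n w F x \<bullet> vec_jump M n v F x \<partial>face_measure F)\<bar> \<le> nrm w * nrm v"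
    using jump_form_bound[OF assms(1) dG_VH[OF assms(2)]] by linarith
  have "nrm w * ((normE + 2) * nrm v) = nrm w * (normE * nrm v) + nrm w * nrm v + nrm w * nrm v"
    by (simp add: algebra_simps)
  then show ?thesis using 1 2 3 unfolding extended_a_def by linarith
qed

text \<open>On the diagonal the two flux terms coincide, and together they are at most
  \<open>\<kappa>\<close> times twice the product of gradient norm and jump norm, hence at most
  \<open>\<kappa>\<close> times the squared norm.\<close>

lemma a_dG_coercive:
  assumes v: "v \<in> V"
  shows "(1 - \<kappa>) * (nrm v)\<^sup>2 \<le> a_dG \<Omega> M n \<eta> v v"
proof -
  let ?G = "L2_norm L\<Omega> (broken_jac M v)" and ?J = "jump_norm \<eta> v"
  let ?s = "\<Sum>F\<in>faces M. \<integral>x. vec_jump M n v F x \<bullet> flux v F x \<partial>face_measure F"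
  have "a_dG \<Omega> M n \<eta> v v = dG_form \<eta> v v - 2 * ?s"
    by (simp add: a_dG_def dG_form_def skeleton_integral_def flux_def inner_commute)
  also have "dG_form \<eta> v v = ?G\<^sup>2 + ?J\<^sup>2" by (simp add: dG_form_self jump_norm_power2[OF eta_pos])
  finally have a: "a_dG \<Omega> M n \<eta> v v = ?G\<^sup>2 + ?J\<^sup>2 - 2 * ?s" .
  have "?s \<le> \<kappa> * (?G * ?J)" using flux_jump_bound[OF v dG_VH[OF v]] by (simp add: mult.assoc)
  moreover have "\<kappa> * (2 * (?G * ?J)) \<le> \<kappa> * (?G\<^sup>2 + ?J\<^sup>2)"
    using sum_squares_bound[of ?G ?J] \<kappa>_bounds by (intro mult_left_mono) (auto simp: mult.assoc)
  ultimately have "2 * ?s \<le> \<kappa> * (?G\<^sup>2 + ?J\<^sup>2)" by simp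
  then show ?thesis unfolding a dG_norm_power2[OF eta_pos] by (simp add: algebra_simps)
qed

section \<open>Discrete pressures and the discrete kernel\<close>

lemma dG_space_0_L2: "q \<in> Dq \<Longrightarrow> q \<in> L2 L\<Omega>" "q \<in> Dq \<Longrightarrow> q \<in> dG_space M (int l - 1)"
  by (auto simp: dG_space_0_def L2_0_def)

lemma dG_space_0_diff:
  assumes "p \<in> Dq" "q \<in> Dq" shows "(\<lambda>x. p x - q x) \<in> Dq"
proof -
  have fin: "finite_measure L\<Omega>" by (intro finite_measure_lebesgue_on lmeasurable_open bounded_\<Omega> open_\<Omega>)
  have "(\<lambda>x. p x - q x) \<in> dG_space M (int l - 1)"
    using dG_space_lincomb[of p "int l - 1" q 1 "-1"] assms dG_space_0_L2(2) by simp
  moreover have "(\<lambda>x. p x - q x) \<in> L2 L\<Omega>" using assms by (intro L2_diff dG_space_0_L2)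
  moreover have "(\<integral>x. p x - q x \<partial>L\<Omega>) = 0"
    using L2_integrable[OF fin dG_space_0_L2(1)[OF assms(1)]] L2_integrable[OF fin dG_space_0_L2(1)[OF assms(2)]] assms
    by (simp add: dG_space_0_def L2_0_def)
  ultimately show ?thesis by (simp add: dG_space_0_def L2_0_def)
qed

lemma trace_L2: "A \<in> L2 L\<Omega> \<Longrightarrow> (\<lambda>x. trace (A x :: real^'n^'n)) \<in> L2 L\<Omega>"
  unfolding trace_def by (intro L2_sum L2_component) auto

lemma pressure_term_bound:
  assumes "q \<in> L2 L\<Omega>" "v \<in> V"
  shows "\<bar>\<integral>x. q x * trace (gradE v x) \<partial>L\<Omega>\<bar> \<le> L2_norm L\<Omega> q * (2 * normE * nrm v)"
proof -
  have "L2_norm L\<Omega> (\<lambda>x. trace (gradE v x)) \<le> L2_norm L\<Omega> (\<lambda>x. 2 *\<^sub>R gradE v x)"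
    using abs_trace_le[OF small_dim]
    by (intro L2_norm_mono trace_L2 L2_scaleR gradE_L2 assms) simp
  also have "\<dots> \<le> 2 * L2_norm L\<Omega> (gradE v)"
    using L2_norm_lincomb_le[OF gradE_L2[OF assms(2)] gradE_L2[OF assms(2)], of 2 0] by simp
  also have "\<dots> \<le> 2 * normE * nrm v" using smoother_norm_bound[OF assms(2)] by simp
  finally have "L2_norm L\<Omega> q * L2_norm L\<Omega> (\<lambda>x. trace (gradE v x)) \<le> L2_norm L\<Omega> q * (2 * normE * nrm v)"
    by (intro mult_left_mono) auto
  then show ?thesis using L2_CS[OF assms(1) trace_L2[OF gradE_L2[OF assms(2)]]] by simp
qed

lemma b_dG_eq: "v \<in> V \<Longrightarrow> q \<in> Dq \<Longrightarrow> b_dG \<Omega> M n v q = - (\<integral>x. q x * trace (gradE v x) \<partial>L\<Omega>)"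
  by (rule b_dG_consistency[OF smoother moments _ dG_space_0_L2(2)])

text \<open>Linearity of \<open>b_dG\<close> in the velocity is read off from its representation
  through the divergence of \<open>E v\<close>.\<close>

lemma discrete_kernel_diff:
  assumes "v \<in> discrete_kernel \<Omega> M n l" "w \<in> discrete_kernel \<Omega> M n l"
  shows "(\<lambda>x. v x - w x) \<in> discrete_kernel \<Omega> M n l"
proof -
  have VV: "v \<in> V" "w \<in> V" using assms by (auto simp: discrete_kernel_def)
  have d: "(\<lambda>x. v x - w x) \<in> V" using dG_lincomb[OF VV, of 1 "-1"] by simp
  moreover have "b_dG \<Omega> M n (\<lambda>x. v x - w x) q = 0" if q: "q \<in> Dq" for q
  proof -
    have "(\<integral>x. q x * trace (gradE (\<lambda>x. v x - w x) x) \<partial>L\<Omega>) =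
        (\<integral>x. q x * trace (gradE v x) - q x * trace (gradE w x) \<partial>L\<Omega>)"
    proof (rule lebesgue_on_integral_AE_cong)
      have "AE x in L\<Omega>. gradE (\<lambda>x. v x - w x) x = gradE v x - gradE w x"
        using gradE_lincomb[OF VV, of 1 "-1"] by simp
      then show "AE x in L\<Omega>. q x * trace (gradE (\<lambda>x. v x - w x) x) = q x * trace (gradE v x) - q x * trace (gradE w x)"
        by eventually_elim (simp add: trace_def sum_subtractf right_diff_distrib)
    qed simp
    also have "\<dots> = (\<integral>x. q x * trace (gradE v x) \<partial>L\<Omega>) - (\<integral>x. q x * trace (gradE w x) \<partial>L\<Omega>)"
      by (intro Bochner_Integration.integral_diff L2_integrable_mult dG_space_0_L2 q trace_L2 gradE_L2 VV)
    also have "\<dots> = 0"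
      using assms q b_dG_eq[OF VV(1) q] b_dG_eq[OF VV(2) q] by (simp add: discrete_kernel_def)
    finally show ?thesis using b_dG_eq[OF d q] by simp
  qed
  ultimately show ?thesis by (simp add: discrete_kernel_def)
qed

end

section \<open>Quasi-optimality\<close>

context smoothed_mesh
begin

text \<open>The difference is the extended form at \<open>u - w\<close>: for \<open>u\<close> this
  form has no face terms, and for the discrete \<open>w\<close> it is \<open>a_dG\<close>.\<close>

lemma residual_bound:
  assumes u: "u \<in> pow (H10 \<Omega>)" and w: "w \<in> V" and v: "v \<in> V"
  shows "\<bar>(\<integral>x. weak_jac \<Omega> u x \<bullet> gradE v x \<partial>L\<Omega>) - a_dG \<Omega> M n \<eta> w v\<bar> \<le>
    nrm (\<lambda>x. u x - w x) * ((normE + 2) * nrm v)"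
proof -
  have "(\<lambda>x. u x - w x) \<in> VH" using VH_lincomb[OF H10_VH[OF u] dG_VH[OF w], of 1 "-1"] by simp
  moreover have "extended_a (\<lambda>x. u x - w x) v = (\<integral>x. weak_jac \<Omega> u x \<bullet> gradE v x \<partial>L\<Omega>) - a_dG \<Omega> M n \<eta> w v"
    using extended_a_lincomb[OF H10_VH[OF u] dG_VH[OF w] v, of 1 "-1"] extended_a_H10[OF u v] a_dG_eq_extended[OF w v]
    by simp
  ultimately show ?thesis using extended_a_bound[OF _ v] by metis
qed

text \<open>For discrete \<open>q\<close> the form \<open>b_dG\<close> is minus the integral of
  \<open>q\<close> against the divergence of \<open>E v\<close>, so only \<open>p - q\<close> is
  left. This is why the pressure error enters the velocity estimate through its best
  approximation.\<close>

lemma pressure_consistency: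
  assumes p: "p \<in> L2 L\<Omega>" and q: "q \<in> Dq" and v: "v \<in> V"
  shows "\<bar>(\<integral>x. p x * trace (gradE v x) \<partial>L\<Omega>) + b_dG \<Omega> M n v q\<bar> \<le>
    L2_norm L\<Omega> (\<lambda>x. p x - q x) * (2 * normE * nrm v)"
proof -
  have "(\<integral>x. (p x - q x) * trace (gradE v x) \<partial>L\<Omega>) =
      (\<integral>x. p x * trace (gradE v x) - q x * trace (gradE v x) \<partial>L\<Omega>)"
    by (simp add: left_diff_distrib)
  also have "\<dots> = (\<integral>x. p x * trace (gradE v x) \<partial>L\<Omega>) - (\<integral>x. q x * trace (gradE v x) \<partial>L\<Omega>)"
    by (intro Bochner_Integration.integral_diff L2_integrable_mult trace_L2 gradE_L2 v p dG_space_0_L2 q)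
  also have "\<dots> = (\<integral>x. p x * trace (gradE v x) \<partial>L\<Omega>) + b_dG \<Omega> M n v q"
    using b_dG_eq[OF v q] by simp
  finally show ?thesis
    using pressure_term_bound[OF L2_diff[OF p dG_space_0_L2(1)[OF q]] v] by simp
qed

lemma b_dG_diff:
  assumes v: "v \<in> V" and pq: "p \<in> Dq" "q \<in> Dq"
  shows "b_dG \<Omega> M n v (\<lambda>x. p x - q x) = b_dG \<Omega> M n v p - b_dG \<Omega> M n v q"
proof -
  have "(\<integral>x. (p x - q x) * trace (gradE v x) \<partial>L\<Omega>) =
      (\<integral>x. p x * trace (gradE v x) - q x * trace (gradE v x) \<partial>L\<Omega>)"
    by (simp add: left_diff_distrib)
  also have "\<dots> = (\<integral>x. p x * trace (gradE v x) \<partial>L\<Omega>) - (\<integral>x. q x * trace (gradE v x) \<partial>L\<Omega>)"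
    by (intro Bochner_Integration.integral_diff L2_integrable_mult trace_L2 gradE_L2 v dG_space_0_L2 pq)
  finally show ?thesis using b_dG_eq[OF v] dG_space_0_diff[OF pq] pq by simp
qed

text \<open>The comparison functions \<open>z\<close> and \<open>q\<close> are kept fixed and infima
  are taken afterwards. Taking \<open>z\<close> from the discrete kernel makes
  \<open>u_dG - z\<close> an admissible test function without any discrete pressure.\<close>

lemma quasi_optimality:
  assumes \<mu>: "0 < \<mu>" and stokes: "stokes_solution \<Omega> \<mu> f u p"
    and dG: "dG_solution \<Omega> M n l \<eta> E \<mu> f u_dG p_dG"
    and infsup: "inf_sup_const \<Omega> M n l \<eta> \<beta>"
    and z: "z \<in> discrete_kernel \<Omega> M n l" and q: "q \<in> Dq"
  defines "X \<equiv> \<mu> * nrm (\<lambda>x. u x - z x) + L2_norm L\<Omega> (\<lambda>x. p x - q x)"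
  shows "\<mu> * nrm (\<lambda>x. u x - u_dG x) \<le> 9 * ((1 + normE) / (1 - \<kappa>)) * X"
    and "L2_norm L\<Omega> (\<lambda>x. p x - p_dG x) \<le> 9 * ((1 + normE)\<^sup>2 / ((1 - \<kappa>) * \<beta>)) * X"
proof -
  let ?B = "b_dG \<Omega> M n" and ?A = "a_dG \<Omega> M n \<eta>" and ?\<alpha> = "1 - \<kappa>"
  let ?P = "L2_norm L\<Omega> (\<lambda>x. p x - q x)"
  have u: "u \<in> pow (H10 \<Omega>)" and pL2: "p \<in> L2 L\<Omega>"
    using stokes by (auto simp: stokes_solution_def L2_0_def)
  have uV: "u_dG \<in> V" and pD: "p_dG \<in> Dq" and eqn: "\<And>v. v \<in> V \<Longrightarrow> \<mu> * ?A u_dG v + ?B v p_dG = f (E v)"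
    using dG by (auto simp: dG_solution_def)
  have uZ: "u_dG \<in> discrete_kernel \<Omega> M n l"
    using dG by (auto simp: dG_solution_def discrete_kernel_def)
  have zV: "z \<in> V" using z by (simp add: discrete_kernel_def)
  have stokesE: "f (E v) = \<mu> * (\<integral>x. weak_jac \<Omega> u x \<bullet> gradE v x \<partial>L\<Omega>) - (\<integral>x. p x * trace (gradE v x) \<partial>L\<Omega>)" if "v \<in> V" for v
    using stokes E_H10[OF that] by (simp add: stokes_solution_def)
  note nn = dG_norm_ge(3)[OF eta_pos]
  have \<alpha>: "0 < ?\<alpha>" "?\<alpha> \<le> 1" using \<kappa>_bounds by auto
  have P0: "0 \<le> ?P" by simp
  have X0: "0 \<le> X" unfolding X_def using \<mu> nn by simp
  have E0: "0 \<le> normE" by (rule normE_nonneg)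
  let ?e = "\<lambda>x. u_dG x - z x"
  have eZ: "?e \<in> discrete_kernel \<Omega> M n l" by (rule discrete_kernel_diff[OF uZ z])
  then have eV: "?e \<in> V" and eB: "\<And>q. q \<in> Dq \<Longrightarrow> ?B ?e q = 0" by (auto simp: discrete_kernel_def)
  \<comment> \<open>Linearity of \<open>a_dG\<close> in its first argument is inherited from the
    extended form.\<close>
  have A_diff: "?A ?e ?e = ?A u_dG ?e - ?A z ?e"
    using extended_a_lincomb[OF dG_VH[OF uV] dG_VH[OF zV] eV, of 1 "-1"]
      a_dG_eq_extended[OF eV eV] a_dG_eq_extended[OF uV eV] a_dG_eq_extended[OF zV eV] by simp
  have error: "\<mu> * nrm ?e \<le> 2 * (1 + normE) / ?\<alpha> * X"
  proof -
    let ?R = "(\<integral>x. weak_jac \<Omega> u x \<bullet> gradE ?e x \<partial>L\<Omega>) - ?A z ?e"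
    let ?S = "(\<integral>x. p x * trace (gradE ?e x) \<partial>L\<Omega>)"
    \<comment> \<open>The discrete problem is tested with \<open>?e\<close> and the Stokes problem
      with \<open>E ?e\<close>; the load is the same. The discrete pressure drops out because
      \<open>?e\<close> is in the kernel.\<close>
    have "\<mu> * ?A ?e ?e = \<mu> * ?R - ?S"
      using eqn[OF eV] stokesE[OF eV] eB[OF pD] unfolding A_diff by (simp add: algebra_simps)
    moreover have "\<mu> * ?R \<le> \<mu> * (nrm (\<lambda>x. u x - z x) * ((normE + 2) * nrm ?e))"
      using residual_bound[OF u zV eV] \<mu> by (intro mult_left_mono) auto
    moreover have "- ?S \<le> ?P * (2 * normE * nrm ?e)"
      using pressure_consistency[OF pL2 q eV] eB[OF q] by simp
    moreover have "\<mu> * (?\<alpha> * (nrm ?e)\<^sup>2) \<le> \<mu> * ?A ?e ?e"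
      using a_dG_coercive[OF eV] \<mu> by (intro mult_left_mono) auto
    moreover have "\<mu> * (nrm (\<lambda>x. u x - z x) * ((normE + 2) * nrm ?e)) + ?P * (2 * normE * nrm ?e) \<le>
        2 * (1 + normE) * X * nrm ?e"
    proof -
      have "0 \<le> (\<mu> * nrm (\<lambda>x. u x - z x) * normE + 2 * ?P) * nrm ?e"
        using \<mu> nn E0 P0 by (intro mult_nonneg_nonneg add_nonneg_nonneg) auto
      then show ?thesis unfolding X_def by (simp add: algebra_simps)
    qed
    ultimately have le: "(\<mu> * ?\<alpha> * nrm ?e) * nrm ?e \<le> (2 * (1 + normE) * X) * nrm ?e"
      by (simp add: power2_eq_square mult.assoc)
    \<comment> \<open>One factor \<open>nrm ?e\<close> cancels; if it is zero, the left-hand side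
      vanishes anyway.\<close>
    have "\<mu> * ?\<alpha> * nrm ?e \<le> 2 * (1 + normE) * X"
    proof (cases "nrm ?e = 0")
      case True
      then show ?thesis using X0 E0 by simp
    next
      case False
      then have "0 < nrm ?e" using nn[of ?e] by linarith
      with le show ?thesis by (rule mult_right_le_imp_le)
    qed
    then show ?thesis using \<alpha> by (simp add: pos_le_divide_eq mult_ac)
  qed
  \<comment> \<open>Coercivity constants do not exceed 1, so the plain error \<open>X\<close> can be
    absorbed into \<open>T\<close>.\<close>
  have one_le: "1 \<le> (1 + normE) / ?\<alpha>"
  proof -
    have "?\<alpha> \<le> 1 + normE" using \<alpha>(2) E0 by linarith
    then show ?thesis by (simp only: le_divide_eq_1_pos[OF \<alpha>(1)])
  qed
  define T where "T = (1 + normE) / ?\<alpha> * X"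
  have XT: "X \<le> T" unfolding T_def using mult_right_mono[OF one_le X0] by simp
  have T0: "0 \<le> T" using XT X0 by linarith
  have "nrm (\<lambda>x. u x - u_dG x) \<le> nrm (\<lambda>x. u x - z x) + nrm ?e"
    by (rule dG_norm_triangle[OF eta_pos H10_VH[OF u] dG_VH[OF zV] dG_VH[OF uV]])
  then have "\<mu> * nrm (\<lambda>x. u x - u_dG x) \<le> \<mu> * nrm (\<lambda>x. u x - z x) + \<mu> * nrm ?e"
    using mult_left_mono[of _ _ \<mu>] \<mu> by (simp add: distrib_left[symmetric])
  moreover have "\<mu> * nrm (\<lambda>x. u x - z x) \<le> X" unfolding X_def using P0 by simp
  moreover have "\<mu> * nrm ?e \<le> 2 * T"
    using error by (simp only: T_def times_divide_eq_left times_divide_eq_right mult.assoc)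
  ultimately have vel: "\<mu> * nrm (\<lambda>x. u x - u_dG x) \<le> 3 * T" using XT by linarith
  have "9 * ((1 + normE) / ?\<alpha>) * X = 9 * T" by (simp only: T_def mult.assoc)
  moreover have "\<mu> * nrm (\<lambda>x. u x - u_dG x) \<le> 9 * T" using vel T0 by linarith
  ultimately show "\<mu> * nrm (\<lambda>x. u x - u_dG x) \<le> 9 * ((1 + normE) / ?\<alpha>) * X" by (simp only:)

  have \<beta>: "0 < \<beta>" "\<beta> \<le> 1" using infsup by (auto simp: inf_sup_const_def)
  \<comment> \<open>A second factor \<open>1 + normE\<close> arises from testing the momentum
    balance with an arbitrary \<open>w\<close>, which is why the pressure estimate carries a
    square.\<close>
  define Y where "Y = T * (1 + normE)"
  have Y0: "0 \<le> Y" unfolding Y_def using T0 E0 by (intro mult_nonneg_nonneg) auto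
  have TY: "T \<le> Y" unfolding Y_def using T0 E0 by (simp add: algebra_simps)
  let ?r = "\<lambda>x. p_dG x - q x"
  \<comment> \<open>The momentum equations express \<open>b_dG\<close> at \<open>p_dG - q\<close>
    through the velocity error and \<open>p - q\<close>. The former contributes 3 times 2 and the
    latter 2. For \<open>nrm w = 0\<close> the quotient is 0 by convention.\<close>
  have quot: "?B w ?r / nrm w \<le> 8 * Y" if w: "w \<in> V" for w
  proof (cases "nrm w = 0")
    case False
    let ?R = "(\<integral>x. weak_jac \<Omega> u x \<bullet> gradE w x \<partial>L\<Omega>) - ?A u_dG w"
    let ?S = "(\<integral>x. p x * trace (gradE w x) \<partial>L\<Omega>) + ?B w q"
    have w0: "0 < nrm w" using False nn[of w] by simp
    have "?B w ?r = \<mu> * ?R - ?S"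
      using eqn[OF w] stokesE[OF w] b_dG_diff[OF w pD q] by (simp add: algebra_simps)
    moreover have "\<mu> * ?R \<le> \<mu> * (nrm (\<lambda>x. u x - u_dG x) * ((normE + 2) * nrm w))"
      using residual_bound[OF u uV w] \<mu> by (intro mult_left_mono) auto
    moreover have "- ?S \<le> ?P * (2 * normE * nrm w)"
      using pressure_consistency[OF pL2 q w] by linarith
    ultimately have "?B w ?r \<le> (\<mu> * nrm (\<lambda>x. u x - u_dG x) * (normE + 2) + ?P * (2 * normE)) * nrm w"
      by (simp add: algebra_simps)
    also have "\<dots> \<le> (3 * T * (2 * (1 + normE)) + T * (2 * (1 + normE))) * nrm w"
    proof (intro mult_right_mono add_mono)
      show "\<mu> * nrm (\<lambda>x. u x - u_dG x) * (normE + 2) \<le> 3 * T * (2 * (1 + normE))"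
        by (rule mult_mono[OF vel]) (use E0 T0 in auto)
      have "?P \<le> X" unfolding X_def using \<mu> nn by simp
      then have "?P \<le> T" using XT by linarith
      then show "?P * (2 * normE) \<le> T * (2 * (1 + normE))"
        by (rule mult_mono) (use E0 T0 in auto)
    qed (use w0 in simp)
    also have "\<dots> = 8 * Y * nrm w" by (simp add: Y_def algebra_simps)
    finally show ?thesis using w0 by (simp add: pos_divide_le_eq)
  qed (use Y0 in simp)
  have "\<beta> * L2_norm L\<Omega> ?r \<le> (SUP w\<in>V. ?B w ?r / nrm w)"
    using infsup dG_space_0_diff[OF pD q] by (simp add: inf_sup_const_def)
  also have "\<dots> \<le> 8 * Y" by (rule cSUP_least) (use uV quot in auto)
  finally have r: "L2_norm L\<Omega> ?r \<le> 8 * Y / \<beta>" using \<beta> by (simp add: pos_le_divide_eq mult.commute)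
  have "L2_norm L\<Omega> (\<lambda>x. p x - p_dG x) \<le> ?P + L2_norm L\<Omega> (\<lambda>x. q x - p_dG x)"
    by (rule L2_norm_diff_triangle[OF pL2 dG_space_0_L2(1)[OF q] dG_space_0_L2(1)[OF pD]])
  also have "L2_norm L\<Omega> (\<lambda>x. q x - p_dG x) = L2_norm L\<Omega> ?r" by (rule L2_norm_minus_commute)
  finally have "L2_norm L\<Omega> (\<lambda>x. p x - p_dG x) \<le> ?P + L2_norm L\<Omega> ?r" .
  \<comment> \<open>Since \<open>\<beta>\<close> is at most 1, the remaining approximation error
    fits under the bound of the discrete part.\<close>
  moreover have "?P \<le> Y / \<beta>"
  proof -
    have "?P \<le> X" unfolding X_def using \<mu> nn by simp
    also have "\<dots> \<le> Y" using XT TY by linarith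
    also have "\<dots> \<le> Y / \<beta>" using \<beta> Y0 by (simp add: pos_le_divide_eq mult_left_le)
    finally show ?thesis .
  qed
  moreover have "8 * Y / \<beta> = 8 * (Y / \<beta>)" by simp
  ultimately have "L2_norm L\<Omega> (\<lambda>x. p x - p_dG x) \<le> 9 * (Y / \<beta>)" using r by linarith
  moreover have "9 * ((1 + normE)\<^sup>2 / (?\<alpha> * \<beta>)) * X = 9 * (Y / \<beta>)"
    by (simp add: Y_def T_def power2_eq_square)
  ultimately show "L2_norm L\<Omega> (\<lambda>x. p x - p_dG x) \<le> 9 * ((1 + normE)\<^sup>2 / (?\<alpha> * \<beta>)) * X" by (simp only:)
qed

end

text \<open>An infimum is accessible only through lower bounds, so the inequality is solved first
  for \<open>F z\<close> with \<open>q\<close> fixed, and then for \<open>G q\<close>.\<close>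

lemma le_sum_of_infima:
  fixes c \<mu> L :: real
  assumes le: "\<And>z q. z \<in> Z \<Longrightarrow> q \<in> Q \<Longrightarrow> L \<le> c * (\<mu> * F z + G q)"
    and "0 < c" "0 < \<mu>" "Z \<noteq> {}" "Q \<noteq> {}"
  shows "L \<le> c * (\<mu> * (INF z\<in>Z. F z) + (INF q\<in>Q. G q))"
proof -
  have "(L / c - G q) / \<mu> \<le> (INF z\<in>Z. F z)" if "q \<in> Q" for q
  proof (rule cINF_greatest[OF \<open>Z \<noteq> {}\<close>])
    fix z assume "z \<in> Z"
    then have "L / c \<le> \<mu> * F z + G q" using le[OF _ that] \<open>0 < c\<close> by (simp add: pos_divide_le_eq mult.commute)
    then show "(L / c - G q) / \<mu> \<le> F z" using \<open>0 < \<mu>\<close> by (simp add: pos_divide_le_eq mult.commute)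
  qed
  then have "L / c - \<mu> * (INF z\<in>Z. F z) \<le> G q" if "q \<in> Q" for q
    using that \<open>0 < \<mu>\<close> by (simp add: pos_divide_le_eq mult.commute algebra_simps)
  then have "L / c - \<mu> * (INF z\<in>Z. F z) \<le> (INF q\<in>Q. G q)"
    by (intro cINF_greatest[OF \<open>Q \<noteq> {}\<close>])
  then show ?thesis using \<open>0 < c\<close> by (simp add: pos_divide_le_eq mult.commute algebra_simps)
qed

theorem theorem10:
  fixes \<Omega> :: "(real^'n) set" and l :: nat
  assumes "CARD('n) = 2 \<or> CARD('n) = 3"
    and "1 \<le> l"
    and "polyhedral_domain \<Omega>"
  shows "\<exists>C :: real \<Rightarrow> real. mono C \<and> (\<forall>\<gamma>. 0 < C \<gamma>) \<and>
    (\<forall>(M :: (real^'n) set set) (n :: (real^'n) set \<Rightarrow> real^'n)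
      (E :: (real^'n \<Rightarrow> real^'n) \<Rightarrow> (real^'n \<Rightarrow> real^'n))
      (etabar :: real) (\<eta> :: real) (\<mu> :: real) (f :: (real^'n \<Rightarrow> real^'n) \<Rightarrow> real)
      (u :: real^'n \<Rightarrow> real^'n) (p :: real^'n \<Rightarrow> real)
      (u_dG :: real^'n \<Rightarrow> real^'n) (p_dG :: real^'n \<Rightarrow> real)
      (\<beta> :: real) (\<delta> :: real).
      simplicial_mesh \<Omega> M \<longrightarrow> normal_field \<Omega> M n \<longrightarrow>
      linear_smoother \<Omega> M l E \<longrightarrow> preserves_moments M n l E \<longrightarrow>
      trace_const \<Omega> M n l etabar \<longrightarrow> etabar < \<eta> \<longrightarrow>
      0 < \<mu> \<longrightarrow> f \<in> H_minus1 \<Omega> \<longrightarrow>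
      stokes_solution \<Omega> \<mu> f u p \<longrightarrow>
      dG_solution \<Omega> M n l \<eta> E \<mu> f u_dG p_dG \<longrightarrow>
      inf_sup_const \<Omega> M n l \<eta> \<beta> \<longrightarrow>
      velocity_error \<Omega> M n \<eta> (discrete_kernel \<Omega> M n l) u
        \<le> \<delta> * velocity_error \<Omega> M n \<eta> (pow (dG_space M (int l))) u \<longrightarrow>
      \<mu> * dG_norm \<Omega> M n \<eta> (\<lambda>x. u x - u_dG x)
        \<le> C (shape_const M) * ((1 + smoother_norm \<Omega> M n l \<eta> E) / (1 - sqrt (etabar / \<eta>)))
          * (\<delta> * \<mu> * velocity_error \<Omega> M n \<eta> (pow (dG_space M (int l))) u
             + pressure_error \<Omega> (dG_space_0 \<Omega> M (int l - 1)) p)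
      \<and>
      L2_norm (lebesgue_on \<Omega>) (\<lambda>x. p x - p_dG x)
        \<le> C (shape_const M)
          * ((1 + smoother_norm \<Omega> M n l \<eta> E)\<^sup>2 / ((1 - sqrt (etabar / \<eta>)) * \<beta>))
          * (\<delta> * \<mu> * velocity_error \<Omega> M n \<eta> (pow (dG_space M (int l))) u
             + pressure_error \<Omega> (dG_space_0 \<Omega> M (int l - 1)) p))"
proof (intro exI[of _ "\<lambda>_. 9"] conjI allI impI)
  show "mono (\<lambda>_::real. 9::real)" by (simp add: mono_def)
  show "0 < (9::real)" by simp
next
  fix M :: "(real^'n) set set" and n :: "(real^'n) set \<Rightarrow> real^'n"
    and E :: "(real^'n \<Rightarrow> real^'n) \<Rightarrow> (real^'n \<Rightarrow> real^'n)"
    and etabar \<eta> \<mu> :: real and f :: "(real^'n \<Rightarrow> real^'n) \<Rightarrow> real"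
    and u :: "real^'n \<Rightarrow> real^'n" and p :: "real^'n \<Rightarrow> real"
    and u_dG :: "real^'n \<Rightarrow> real^'n" and p_dG :: "real^'n \<Rightarrow> real" and \<beta> \<delta> :: real
  assume h: "simplicial_mesh \<Omega> M" "normal_field \<Omega> M n" "linear_smoother \<Omega> M l E" "preserves_moments M n l E"
    "trace_const \<Omega> M n l etabar" "etabar < \<eta>" and \<mu>: "0 < \<mu>" and "f \<in> H_minus1 \<Omega>"
    and sol: "stokes_solution \<Omega> \<mu> f u p" "dG_solution \<Omega> M n l \<eta> E \<mu> f u_dG p_dG" "inf_sup_const \<Omega> M n l \<eta> \<beta>"
    and \<delta>: "velocity_error \<Omega> M n \<eta> (discrete_kernel \<Omega> M n l) u
        \<le> \<delta> * velocity_error \<Omega> M n \<eta> (pow (dG_space M (int l))) u"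
  interpret smoothed_mesh \<Omega> M n l E \<eta> etabar
    by unfold_locales (use assms h in auto)
  let ?Z = "discrete_kernel \<Omega> M n l"
  let ?V = "velocity_error \<Omega> M n \<eta> ?Z u" and ?P = "pressure_error \<Omega> Dq p"
  let ?D = "\<delta> * \<mu> * velocity_error \<Omega> M n \<eta> V u + ?P"
  \<comment> \<open>The discrete solution itself witnesses that both sets are nonempty, so that the
    infima are genuine.\<close>
  have ne: "?Z \<noteq> {}" "Dq \<noteq> {}"
    using sol(2) by (auto simp: dG_solution_def discrete_kernel_def)
  have \<beta>: "0 < \<beta>" using sol(3) by (simp add: inf_sup_const_def)
  have c1: "0 < 9 * ((1 + normE) / (1 - \<kappa>))" and c2: "0 < 9 * ((1 + normE)\<^sup>2 / ((1 - \<kappa>) * \<beta>))"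
    using normE_nonneg \<kappa>_bounds \<beta> by (auto intro!: divide_pos_pos mult_pos_pos zero_less_power)
  \<comment> \<open>The quantity \<open>\<delta>\<close> enters only here, in the passage from the
    discrete kernel to the full discrete space.\<close>
  have "\<mu> * ?V \<le> \<mu> * (\<delta> * velocity_error \<Omega> M n \<eta> V u)" using \<delta> \<mu> by (intro mult_left_mono) auto
  then have D: "\<mu> * ?V + ?P \<le> ?D" by (simp add: mult_ac)
  have "\<mu> * nrm (\<lambda>x. u x - u_dG x) \<le> 9 * ((1 + normE) / (1 - \<kappa>)) * (\<mu> * ?V + ?P)"
    unfolding velocity_error_def pressure_error_def
    by (rule le_sum_of_infima[OF quasi_optimality(1)[OF \<mu> sol] c1 \<mu> ne])
  also have "\<dots> \<le> 9 * ((1 + normE) / (1 - \<kappa>)) * ?D" using D c1 by (intro mult_left_mono) auto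
  finally show "\<mu> * nrm (\<lambda>x. u x - u_dG x) \<le> 9 * ((1 + normE) / (1 - \<kappa>)) * ?D" .
  have "L2_norm L\<Omega> (\<lambda>x. p x - p_dG x) \<le> 9 * ((1 + normE)\<^sup>2 / ((1 - \<kappa>) * \<beta>)) * (\<mu> * ?V + ?P)"
    unfolding velocity_error_def pressure_error_def
    by (rule le_sum_of_infima[OF quasi_optimality(2)[OF \<mu> sol] c2 \<mu> ne])
  also have "\<dots> \<le> 9 * ((1 + normE)\<^sup>2 / ((1 - \<kappa>) * \<beta>)) * ?D" using D c2 by (intro mult_left_mono) auto
  finally show "L2_norm L\<Omega> (\<lambda>x. p x - p_dG x) \<le> 9 * ((1 + normE)\<^sup>2 / ((1 - \<kappa>) * \<beta>)) * ?D" .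
qed

end
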